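(* Let $\mu>0$, $\nu>0$, $M>0$, and let $C$ be the absolute constant fixed in the context. There exist a constant $C_*>0$ and a small constant $\delta_0>0$, depending only on $\mu$, $\nu$ and $M$, such that the following holds. Let $u_{01},u_{02},h_{01},h_{02}$ be divergence free vector fields on $\mathbb{R}^3$ with $u_{01}+u_{02},\ h_{01}+h_{02}\in C^\infty(\mathbb{R}^3;\mathbb{R}^3)$, and suppose that $$\int_{\mathbb{R}^3}\Big(1+\frac1{|\xi|^2}\Big)|\widehat{u_{02}}(\xi)|\,d\xi+\int_{\mathbb{R}^3}\Big(1+\frac1{|\xi|^2}\Big)|\widehat{h_{02}}(\xi)|\,d\xi\le 4CM.$$ Let $f$ and $g$ be the (divergence free) solutions of the heat equations $$f_t-\nu\Delta f=0,\quad f|_{t=0}=u_{02},\qquad\qquad g_t-\mu\Delta g=0,\quad g|_{t=0}=h_{02},$$ and set $$F=f\times(\nabla\times f)-g\times(\nabla\times g),\qquad G=g\cdot\nabla f-f\cdot\nabla g.$$ If, for all $t\ge 0$, $$\int_{\mathbb{R}^3}\frac{|\widehat{u_{01}}(\xi)|}{|\xi|}d\xi+\int_{\mathbb{R}^3}\frac{|\widehat{h_{01}}(\xi)|}{|\xi|}d\xi+\int_0^t\int_{\mathbb{R}^3}\frac{|\widehat{F}(\tau,\xi)|}{|\xi|}d\xi d\tau+\int_0^t\int_{\mathbb{R}^3}\frac{|\widehat{G}(\tau,\xi)|}{|\xi|}d\xi d\tau\le\delta_0,$$ then the system $$\begin{aligned} &U_t-\nu\Delta U=-\mathbb{P}\nabla\cdot(U\otimes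 U+f\otimes U+U\otimes f-H\otimes H-g\otimes H-H\otimes g)+\mathbb{P}F,\\ &H_t-\mu\Delta H=-\nabla\cdot(U\otimes H+f\otimes H+U\otimes g-H\otimes U-g\otimes U-H\otimes f)+G,\\ &\nabla\cdot U=\nabla\cdot H=0,\\ &U|_{t=0}=u_{01},\qquad H|_{t=0}=h_{01}, \end{aligned}$$ on $t>0$, $x\in\mathbb{R}^3$, has a global smooth solution $(U,H)$ satisfying, for all $t\ge0$, $$\int_{\mathbb{R}^3}\frac{|\widehat{U}(t,\xi)|}{|\xi|}d\xi+\nu\int_0^t\int_{\mathbb{R}^3}|\xi||\widehat{U}(\tau,\xi)|d\xi d\tau+\int_{\mathbb{R}^3}\frac{|\widehat{H}(t,\xi)|}{|\xi|}d\xi+\mu\int_0^t\int_{\mathbb{R}^3}|\xi||\widehat{H}(\tau,\xi)|d\xi d\tau\le C_*\delta_0.$$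
   Context: The hat $\widehat{\cdot}$ denotes the Fourier transform in $x\in\mathbb{R}^3$ (applied componentwise to vector fields); finiteness of the weighted integrals presupposes that the Fourier transforms involved are functions. $C>0$ is a fixed absolute constant such that $\|\widehat{v}\|_{L^1(\mathbb{R}^3)}\le C\delta^{1/2}\|v\|_{L^2(\mathbb{R}^3)}$ for every $0<\delta\le\frac12$ and every $v\in L^2(\mathbb{R}^3)$ with $\operatorname{supp}\widehat v\subset\{1-\delta\le|\xi|\le1+\delta\}$. $\mathbb{P}=(-\Delta)^{-1}\nabla\times\nabla\times$ is the projection onto divergence free vector fields. For vector fields $a,b$: $(a\cdot\nabla b)_i=\sum_j a_j\partial_j b_i$ and $(\nabla\cdot(a\otimes b))_i=\sum_j\partial_j(a_jb_i)$. The system for $(U,H)$ is the one satisfied by $U=u-f$, $H=h-g$ when $(u,h)$ solves the incompressible MHD system $u_t+u\cdot\nabla u-h\cdot\nabla h+\nabla q=\nu\Delta u$, $h_t+u\cdot\nabla h-h\cdot\nabla u=\mu\Delta h$, $\nabla\cdot u=\nabla\cdot h=0$ with initial data $u_0=u_{01}+u_{02}$, $h_0=h_{01}+h_{02}$. A global smooth solution is one that exists and is smooth for all times $t>0$ and takes the prescribed initial data at $t=0$. *)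

theory Defs
  imports "HOL-Analysis.Analysis"
begin

subsection \<open>Smooth functions and differential operators\<close>

text \<open>On an open set, \<^term>\<open>Ck_on k S f\<close> says that \<^term>\<open>f\<close> is \<^term>\<open>k\<close> times continuously
  differentiable; all derivatives are iterated partial derivatives along \<^term>\<open>Basis\<close>.\<close>

primrec Ck_on :: "nat \<Rightarrow> 'a::euclidean_space set \<Rightarrow> ('a \<Rightarrow> 'b::real_normed_vector) \<Rightarrow> bool" where
  "Ck_on 0 S f \<longleftrightarrow> continuous_on S f"
| "Ck_on (Suc k) S f \<longleftrightarrow> continuous_on S f \<and> f differentiable_on S \<and>
     (\<forall>b\<in>Basis. Ck_on k S (\<lambda>x. frechet_derivative f (at x) b))"

definition smooth_on :: "'a::euclidean_space set \<Rightarrow> ('a \<Rightarrow> 'b::real_normed_vector) \<Rightarrow> bool" where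
  "smooth_on S f \<longleftrightarrow> (\<forall>k. Ck_on k S f)"

definition partial :: "3 \<Rightarrow> (real^3 \<Rightarrow> 'b::real_normed_vector) \<Rightarrow> real^3 \<Rightarrow> 'b" where
  "partial j a x = frechet_derivative a (at x) (axis j 1)"

definition time_deriv :: "(real \<Rightarrow> real^3 \<Rightarrow> real^3) \<Rightarrow> real \<Rightarrow> real^3 \<Rightarrow> real^3" where
  "time_deriv a t x = vector_derivative (\<lambda>s. a s x) (at t)"

definition laplacian :: "(real^3 \<Rightarrow> 'b::real_normed_vector) \<Rightarrow> real^3 \<Rightarrow> 'b" where
  "laplacian a x = (\<Sum>j\<in>UNIV. partial j (partial j a) x)"

definition divergence :: "(real^3 \<Rightarrow> real^3) \<Rightarrow> real^3 \<Rightarrow> real" where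
  "divergence a x = (\<Sum>j\<in>UNIV. partial j a x $ j)"

definition curl :: "(real^3 \<Rightarrow> real^3) \<Rightarrow> real^3 \<Rightarrow> real^3" where
  "curl a x = vector [partial 2 a x $ 3 - partial 3 a x $ 2,
                      partial 3 a x $ 1 - partial 1 a x $ 3,
                      partial 1 a x $ 2 - partial 2 a x $ 1]"

definition advect :: "(real^3 \<Rightarrow> real^3) \<Rightarrow> (real^3 \<Rightarrow> real^3) \<Rightarrow> real^3 \<Rightarrow> real^3" where
  "advect a b x = (\<Sum>j\<in>UNIV. (a x $ j) *\<^sub>R partial j b x)"

definition tensor :: "real^3 \<Rightarrow> real^3 \<Rightarrow> real^3^3" where
  "tensor a b = (\<chi> j i. a $ j * b $ i)"

definition tensor_div :: "(real^3 \<Rightarrow> real^3^3) \<Rightarrow> real^3 \<Rightarrow> real^3" where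
  "tensor_div T x = (\<chi> i. \<Sum>j\<in>UNIV. partial j (\<lambda>y. T y $ j $ i) x)"

definition test_function :: "(real^3 \<Rightarrow> 'b::real_normed_vector) \<Rightarrow> bool" where
  "test_function \<phi> \<longleftrightarrow> smooth_on UNIV \<phi> \<and> bounded {x. \<phi> x \<noteq> 0}"

definition locally_integrable :: "(real^3 \<Rightarrow> 'b::euclidean_space) \<Rightarrow> bool" where
  "locally_integrable a \<longleftrightarrow> (\<forall>R. set_integrable lborel (cball 0 R) a)"

text \<open>Divergence free in the sense of distributions: the initial fields need not be differentiable.\<close>

definition weakly_divergence_free :: "(real^3 \<Rightarrow> real^3) \<Rightarrow> bool" where
  "weakly_divergence_free a \<longleftrightarrow> locally_integrable a \<and>
     (\<forall>\<phi> :: real^3 \<Rightarrow> real. test_function \<phi> \<longrightarrow>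
        (\<integral>x. (\<Sum>j\<in>UNIV. a x $ j * partial j \<phi> x) \<partial>lborel) = 0)"

subsection \<open>Fourier transforms that are functions\<close>

text \<open>The convention is \<open>v(\<xi>) = \<integral> exp(- i x \<cdot> \<xi>) a(x) dx\<close>.  The fields considered need not be integrable,
  so the transform is the one of tempered distributions: \<open>v\<close> is a function defining a tempered
  distribution by absolutely convergent integrals, and \<open>a\<close> is its inverse Fourier transform.  Two
  distributions are equal as soon as they agree on compactly supported smooth functions, so
  only those are tested; this avoids any growth condition on \<open>a\<close> itself.\<close>

definition inv_fourier_int :: "(real^3 \<Rightarrow> complex) \<Rightarrow> real^3 \<Rightarrow> complex" where
  "inv_fourier_int \<phi> \<xi> = (\<integral>x. cis (x \<bullet> \<xi>) * \<phi> x \<partial>lborel) / of_real ((2 * pi) ^ 3)"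

definition has_scalar_fourier :: "(real^3 \<Rightarrow> complex) \<Rightarrow> (real^3 \<Rightarrow> complex) \<Rightarrow> bool" where
  "has_scalar_fourier a v \<longleftrightarrow>
     locally_integrable a \<and>
     (\<exists>N::nat. integrable lborel (\<lambda>\<xi>. v \<xi> /\<^sub>R (1 + norm \<xi>) ^ N)) \<and>
     (\<forall>\<phi>. test_function \<phi> \<longrightarrow>
        (\<integral>x. a x * \<phi> x \<partial>lborel) = (\<integral>\<xi>. v \<xi> * inv_fourier_int \<phi> \<xi> \<partial>lborel))"

definition has_fourier :: "(real^3 \<Rightarrow> real^3) \<Rightarrow> (real^3 \<Rightarrow> complex^3) \<Rightarrow> bool" where
  "has_fourier a v \<longleftrightarrow>
     (\<forall>i. has_scalar_fourier (\<lambda>x. complex_of_real (a x $ i)) (\<lambda>\<xi>. v \<xi> $ i))"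

text \<open>Determined up to a null set.\<close>

definition fourier :: "(real^3 \<Rightarrow> real^3) \<Rightarrow> real^3 \<Rightarrow> complex^3" where
  "fourier a = (SOME v. has_fourier a v)"

text \<open>The integral of \<open>w(\<xi>)\<close> times the modulus of the Fourier transform of \<open>a\<close>, for \<open>w \<ge> 0\<close>.  It is
  infinite if the Fourier transform is not a function.\<close>

definition fourier_weight :: "(real^3 \<Rightarrow> real) \<Rightarrow> (real^3 \<Rightarrow> real^3) \<Rightarrow> ennreal" where
  "fourier_weight w a =
     (if \<exists>v. has_fourier a v then \<integral>\<^sup>+\<xi>. ennreal (w \<xi> * norm (fourier a \<xi>)) \<partial>lborel else \<infinity>)"

text \<open>\<open>p\<close> is the projection \<open>(-\<Delta>)\<^sup>-\<^sup>1 \<nabla>\<times>\<nabla>\<times>\<close> of the (twice differentiable) field \<open>a\<close>, where \<open>(-\<Delta>)\<^sup>-\<^sup>1\<close> is the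
  Fourier multiplier \<open>1/|\<xi>|\<^sup>2\<close>.\<close>

definition is_leray :: "(real^3 \<Rightarrow> real^3) \<Rightarrow> (real^3 \<Rightarrow> real^3) \<Rightarrow> bool" where
  "is_leray a p \<longleftrightarrow>
     (\<exists>v. has_fourier (curl (curl a)) v \<and> has_fourier p (\<lambda>\<xi>. v \<xi> /\<^sub>R (norm \<xi>)\<^sup>2))"

definition annulus_constant :: "real \<Rightarrow> bool" where
  "annulus_constant C \<longleftrightarrow> C > 0 \<and>
     (\<forall>\<delta> v w. 0 < \<delta> \<and> \<delta> \<le> 1/2 \<and>
        v \<in> borel_measurable lborel \<and> integrable lborel (\<lambda>x. (norm (v x))\<^sup>2) \<and>
        has_scalar_fourier v w \<and>
        (AE \<xi> in lborel. w \<xi> \<noteq> 0 \<longrightarrow> 1 - \<delta> \<le> norm \<xi> \<and> norm \<xi> \<le> 1 + \<delta>) \<longrightarrow>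
        (\<integral>\<^sup>+\<xi>. ennreal (norm (w \<xi>)) \<partial>lborel)
          \<le> ennreal (C * sqrt \<delta> * sqrt (\<integral>x. (norm (v x))\<^sup>2 \<partial>lborel)))"

subsection \<open>The equations\<close>

text \<open>The bounded classical solution; without a growth condition
  solutions of the heat equation are not unique.\<close>

definition heat_solution ::
    "real \<Rightarrow> (real^3 \<Rightarrow> real^3) \<Rightarrow> (real \<Rightarrow> real^3 \<Rightarrow> real^3) \<Rightarrow> bool" where
  "heat_solution \<kappa> a f \<longleftrightarrow>
     smooth_on ({0<..} \<times> UNIV) (\<lambda>(t, x). f t x) \<and>
     continuous_on ({0..} \<times> UNIV) (\<lambda>(t, x). f t x) \<and>
     (\<exists>K. \<forall>t\<ge>0. \<forall>x. norm (f t x) \<le> K) \<and>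
     (\<forall>t>0. \<forall>x. time_deriv f t x - \<kappa> *\<^sub>R laplacian (f t) x = 0) \<and>
     f 0 = a"

definition forcing_F :: "(real^3 \<Rightarrow> real^3) \<Rightarrow> (real^3 \<Rightarrow> real^3) \<Rightarrow> real^3 \<Rightarrow> real^3" where
  "forcing_F f g x = cross3 (f x) (curl f x) - cross3 (g x) (curl g x)"

definition forcing_G :: "(real^3 \<Rightarrow> real^3) \<Rightarrow> (real^3 \<Rightarrow> real^3) \<Rightarrow> real^3 \<Rightarrow> real^3" where
  "forcing_G f g x = advect g f x - advect f g x"

definition flux_U ::
    "real^3 \<Rightarrow> real^3 \<Rightarrow> real^3 \<Rightarrow> real^3 \<Rightarrow> real^3^3" where
  "flux_U f g U H = tensor U U + tensor f U + tensor U f - tensor H H - tensor g H - tensor H g"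

definition flux_H ::
    "real^3 \<Rightarrow> real^3 \<Rightarrow> real^3 \<Rightarrow> real^3 \<Rightarrow> real^3^3" where
  "flux_H f g U H = tensor U H + tensor f H + tensor U g - tensor H U - tensor g U - tensor H f"

text \<open>The initial value is attained in the norm with weight \<open>1/|\<xi>|\<close>, in which the initial
  data and the solution are measured; in particular it is attained in the sense of distributions.
  The functions \<open>p\<close> and \<open>q\<close> are the projections of the flux divergence and of the forcing.\<close>

definition global_smooth_solution ::
    "real \<Rightarrow> real \<Rightarrow> (real \<Rightarrow> real^3 \<Rightarrow> real^3) \<Rightarrow> (real \<Rightarrow> real^3 \<Rightarrow> real^3) \<Rightarrow>
     (real^3 \<Rightarrow> real^3) \<Rightarrow> (real^3 \<Rightarrow> real^3) \<Rightarrow>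
     (real \<Rightarrow> real^3 \<Rightarrow> real^3) \<Rightarrow> (real \<Rightarrow> real^3 \<Rightarrow> real^3) \<Rightarrow> bool" where
  "global_smooth_solution \<nu> \<mu> f g u01 h01 U H \<longleftrightarrow>
     smooth_on ({0<..} \<times> UNIV) (\<lambda>(t, x). U t x) \<and>
     smooth_on ({0<..} \<times> UNIV) (\<lambda>(t, x). H t x) \<and>
     (\<forall>t>0. \<exists>p q.
        is_leray (tensor_div (\<lambda>x. flux_U (f t x) (g t x) (U t x) (H t x))) p \<and>
        is_leray (forcing_F (f t) (g t)) q \<and>
        (\<forall>x. time_deriv U t x - \<nu> *\<^sub>R laplacian (U t) x = - p x + q x)) \<and>
     (\<forall>t>0. \<forall>x. time_deriv H t x - \<mu> *\<^sub>R laplacian (H t) x =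
        - tensor_div (\<lambda>y. flux_H (f t y) (g t y) (U t y) (H t y)) x + forcing_G (f t) (g t) x) \<and>
     (\<forall>t>0. \<forall>x. divergence (U t) x = 0 \<and> divergence (H t) x = 0) \<and>
     U 0 = u01 \<and> H 0 = h01 \<and>
     ((\<lambda>t. fourier_weight (\<lambda>\<xi>. 1 / norm \<xi>) (\<lambda>x. U t x - u01 x)) \<longlongrightarrow> 0) (at_right 0) \<and>
     ((\<lambda>t. fourier_weight (\<lambda>\<xi>. 1 / norm \<xi>) (\<lambda>x. H t x - h01 x)) \<longlongrightarrow> 0) (at_right 0)"

end

theory Submission
  imports Defs "HOL-Probability.Probability"
begin

text \<open>Taking the Fourier transform in space turns the full system for \<open>(u, h)\<close> into a mild integral equation
  with a quadratic convolution term, solved by iteration around the heat flow of the large data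
  \<open>(u\<^sub>0\<^sub>2, h\<^sub>0\<^sub>2)\<close>.  Pointwise in frequency, the differences of the iterates are dominated by nonnegative
  functions obeying a linear inequality with the same convolution structure.  In the norm with weight
  \<open>1/|\<xi>|\<close> this inequality contracts: the part linear in the heat flow is absorbed by a factor
  \<open>exp (\<lambda> \<integral>\<psi>\<^sup>2)\<close>, where \<open>\<psi>\<close> is the mass of the heat flow, square integrable in time because of the weight
  \<open>1 + 1/|\<xi>|\<^sup>2\<close>; the remaining terms are small.  Carrying the weight \<open>exp (sqrt t |\<xi>| / 2)\<close> through
  the estimates gives exponential decay in frequency for \<open>t > 0\<close>, hence smoothness; the equation for
  \<open>(U, H) = (u - f, h - g)\<close> is then read off in Fourier variables, once the maximum principle has identified
  \<open>f\<close> and \<open>g\<close> with the inverse transforms of the heat flow.\<close>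

text \<open>The iteration is run for the full fields and not for the perturbation
  \<open>(U, H)\<close>: the equation for \<open>(u, h)\<close> is purely quadratic, while the one
  for \<open>(U, H)\<close> has linear terms with large coefficients and a forcing. In Fourier
  variables the quadratic term evaluated at the heat flow is exactly the projected \<open>F\<close>
  and the forcing \<open>G\<close>, because the Leray symbol kills the gradient part of
  \<open>F\<close>; so the smallness hypothesis makes the first increment small. The factor |xi| of
  the divergence cancels against the weight 1/|xi|, and masses are recovered by interpolating
  between the weights 1/|xi| and |xi|. The obstacle is that the hypothesis on the forcing carries no
  exponential weight. The background tolerates even the square of that weight, at the price of half
  of the viscosity, so the weighted forcing is bounded by a large multiple of the small one plus a
  small multiple of one that is merely bounded; \<open>split_const\<close> balances the two. The
  final bound need not be proportional to the data: \<open>\<delta>\<^sub>0\<close> is a fixed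
  number, so a bound by a constant suffices and \<open>C\<^sub>s\<close> is a quotient.\<close>

type_synonym R3 = "real^3"

abbreviation (input) lborel_nn_integral :: "('a::euclidean_space \<Rightarrow> ennreal) \<Rightarrow> ennreal" (binder "nint " 10) where
  "lborel_nn_integral F \<equiv> nn_integral lborel F"
abbreviation (input) lborel_integral :: "('a::euclidean_space \<Rightarrow> 'b::{banach,second_countable_topology}) \<Rightarrow> 'b" (binder "lint " 10) where
  "lborel_integral F \<equiv> integral\<^sup>L lborel F"
abbreviation (input) sum_UNIV :: "('a \<Rightarrow> 'b::comm_monoid_add) \<Rightarrow> 'b" (binder "SU " 10) where
  "sum_UNIV F \<equiv> sum F UNIV"
abbreviation (input) BM :: "('a::topological_space \<Rightarrow> 'b::topological_space) set" where
  "BM \<equiv> borel_measurable borel"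
abbreviation (input) nsq :: "R3 \<Rightarrow> real" where
  "nsq \<xi> \<equiv> (norm \<xi>)\<^sup>2"
abbreviation (input) hk :: "real \<Rightarrow> real \<Rightarrow> R3 \<Rightarrow> real" where
  "hk k t \<xi> \<equiv> exp (- (k * t * (norm \<xi>)\<^sup>2))"
abbreviation (input) en :: "'a::real_normed_vector \<Rightarrow> ennreal" where
  "en z \<equiv> ennreal (norm z)"
abbreviation (input) ind :: "real \<Rightarrow> real \<Rightarrow> 'a::zero_neq_one" where
  "ind t \<equiv> indicator {0..t}"
abbreviation (input) "ift \<equiv> inv_fourier_int"
abbreviation (input) "fw1 \<equiv> fourier_weight (\<lambda>\<xi>. 1 / norm \<xi>)"

section \<open>Closure properties of the k times continuously differentiable functions\<close>

lemma Ck_on_imp_continuous_on: "Ck_on k S f ==> continuous_on S f" by (cases k) auto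

lemma Ck_on_Suc_D: "Ck_on (Suc k) S f ==> Ck_on k S f" by (induction k arbitrary: f) auto

lemma Ck_on_cong:
 assumes "open S" "!!x. x \<in> S ==> f x = g x"
 shows "Ck_on k S f \<longleftrightarrow> Ck_on k S g"
 using assms(2)
proof (induction k arbitrary: f g)
 case 0
 thus ?case by (simp cong: continuous_on_cong)
next
 case (Suc k)
 have d: "(f has_derivative D) (at x) \<longleftrightarrow> (g has_derivative D) (at x)" if "x \<in> S" for x D
  using has_derivative_transform_within_open[OF _ assms(1) that] Suc.prems by metis
 have "frechet_derivative f (at x) = frechet_derivative g (at x)" if "x \<in> S" for x
  unfolding frechet_derivative_def using d[OF that] by simp
 hence "Ck_on k S (%x. frechet_derivative f (at x) b) \<longleftrightarrow>
   Ck_on k S (%x. frechet_derivative g (at x) b)" for b by (intro Suc.IH) auto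
 moreover have "f differentiable_on S \<longleftrightarrow> g differentiable_on S"
  using d assms(1) by (auto simp: differentiable_on_eq_differentiable_at differentiable_def)
 moreover have "continuous_on S f \<longleftrightarrow> continuous_on S g"
  using Suc.prems by (simp cong: continuous_on_cong)
 ultimately show ?case by simp
qed

text \<open>Derivatives on an open set are unique, so any candidate \<open>f'\<close> may stand for
  \<open>frechet_derivative\<close>; the closure properties below then never have to compute the
  latter.\<close>

lemma Ck_on_SucI:
 assumes "open S" "!!x. x \<in> S ==> (f has_derivative f' x) (at x)"
  and "!!b. b \<in> Basis ==> Ck_on k S (%x. f' x b)"
 shows "Ck_on (Suc k) S f"
proof -
 have "f differentiable_on S"
  using assms(1,2) by (auto simp: differentiable_on_eq_differentiable_at differentiable_def)
 moreover have "Ck_on k S (%x. frechet_derivative f (at x) b)" if "b \<in> Basis" for b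
  using Ck_on_cong[OF assms(1), of "%x. frechet_derivative f (at x) b" "%x. f' x b" k]
   assms(2) assms(3)[OF that] frechet_derivative_at by metis
 ultimately show ?thesis by (simp add: differentiable_imp_continuous_on)
qed

lemma Ck_on_Suc_has_derivative:
 assumes "open S" "Ck_on (Suc k) S f" "x \<in> S"
 shows "(f has_derivative frechet_derivative f (at x)) (at x)"
 using assms by (simp add: differentiable_on_eq_differentiable_at frechet_derivative_works)

lemma Ck_on_bounded_linear:
 assumes "bounded_linear L" "open S" "Ck_on k S f"
 shows "Ck_on k S (%x. L (f x))"
 using assms(3)
proof (induction k arbitrary: f)
 case 0
 thus ?case
  using assms(1) by (simp add: bounded_linear.continuous_on)
next
 case (Suc k)
 show ?case
 proof (rule Ck_on_SucI[OF assms(2)])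
  show "((%x. L (f x)) has_derivative (%h. L (frechet_derivative f (at x) h))) (at x)" if "x \<in> S" for x
   using bounded_linear.has_derivative[OF assms(1)] Ck_on_Suc_has_derivative[OF assms(2) Suc.prems that]
   by blast
  show "Ck_on k S (%x. L (frechet_derivative f (at x) b))" if "b \<in> Basis" for b
   using Suc.IH Suc.prems that by simp
 qed
qed

lemma Ck_on_add:
 assumes "open S" "Ck_on k S f" "Ck_on k S g"
 shows "Ck_on k S (%x. f x + g x)"
 using assms(2,3)
proof (induction k arbitrary: f g)
 case 0
 thus ?case by (simp add: continuous_on_add)
next
 case (Suc k)
 show ?case
 proof (rule Ck_on_SucI[OF assms(1)])
  show "((%x. f x + g x) has_derivative
    (%h. frechet_derivative f (at x) h + frechet_derivative g (at x) h)) (at x)" if "x \<in> S" for x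
   by (intro has_derivative_add Ck_on_Suc_has_derivative[OF assms(1) Suc.prems(1) that]
     Ck_on_Suc_has_derivative[OF assms(1) Suc.prems(2) that])
  show "Ck_on k S (%x. frechet_derivative f (at x) b + frechet_derivative g (at x) b)"
   if "b \<in> Basis" for b
   using Suc.IH Suc.prems that by simp
 qed
qed

lemma Ck_on_diff:
 assumes "open S" "Ck_on k S f" "Ck_on k S g"
 shows "Ck_on k S (%x. f x - g x)"
 using Ck_on_add[OF assms(1,2) Ck_on_bounded_linear[OF bounded_linear_minus[OF bounded_linear_ident] assms(1,3)]]
 by simp

lemma Ck_on_const: "open S ==> Ck_on k S (%x. c)"
proof (induction k arbitrary: c)
 case (Suc k)
 thus ?case by (intro Ck_on_SucI[where f' = "%x h. 0"]) auto
qed simp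

lemma Ck_on_sum:
 assumes "open S" "finite I" "!!i. i \<in> I ==> Ck_on k S (f i)"
 shows "Ck_on k S (%x. \<Sum>i\<in>I. f i x)"
 using assms(2,3) by (induction rule: finite_induct) (auto intro: Ck_on_add Ck_on_const assms(1))

lemma Ck_on_mult:
 fixes f g :: "'a::euclidean_space => real"
 assumes "open S" "Ck_on k S f" "Ck_on k S g"
 shows "Ck_on k S (%x. f x * g x)"
 using assms(2,3)
proof (induction k arbitrary: f g)
 case 0
 thus ?case by (simp add: continuous_on_mult)
next
 case (Suc k)
 show ?case
 proof (rule Ck_on_SucI[OF assms(1)])
  show "((%x. f x * g x) has_derivative
    (%h. f x * frechet_derivative g (at x) h + frechet_derivative f (at x) h * g x)) (at x)"
   if "x \<in> S" for x by (intro has_derivative_mult Ck_on_Suc_has_derivative[OF assms(1) Suc.prems(1) that]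
     Ck_on_Suc_has_derivative[OF assms(1) Suc.prems(2) that])
  show "Ck_on k S (%x. f x * frechet_derivative g (at x) b + frechet_derivative f (at x) b * g x)"
   if "b \<in> Basis" for b
  proof (intro Ck_on_add[OF assms(1)] Suc.IH)
   show "Ck_on k S f" "Ck_on k S g"
    using Suc.prems by (blast intro: Ck_on_Suc_D)+
  qed (use Suc.prems that in auto)
 qed
qed

lemma Ck_on_vec:
 fixes f :: "'a::euclidean_space => real^3"
 assumes "open S" "!!i. Ck_on k S (%x. f x $ i)"
 shows "Ck_on k S f"
proof -
 have bl: "bounded_linear (%r. r *\<^sub>R axis i (1::real) :: real^3)" for i
  by (rule bounded_linear_scaleR_left)
 have "Ck_on k S (%x. SU i. (f x $ i) *\<^sub>R axis i (1::real))"
  by (rule Ck_on_sum[OF assms(1) finite]) (rule Ck_on_bounded_linear[OF bl assms(1) assms(2)])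
 moreover have "(SU i. (y $ i) *\<^sub>R axis i 1) = y" for y :: "real^3"
  using basis_expansion[of y] by (simp add: scalar_mult_eq_scaleR)
 ultimately show ?thesis by simp
qed

text \<open>The total derivative in the directions \<open>(0, h)\<close> and \<open>(1, 0)\<close>;
  through it one joint statement in \<open>(t, x)\<close> yields both the spatial and the time
  derivative.\<close>

lemma has_derivative_slice:
 fixes F :: "real \<times> R3 => 'b::real_normed_vector"
 assumes "(F has_derivative D) (at (t, x))"
 shows "((%y. F (t, y)) has_derivative (%h. D (0, h))) (at x)"
  and "((%s. F (s, x)) has_vector_derivative D (1, 0)) (at t)"
proof -
 have 1: "((%y. (t, y)) has_derivative (%h. (0, h))) (at x)"
  by (intro has_derivative_Pair has_derivative_const has_derivative_ident)
 show "((%y. F (t, y)) has_derivative (%h. D (0, h))) (at x)"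
  using has_derivative_compose[OF 1, of F D] assms by simp
 have 2: "((%s. (s, x)) has_derivative (%h. (h, 0))) (at t)"
  by (intro has_derivative_Pair has_derivative_const has_derivative_ident)
 have "((%s. F (s, x)) has_derivative (%h. D (h, 0))) (at t)"
  using has_derivative_compose[OF 2, of F D] assms by simp
 moreover have "D (h, 0) = h *\<^sub>R D (1, 0)" for h
  using linear_scale[OF has_derivative_linear[OF assms], of h "(1, 0)"] by simp
 hence "(%h. D (h, 0)) = (%h. h *\<^sub>R D (1, 0))" by (rule ext)
 ultimately show "((%s. F (s, x)) has_vector_derivative D (1, 0)) (at t)"
  unfolding has_vector_derivative_def by (simp only:)
qed

lemma Ck_on_slice:
 fixes F :: "real \<times> R3 => 'b::real_normed_vector"
 assumes "Ck_on k ({0<..} \<times> UNIV) F" "t > 0"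
 shows "Ck_on k UNIV (%x. F (t, x))"
 using assms(1)
proof (induction k arbitrary: F)
 case 0
 hence "continuous_on ({0<..} \<times> UNIV) F" by simp
 hence "continuous_on UNIV (%x. F (t, x))"
  using assms(2) by (intro continuous_on_compose2[of "{0<..} \<times> UNIV" F UNIV "%x. (t, x)"])
   (auto intro: continuous_on_Pair continuous_on_const continuous_on_id)
 thus ?case by simp
next
 case (Suc k)
 have op: "open ({0<..} \<times> UNIV :: (real \<times> R3) set)" by (intro open_Times) auto
 show ?case
 proof (rule Ck_on_SucI)
  show "((%x. F (t, x)) has_derivative (%h. frechet_derivative F (at (t, x)) (0, h))) (at x)" for x
   using has_derivative_slice(1)[OF Ck_on_Suc_has_derivative[OF op Suc.prems, of "(t, x)"]] assms(2) by simp
  fix b :: R3 assume "b \<in> Basis"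
  hence "(0, b) \<in> (Basis :: (real \<times> R3) set)" by (simp add: Basis_prod_def)
  hence "Ck_on k ({0<..} \<times> UNIV) (%p. frechet_derivative F (at p) (0, b))"
   using Suc.prems by simp
  from Suc.IH[OF this] show "Ck_on k UNIV (%x. frechet_derivative F (at (t, x)) (0, b))" .
 qed auto
qed

section \<open>Smooth cutoff functions\<close>

primrec Ck_real :: "nat => (real => real) => bool" where
 "Ck_real 0 q \<longleftrightarrow> continuous_on UNIV q"
| "Ck_real (Suc k) q \<longleftrightarrow> (\<exists>q'. (\<forall>x. (q has_real_derivative q' x) (at x)) & Ck_real k q')"

lemma Ck_real_SucI:
 "(!!x. (q has_real_derivative q' x) (at x)) ==> Ck_real k q' ==> Ck_real (Suc k) q"
 unfolding Ck_real.simps by (intro exI[of _ q'] conjI allI)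

lemma Ck_real_imp_continuous: "Ck_real k q ==> continuous_on UNIV q"
 by (cases k) (auto intro: DERIV_continuous_on)

lemma Ck_real_Suc_D: "Ck_real (Suc k) q ==> Ck_real k q"
proof (induction k arbitrary: q)
 case 0
 thus ?case using Ck_real_imp_continuous[OF 0] by simp
next
 case (Suc k)
 thus ?case by (metis Ck_real.simps(2))
qed

lemma Ck_real_add: "Ck_real k p ==> Ck_real k q ==> Ck_real k (%x. p x + q x)"
proof (induction k arbitrary: p q)
 case 0
 thus ?case by (auto intro: continuous_on_add)
next
 case (Suc k)
 then obtain p' q' where "\<forall>x. (p has_real_derivative p' x) (at x)" "Ck_real k p'"
  "\<forall>x. (q has_real_derivative q' x) (at x)" "Ck_real k q'" by auto
 thus ?case
  using Suc.IH by (auto intro!: exI[of _ "%x. p' x + q' x"] DERIV_add)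
qed

lemma Ck_real_mult: "Ck_real k p ==> Ck_real k q ==> Ck_real k (%x. p x * q x)"
proof (induction k arbitrary: p q)
 case 0
 thus ?case by (auto intro: continuous_on_mult)
next
 case (Suc k)
 obtain p' q' where d: "\<forall>x. (p has_real_derivative p' x) (at x)" "Ck_real k p'"
  "\<forall>x. (q has_real_derivative q' x) (at x)" "Ck_real k q'" using Suc.prems by auto
 have "Ck_real k (%x. p' x * q x + q' x * p x)"
  by (intro Ck_real_add Suc.IH d(2,4) Ck_real_Suc_D[OF Suc.prems(1)] Ck_real_Suc_D[OF Suc.prems(2)])
 moreover have "((%x. p x * q x) has_real_derivative p' x * q x + q' x * p x) (at x)" for x
  using d by (intro DERIV_mult) auto
 ultimately show ?case by (intro Ck_real_SucI)
qed

lemma Ck_real_const: "Ck_real k (%x. c)"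
proof (induction k arbitrary: c)
 case (Suc k)
 thus ?case by (auto intro!: exI[of _ "%x. 0"])
qed simp

lemma Ck_real_affine: "Ck_real k q ==> Ck_real k (%x. q (c * x + d))"
proof (induction k arbitrary: q)
 case 0
 thus ?case by (auto intro: continuous_on_compose2 intro!: continuous_intros)
next
 case (Suc k)
 then obtain q' where d: "\<forall>x. (q has_real_derivative q' x) (at x)" "Ck_real k q'" by auto
 have "((%x. q (c * x + d)) has_real_derivative c * q' (c * x + d)) (at x)" for x
  by (rule DERIV_cong, rule DERIV_chain2[of q "q' (c*x+d)"])
    (auto intro!: derivative_eq_intros simp: d(1))
 moreover have "Ck_real k (%x. c * q' (c * x + d))" by (intro Ck_real_mult Ck_real_const Suc.IH d)
 ultimately show ?case by (intro Ck_real_SucI)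
qed

text \<open>The derivatives of exp (-1/x) are combinations of the functions x^(-n) exp (-1/x); with
  the whole family at hand, smoothness is a single induction over the order, for all
  \<open>n\<close> at once.\<close>

definition exp_inv_pow :: "nat => real => real" where
 "exp_inv_pow n x = (if x > 0 then inverse x ^ n * exp (- inverse x) else 0)"

lemma exp_inv_pow_tendsto: "((%x. inverse x ^ n * exp (- inverse x)) \<longlongrightarrow> 0) (at_right (0::real))"
proof -
 have "((%y::real. y ^ n / exp y) \<longlongrightarrow> 0) at_top" by (rule tendsto_power_div_exp_0)
 hence "((%x::real. inverse x ^ n / exp (inverse x)) \<longlongrightarrow> 0) (at_right 0)"
  using filterlim_compose[OF _ filterlim_inverse_at_top_right] by blast
 thus ?thesis by (simp add: exp_minus field_simps)
qed

lemma exp_inv_pow_deriv: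
 "(exp_inv_pow n has_real_derivative (exp_inv_pow (n + 2) x - real n * exp_inv_pow (n + 1) x)) (at x)"
proof -
 consider "x > 0" | "x < 0" | "x = 0" by linarith
 thus ?thesis
 proof cases
  case 1
  have "((%x. inverse x ^ n * exp (- inverse x)) has_real_derivative
    (exp_inv_pow (n + 2) x - real n * exp_inv_pow (n + 1) x)) (at x)"
  proof -
   have i: "(inverse has_real_derivative - (inverse x ^ 2)) (at x)"
    using DERIV_inverse[of x] 1 by (simp add: numeral_2_eq_2)
   have "((%x. inverse x ^ n * exp (- inverse x)) has_real_derivative
     real n * inverse x ^ (n - 1) * - (inverse x ^ 2) * exp (- inverse x) +
     exp (- inverse x) * - (- (inverse x ^ 2)) * inverse x ^ n) (at x)"
    by (rule DERIV_mult DERIV_power DERIV_fun_exp DERIV_minus i DERIV_cong[OF DERIV_power[OF i]] | simp)+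
   thus ?thesis
    by (rule DERIV_cong) (use 1 in \<open>cases n; simp add: exp_inv_pow_def power2_eq_square algebra_simps\<close>)
  qed
  thus ?thesis by (rule has_field_derivative_transform_within_open[of _ _ _ "{0<..}"])
    (use 1 in \<open>auto simp: exp_inv_pow_def\<close>)
 next
  case 2
  have "((%x. 0) has_real_derivative
    (exp_inv_pow (n + 2) x - real n * exp_inv_pow (n + 1) x)) (at x)"
   using 2 by (auto simp: exp_inv_pow_def)
  thus ?thesis by (rule has_field_derivative_transform_within_open[of _ _ _ "{..<0}"])
    (use 2 in \<open>auto simp: exp_inv_pow_def\<close>)
 next
  case 3
  \<comment> \<open>To the right of 0 the difference quotient is again a member of the family, with
    exponent raised by one.\<close>
  have r: "((%h. exp_inv_pow n h / h) \<longlongrightarrow> 0) (at_right 0)"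
   by (rule Lim_transform_eventually[OF exp_inv_pow_tendsto[of "Suc n"]])
    (auto simp: eventually_at_filter exp_inv_pow_def field_simps intro!: always_eventually)
  have l: "((%h. exp_inv_pow n h / h) \<longlongrightarrow> 0) (at_left 0)"
   by (rule Lim_transform_eventually[of "%x. 0"])
    (auto simp: eventually_at_filter exp_inv_pow_def intro!: always_eventually)
  have "((%h. exp_inv_pow n h / h) \<longlongrightarrow> 0) (at 0)"
   using l r filterlim_split_at by blast
  thus ?thesis
   using 3 by (simp add: DERIV_def exp_inv_pow_def)
 qed
qed

lemma Ck_real_exp_inv_pow: "Ck_real k (exp_inv_pow n)"
proof (induction k arbitrary: n)
 case 0
 thus ?case
  using DERIV_continuous_on[OF has_field_derivative_at_within[OF exp_inv_pow_deriv[of n]]] by simp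
next
 case (Suc k)
 have "Ck_real k (%x. exp_inv_pow (n + 2) x + (- real n) * exp_inv_pow (n + 1) x)"
  by (intro Ck_real_add Ck_real_mult Ck_real_const Suc)
 hence "Ck_real k (%x. exp_inv_pow (n + 2) x - real n * exp_inv_pow (n + 1) x)" by simp
 thus ?case using exp_inv_pow_deriv[of n] by (intro Ck_real_SucI)
qed

lemma Ck_on_component: "Ck_real k q ==> Ck_on k UNIV (%x::R3. q (x $ i))"
proof (induction k arbitrary: q)
 case 0
 thus ?case by (auto intro: continuous_on_compose2 intro!: continuous_intros)
next
 case (Suc k)
 then obtain q' where d: "\<forall>x. (q has_real_derivative q' x) (at x)" "Ck_real k q'" by auto
 show ?case
 proof (rule Ck_on_SucI)
  show "((%x::R3. q (x $ i)) has_derivative (%h. (h $ i) * q' (x $ i))) (at x)" for x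
  proof (rule has_derivative_eq_rhs)
   show "((%x::R3. q (x $ i)) has_derivative (%h. (*) (q' (x $ i)) (h $ i))) (at x)"
    by (rule has_derivative_compose[of "%x::R3. x $ i" "%h. h $ i" x UNIV q])
      (use d(1) in \<open>auto simp: has_field_derivative_def intro!: bounded_linear_imp_has_derivative bounded_linear_vec_nth\<close>)
  qed (simp add: mult.commute)
  show "Ck_on k UNIV (%x::R3. (b $ i) * q' (x $ i))" for b :: R3
   by (intro Ck_on_mult Ck_on_const Suc.IH d) auto
 qed auto
qed

text \<open>Product of a left and a right cutoff; for \<open>n > 0\<close> it is nonzero exactly
  within distance \<open>1 / n\<close> of \<open>y\<close>.\<close>

definition bump1 :: "nat => real => real => real" where
 "bump1 n y s = exp_inv_pow 0 (real n * (s - y) + 1) * exp_inv_pow 0 (1 - real n * (s - y))"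

definition bump :: "nat => R3 => R3 => real" where
 "bump n y x = bump1 n (y $ 1) (x $ 1) * bump1 n (y $ 2) (x $ 2) * bump1 n (y $ 3) (x $ 3)"

lemma Ck_real_bump1: "Ck_real k (bump1 n y)"
proof -
 have "Ck_real k (%s. exp_inv_pow 0 (real n * s + (1 - real n * y)) *
   exp_inv_pow 0 (- real n * s + (1 + real n * y)))"
  by (intro Ck_real_mult Ck_real_affine Ck_real_exp_inv_pow)
 thus ?thesis by (simp add: bump1_def[abs_def] algebra_simps)
qed

lemma smooth_on_bump: "smooth_on UNIV (bump n y)"
 unfolding smooth_on_def bump_def[abs_def]
 using Ck_on_mult[OF open_UNIV Ck_on_mult[OF open_UNIV Ck_on_component[OF Ck_real_bump1, of _ n "y $ 1" 1]
   Ck_on_component[OF Ck_real_bump1, of _ n "y $ 2" 2]] Ck_on_component[OF Ck_real_bump1, of _ n "y $ 3" 3]]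
 by blast

lemma exp_inv_pow_0_nonneg: "exp_inv_pow 0 x >= 0" by (simp add: exp_inv_pow_def)

lemma exp_inv_pow_0_pos_iff: "exp_inv_pow 0 x ~= 0 \<longleftrightarrow> x > 0" by (simp add: exp_inv_pow_def)

lemma bump_nonneg: "bump n y x >= 0"
 unfolding bump_def bump1_def by (intro mult_nonneg_nonneg exp_inv_pow_0_nonneg)

lemma bump_center: "bump n y y > 0"
proof -
 have "exp_inv_pow 0 1 > 0" by (simp add: exp_inv_pow_def)
 thus ?thesis by (simp add: bump_def bump1_def)
qed

lemma bump_support:
 assumes "bump n y x ~= 0" "n > 0"
 shows "norm (x - y) <= 3 / real n"
proof -
 have c: "\<bar>s - z\<bar> <= 1 / real n" if "bump1 n z s ~= 0" for z s
 proof -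
  have "\<bar>real n * (s - z)\<bar> < 1"
   using that by (simp add: bump1_def exp_inv_pow_0_pos_iff abs_less_iff)
  hence "real n * \<bar>s - z\<bar> <= 1" by (simp add: abs_mult)
  thus ?thesis using assms(2) by (simp add: pos_le_divide_eq mult.commute)
 qed
 have "\<bar>(x - y) $ i\<bar> <= 1 / real n" for i
 proof -
  have "bump1 n (y $ 1) (x $ 1) ~= 0" "bump1 n (y $ 2) (x $ 2) ~= 0" "bump1 n (y $ 3) (x $ 3) ~= 0"
   using assms(1) unfolding bump_def by auto
  hence "bump1 n (y $ i) (x $ i) ~= 0"
   using exhaust_3[of i] by (elim disjE) simp_all
  thus ?thesis using c by simp
 qed
 hence "(SU i. \<bar>(x - y) $ i\<bar>) <= (\<Sum>i\<in>(UNIV::3 set). 1 / real n)" by (intro sum_mono)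
 thus ?thesis
  using norm_le_l1_cart[of "x - y"] by simp
qed

lemma bump_translate: "bump n y x = bump n 0 (x - y)"
 unfolding bump_def bump1_def by simp

lemma test_function_of_real_bump:
 assumes "n > 0"
 shows "test_function (%x. of_real (bump n y x) :: complex)"
proof -
 have "{x. bump n y x ~= 0} \<subseteq> cball y (3 / real n)"
  using bump_support[OF _ assms, of y] by (auto simp: mem_cball dist_norm norm_minus_commute[of y])
 hence "bounded {x. bump n y x ~= 0}"
  using bounded_cball bounded_subset by blast
 moreover have "smooth_on UNIV (%x. of_real (bump n y x) :: complex)"
  using smooth_on_bump[of n y] Ck_on_bounded_linear[OF bounded_linear_of_real open_UNIV]
  unfolding smooth_on_def by blast
 ultimately show ?thesis by (simp add: test_function_def)
qed

section \<open>Limits, derivatives and changes of variables under the integral\<close>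

lemma tendsto_integral_dominated:
 fixes g :: "'p::first_countable_topology => 'x => 'b::{banach,second_countable_topology}"
 assumes int: "!!p. p \<in> S ==> p \<in> U ==> g p \<in> borel_measurable M" and "g0 \<in> borel_measurable M"
  and U: "open U" "p0 \<in> U"
  and lim: "AE x in M. ((%p. g p x) \<longlongrightarrow> g0 x) (at p0 within S)"
  and bound: "AE x in M. \<forall>p\<in>U \<inter> S. norm (g p x) <= B x"
  and B: "integrable M (B :: 'x => real)"
 shows "((%p. \<integral>x. g p x \<partial>M) \<longlongrightarrow> (\<integral>x. g0 x \<partial>M)) (at p0 within S)"
 unfolding tendsto_at_iff_sequentially
proof (intro allI impI)
 fix X assume X: "\<forall>i. X i \<in> S - {p0}" "X \<longlonglongrightarrow> p0"
 hence "eventually (%n. X n \<in> U) sequentially"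
  using U by (auto dest: topological_tendstoD)
 \<comment> \<open>The bound holds only for parameters in \<open>U\<close>, so the first terms of
   the sequence are skipped.\<close>
 then obtain N where N: "!!n. n >= N ==> X n \<in> U" by (auto simp: eventually_sequentially)
 have X': "(%n. X (n + N)) \<longlonglongrightarrow> p0" using X(2) by (rule LIMSEQ_ignore_initial_segment)
 have "(%n. \<integral>x. g (X (n + N)) x \<partial>M) \<longlonglongrightarrow> (\<integral>x. g0 x \<partial>M)"
 proof (rule integral_dominated_convergence[where w = B])
  show "g (X (n + N)) \<in> borel_measurable M" for n
   using X(1) N[of "n + N"] by (intro int) auto
  show "AE x in M. (%n. g (X (n + N)) x) \<longlonglongrightarrow> g0 x"
   using lim
  proof eventually_elim
   case (elim x)
   from elim[unfolded tendsto_at_iff_sequentially, rule_format, of "%n. X (n + N)"]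
   show ?case using X(1) X' by (simp add: comp_def)
  qed
  show "AE x in M. norm (g (X (n + N)) x) <= B x" for n
   using bound X(1) N[of "n + N"] by auto
 qed (use assms in auto)
 hence "(%n. (\<integral>x. g (X n) x \<partial>M)) \<longlonglongrightarrow> (\<integral>x. g0 x \<partial>M)"
  by (rule LIMSEQ_offset)
 thus "((%p. \<integral>x. g p x \<partial>M) \<circ> X) \<longlonglongrightarrow> (\<integral>x. g0 x \<partial>M)"
  by (simp add: comp_def)
qed

text \<open>By the mean value inequality the increment is at most \<open>B x\<close> times the norm
  of \<open>h\<close>, so the normalised remainder is bounded by \<open>2 * B x\<close> and
  dominated convergence applies. A single null set has to serve all parameters of the ball; hence
  the quantifiers inside \<open>AE\<close>.\<close>

lemma has_derivative_integral_dominated: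
 fixes g :: "'p::euclidean_space => 'x => 'b::{banach,second_countable_topology}"
 assumes r: "r > 0"
  and int: "!!p. p \<in> ball p0 r ==> integrable M (g p)"
  and meas: "!!h. (%x. g' p0 x h) \<in> borel_measurable M"
  and der: "AE x in M. \<forall>p\<in>ball p0 r. ((%p. g p x) has_derivative g' p x) (at p)"
  and bound: "AE x in M. \<forall>p\<in>ball p0 r. \<forall>h. norm (g' p x h) <= B x * norm h"
  and B: "integrable M (B :: 'x => real)"
 shows "((%p. \<integral>x. g p x \<partial>M) has_derivative (%h. \<integral>x. g' p0 x h \<partial>M)) (at p0)"
proof -
 have p0: "p0 \<in> ball p0 r" using r by simp
 have int': "integrable M (%x. g' p0 x h)" for h
 proof (rule Bochner_Integration.integrable_bound)
  show "integrable M (%x. B x * norm h)" using B by simp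
  show "AE x in M. norm (g' p0 x h) <= norm (B x * norm h)"
   using bound
  proof eventually_elim
   case (elim x)
   hence "norm (g' p0 x h) <= B x * norm h" using p0 by blast
   thus ?case by simp
  qed
 qed (rule meas)
 have lin: "AE x in M. linear (g' p0 x)"
  using der
 proof eventually_elim
  case (elim x)
  thus ?case using p0 by (intro has_derivative_linear[of "%p. g p x" _ "at p0"]) blast
 qed
 have "linear (%h. \<integral>x. g' p0 x h \<partial>M)"
 proof
  fix a b :: 'p and c :: real
  have "(\<integral>x. g' p0 x (a + b) \<partial>M) = (\<integral>x. g' p0 x a + g' p0 x b \<partial>M)"
   by (intro integral_cong_AE meas borel_measurable_add) (use lin in \<open>auto elim!: eventually_mono simp: linear_add\<close>)
  thus "(\<integral>x. g' p0 x (a + b) \<partial>M) = (\<integral>x. g' p0 x a \<partial>M) + (\<integral>x. g' p0 x b \<partial>M)"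
   using int' by simp
  have "(\<integral>x. g' p0 x (c *\<^sub>R a) \<partial>M) = (\<integral>x. c *\<^sub>R g' p0 x a \<partial>M)"
   by (intro integral_cong_AE meas borel_measurable_scaleR) (use lin in \<open>auto elim!: eventually_mono simp: linear_scale\<close>)
  thus "(\<integral>x. g' p0 x (c *\<^sub>R a) \<partial>M) = c *\<^sub>R (\<integral>x. g' p0 x a \<partial>M)"
   using int' by simp
 qed
 moreover have "((%h. norm ((\<integral>x. g (p0 + h) x \<partial>M) - (\<integral>x. g p0 x \<partial>M) - (\<integral>x. g' p0 x h \<partial>M)) / norm h) \<longlongrightarrow> 0) (at 0)"
 proof -
  define R where "R h x = (g (p0 + h) x - g p0 x - g' p0 x h) /\<^sub>R norm h" for h x
  have inb: "p0 + h \<in> ball p0 r" if "h \<in> ball 0 r" for h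
   using that by (simp add: dist_norm)
  have "((%h. \<integral>x. R h x \<partial>M) \<longlongrightarrow> (\<integral>x. 0 \<partial>M)) (at 0 within UNIV)"
  proof (rule tendsto_integral_dominated[where U = "ball 0 r" and B = "%x. 2 * B x"])
   show "R h \<in> borel_measurable M" if "h \<in> ball 0 r" for h
    unfolding R_def using int[OF inb[OF that]] int[OF p0] meas by measurable
   show "AE x in M. ((%h. R h x) \<longlongrightarrow> 0) (at 0)"
    using der
   proof eventually_elim
    case (elim x)
    hence "((%h. norm (g (p0 + h) x - g p0 x - g' p0 x h) / norm h) \<longlongrightarrow> 0) (at 0)"
     using p0 unfolding has_derivative_at by blast
    moreover have "norm (R h x) = norm (g (p0 + h) x - g p0 x - g' p0 x h) / norm h" for h
     unfolding R_def by (simp add: divide_inverse mult.commute)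
    ultimately have "((%h. norm (R h x)) \<longlongrightarrow> 0) (at 0)" by simp
    thus ?case by (rule tendsto_norm_zero_cancel)
   qed
   show "AE x in M. \<forall>h\<in>ball 0 r \<inter> UNIV. norm (R h x) <= 2 * B x"
    using der bound
   proof (eventually_elim, intro ballI)
    fix x h
    assume d: "\<forall>p\<in>ball p0 r. ((%p. g p x) has_derivative g' p x) (at p)"
     and b: "\<forall>p\<in>ball p0 r. \<forall>h. norm (g' p x h) <= B x * norm h"
     and h: "h \<in> ball 0 r \<inter> (UNIV::'p set)"
    \<comment> \<open>Testing the bound on a unit vector shows that \<open>B x\<close> is
      nonnegative, as the operator norm estimate requires.\<close>
    obtain e :: 'p where "norm e = 1" using vector_choose_size[of 1] by auto
    hence "norm (g' p0 x e) <= B x" using b[rule_format, OF p0, of e] by simp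
    hence B0: "B x >= 0" by (rule order_trans[OF norm_ge_zero])
    have "norm (g (p0 + h) x - g p0 x) <= B x * norm (p0 + h - p0)"
    proof (rule differentiable_bound[where S = "ball p0 r" and f' = "%p. g' p x"])
     show "((%p. g p x) has_derivative g' p x) (at p within ball p0 r)" if "p \<in> ball p0 r" for p
      using d that has_derivative_at_withinI by blast
     show "onorm (g' p x) <= B x" if "p \<in> ball p0 r" for p
      using b that B0 by (intro onorm_bound) auto
    qed (use inb h p0 in auto)
    hence "norm (g (p0 + h) x - g p0 x - g' p0 x h) <= 2 * B x * norm h"
     using norm_triangle_ineq4[of "g (p0 + h) x - g p0 x" "g' p0 x h"] b[rule_format, OF p0, of h] by simp
    thus "norm (R h x) <= 2 * B x"
    proof (cases "h = 0")
     case False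
     thus ?thesis
      using \<open>norm (g (p0 + h) x - g p0 x - g' p0 x h) <= _\<close>
      by (simp add: R_def divide_inverse[symmetric] pos_divide_le_eq mult.commute[of "inverse _"])
    qed (use B0 in \<open>simp add: R_def\<close>)
   qed
   show "integrable M (%x. 2 * B x)" using B by simp
  qed (use r in auto)
  hence "((%h. norm (\<integral>x. R h x \<partial>M)) \<longlongrightarrow> 0) (at 0)"
   by (intro tendsto_norm_zero) simp
  moreover have "\<forall>\<^sub>F h in at 0. norm (\<integral>x. R h x \<partial>M) =
    norm ((\<integral>x. g (p0 + h) x \<partial>M) - (\<integral>x. g p0 x \<partial>M) - (\<integral>x. g' p0 x h \<partial>M)) / norm h"
  proof -
   have "\<forall>\<^sub>F h in at 0. h \<in> ball (0::'p) r"
    using r by (intro eventually_at_in_open') auto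
   thus ?thesis
   proof eventually_elim
    case (elim h)
    have "(\<integral>x. R h x \<partial>M) = ((\<integral>x. g (p0 + h) x \<partial>M) - (\<integral>x. g p0 x \<partial>M) - (\<integral>x. g' p0 x h \<partial>M)) /\<^sub>R norm h"
     unfolding R_def using int[OF inb[OF elim]] int[OF p0] int' by simp
    thus ?case by (simp add: divide_inverse mult.commute)
   qed
  qed
  ultimately show ?thesis by (rule Lim_transform_eventually)
 qed
 ultimately show ?thesis
  unfolding has_derivative_at by (simp add: linear_conv_bounded_linear)
qed

lemma integral_affine_R3:
 fixes h :: "R3 => 'b::{banach,second_countable_topology}"
 assumes [measurable]: "h \<in> BM" and "c ~= 0"
 shows "(lint y. h y) = \<bar>c\<bar> ^ 3 *\<^sub>R (lint z. h (t + c *\<^sub>R z))"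
 by (subst lborel_affine[OF assms(2), of t])
   (simp add: integral_density integral_distr)

lemma integral_translate_R3:
 fixes h :: "R3 => 'b::{banach,second_countable_topology}"
 assumes [measurable]: "h \<in> BM"
 shows "(lint y. h (y - t)) = (lint z. h z)"
 using integral_affine_R3[of "%y. h (y - t)" 1 t] by simp

text \<open>The kernels in question are complex exponentials and rescaled Gaussians, all bounded by
  1; integrability of each factor in its own variable is then enough.\<close>

lemma Fubini_kernel:
 fixes k :: "'a::euclidean_space \<times> 'b::euclidean_space => complex"
 assumes [measurable]: "k \<in> BM" and k: "!!p. norm (k p) <= 1"
  and v: "integrable lborel v" and ph: "integrable lborel ph"
 shows "(lint x. (lint xi. k (x, xi) * v xi) * ph x) = (lint xi. v xi * (lint x. k (x, xi) * ph x))"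
proof -
 have [measurable]: "v \<in> BM" "ph \<in> BM"
  using v ph by (auto dest: borel_measurable_integrable)
 have kv: "integrable lborel (%xi. k (x, xi) * v xi)" for x
  by (rule Bochner_Integration.integrable_bound[OF v])
    (auto simp: norm_mult intro!: mult_left_le_one_le k)
 have "integrable (lborel \<Otimes>\<^sub>M lborel) (%(x, xi). k (x, xi) * v xi * ph x)"
 proof (rule lborel_pair.Fubini_integrable)
  show "AE x in lborel. integrable lborel (%y. case (x, y) of (x, xi) => k (x, xi) * v xi * ph x)"
   using kv by auto
  have "integrable lborel (%x. norm (ph x) * (lint y. norm (v y)))"
   using ph by simp
  thus "integrable lborel (%x. \<integral>y. norm (case (x, y) of (x, xi) => k (x, xi) * v xi * ph x) \<partial>lborel)"
  proof (rule Bochner_Integration.integrable_bound)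
   show "AE x in lborel. norm (lint y. norm (case (x, y) of (x, xi) => k (x, xi) * v xi * ph x))
     <= norm (norm (ph x) * (lint y. norm (v y)))"
   proof (rule AE_I2)
    fix x
    have "(lint y. norm (k (x, y) * v y * ph x)) <= (lint y. norm (ph x) * norm (v y))"
    proof (rule integral_mono)
     show "integrable lborel (%y. norm (k (x, y) * v y * ph x))" using kv by simp
     show "integrable lborel (%y. norm (ph x) * norm (v y))" using v by simp
     show "norm (k (x, y) * v y * ph x) <= norm (ph x) * norm (v y)" for y
      using mult_right_mono[OF k[of "(x,y)"], of "norm (ph x) * norm (v y)"] by (simp add: norm_mult mult_ac)
    qed
    thus "norm (lint y. norm (case (x, y) of (x, xi) => k (x, xi) * v xi * ph x))
     <= norm (norm (ph x) * (lint y. norm (v y)))" by simp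
   qed
  qed measurable
 qed measurable
 from lborel_pair.Fubini_integral[OF this]
 have "(lint xi. \<integral>x. k (x, xi) * v xi * ph x \<partial>lborel) = (lint x. \<integral>xi. k (x, xi) * v xi * ph x \<partial>lborel)" .
 moreover have "(lint xi. k (x, xi) * v xi * ph x) = (lint xi. k (x, xi) * v xi) * ph x" for x
  by (rule integral_mult_left_zero)
 moreover have "(lint x. k (x, xi) * v xi * ph x) = v xi * (lint x. k (x, xi) * ph x)" for xi
  unfolding integral_mult_right_zero[symmetric] by (simp add: mult_ac)
 ultimately show ?thesis by simp
qed

subsection \<open>Uniqueness for the Fourier transform of integrable functions\<close>

text \<open>Written as a product so that its Fourier integral factorises into characteristic
  functions of the one-dimensional standard normal distribution.\<close>

definition gauss3 :: "R3 => real" where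
 "gauss3 x = (\<Prod>b\<in>Basis. std_normal_density (x \<bullet> b))"

lemma integral_prod_R3:
 fixes f :: "R3 => real => 'c::{real_normed_field,banach,second_countable_topology}"
 assumes f: "!!b. b \<in> Basis ==> integrable lborel (f b)"
 shows "integrable lborel (%x. \<Prod>b\<in>Basis. f b (x \<bullet> b))"
  and "(lint x. (\<Prod>b\<in>Basis. f b (x \<bullet> b))) = (\<Prod>b\<in>Basis. \<integral>s. f b s \<partial>lborel)"
proof -
 interpret product_sigma_finite "%b::R3. lborel :: real measure" ..
 have [measurable]: "b \<in> Basis ==> f b \<in> BM" for b
  using borel_measurable_integrable[OF f[of b]] by simp
 have eq: "(\<Prod>b\<in>Basis. f b ((\<Sum>c\<in>Basis. g c *\<^sub>R c) \<bullet> b)) = (\<Prod>b\<in>Basis. f b (g b))" for g :: "R3 => real"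
  by (intro prod.cong refl) (simp add: inner_sum_left_Basis)
 have m: "(%f. \<Sum>b\<in>Basis. f b *\<^sub>R b) \<in> (\<Pi>\<^sub>M b\<in>Basis. lborel) \<rightarrow>\<^sub>M (borel :: R3 measure)"
  by measurable
 show "integrable lborel (%x. \<Prod>b\<in>Basis. f b (x \<bullet> b))"
  unfolding lborel_eq[where 'a = R3]
  by (subst integrable_distr_eq[OF m]) (use product_integrable_prod[OF finite_Basis f] eq in auto)
 show "(lint x. (\<Prod>b\<in>Basis. f b (x \<bullet> b))) = (\<Prod>b\<in>Basis. \<integral>s. f b s \<partial>lborel)"
  unfolding lborel_eq[where 'a = R3]
  by (subst integral_distr[OF m]) (use product_integral_prod[OF finite_Basis f] eq in auto)
qed

lemma integrable_gauss3: "integrable lborel gauss3"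
 unfolding gauss3_def[abs_def] by (intro integral_prod_R3(1)) simp

lemma integral_std_normal_cis:
 "integrable lborel (%s. of_real (std_normal_density s) * cis (s * t))"
 "(lint s. of_real (std_normal_density s) * cis (s * t)) = of_real (exp (- t\<^sup>2 / 2))"
proof -
 show "integrable lborel (%s. of_real (std_normal_density s) * cis (s * t))"
  by (rule Bochner_Integration.integrable_bound[of _ std_normal_density])
    (auto simp: norm_mult cis_conv_exp)
 have "char std_normal_distribution t = of_real (exp (- t\<^sup>2 / 2))"
  by (simp add: char_std_normal_distribution)
 moreover have "char std_normal_distribution t = (lint s. std_normal_density s *\<^sub>R iexp (t * s))"
  unfolding char_def by (subst integral_density) auto
 ultimately show "(lint s. of_real (std_normal_density s) * cis (s * t)) = of_real (exp (- t\<^sup>2 / 2))"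
  by (simp add: cis_conv_exp scaleR_conv_of_real mult_ac)
qed

lemma cis_inner_prod: "cis (x \<bullet> y) = (\<Prod>b\<in>Basis. cis ((x \<bullet> b) * (y \<bullet> b)))" for x y :: R3
 by (simp add: euclidean_inner[of x y] cis_conv_exp sum_distrib_left exp_sum)

lemma sum_half_squares: "(\<Sum>b\<in>Basis. - (y \<bullet> b)\<^sup>2 / 2) = - nsq y / 2" for y :: R3
proof -
 have "nsq y = (\<Sum>b\<in>Basis. (y \<bullet> b)\<^sup>2)"
  by (subst power2_norm_eq_inner, subst euclidean_inner) (simp add: power2_eq_square)
 thus ?thesis by (simp add: sum_negf sum_divide_distrib)
qed

lemma integral_gauss3_cis:
 "(lint x. of_real (gauss3 x) * cis (x \<bullet> y)) = of_real (exp (- nsq y / 2))"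
proof -
 have "(lint x. of_real (gauss3 x) * cis (x \<bullet> y)) =
   (lint x. (\<Prod>b\<in>Basis. of_real (std_normal_density (x \<bullet> b)) * cis ((x \<bullet> b) * (y \<bullet> b))))"
  by (simp add: gauss3_def cis_inner_prod[of _ y] prod.distrib)
 also have "... = (\<Prod>b\<in>Basis. of_real (exp (- (y \<bullet> b)\<^sup>2 / 2)))"
  by (subst integral_prod_R3(2)) (auto simp: integral_std_normal_cis)
 also have "... = of_real (exp (\<Sum>b\<in>Basis. - (y \<bullet> b)\<^sup>2 / 2))" by (simp add: exp_sum)
 also note sum_half_squares
 finally show ?thesis .
qed

lemma gauss3_eq: "gauss3 x = (1 / sqrt (2 * pi)) ^ 3 * exp (- nsq x / 2)"
proof -
 have "gauss3 x = (1 / sqrt (2 * pi)) ^ 3 * exp (\<Sum>b\<in>Basis. - (x \<bullet> b)\<^sup>2 / 2)"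
  by (simp add: gauss3_def std_normal_density_def exp_sum prod_dividef power_one_over)
 also note sum_half_squares
 finally show ?thesis .
qed

lemma integrable_gaussian: "integrable lborel (%x::R3. exp (- nsq x / 2))"
proof -
 have "integrable lborel (%x. gauss3 x / (1 / sqrt (2 * pi)) ^ 3)"
  by (intro integrable_divide integrable_gauss3)
 thus ?thesis by (simp add: gauss3_eq)
qed

lemma integral_gaussian_pos: "(lint x. exp (- (norm (x::R3))\<^sup>2 / 2)) > 0"
proof -
 have "(lint x. of_real (gauss3 x) * cis (x \<bullet> 0)) = (of_real (exp (- (norm (0::R3))\<^sup>2 / 2)) :: complex)"
  by (rule integral_gauss3_cis)
 hence "(lint x. complex_of_real (gauss3 x)) = 1" by simp
 hence "(lint x. gauss3 x) = 1" by simp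
 hence "(1 / sqrt (2 * pi)) ^ 3 * (lint x. exp (- (norm (x::R3))\<^sup>2 / 2)) = 1"
  by (simp add: gauss3_eq[abs_def])
 moreover have "(1 / sqrt (2 * pi)) ^ 3 > 0" by simp
 ultimately show ?thesis by (metis less_numeral_extra(1) zero_less_mult_pos)
qed

text \<open>Indicators of closed sets are bounded limits of continuous functions, and the closed
  sets form an intersection-stable generator of the Borel sets; so the integral over every Borel set
  vanishes.\<close>

lemma AE_zero_if_integral_continuous_zero:
 fixes W :: "R3 => complex"
 assumes W: "integrable lborel W"
  and z: "!!b :: R3 => real. continuous_on UNIV b ==> (!!x. \<bar>b x\<bar> <= 1) ==> (lint x. W x * of_real (b x)) = 0"
 shows "AE x in lborel. W x = 0"
proof -
 have [measurable]: "W \<in> BM" using W by (auto dest: borel_measurable_integrable)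
 have int_set: "set_integrable lborel A W" if "A \<in> sets borel" for A
  using W that unfolding set_integrable_def by (intro integrable_mult_indicator) auto
 have tot: "(lint x. W x) = 0" using z[of "%x. 1"] by simp
 have closed0: "set_lebesgue_integral lborel C W = 0" if C: "closed C" for C
 proof (cases "C = {}")
  case False
  \<comment> \<open>Equal to 1 on \<open>C\<close> and to 0 at distance \<open>1 / k\<close> or more
    from it.\<close>
  define b where "b k x = max 0 (1 - real k * infdist x C)" for k x
  have b01: "0 <= b k x & b k x <= 1" for k x by (auto simp: b_def infdist_nonneg)
  have bc: "continuous_on UNIV (b k)" for k
   unfolding b_def[abs_def] by (intro continuous_intros)
  have "(%k. \<integral>x. W x * of_real (b k x) \<partial>lborel) \<longlonglongrightarrow> (lint x. W x * of_real (indicator C x))"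
  proof (rule integral_dominated_convergence[where w = "%x. norm (W x)"])
   show "(%x. W x * of_real (b k x)) \<in> borel_measurable lborel" for k
    using borel_measurable_continuous_onI[OF bc[of k]] by measurable
   show "(%x. W x * of_real (indicator C x)) \<in> borel_measurable lborel"
    using borel_closed[OF C] by measurable
   show "AE x in lborel. norm (W x * of_real (b k x)) <= norm (W x)" for k
    using b01 by (auto simp: norm_mult intro!: mult_left_le)
   show "AE x in lborel. (%k. W x * of_real (b k x)) \<longlonglongrightarrow> W x * of_real (indicator C x)"
   proof (rule AE_I2)
    fix x
    have "(%k. b k x) \<longlonglongrightarrow> indicator C x"
    proof (cases "x \<in> C")
     case True
     thus ?thesis by (simp add: b_def)
    next
     case out: False
     hence d: "infdist x C > 0"
      using in_closed_iff_infdist_zero[OF C False] infdist_nonneg[of x C] by force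
     obtain N :: nat where N: "real N > 1 / infdist x C" using reals_Archimedean2 by blast
     have "b k x = 0" if "k >= N" for k
     proof -
      have "1 / infdist x C < real k" using N that by linarith
      hence "1 < real k * infdist x C" using d by (simp add: pos_divide_less_eq)
      thus ?thesis by (simp add: b_def)
     qed
     hence "\<forall>\<^sub>F k in sequentially. b k x = 0" by (auto simp: eventually_sequentially)
     thus ?thesis using out by (simp add: tendsto_eventually)
    qed
    thus "(%k. W x * of_real (b k x)) \<longlonglongrightarrow> W x * of_real (indicator C x)"
     by (intro tendsto_intros)
   qed
  qed (use W in auto)
  moreover have "(lint x. W x * of_real (b k x)) = 0" for k
  proof -
   have "\<bar>b k x\<bar> <= 1" for x using b01[of k x] by linarith
   thus ?thesis by (intro z bc)
  qed
  ultimately have "(lint x. W x * of_real (indicator C x)) = 0" by (simp add: LIMSEQ_const_iff)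
  thus ?thesis
   unfolding set_lebesgue_integral_def by (simp add: scaleR_conv_of_real mult.commute)
 qed (simp add: set_lebesgue_integral_def)
 have "set_lebesgue_integral lborel A W = 0" if "A \<in> sets lborel" for A
 proof -
  have A: "A \<in> sigma_sets UNIV (Collect closed)"
   using that by (simp add: borel_eq_closed)
  have stable: "Int_stable (Collect closed :: R3 set set)" by (auto intro!: Int_stableI)
  have sub: "Collect closed \<subseteq> Pow (UNIV :: R3 set)" by simp
  from stable sub A show ?thesis
  proof (induction rule: sigma_sets_induct_disjoint)
   case (basic A)
   thus ?case using closed0 by simp
  next
   case empty
   thus ?case by (simp add: set_lebesgue_integral_def)
  next
   case (compl A)
   hence A: "A \<in> sets borel" by (simp add: borel_eq_closed)
   have "(lint x. W x) = set_lebesgue_integral lborel (A \<union> (UNIV - A)) W"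
    by (simp add: set_lebesgue_integral_def)
   also have "... = set_lebesgue_integral lborel A W + set_lebesgue_integral lborel (UNIV - A) W"
    by (rule set_integral_Un) (use int_set A in auto)
   finally show ?case using compl tot by simp
  next
   case (union A)
   have A: "A i \<in> sets borel" for i using union(2) by (auto simp: borel_eq_closed)
   have "set_lebesgue_integral lborel (\<Union>i. A i) W = (\<Sum>i. set_lebesgue_integral lborel (A i) W)"
    by (rule lebesgue_integral_countable_add)
      (use A union(1) int_set in \<open>auto simp: disjoint_family_on_def intro!: sets.countable_UN\<close>)
   thus ?case using union(3) by simp
  qed
 qed
 thus ?thesis by (intro sigma_finite_measure.density_zero[OF sigma_finite_lborel W])
qed

text \<open>Integrating the vanishing transform against a Gaussian shows that all Gaussian means of
  \<open>w\<close> vanish. Averaging these means over their centres against a function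
  \<open>ph\<close>, and letting the Gaussians concentrate, gives the integral of \<open>w\<close>
  times \<open>ph\<close> up to the constant \<open>\<Gamma>\<close>.\<close>

lemma L1_fourier_unique:
 fixes w :: "R3 => complex"
 assumes w: "integrable lborel w"
  and z: "!!x. (lint xi. cis (x \<bullet> xi) * w xi) = 0"
 shows "AE xi in lborel. w xi = 0"
proof -
 define G :: "R3 => real" where "G x = exp (- nsq x / 2)" for x
 have Gm[measurable]: "G \<in> BM"
  unfolding G_def[abs_def] by measurable
 have Gi: "integrable lborel G" using integrable_gaussian by (simp add: G_def[abs_def])
 have G01: "0 < G x & G x <= 1" for x by (simp add: G_def)
 define \<Gamma> where "\<Gamma> = (lint x. G x)"
 have \<Gamma>: "\<Gamma> > 0" unfolding \<Gamma>_def G_def by (rule integral_gaussian_pos)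
 have [measurable]: "w \<in> BM" using w by (auto dest: borel_measurable_integrable)
 have step1: "(lint xi. of_real (G (\<sigma> *\<^sub>R (xi - y))) * w xi) = 0" for \<sigma> y
 proof -
  have "(lint x. (lint xi. cis (x \<bullet> (\<sigma> *\<^sub>R (xi - y))) * w xi) * of_real (gauss3 x)) =
   (lint xi. w xi * (lint x. cis (x \<bullet> (\<sigma> *\<^sub>R (xi - y))) * of_real (gauss3 x)))"
  proof -
   have "continuous_on UNIV (%p. cis (fst p \<bullet> (\<sigma> *\<^sub>R (snd p - y))))"
    unfolding cis_conv_exp by (intro continuous_intros)
   from Fubini_kernel[OF borel_measurable_continuous_onI[OF this] _ w integrable_of_real[OF integrable_gauss3]]
   show ?thesis by (simp only: fst_conv snd_conv norm_cis order_refl)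
  qed
  moreover have "(lint xi. cis (x \<bullet> (\<sigma> *\<^sub>R (xi - y))) * w xi) = 0" for x
  proof -
   have "cis (x \<bullet> (\<sigma> *\<^sub>R (xi - y))) = cis (- (\<sigma> * (x \<bullet> y))) * cis ((\<sigma> *\<^sub>R x) \<bullet> xi)" for xi
    by (simp add: cis_mult inner_diff_right right_diff_distrib)
   thus ?thesis by (simp only: mult.assoc integral_mult_right_zero z mult_zero_right)
  qed
  moreover have "(lint x. cis (x \<bullet> u) * of_real (gauss3 x)) = of_real (G u)" for u
   using integral_gauss3_cis[of u] by (simp add: G_def mult.commute)
  ultimately have "(lint xi. w xi * of_real (G (\<sigma> *\<^sub>R (xi - y)))) = 0"
   by (simp only: mult_zero_left Bochner_Integration.integral_zero)
  thus ?thesis by (simp only: mult.commute)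
 qed
 have main: "(lint xi. w xi * of_real (b xi * G xi)) = 0"
  if b: "continuous_on UNIV b" "!!x. \<bar>b x\<bar> <= 1" for b :: "R3 => real"
 proof -
  have [measurable]: "b \<in> BM" using b(1) by (rule borel_measurable_continuous_onI)
  \<comment> \<open>The Gaussian factor makes the bounded function \<open>b\<close> integrable, as
    Fubini requires; being positive, it can be removed at the very end.\<close>
  define ph where "ph x = b x * G x" for x
  have [measurable]: "ph \<in> BM" unfolding ph_def[abs_def] by measurable
  have ph1: "\<bar>ph x\<bar> <= G x" for x
   using mult_right_mono[OF b(2)[of x], of "G x"] G01[of x] by (simp add: ph_def abs_mult)
  have phle1: "\<bar>ph x\<bar> <= 1" for x using ph1[of x] G01[of x] by linarith
  have phi: "integrable lborel ph"
   by (rule Bochner_Integration.integrable_bound[OF Gi]) (use ph1 G01 in \<open>auto simp: abs_of_pos\<close>)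
  have phc: "continuous_on UNIV ph"
   unfolding ph_def[abs_def] G_def by (intro continuous_intros b) auto
  \<comment> \<open>Averages of \<open>ph\<close> around \<open>xi\<close> at scale
    \<open>1 / (n + 1)\<close>; they arise from the Gaussian means by the substitution y = xi + z /
    \<sigma> and tend to \<open>\<Gamma> * ph xi\<close>.\<close>
  define K where "K n xi = (lint z. G z * ph (xi + inverse (real (Suc n)) *\<^sub>R z))" for n xi
  have Km[measurable]: "K n \<in> BM" for n
   unfolding K_def[abs_def] by measurable
  have Kb: "\<bar>K n xi\<bar> <= \<Gamma>" for n xi
  proof -
   have "\<bar>K n xi\<bar> <= (lint z. \<bar>G z * ph (xi + inverse (real (Suc n)) *\<^sub>R z)\<bar>)"
    unfolding K_def by (rule integral_abs_bound)
   also have "... <= (lint z. G z)"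
   proof (rule integral_mono[OF _ Gi])
    show le: "\<bar>G z * ph (xi + inverse (real (Suc n)) *\<^sub>R z)\<bar> <= G z" for z
     using mult_left_mono[OF phle1, of "G z" "xi + inverse (real (Suc n)) *\<^sub>R z"] G01[of z]
     by (simp add: abs_mult)
    show "integrable lborel (%z. \<bar>G z * ph (xi + inverse (real (Suc n)) *\<^sub>R z)\<bar>)"
     by (rule Bochner_Integration.integrable_bound[OF Gi]) (use le G01 in \<open>auto simp: abs_of_pos\<close>)
   qed
   finally show ?thesis by (simp add: \<Gamma>_def)
  qed
  have K0: "(lint xi. w xi * of_real (K n xi)) = 0" for n
  proof -
   define \<sigma> where "\<sigma> = real (Suc n)"
   have \<sigma>: "\<sigma> > 0" by (simp add: \<sigma>_def)
   have "(lint y. (lint xi. of_real (G (\<sigma> *\<^sub>R (xi - y))) * w xi) * of_real (ph y)) =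
    (lint xi. w xi * (lint y. of_real (G (\<sigma> *\<^sub>R (xi - y))) * of_real (ph y)))"
   proof -
    have "continuous_on UNIV (%p::R3 \<times> R3. complex_of_real (G (\<sigma> *\<^sub>R (snd p - fst p))))"
     unfolding G_def by (intro continuous_intros) auto
    from Fubini_kernel[OF borel_measurable_continuous_onI[OF this] _ w integrable_of_real[OF phi]]
    show ?thesis using G01 by (simp add: less_imp_le abs_of_pos)
   qed
   moreover have "(lint y. complex_of_real (G (\<sigma> *\<^sub>R (xi - y))) * of_real (ph y)) =
     of_real (\<bar>inverse \<sigma>\<bar> ^ 3 * K n xi)" for xi :: R3
   proof -
    have "(lint y. G (\<sigma> *\<^sub>R (xi - y)) * ph y) = \<bar>inverse \<sigma>\<bar> ^ 3 *\<^sub>R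
      (lint z. G (\<sigma> *\<^sub>R (xi - (xi + inverse \<sigma> *\<^sub>R z))) * ph (xi + inverse \<sigma> *\<^sub>R z))"
     using \<sigma> by (intro integral_affine_R3) (auto intro: borel_measurable_times)
    also have "(%z. G (\<sigma> *\<^sub>R (xi - (xi + inverse \<sigma> *\<^sub>R z)))) = G"
     using \<sigma> by (auto simp: G_def)
    hence "(%z. G (\<sigma> *\<^sub>R (xi - (xi + inverse \<sigma> *\<^sub>R z))) * ph (xi + inverse \<sigma> *\<^sub>R z)) =
      (%z. G z * ph (xi + inverse \<sigma> *\<^sub>R z))" by (metis (lifting))
    finally show ?thesis
     by (simp only: K_def \<sigma>_def real_scaleR_def of_real_mult[symmetric] integral_complex_of_real)
   qed
   ultimately have "0 = (lint xi. w xi * of_real (\<bar>inverse \<sigma>\<bar> ^ 3 * K n xi))"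
    by (simp add: step1)
   also have "... = of_real (\<bar>inverse \<sigma>\<bar> ^ 3) * (lint xi. w xi * of_real (K n xi))"
    by (subst integral_mult_right_zero[symmetric]) (simp add: mult_ac)
   finally show ?thesis using \<sigma> by simp
  qed
  have "(%n. \<integral>xi. w xi * of_real (K n xi) \<partial>lborel) \<longlonglongrightarrow> (lint xi. w xi * of_real (\<Gamma> * ph xi))"
  proof (rule integral_dominated_convergence[where w = "%x. norm (w x) * \<Gamma>"])
   show "AE x in lborel. norm (w x * of_real (K n x)) <= norm (w x) * \<Gamma>" for n
    using Kb by (auto simp: norm_mult intro!: mult_left_mono)
   show "AE x in lborel. (%n. w x * of_real (K n x)) \<longlonglongrightarrow> w x * of_real (\<Gamma> * ph x)"
   proof (rule AE_I2)
    fix x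
    have "(%n. K n x) \<longlonglongrightarrow> (lint z. G z * ph x)"
     unfolding K_def
    proof (rule integral_dominated_convergence[where w = G])
     show "AE z in lborel. norm (G z * ph (x + inverse (real (Suc n)) *\<^sub>R z)) <= G z" for n
     proof (rule AE_I2)
      fix z show "norm (G z * ph (x + inverse (real (Suc n)) *\<^sub>R z)) <= G z"
      using mult_left_mono[OF phle1, of "G z" "x + inverse (real (Suc n)) *\<^sub>R z"] G01[of z]
      by (simp add: abs_mult)
     qed
     show "AE z in lborel. (%n. G z * ph (x + inverse (real (Suc n)) *\<^sub>R z)) \<longlonglongrightarrow> G z * ph x"
     proof (rule AE_I2)
      fix z
      have "(%n. x + inverse (real (Suc n)) *\<^sub>R z) \<longlonglongrightarrow> x + 0 *\<^sub>R z"
       by (intro tendsto_intros LIMSEQ_inverse_real_of_nat)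
      hence "(%n. ph (x + inverse (real (Suc n)) *\<^sub>R z)) \<longlonglongrightarrow> ph x"
       using phc continuous_on_tendsto_compose[of UNIV ph] by (simp add: continuous_on_tendsto_compose)
      thus "(%n. G z * ph (x + inverse (real (Suc n)) *\<^sub>R z)) \<longlonglongrightarrow> G z * ph x"
       by (intro tendsto_intros)
     qed
    qed (use Gi in auto)
    hence "(%n. K n x) \<longlonglongrightarrow> \<Gamma> * ph x" by (simp add: \<Gamma>_def)
    thus "(%n. w x * of_real (K n x)) \<longlonglongrightarrow> w x * of_real (\<Gamma> * ph x)"
     by (intro tendsto_intros)
   qed
  qed (use w in auto)
  hence "(lint xi. w xi * of_real (\<Gamma> * ph xi)) = 0"
   by (simp add: K0 LIMSEQ_const_iff del: of_real_mult)
  moreover have "(lint xi. w xi * of_real (\<Gamma> * ph xi)) = of_real \<Gamma> * (lint xi. w xi * of_real (ph xi))"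
   by (subst integral_mult_right_zero[symmetric]) (simp add: mult_ac)
  ultimately show ?thesis using \<Gamma> by (simp add: ph_def)
 qed
 have "AE xi in lborel. w xi * of_real (G xi) = 0"
 proof (rule AE_zero_if_integral_continuous_zero)
  show "integrable lborel (%xi. w xi * of_real (G xi))" by (rule Bochner_Integration.integrable_bound[OF w])
     (use G01 in \<open>auto simp: norm_mult abs_of_pos intro!: mult_left_le\<close>)
  show "(lint x. w x * of_real (G x) * of_real (b x)) = 0"
   if "continuous_on UNIV b" "!!x. \<bar>b x\<bar> <= 1" for b
   using main[OF that] by (simp add: mult_ac)
 qed
 thus ?thesis
 proof eventually_elim
  case (elim x)
  thus ?case using G01[of x] by simp
 qed
qed

subsection \<open>Test functions and their Fourier transforms\<close>

lemma Basis_R3: "(Basis :: R3 set) = range (%j. axis j 1)" by (auto simp: Basis_vec_def)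

lemma test_function_continuous: "test_function ph ==> continuous_on UNIV ph"
 unfolding test_function_def smooth_on_def using Ck_on_imp_continuous_on by blast

lemma test_function_has_derivative:
 assumes "test_function ph"
 shows "(ph has_derivative frechet_derivative ph (at x)) (at x)"
proof -
 have "Ck_on (Suc 0) UNIV ph" using assms unfolding test_function_def smooth_on_def by blast
 from Ck_on_Suc_has_derivative[OF open_UNIV this] show ?thesis by simp
qed

lemma test_function_partial:
 assumes "test_function ph"
 shows "test_function (partial j ph)"
 unfolding test_function_def
proof
 have b: "axis j 1 \<in> (Basis :: R3 set)" by (simp add: Basis_R3)
 show "smooth_on UNIV (partial j ph)"
  unfolding smooth_on_def
 proof
  fix k
  have "Ck_on (Suc k) UNIV ph" using assms unfolding test_function_def smooth_on_def by blast
  thus "Ck_on k UNIV (partial j ph)" using b by (simp add: partial_def[abs_def])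
 qed
 have bnd: "bounded (closure {x. ph x ~= 0})"
  using assms unfolding test_function_def by (intro bounded_closure) simp
 have "partial j ph x = 0" if "x \<notin> closure {x. ph x ~= 0}" for x
 proof -
  have "(ph has_derivative (%h. 0)) (at x)"
  proof (rule has_derivative_transform_within_open[of "%x. 0" _ _ _ "- closure {x. ph x ~= 0}"])
   show "0 = ph y" if "y \<in> - closure {x. ph x ~= 0}" for y
    using that closure_subset[of "{x. ph x ~= 0}"] by auto
  qed (use that in auto)
  hence "frechet_derivative ph (at x) = (%h. 0)" by (metis frechet_derivative_at)
  thus ?thesis by (simp add: partial_def)
 qed
 hence "{x. partial j ph x ~= 0} \<subseteq> closure {x. ph x ~= 0}" by auto
 with bnd show "bounded {x. partial j ph x ~= 0}" by (rule bounded_subset)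
qed

lemma test_function_support:
 assumes "test_function ph"
 obtains R where "R > 0" "!!x. ph x ~= 0 ==> norm x <= R"
proof -
 obtain R where "\<forall>x\<in>{x. ph x ~= 0}. norm x <= R" "R > 0"
  using assms unfolding test_function_def bounded_pos by blast
 thus ?thesis using that by blast
qed

lemma test_function_bounded:
 assumes "test_function ph"
 obtains B where "B > 0" "!!x. norm (ph x) <= B"
proof -
 obtain R where R: "R > 0" "!!x. ph x ~= 0 ==> norm x <= R" using test_function_support[OF assms] by blast
 have "compact (ph ` cball 0 R)"
  by (intro compact_continuous_image compact_cball continuous_on_subset[OF test_function_continuous[OF assms]]) auto
 then obtain B where B: "B > 0" "\<forall>y\<in>ph ` cball 0 R. norm y <= B"
  using compact_imp_bounded bounded_pos by blast
 have "norm (ph x) <= B" for x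
 proof (cases "ph x = 0")
  case False
  hence "x \<in> cball 0 R" using R by simp
  thus ?thesis using B by blast
 qed (use B in simp)
 thus ?thesis using B that by blast
qed

lemma test_function_integrable:
 fixes ph :: "R3 => 'b::euclidean_space"
 assumes "test_function ph"
 shows "integrable lborel ph"
proof -
 obtain R where R: "!!x. ph x ~= 0 ==> norm x <= R" using test_function_support[OF assms] by blast
 have "integrable lborel (%x. indicator (cball 0 R) x *\<^sub>R ph x)"
  by (rule borel_integrable_compact) (auto intro: continuous_on_subset[OF test_function_continuous[OF assms]])
 moreover have "(%x. indicator (cball 0 R) x *\<^sub>R ph x) = ph"
  using R by (auto simp: indicator_def fun_eq_iff)
 ultimately show ?thesis by simp
qed

text \<open>By translation invariance the integral of F (x + h e) does not depend on
  \<open>h\<close>; differentiating at 0 under the integral gives the claim.\<close>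

lemma integral_partial_zero:
 fixes F :: "R3 => complex"
 assumes der: "!!x. (F has_derivative F' x) (at x)"
  and Fi: "integrable lborel F"
  and cont: "continuous_on UNIV (%x. F' x (axis j 1))"
  and supp: "!!x. norm x > R ==> F' x (axis j 1) = 0"
  and bnd: "!!x. norm (F' x (axis j 1)) <= B"
 shows "(lint x. F' x (axis j 1)) = 0"
proof -
 define e :: R3 where "e = axis j 1"
 have ne: "norm e = 1" by (simp add: e_def)
 have [measurable]: "(%x. F' x e) \<in> BM"
  using borel_measurable_continuous_onI[OF cont] by (simp add: e_def)
 have [measurable]: "F \<in> BM" using Fi by (auto dest: borel_measurable_integrable)
 have B0: "B >= 0" using bnd[of 0] norm_ge_zero order_trans by blast
 have sc: "F' x (h *\<^sub>R e) = h *\<^sub>R F' x e" for x h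
  using has_derivative_linear[OF der[of x]] by (rule linear_scale)
 have "((%h. \<integral>x. F (x + h *\<^sub>R e) \<partial>lborel) has_derivative (%h. \<integral>x. h *\<^sub>R F' (x + 0 *\<^sub>R e) e \<partial>lborel)) (at 0)"
 \<comment> \<open>The derivative is bounded and vanishes outside a ball; the radius |R| + 1 leaves
   room for shifts by less than 1.\<close>
 proof (rule has_derivative_integral_dominated[where r = 1 and g' = "%s x h. h *\<^sub>R F' (x + s *\<^sub>R e) e"
   and B = "%x. B * indicator (cball 0 (\<bar>R\<bar> + 1)) x"])
  show "integrable lborel (%x. F (x + h *\<^sub>R e))" for h
   using Fi lborel_integrable_real_affine
   by (subst (asm) lborel_affine[of 1 "h *\<^sub>R e"]) (auto simp: integrable_density integrable_distr_eq density_1 add.commute)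
  show "AE x in lborel. \<forall>p\<in>ball 0 1. ((%p. F (x + p *\<^sub>R e)) has_derivative (%h. h *\<^sub>R F' (x + p *\<^sub>R e) e)) (at p)"
  proof (intro AE_I2 ballI)
   fix x and p :: real
   have "((%p. x + p *\<^sub>R e) has_derivative (%h. h *\<^sub>R e)) (at p)"
    by (auto intro!: derivative_eq_intros)
   from has_derivative_compose[OF this der]
   show "((%p. F (x + p *\<^sub>R e)) has_derivative (%h. h *\<^sub>R F' (x + p *\<^sub>R e) e)) (at p)"
    by (simp add: sc)
  qed
  show "AE x in lborel. \<forall>p\<in>ball 0 1. \<forall>h. norm (h *\<^sub>R F' (x + p *\<^sub>R e) e)
    <= B * indicator (cball 0 (\<bar>R\<bar> + 1)) x * norm h"
  proof (intro AE_I2 ballI allI)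
   fix x and p h :: real assume p: "p \<in> ball 0 1"
   show "norm (h *\<^sub>R F' (x + p *\<^sub>R e) e) <= B * indicator (cball 0 (\<bar>R\<bar> + 1)) x * norm h"
   proof (cases "norm x <= \<bar>R\<bar> + 1")
    case True
    thus ?thesis
     using mult_left_mono[OF bnd[of "x + p *\<^sub>R e"], of "\<bar>h\<bar>"] by (simp add: e_def mult.commute)
   next
    case False
    have "norm x <= norm (x + p *\<^sub>R e) + norm (p *\<^sub>R e)"
     using norm_triangle_ineq4[of "x + p *\<^sub>R e" "p *\<^sub>R e"] by simp
    hence "norm (x + p *\<^sub>R e) > R" using False p ne by (simp add: dist_norm)
    thus ?thesis using supp B0 by (simp add: e_def)
   qed
  qed
  show "integrable lborel (%x. B * indicator (cball 0 (\<bar>R\<bar> + 1)) x)"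
   using emeasure_bounded_finite[OF bounded_cball]
   by (intro integrable_mult_right integrable_real_indicator) auto
 qed auto
 moreover have "(%h. \<integral>x. F (x + h *\<^sub>R e) \<partial>lborel) = (%h. \<integral>x. F x \<partial>lborel)"
 proof (rule ext)
  fix h show "(lint x. F (x + h *\<^sub>R e)) = (lint x. F x)"
   using integral_translate_R3[of F "- (h *\<^sub>R e)"] by simp
 qed
 moreover have "((%h::real. \<integral>x. F x \<partial>lborel) has_derivative (%h. 0)) (at 0)" by simp
 ultimately have "(%h. \<integral>x. h *\<^sub>R F' (x + 0 *\<^sub>R e) e \<partial>lborel) = (%h. 0)"
  using has_derivative_unique by metis
 from fun_cong[OF this, of 1] show ?thesis by (simp add: e_def)
qed

text \<open>Integration by parts: the derivative of the product of the exponential and the test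
  function has integral zero.\<close>

lemma ift_partial:
 assumes "test_function ph"
 shows "ift (partial j ph) xi = - (\<i> * of_real (xi $ j)) * ift ph xi"
proof -
 define F where "F x = cis (x \<bullet> xi) * ph x" for x
 define F' where "F' x h = cis (x \<bullet> xi) * frechet_derivative ph (at x) h + (h \<bullet> xi) *\<^sub>R (\<i> * cis (x \<bullet> xi)) * ph x" for x h
 have test': "test_function (partial j ph)" by (rule test_function_partial[OF assms])
 have cisc: "continuous_on UNIV (%x. cis (x \<bullet> xi))"
  unfolding cis_conv_exp by (intro continuous_intros)
 have cism[measurable]: "(%x. cis (x \<bullet> xi)) \<in> BM"
  by (rule borel_measurable_continuous_onI[OF cisc])
 have ci: "integrable lborel (%x. cis (x \<bullet> xi) * ps x)" if "integrable lborel ps" for ps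
  using that borel_measurable_integrable[OF that]
  by (intro Bochner_Integration.integrable_bound[OF that]) (auto simp: norm_mult)
 have F'j: "F' x (axis j 1) = cis (x \<bullet> xi) * partial j ph x + \<i> * of_real (xi $ j) * (cis (x \<bullet> xi) * ph x)" for x
  by (simp add: F'_def partial_def inner_axis' scaleR_conv_of_real)
 obtain R1 where R1: "!!x. ph x ~= 0 ==> norm x <= R1" using test_function_support[OF assms] by blast
 obtain R2 where R2: "!!x. partial j ph x ~= 0 ==> norm x <= R2" using test_function_support[OF test'] by blast
 obtain B1 where B1: "!!x. norm (ph x) <= B1" using test_function_bounded[OF assms] by blast
 obtain B2 where B2: "!!x. norm (partial j ph x) <= B2" using test_function_bounded[OF test'] by blast
 have "(lint x. F' x (axis j 1)) = 0"
 proof (rule integral_partial_zero[where R = "max R1 R2" and B = "B2 + \<bar>xi $ j\<bar> * B1"])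
  show "(F has_derivative F' x) (at x)" for x
  proof -
   have "((%x. cis (x \<bullet> xi)) has_derivative (%h. (h \<bullet> xi) *\<^sub>R (\<i> * cis (x \<bullet> xi)))) (at x)"
    by (rule has_derivative_cis) (auto intro!: derivative_eq_intros)
   from has_derivative_mult[OF this test_function_has_derivative[OF assms, of x]]
   show ?thesis unfolding F_def[abs_def] F'_def[abs_def] .
  qed
  show "integrable lborel F"
   unfolding F_def[abs_def] by (intro ci test_function_integrable assms)
  show "continuous_on UNIV (%x. F' x (axis j 1))"
   unfolding F'j by (intro continuous_intros cisc test_function_continuous assms test')
  show "F' x (axis j 1) = 0" if "norm x > max R1 R2" for x
  proof -
   have "ph x = 0" "partial j ph x = 0" using R1[of x] R2[of x] that by auto
   thus ?thesis by (simp add: F'j)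
  qed
  show "norm (F' x (axis j 1)) <= B2 + \<bar>xi $ j\<bar> * B1" for x
   unfolding F'j
   by (rule order_trans[OF norm_triangle_ineq]) (use B1 B2 in \<open>auto simp: norm_mult intro!: add_mono mult_left_mono\<close>)
 qed
 also have "(%x. F' x (axis j 1)) = (%x. cis (x \<bullet> xi) * partial j ph x + \<i> * of_real (xi $ j) * (cis (x \<bullet> xi) * ph x))"
  by (simp add: F'j)
 finally have "(lint x. cis (x \<bullet> xi) * partial j ph x) + \<i> * of_real (xi $ j) * (lint x. cis (x \<bullet> xi) * ph x) = 0"
  using ci[OF test_function_integrable[OF assms]] ci[OF test_function_integrable[OF test']]
  by (simp del: inner_axis)
 thus ?thesis
  unfolding inv_fourier_int_def by (simp add: add_eq_0_iff field_simps)
qed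

lemma norm_ift_le:
 "norm (ift ph xi) <= (lint x. norm (ph x))"
proof -
 have "norm (lint x. cis (x \<bullet> xi) * ph x) <= (lint x. norm (cis (x \<bullet> xi) * ph x))"
  by (rule integral_norm_bound)
 also have "... = (lint x. norm (ph x))" by (simp add: norm_mult)
 finally have *: "norm (lint x. cis (x \<bullet> xi) * ph x) <= (lint x. norm (ph x))" .
 have pos: "(lint x. norm (ph x)) >= 0" by simp
 have "(2 * pi) ^ 3 >= 1" using pi_gt3 by (intro one_le_power) simp
 hence "norm (lint x. cis (x \<bullet> xi) * ph x) / (2 * pi) ^ 3 <= norm (lint x. cis (x \<bullet> xi) * ph x) / 1"
  by (intro divide_left_mono) auto
 with * show ?thesis by (simp add: inv_fourier_int_def norm_divide norm_power norm_mult)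
qed

text \<open>Each |xi_j| is traded for a derivative of the test function by
  \<open>ift_partial\<close>; hence the induction over the power with the test function
  arbitrary.\<close>

lemma ift_test_function_decay:
 "test_function ph ==> \<exists>C. \<forall>xi. (1 + norm xi) ^ N * norm (ift ph xi) <= C"
proof (induction N arbitrary: ph)
 case 0
 thus ?case using norm_ift_le[of ph] by auto
next
 case (Suc N)
 obtain C where C: "!!xi. (1 + norm xi) ^ N * norm (ift ph xi) <= C" using Suc by blast
 have "\<forall>j. \<exists>D. \<forall>xi. (1 + norm xi) ^ N * norm (ift (partial j ph) xi) <= D"
  using Suc test_function_partial by blast
 then obtain D where D: "!!j xi. (1 + norm xi) ^ N * norm (ift (partial j ph) xi) <= D j" by metis
 have "(1 + norm xi) ^ Suc N * norm (ift ph xi) <= C + (SU j. D j)" for xi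
 proof -
  have "(1 + norm xi) ^ Suc N * norm (ift ph xi) =
    (1 + norm xi) ^ N * norm (ift ph xi) + norm xi * ((1 + norm xi) ^ N * norm (ift ph xi))"
   by (simp add: algebra_simps)
  also have "... <= C + (SU j. \<bar>xi $ j\<bar>) * ((1 + norm xi) ^ N * norm (ift ph xi))"
   using C[of xi] norm_le_l1_cart[of xi] by (intro add_mono mult_right_mono) auto
  also have "(SU j. \<bar>xi $ j\<bar>) * ((1 + norm xi) ^ N * norm (ift ph xi)) =
    (SU j. (1 + norm xi) ^ N * norm (ift (partial j ph) xi))"
   by (simp add: ift_partial[OF Suc.prems] norm_mult sum_distrib_left sum_distrib_right mult_ac)
  also have "C + ... <= C + (SU j. D j)" by (intro add_left_mono sum_mono D)
  finally show ?thesis .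
 qed
 thus ?case by blast
qed

lemma ift_measurable:
 assumes [measurable]: "v \<in> BM"
 shows "ift v \<in> BM"
proof -
 have "continuous_on UNIV (%p::R3 \<times> R3. cis (snd p \<bullet> fst p))"
  unfolding cis_conv_exp by (intro continuous_intros)
 hence [measurable]: "(%p::R3 \<times> R3. cis (snd p \<bullet> fst p)) \<in> borel_measurable (borel \<Otimes>\<^sub>M borel)"
  unfolding borel_prod by (rule borel_measurable_continuous_onI)
 have "(%p. cis (snd p \<bullet> fst p) * v (snd p)) \<in> borel_measurable (borel \<Otimes>\<^sub>M lborel)"
  by measurable
 hence "(%xi. \<integral>x. cis (x \<bullet> xi) * v x \<partial>lborel) \<in> BM"
  by (intro lborel.borel_measurable_lebesgue_integral) (simp add: case_prod_beta')
 thus ?thesis unfolding inv_fourier_int_def[abs_def] by measurable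
qed

text \<open>Translation becomes a phase, so testing with all translates of one bump amounts to
  evaluating a Fourier integral at every point.\<close>

lemma ift_bump_translate:
 "ift (%x. of_real (bump n y x)) xi = cis (y \<bullet> xi) * ift (%x. of_real (bump n 0 x)) xi"
proof -
 have [measurable]: "bump n 0 \<in> BM"
  using smooth_on_bump[of n 0] unfolding smooth_on_def
  by (intro borel_measurable_continuous_onI) (use Ck_on_imp_continuous_on in blast)
 have "continuous_on UNIV (%x. cis (x \<bullet> xi))"
  unfolding cis_conv_exp by (intro continuous_intros)
 hence [measurable]: "(%x. cis (x \<bullet> xi)) \<in> BM" by (rule borel_measurable_continuous_onI)
 have "(lint x. cis (x \<bullet> xi) * of_real (bump n y x)) =
   (lint x. cis (y \<bullet> xi) * (cis ((x - y) \<bullet> xi) * of_real (bump n 0 (x - y))))"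
  by (subst bump_translate) (simp add: mult.assoc[symmetric] cis_mult inner_diff_left)
 also have "... = cis (y \<bullet> xi) * (lint x. cis (x \<bullet> xi) * of_real (bump n 0 x))"
  unfolding integral_mult_right_zero
  by (subst integral_translate_R3[of "%x. cis (x \<bullet> xi) * complex_of_real (bump n 0 x)" y]) measurable
 finally show ?thesis by (simp add: inv_fourier_int_def)
qed

lemma bump_integrable: "n > 0 ==> integrable lborel (bump n y)"
 using integrable_Re[OF test_function_integrable[OF test_function_of_real_bump[of n y]]] by simp

lemma integral_bump_pos:
 assumes "n > 0"
 shows "(lint x. bump n y x) > 0"
proof (rule ccontr)
 assume "\<not> ?thesis"
 hence "(lint x. bump n y x) = 0"
  using Bochner_Integration.integral_nonneg[of lborel "bump n y"] bump_nonneg by (metis linorder_not_less order_antisym)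
 hence "AE x in lborel. bump n y x = 0"
  using integral_nonneg_eq_0_iff_AE[OF bump_integrable[OF assms]] bump_nonneg by auto
 moreover have bc: "continuous_on UNIV (bump n y)"
  using smooth_on_bump[of n y] Ck_on_imp_continuous_on unfolding smooth_on_def by blast
 have op: "open {x. bump n y x ~= 0}" by (intro open_Collect_neq bc continuous_on_const)
 ultimately have "emeasure lborel {x. bump n y x ~= 0} = 0" by (subst (asm) AE_iff_measurable) auto
 moreover have "y \<in> {x. bump n y x ~= 0}" using bump_center[of n y] by simp
 ultimately show False
  using op open_not_negligible[OF op] null_sets_completionI[of "{x. bump n y x ~= 0}" lborel]
  by (auto simp: negligible_iff_null_sets null_sets_def)
qed

text \<open>On the support of the bump the phase is at most 1 in modulus, so its cosine is at least
  cos 1 > 0 and the real part of the integral is positive.\<close>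

lemma ift_bump_nonzero:
 assumes n: "real n >= 3 * norm xi" "n > 0"
 shows "ift (%x. of_real (bump n 0 x)) xi ~= 0"
proof
 assume "ift (%x. of_real (bump n 0 x)) xi = 0"
 hence z: "(lint x. cis (x \<bullet> xi) * of_real (bump n 0 x)) = 0" by (simp add: inv_fourier_int_def)
 have "continuous_on UNIV (%x. cis (x \<bullet> xi))"
  unfolding cis_conv_exp by (intro continuous_intros)
 hence [measurable]: "(%x. cis (x \<bullet> xi)) \<in> BM" by (rule borel_measurable_continuous_onI)
 have [measurable]: "bump n 0 \<in> BM"
  using bump_integrable[OF n(2)] by (auto dest: borel_measurable_integrable)
 have i: "integrable lborel (%x. cis (x \<bullet> xi) * of_real (bump n 0 x))"
  by (rule Bochner_Integration.integrable_bound[OF bump_integrable[OF n(2), of 0]]) (auto simp: norm_mult)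
 have "(lint x. cos (x \<bullet> xi) * bump n 0 x) = Re (lint x. cis (x \<bullet> xi) * of_real (bump n 0 x))"
  using integral_Re[OF i] by simp
 hence "(lint x. cos (x \<bullet> xi) * bump n 0 x) = 0" by (simp add: z)
 moreover have "(lint x. cos 1 * bump n 0 x) <= (lint x. cos (x \<bullet> xi) * bump n 0 x)"
 proof (rule integral_mono)
  show "integrable lborel (%x. cos 1 * bump n 0 x)" using bump_integrable[OF n(2)] by simp
  show "integrable lborel (%x. cos (x \<bullet> xi) * bump n 0 x)"
   using integrable_Re[OF i] by simp
  show "cos 1 * bump n 0 x <= cos (x \<bullet> xi) * bump n 0 x" for x
  proof (cases "bump n 0 x = 0")
   case False
   hence "norm x <= 3 / real n" using bump_support[OF _ n(2), of 0 x] by simp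
   hence "\<bar>x \<bullet> xi\<bar> <= 3 / real n * norm xi"
    using Cauchy_Schwarz_ineq2[of x xi] by (meson mult_right_mono norm_ge_zero order_trans)
   also have "... <= 1" using n by (simp add: field_simps)
   finally have "cos 1 <= cos \<bar>x \<bullet> xi\<bar>" using pi_gt3 by (intro cos_monotone_0_pi_le) auto
   thus ?thesis using bump_nonneg[of n 0 x] by (simp add: mult_right_mono)
  qed simp
 qed
 moreover have "cos (1::real) > 0" using pi_gt3 by (intro cos_gt_zero) auto
 moreover have "(lint x. cos 1 * bump n 0 x) = cos 1 * (lint x. bump n 0 x)" by simp
 ultimately show False using integral_bump_pos[OF n(2), of 0] by (metis linorder_not_less mult_pos_pos)
qed

text \<open>Averages of \<open>d\<close> against ever narrower bumps at \<open>y\<close>, normalised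
  by their positive mass, approach \<open>d y\<close>.\<close>

lemma continuous_zero_if_integral_test_zero:
 fixes d :: "R3 => complex"
 assumes d: "continuous_on UNIV d"
  and z: "!!ph :: R3 => complex. test_function ph ==> (lint x. d x * ph x) = 0"
 shows "d y = 0"
proof -
 have dm[measurable]: "d \<in> BM" by (rule borel_measurable_continuous_onI[OF d])
 have "norm (d y) <= e" if e: "e > 0" for e
 proof -
  obtain r where r: "r > 0" "!!x. dist x y < r ==> dist (d x) (d y) < e"
   using d e unfolding continuous_on_iff by fastforce
  obtain n :: nat where n: "real n > 3 / r" using reals_Archimedean2 by blast
  hence n0: "n > 0" using r(1) by (metis divide_pos_pos less_numeral_extra(3) of_nat_0_less_iff order_less_trans zero_less_numeral)
  have bi: "integrable lborel (bump n y)" by (rule bump_integrable[OF n0])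
  have bm[measurable]: "bump n y \<in> BM" using bi by (auto dest: borel_measurable_integrable)
  have le: "norm (d x * of_real (bump n y x) - d y * of_real (bump n y x)) <= e * bump n y x" for x
  proof (cases "bump n y x = 0")
   case False
   hence "norm (x - y) <= 3 / real n" using bump_support[OF _ n0] by simp
   also have "... < r" using n r(1) n0 by (simp add: field_simps)
   finally have "norm (d x - d y) <= e" using r(2)[of x] by (simp add: dist_norm)
   thus ?thesis
    using mult_right_mono[of "norm (d x - d y)" e "bump n y x"] bump_nonneg[of n y x]
    by (simp add: left_diff_distrib[symmetric] norm_mult)
  qed simp
  have i1: "integrable lborel (%x. d x * of_real (bump n y x) - d y * of_real (bump n y x))"
   by (rule Bochner_Integration.integrable_bound[of _ "%x. e * bump n y x"])
     (use bi le e in \<open>auto intro: order_trans[OF _ abs_ge_self]\<close>)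
  have i2: "integrable lborel (%x. d y * of_real (bump n y x))" using bi by simp
  have "norm (d y) * (lint x. bump n y x) = norm (lint x. d y * of_real (bump n y x))"
   using integral_bump_pos[OF n0, of y] by (simp add: norm_mult abs_of_pos)
  also have "(lint x. d y * of_real (bump n y x)) =
    (lint x. d x * of_real (bump n y x)) - (lint x. d x * of_real (bump n y x) - d y * of_real (bump n y x))"
  proof -
   have "(lint x. (d x * of_real (bump n y x) - d y * of_real (bump n y x)) + d y * of_real (bump n y x)) =
    (lint x. d x * of_real (bump n y x) - d y * of_real (bump n y x)) + (lint x. d y * of_real (bump n y x))"
    by (rule Bochner_Integration.integral_add[OF i1 i2])
   thus ?thesis by (simp add: algebra_simps)
  qed
  also have "(lint x. d x * of_real (bump n y x)) = 0" by (intro z test_function_of_real_bump n0)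
  also have "norm (0 - (lint x. d x * of_real (bump n y x) - d y * of_real (bump n y x))) <= (lint x. e * bump n y x)"
   using Bochner_Integration.integral_norm_bound_integral[OF i1 _ le] bi by simp
  also have "... = e * (lint x. bump n y x)" by simp
  finally show ?thesis using integral_bump_pos[OF n0, of y] by simp
 qed
 thus ?thesis using field_le_epsilon[of "norm (d y)" 0] by simp
qed

lemma tempered_times_test_integrable:
 assumes v: "integrable lborel (%xi. v xi /\<^sub>R (1 + norm xi) ^ N)" and ph: "test_function ph"
 shows "integrable lborel (%xi. v xi * ift ph xi)"
proof -
 obtain C where C: "!!xi. (1 + norm xi) ^ N * norm (ift ph xi) <= C"
  using ift_test_function_decay[OF ph] by blast
 have [measurable]: "ift ph \<in> BM"
  using test_function_integrable[OF ph] by (intro ift_measurable) (auto dest: borel_measurable_integrable)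
 have pos: "(1 + norm xi) ^ N > 0" for xi :: R3 by (intro zero_less_power) (simp add: add_pos_nonneg)
 have [measurable]: "(%xi. v xi /\<^sub>R (1 + norm xi) ^ N) \<in> BM"
  using v by (auto dest: borel_measurable_integrable)
 have eq: "v xi * ift ph xi = (v xi /\<^sub>R (1 + norm xi) ^ N) * ((1 + norm xi) ^ N *\<^sub>R ift ph xi)" for xi
 proof -
  have "(1 + norm xi) ^ N * inverse ((1 + norm xi) ^ N) = 1"
   using pos[of xi] by (intro right_inverse) linarith
  thus ?thesis by simp
 qed
 show ?thesis
  unfolding eq
 proof (rule Bochner_Integration.integrable_bound)
  show "integrable lborel (%xi. C * norm (v xi /\<^sub>R (1 + norm xi) ^ N))"
   by (intro integrable_mult_right integrable_norm v)
  show "AE xi in lborel. norm ((v xi /\<^sub>R (1 + norm xi) ^ N) * ((1 + norm xi) ^ N *\<^sub>R ift ph xi))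
    <= norm (C * norm (v xi /\<^sub>R (1 + norm xi) ^ N))"
  proof (rule AE_I2)
   fix xi
   have "norm ((1 + norm xi) ^ N *\<^sub>R ift ph xi) <= C"
    using C[of xi] pos[of xi] by simp
   hence "norm (v xi /\<^sub>R (1 + norm xi) ^ N) * norm ((1 + norm xi) ^ N *\<^sub>R ift ph xi)
     <= norm (v xi /\<^sub>R (1 + norm xi) ^ N) * C" by (rule mult_left_mono) (rule norm_ge_zero)
   also have "... = C * norm (v xi /\<^sub>R (1 + norm xi) ^ N)" by (rule mult.commute)
   also have "... <= norm (C * norm (v xi /\<^sub>R (1 + norm xi) ^ N))"
    unfolding real_norm_def by (rule abs_ge_self)
   finally show "norm ((v xi /\<^sub>R (1 + norm xi) ^ N) * ((1 + norm xi) ^ N *\<^sub>R ift ph xi))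
     <= norm (C * norm (v xi /\<^sub>R (1 + norm xi) ^ N))"
    unfolding norm_mult[of "v xi /\<^sub>R (1 + norm xi) ^ N"] .
  qed
 qed measurable
qed

text \<open>Testing with all translates of one bump function \<open>\<rho>\<close> makes \<open>v\<close> times the transform of \<open>\<rho>\<close> an
 integrable function with vanishing Fourier transform.\<close>

lemma tempered_zero:
 assumes v: "integrable lborel (%xi. v xi /\<^sub>R (1 + norm xi) ^ N)"
  and z: "!!ph. test_function ph ==> (lint xi. v xi * ift ph xi) = 0"
 shows "AE xi in lborel. v xi = 0"
proof -
 have "AE xi in lborel. v xi * ift (%x. of_real (bump (Suc n) 0 x)) xi = 0" for n
 proof (rule L1_fourier_unique)
  show "integrable lborel (%xi. v xi * ift (%x. of_real (bump (Suc n) 0 x)) xi)"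
   by (rule tempered_times_test_integrable[OF v test_function_of_real_bump]) simp
  fix y
  have "(lint xi. v xi * ift (%x. of_real (bump (Suc n) y x)) xi) = 0"
   by (intro z test_function_of_real_bump) simp
  thus "(lint xi. cis (y \<bullet> xi) * (v xi * ift (%x. of_real (bump (Suc n) 0 x)) xi)) = 0"
   unfolding ift_bump_translate[of "Suc n" y] by (simp only: mult_ac)
 qed
 hence "AE xi in lborel. \<forall>n. v xi * ift (%x. of_real (bump (Suc n) 0 x)) xi = 0"
  unfolding AE_all_countable by blast
 thus ?thesis
 proof eventually_elim
  case (elim xi)
  \<comment> \<open>At every frequency a sufficiently narrow bump has nonzero transform; the
    countably many widths share one null set.\<close>
  obtain n :: nat where "3 * norm xi <= real n" using real_arch_simple by blast
  hence "ift (%x. of_real (bump (Suc n) 0 x)) xi ~= 0" by (intro ift_bump_nonzero) auto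
  thus ?case using elim[rule_format, of n] by simp
 qed
qed

lemma tempered_weaken:
 assumes "integrable lborel (%xi::R3. v xi /\<^sub>R (1 + norm xi) ^ N)" "N <= N'"
 shows "integrable lborel (%xi. (v xi :: complex) /\<^sub>R (1 + norm xi) ^ N')"
proof (rule Bochner_Integration.integrable_bound[OF assms(1)])
 have [measurable]: "(%xi. v xi /\<^sub>R (1 + norm xi) ^ N) \<in> BM"
  using assms(1) by (auto dest: borel_measurable_integrable)
 have eq: "v xi /\<^sub>R (1 + norm xi) ^ N' = (v xi /\<^sub>R (1 + norm xi) ^ N) /\<^sub>R (1 + norm xi) ^ (N' - N)" for xi
  using assms(2) by (simp add: power_add[symmetric] flip: inverse_mult_distrib)
 show "(%xi. v xi /\<^sub>R (1 + norm xi) ^ N') \<in> borel_measurable lborel"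
  unfolding eq by measurable
 show "AE xi in lborel. norm (v xi /\<^sub>R (1 + norm xi) ^ N') <= norm (v xi /\<^sub>R (1 + norm xi) ^ N)"
 proof (rule AE_I2)
  fix xi :: R3
  have "inverse ((1 + norm xi) ^ (N' - N)) <= 1"
   by (intro inverse_le_1_iff[THEN iffD2] disjI2 one_le_power) simp
  thus "norm (v xi /\<^sub>R (1 + norm xi) ^ N') <= norm (v xi /\<^sub>R (1 + norm xi) ^ N)"
   unfolding eq norm_scaleR[of "inverse ((1 + norm xi) ^ (N' - N))"] by (intro mult_left_le_one_le) auto
 qed
qed

lemma locally_integrable_times_test:
 fixes a :: "R3 => complex"
 assumes a: "locally_integrable a" and ph: "test_function ph"
 shows "integrable lborel (%x. a x * ph x)"
proof -
 obtain R where R: "!!x. ph x ~= 0 ==> norm x <= R" using test_function_support[OF ph] by blast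
 obtain B where B: "B > 0" "!!x. norm (ph x) <= B" using test_function_bounded[OF ph] by blast
 have aR: "integrable lborel (%x. indicator (cball 0 R) x *\<^sub>R a x)"
  using a unfolding locally_integrable_def set_integrable_def by blast
 have [measurable]: "(%x. indicator (cball 0 R) x *\<^sub>R a x) \<in> BM"
  using borel_measurable_integrable[OF aR] by simp
 have [measurable]: "ph \<in> BM" by (intro borel_measurable_continuous_onI test_function_continuous ph)
 have eq: "a x * ph x = (indicator (cball 0 R) x *\<^sub>R a x) * ph x" for x
  using R[of x] by (cases "ph x = 0") auto
 have "integrable lborel (%x. (indicator (cball 0 R) x *\<^sub>R a x) * ph x)"
 proof (rule Bochner_Integration.integrable_bound)
  show "integrable lborel (%x. norm (indicator (cball 0 R) x *\<^sub>R a x) * B)"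
   using aR by (intro integrable_mult_left integrable_norm)
  show "AE x in lborel. norm ((indicator (cball 0 R) x *\<^sub>R a x) * ph x)
    <= norm (norm (indicator (cball 0 R) x *\<^sub>R a x) * B)"
   using B by (intro AE_I2) (auto simp: norm_mult indicator_def intro!: mult_left_mono)
 qed measurable
 thus ?thesis by (simp only: eq[symmetric])
qed

lemma has_scalar_fourier_unique:
 assumes "has_scalar_fourier a v" "has_scalar_fourier a w"
 shows "AE xi in lborel. v xi = w xi"
proof -
 obtain N1 N2 where N: "integrable lborel (%xi. v xi /\<^sub>R (1 + norm xi) ^ N1)"
  "integrable lborel (%xi. w xi /\<^sub>R (1 + norm xi) ^ N2)"
  using assms unfolding has_scalar_fourier_def by blast
 have N': "integrable lborel (%xi. v xi /\<^sub>R (1 + norm xi) ^ (N1 + N2))"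
  "integrable lborel (%xi. w xi /\<^sub>R (1 + norm xi) ^ (N1 + N2))"
  by (rule tempered_weaken[OF N(1)], simp, rule tempered_weaken[OF N(2)], simp)
 have "AE xi in lborel. v xi - w xi = 0"
 proof (rule tempered_zero[where N = "N1 + N2"])
  show "integrable lborel (%xi. (v xi - w xi) /\<^sub>R (1 + norm xi) ^ (N1 + N2))"
   using Bochner_Integration.integrable_diff[OF N'] by (simp add: scaleR_diff_right)
  fix ph :: "R3 => complex" assume t: "test_function ph"
  show "(lint xi. (v xi - w xi) * ift ph xi) = 0"
   using assms t tempered_times_test_integrable[OF N(1) t] tempered_times_test_integrable[OF N(2) t]
   unfolding has_scalar_fourier_def by (simp add: left_diff_distrib)
 qed
 thus ?thesis by simp
qed

lemma has_scalar_fourier_diff: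
 assumes "has_scalar_fourier a v" "has_scalar_fourier b w"
 shows "has_scalar_fourier (%x. a x - b x) (%xi. v xi - w xi)"
proof -
 obtain N1 N2 where N: "integrable lborel (%xi. v xi /\<^sub>R (1 + norm xi) ^ N1)"
  "integrable lborel (%xi. w xi /\<^sub>R (1 + norm xi) ^ N2)"
  using assms unfolding has_scalar_fourier_def by blast
 have N': "integrable lborel (%xi. v xi /\<^sub>R (1 + norm xi) ^ (N1 + N2))"
  "integrable lborel (%xi. w xi /\<^sub>R (1 + norm xi) ^ (N1 + N2))"
  by (rule tempered_weaken[OF N(1)], simp, rule tempered_weaken[OF N(2)], simp)
 have loc: "locally_integrable a" "locally_integrable b"
  using assms unfolding has_scalar_fourier_def by blast+
 show ?thesis
  unfolding has_scalar_fourier_def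
 proof (intro conjI allI impI)
  show "locally_integrable (%x. a x - b x)"
   using loc unfolding locally_integrable_def by (auto intro: set_integral_diff)
  show "\<exists>N. integrable lborel (%xi. (v xi - w xi) /\<^sub>R (1 + norm xi) ^ N)"
   using Bochner_Integration.integrable_diff[OF N'] by (intro exI[of _ "N1 + N2"]) (simp add: scaleR_diff_right)
  fix ph :: "R3 => complex" assume t: "test_function ph"
  show "(lint x. (a x - b x) * ph x) = (lint xi. (v xi - w xi) * ift ph xi)"
   using assms t tempered_times_test_integrable[OF N(1) t] tempered_times_test_integrable[OF N(2) t]
    locally_integrable_times_test[OF loc(1) t] locally_integrable_times_test[OF loc(2) t]
   unfolding has_scalar_fourier_def by (simp add: left_diff_distrib)
 qed
qed

lemma continuous_inv_fourier_int:
 assumes v: "integrable lborel v"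
 shows "continuous_on UNIV (ift v)"
proof -
 have [measurable]: "v \<in> BM" using v by (auto dest: borel_measurable_integrable)
 have c: "continuous_on UNIV (%x. cis (x \<bullet> y))" "continuous_on UNIV (%x. cis (y \<bullet> x))" for y :: R3
  unfolding cis_conv_exp by (intro continuous_intros)+
 have "((%y. \<integral>x. cis (x \<bullet> y) * v x \<partial>lborel) \<longlongrightarrow> (lint x. cis (x \<bullet> y0) * v x)) (at y0 within UNIV)" for y0
 proof (rule tendsto_integral_dominated[where U = UNIV and B = "%x. norm (v x)"])
  show m: "(%x. cis (x \<bullet> y) * v x) \<in> borel_measurable lborel" for y
   using borel_measurable_continuous_onI[OF c(1)[of y]] by measurable
  thus "(%x. cis (x \<bullet> y0) * v x) \<in> borel_measurable lborel" .
  show "AE x in lborel. ((%y. cis (x \<bullet> y) * v x) \<longlongrightarrow> cis (x \<bullet> y0) * v x) (at y0)"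
   using c(2) by (intro AE_I2 tendsto_mult tendsto_const) (simp add: continuous_on_def)
 qed (use v in \<open>auto simp: norm_mult\<close>)
 thus ?thesis
  unfolding continuous_on_def inv_fourier_int_def by (intro ballI tendsto_divide tendsto_const) auto
qed

lemma has_scalar_fourier_inv:
 assumes v: "integrable lborel v"
 shows "has_scalar_fourier (ift v) v"
 unfolding has_scalar_fourier_def
proof (intro conjI allI impI)
 have c: "continuous_on UNIV (ift v)" by (rule continuous_inv_fourier_int[OF v])
 show "locally_integrable (ift v)"
  unfolding locally_integrable_def set_integrable_def
  by (intro allI borel_integrable_compact compact_cball continuous_on_subset[OF c]) auto
 show "\<exists>N. integrable lborel (%xi. v xi /\<^sub>R (1 + norm xi) ^ N)"
  using v by (intro exI[of _ 0]) simp
 fix ph :: "R3 => complex" assume t: "test_function ph"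
 have "continuous_on UNIV (%p::R3 \<times> R3. cis (snd p \<bullet> fst p))"
  unfolding cis_conv_exp by (intro continuous_intros)
 from Fubini_kernel[OF borel_measurable_continuous_onI[OF this] _ v test_function_integrable[OF t]]
 have "(lint x. (lint xi. cis (xi \<bullet> x) * v xi) * ph x) = (lint xi. v xi * (lint x. cis (xi \<bullet> x) * ph x))"
  by simp
 thus "(lint x. ift v x * ph x) = (lint xi. v xi * ift ph xi)"
  unfolding inv_fourier_int_def by (simp add: inner_commute)
qed

lemma continuous_eq_inv_fourier_int:
 assumes a: "continuous_on UNIV a" "has_scalar_fourier a v" and v: "integrable lborel v"
 shows "a x = ift v x"
proof -
 have d: "has_scalar_fourier (%x. a x - ift v x) (%xi. v xi - v xi)"
  by (rule has_scalar_fourier_diff[OF a(2) has_scalar_fourier_inv[OF v]])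
 have "a x - ift v x = 0"
 proof (rule continuous_zero_if_integral_test_zero)
  show "continuous_on UNIV (%x. a x - ift v x)" by (intro continuous_on_diff a continuous_inv_fourier_int v)
  show "(lint x. (a x - ift v x) * ph x) = 0" if "test_function ph" for ph
   using d that unfolding has_scalar_fourier_def by simp
 qed
 thus ?thesis by simp
qed

lemma has_fourier_unique:
 assumes "has_fourier a v" "has_fourier a w"
 shows "AE xi in lborel. v xi = w xi"
proof -
 have "AE xi in lborel. \<forall>i. v xi $ i = w xi $ i"
  using assms has_scalar_fourier_unique unfolding has_fourier_def AE_all_countable by blast
 thus ?thesis by (simp add: vec_eq_iff)
qed

text \<open>\<open>fourier\<close> is an arbitrary choice of representative; by uniqueness almost
  everywhere any other one gives the same integral.\<close>

lemma fourier_weight_eq: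
 assumes "has_fourier a v"
 shows "fourier_weight w a = (nint xi. ennreal (w xi * norm (v xi)))"
proof -
 have "has_fourier a (fourier a)"
  unfolding fourier_def using someI[of "has_fourier a" v] assms by simp
 from has_fourier_unique[OF this assms] have "AE xi in lborel. fourier a xi = v xi" .
 hence "(nint xi. ennreal (w xi * norm (fourier a xi))) = (nint xi. ennreal (w xi * norm (v xi)))"
  by (intro nn_integral_cong_AE) auto
 thus ?thesis using assms unfolding fourier_weight_def by auto
qed

lemma has_fourier_diff:
 assumes "has_fourier a v" "has_fourier b w"
 shows "has_fourier (%x. a x - b x) (%xi. v xi - w xi)"
 using assms has_scalar_fourier_diff unfolding has_fourier_def by fastforce

lemma test_function_bounded_linear:
 assumes "bounded_linear L" "test_function ph"
 shows "test_function (%x. L (ph x))"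
proof -
 interpret bounded_linear L by fact
 have "{x. L (ph x) ~= 0} \<subseteq> {x. ph x ~= 0}" using zero by auto
 moreover have "bounded {x. ph x ~= 0}" "smooth_on UNIV ph"
  using assms(2) unfolding test_function_def by auto
 moreover have "smooth_on UNIV (%x. L (ph x))"
  unfolding smooth_on_def
 proof
  fix k
  have "Ck_on k UNIV ph" using assms(2) unfolding test_function_def smooth_on_def by blast
  thus "Ck_on k UNIV (%x. L (ph x))" by (rule Ck_on_bounded_linear[OF assms(1) open_UNIV])
 qed
 ultimately show ?thesis
  unfolding test_function_def using bounded_subset by blast
qed

text \<open>Conjugate the defining identity and use the conjugate test function, \<open>a\<close>
  being real. Together with uniqueness this yields the Hermitian symmetry of transforms of real
  functions.\<close>

lemma has_scalar_fourier_hermitian: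
 assumes h: "has_scalar_fourier (%x. complex_of_real (a x)) v"
 shows "has_scalar_fourier (%x. complex_of_real (a x)) (%xi. cnj (v (- xi)))"
 unfolding has_scalar_fourier_def
proof (intro conjI allI impI)
 obtain N where N: "integrable lborel (%xi. v xi /\<^sub>R (1 + norm xi) ^ N)"
  using h unfolding has_scalar_fourier_def by blast
 show "locally_integrable (%x. complex_of_real (a x))"
  using h unfolding has_scalar_fourier_def by blast
 have refl: "integrable lborel (%xi. g (- xi))" if "integrable lborel g" for g :: "R3 => complex"
 proof -
  have "integrable (distr lborel borel uminus) g"
   using that by (subst (asm) lborel_affine[of "-1" 0]) (auto simp: density_1)
  from integrable_distr[OF _ this] show ?thesis by simp
 qed
 have eq: "cnj (v (- xi)) /\<^sub>R (1 + norm xi) ^ N = cnj (v (- xi) /\<^sub>R (1 + norm (- xi)) ^ N)" for xi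
  by simp
 have "integrable lborel (%xi. cnj (v (- xi)) /\<^sub>R (1 + norm xi) ^ N)"
  unfolding eq complex_integrable_cnj by (rule refl[OF N])
 thus "\<exists>N. integrable lborel (%xi. cnj (v (- xi)) /\<^sub>R (1 + norm xi) ^ N)" by (rule exI)
 fix ph :: "R3 => complex" assume t: "test_function ph"
 have t': "test_function (%x. cnj (ph x))" by (rule test_function_bounded_linear[OF bounded_linear_cnj t])
 have cm: "ift (%x. cnj (ph x)) xi = cnj (ift ph (- xi))" for xi
 proof -
  have "cnj (lint x. cis (x \<bullet> - xi) * ph x) = (lint x. cnj (cis (x \<bullet> - xi) * ph x))"
   by (simp only: Bochner_Integration.integral_cnj)
  thus ?thesis by (simp add: inv_fourier_int_def cis_cnj)
 qed
 have "cnj (lint x. complex_of_real (a x) * ph x) = (lint x. complex_of_real (a x) * cnj (ph x))"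
  by (simp only: Bochner_Integration.integral_cnj[symmetric] complex_cnj_mult complex_cnj_complex_of_real)
 also have "... = (lint xi. v xi * ift (%x. cnj (ph x)) xi)"
  using h t' unfolding has_scalar_fourier_def by blast
 also have "... = (lint xi. v xi * cnj (ift ph (- xi)))" by (simp add: cm)
 also have "... = (lint xi. v (- xi) * cnj (ift ph xi))"
 proof -
  have "(%xi. v xi * ift (%x. cnj (ph x)) xi) \<in> BM"
   using tempered_times_test_integrable[OF N t'] by (auto dest: borel_measurable_integrable)
  from integral_affine_R3[OF this, of "-1" 0] show ?thesis by (simp add: cm)
 qed
 finally have "(lint x. complex_of_real (a x) * ph x) = cnj (lint xi. v (- xi) * cnj (ift ph xi))"
  by (metis complex_cnj_cnj)
 also have "... = (lint xi. cnj (v (- xi)) * ift ph xi)"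
  by (simp only: Bochner_Integration.integral_cnj[symmetric] complex_cnj_mult complex_cnj_cnj)
 finally show "(lint x. complex_of_real (a x) * ph x) = (lint xi. cnj (v (- xi)) * ift ph xi)" .
qed

text \<open>Testing \<open>a\<close> with the gradient of a test function becomes, by
  \<open>ift_partial\<close>, integrating xi . v against its transform; \<open>tempered_zero\<close>
  then applies, with one more power in the growth bound.\<close>

lemma weakly_divergence_free_fourier:
 assumes a: "weakly_divergence_free a" and v: "has_fourier a v"
 shows "AE xi in lborel. (SU j. of_real (xi $ j) * v xi $ j) = 0"
proof -
 have h: "has_scalar_fourier (%x. complex_of_real (a x $ j)) (%xi. v xi $ j)" for j
  using v unfolding has_fourier_def by blast
 have "\<forall>j. \<exists>N. integrable lborel (%xi. v xi $ j /\<^sub>R (1 + norm xi) ^ N)"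
  using h unfolding has_scalar_fourier_def by blast
 then obtain N where N: "!!j. integrable lborel (%xi. v xi $ j /\<^sub>R (1 + norm xi) ^ N j)" by metis
 define M where "M = (SU j. N j)"
 have M: "integrable lborel (%xi. v xi $ j /\<^sub>R (1 + norm xi) ^ M)" for j
  by (rule tempered_weaken[OF N]) (auto simp: M_def intro: member_le_sum)
 have Mj: "integrable lborel (%xi. (of_real (xi $ j) * v xi $ j) /\<^sub>R (1 + norm xi) ^ Suc M)" for j
 proof (rule Bochner_Integration.integrable_bound[OF M[of j]])
  have [measurable]: "(%xi. v xi $ j /\<^sub>R (1 + norm xi) ^ M) \<in> BM"
   using M[of j] by (auto dest: borel_measurable_integrable)
  have eq: "(of_real (xi $ j) * v xi $ j) /\<^sub>R (1 + norm xi) ^ Suc M =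
    of_real (xi $ j / (1 + norm xi)) * (v xi $ j /\<^sub>R (1 + norm xi) ^ M)" for xi :: R3
   by (simp add: scaleR_conv_of_real divide_inverse mult_ac)
  have [measurable]: "(%xi::R3. xi $ j) \<in> BM" by (intro borel_measurable_continuous_onI continuous_intros)
  show "(%xi. (of_real (xi $ j) * v xi $ j) /\<^sub>R (1 + norm xi) ^ Suc M) \<in> borel_measurable lborel"
   unfolding eq by measurable
  show "AE xi in lborel. norm ((of_real (xi $ j) * v xi $ j) /\<^sub>R (1 + norm xi) ^ Suc M) <= norm (v xi $ j /\<^sub>R (1 + norm xi) ^ M)"
  proof (rule AE_I2)
   fix xi :: R3
   have "\<bar>xi $ j / (1 + norm xi)\<bar> <= 1"
    using component_le_norm_cart[of xi j] by (simp add: abs_divide divide_le_eq_1 add_pos_nonneg)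
   thus "norm ((of_real (xi $ j) * v xi $ j) /\<^sub>R (1 + norm xi) ^ Suc M) <= norm (v xi $ j /\<^sub>R (1 + norm xi) ^ M)"
    unfolding eq norm_mult[of "of_real _"] norm_of_real by (intro mult_left_le_one_le) auto
  qed
 qed
 show ?thesis
 proof (rule tempered_zero[where N = "Suc M"])
  have "integrable lborel (%xi. SU j. (of_real (xi $ j) * v xi $ j) /\<^sub>R (1 + norm xi) ^ Suc M)"
   using Mj by (rule Bochner_Integration.integrable_sum)
  thus "integrable lborel (%xi. (SU j. of_real (xi $ j) * v xi $ j) /\<^sub>R (1 + norm xi) ^ Suc M)"
   by (simp only: scaleR_sum_right)
  fix ph :: "R3 => complex" assume t: "test_function ph"
  have loc: "locally_integrable (%x. complex_of_real (a x $ j))" for j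
   using h unfolding has_scalar_fourier_def by blast
  have part: "partial j (%x. L (ph x)) x = L (partial j ph x)" if "bounded_linear L" for L :: "complex => real" and j x
  proof -
   have "((%x. L (ph x)) has_derivative (%h. L (frechet_derivative ph (at x) h))) (at x)"
    using bounded_linear.has_derivative[OF that test_function_has_derivative[OF t]] .
   from frechet_derivative_at[OF this] show ?thesis by (simp add: partial_def) metis
  qed
  have i1: "integrable lborel (%x. complex_of_real (a x $ j) * partial j ph x)" for j
   by (intro locally_integrable_times_test loc test_function_partial t)
  \<comment> \<open>Weak divergence is defined through real test functions, so a complex one is
    split into its real and imaginary parts.\<close>
  have "(lint x. (SU j. complex_of_real (a x $ j) * partial j ph x)) = 0"
  proof (rule complex_eqI)
   have i: "integrable lborel (%x. SU j. complex_of_real (a x $ j) * partial j ph x)"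
    by (intro Bochner_Integration.integrable_sum i1)
   have re: "(lint x. (SU j. a x $ j * partial j (%x. Re (ph x)) x)) = 0"
    using a test_function_bounded_linear[OF bounded_linear_Re t] unfolding weakly_divergence_free_def by blast
   have im: "(lint x. (SU j. a x $ j * partial j (%x. Im (ph x)) x)) = 0"
    using a test_function_bounded_linear[OF bounded_linear_Im t] unfolding weakly_divergence_free_def by blast
   show "Re (lint x. (SU j. complex_of_real (a x $ j) * partial j ph x)) = Re 0"
    using re by (simp add: integral_Re[OF i, symmetric] part[OF bounded_linear_Re])
   show "Im (lint x. (SU j. complex_of_real (a x $ j) * partial j ph x)) = Im 0"
    using im by (simp add: integral_Im[OF i, symmetric] part[OF bounded_linear_Im])
  qed
  hence "(SU j. (lint x. complex_of_real (a x $ j) * partial j ph x)) = 0"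
   by (simp only: Bochner_Integration.integral_sum[OF i1])
  moreover have "(lint x. complex_of_real (a x $ j) * partial j ph x) =
    - \<i> * (lint xi. of_real (xi $ j) * v xi $ j * ift ph xi)" for j
  proof -
   have "(lint x. complex_of_real (a x $ j) * partial j ph x) = (lint xi. v xi $ j * ift (partial j ph) xi)"
    using h test_function_partial[OF t] unfolding has_scalar_fourier_def by blast
   also have "... = (lint xi. - \<i> * (of_real (xi $ j) * v xi $ j * ift ph xi))"
    by (intro Bochner_Integration.integral_cong refl) (simp add: ift_partial[OF t])
   finally show ?thesis by (simp only: integral_mult_right_zero)
  qed
  ultimately have "- \<i> * (SU j. (lint xi. of_real (xi $ j) * v xi $ j * ift ph xi)) = 0"
   by (simp only: sum_distrib_left[symmetric])
  hence "(SU j. (lint xi. of_real (xi $ j) * v xi $ j * ift ph xi)) = 0" by simp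
  thus "(lint xi. (SU j. of_real (xi $ j) * v xi $ j) * ift ph xi) = 0"
   using tempered_times_test_integrable[OF Mj t] by (simp add: sum_distrib_right Bochner_Integration.integral_sum)
 qed
qed

subsection \<open>Uniqueness of bounded solutions of the heat equation\<close>

text \<open>If the second derivative were positive, the first one, zero at the maximum, would be
  positive just to the right of it and the function would increase.\<close>

lemma second_derivative_at_max:
 fixes g g' :: "real => real"
 assumes d: "!!s. (g has_real_derivative g' s) (at s)" and d2: "(g' has_real_derivative c) (at 0)"
  and mx: "!!s. g s <= g 0"
 shows "g' 0 = 0" and "c <= 0"
proof -
 show g0: "g' 0 = 0"
  using DERIV_local_max[OF d[of 0], of 1] mx by simp
 show "c <= 0"
 proof (rule ccontr)
  assume "\<not> c <= 0"
  hence "c > 0" by simp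
  from DERIV_pos_inc_right[OF d2 this] obtain e where e: "e > 0" "!!h. h > 0 ==> h < e ==> g' 0 < g' (0 + h)"
   by blast
  have "g 0 < g (e / 2)"
  proof (rule DERIV_pos_imp_increasing_open[of 0 "e / 2" g])
   show "\<exists>y. (g has_real_derivative y) (at x) & 0 < y" if "0 < x" "x < e / 2" for x
    using d[of x] e(2)[of x] that g0 e(1) by auto
   show "continuous_on {0..e / 2} g"
    using d by (intro continuous_at_imp_continuous_on) (auto intro: DERIV_isCont)
  qed (use e in auto)
  thus False using mx[of "e / 2"] by simp
 qed
qed

lemma has_real_derivative_line:
 fixes a :: "R3 => real"
 assumes "a differentiable (at (x + s *\<^sub>R axis j 1))"
 shows "((%s. a (x + s *\<^sub>R axis j 1)) has_real_derivative partial j a (x + s *\<^sub>R axis j 1)) (at s)"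
proof -
 define D where "D = frechet_derivative a (at (x + s *\<^sub>R axis j 1))"
 have D: "(a has_derivative D) (at (x + s *\<^sub>R axis j 1))"
  using assms unfolding D_def frechet_derivative_works .
 have "((%s. x + s *\<^sub>R axis j 1) has_derivative (%h. h *\<^sub>R axis j 1)) (at s)"
  by (auto intro!: derivative_eq_intros)
 from has_derivative_compose[OF this D]
 have "((%s. a (x + s *\<^sub>R axis j 1)) has_derivative (%h. D (h *\<^sub>R axis j 1))) (at s)" .
 moreover have "D (h *\<^sub>R axis j 1) = partial j a (x + s *\<^sub>R axis j 1) * h" for h
  using linear_scale[OF has_derivative_linear[OF D], of h "axis j 1"] by (simp add: partial_def D_def)
 ultimately show ?thesis by (simp add: has_field_derivative_def)
qed

text \<open>The barrier \<open>\<epsilon> (1 + |x|\<^sup>2 + 7 ka t)\<close> is a strict supersolution, which forces the maximum of the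
 difference to sit at \<open>t = 0\<close>.\<close>

lemma heat_maximum_principle:
 fixes z :: "real => R3 => real"
 assumes ka: "ka > 0"
  and cont: "continuous_on ({0..} \<times> UNIV) (%(t, x). z t x)"
  and bnd: "!!t x. t >= 0 ==> z t x <= K"
  and init: "!!x. z 0 x = 0"
  and dt: "!!t x. t > 0 ==> ((%s. z s x) has_real_derivative zt t x) (at t)"
  and dx: "!!t x. t > 0 ==> z t differentiable (at x)"
  and dxx: "!!t x j. t > 0 ==> partial j (z t) differentiable (at x)"
  and eq: "!!t x. t > 0 ==> zt t x = ka * laplacian (z t) x"
  and T: "T >= 0"
 shows "z T y <= 0"
proof -
 have "z T y <= \<epsilon> * (1 + nsq y + 7 * ka * T)" if \<epsilon>: "\<epsilon> > 0" for \<epsilon>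
 proof (rule ccontr)
  define W where "W t x = z t x - \<epsilon> * (1 + nsq x + 7 * ka * t)" for t x
  assume "\<not> ?thesis"
  hence Wy: "W T y > 0" by (simp add: W_def)
  \<comment> \<open>Outside this radius |x|^2 >= |x| >= |K| / \<epsilon>, so the barrier exceeds the
    bound on \<open>z\<close> and the supremum is attained on a compact set.\<close>
  define R where "R = norm y + \<bar>K\<bar> / \<epsilon> + 1"
  have K0: "\<bar>K\<bar> / \<epsilon> >= 0" using \<epsilon> by simp
  have R: "R >= 1" "R >= norm y" using K0 by (simp_all add: R_def)
  have out: "W t x < 0" if "t >= 0" "norm x >= R" for t x
  proof -
   have "\<bar>K\<bar> / \<epsilon> <= norm x" using that norm_ge_zero[of y] unfolding R_def by linarith
   also have "norm x <= nsq x" using that R by (intro self_le_power) auto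
   finally have "\<bar>K\<bar> <= \<epsilon> * nsq x" using \<epsilon> by (simp add: pos_divide_le_eq mult.commute)
   moreover have "0 <= \<epsilon> * (7 * ka * t)" using \<epsilon> ka that by simp
   ultimately show ?thesis
    using bnd[OF that(1), of x] \<epsilon> by (simp add: W_def ring_distribs)
  qed
  define Q where "Q = {0..T} \<times> cball (0::R3) R"
  have Qc: "compact Q" unfolding Q_def by (intro compact_Times) auto
  have "(T, y) \<in> Q" using T R by (simp add: Q_def)
  have "continuous_on Q (%p. W (fst p) (snd p))"
   unfolding W_def
  proof (intro continuous_intros)
   show "continuous_on Q (%p. z (fst p) (snd p))"
   proof -
    have "Q \<subseteq> {0..} \<times> UNIV" by (auto simp: Q_def)
    from continuous_on_subset[OF cont this] show ?thesis by (simp add: case_prod_beta)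
   qed
  qed
  then obtain p where p: "p \<in> Q" "!!q. q \<in> Q ==> W (fst q) (snd q) <= W (fst p) (snd p)"
   using continuous_attains_sup[OF Qc] \<open>(T, y) \<in> Q\<close> by blast
  obtain t x where px: "p = (t, x)" by fastforce
  have mx: "W s u <= W t x" if "0 <= s" "s <= T" "norm u <= R" for s u
   using p(2)[of "(s, u)"] that by (simp add: px Q_def)
  have tx: "0 <= t" "t <= T" "norm x <= R" using p(1) by (auto simp: px Q_def)
  have pos: "W t x > 0" using mx[of T y] Wy T R by simp
  have t0: "t > 0"
  proof (rule ccontr)
   assume "\<not> t > 0"
   hence "t = 0" using tx by simp
   hence "W t x < 0" using \<epsilon> by (simp add: W_def init add_pos_nonneg)
   thus False using pos by simp
  qed
  have mx': "W t u <= W t x" for u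
  proof (cases "norm u <= R")
   case False
   thus ?thesis using out[of t u] pos tx by simp
  qed (use mx tx in simp)
  \<comment> \<open>Only earlier times are compared, because the maximum may lie at the final time
    \<open>T\<close>; so the time derivative of \<open>W\<close> is nonnegative there but need not
    vanish.\<close>
  have "zt t x >= 7 * ka * \<epsilon>"
  proof (rule ccontr)
   assume "\<not> ?thesis"
   moreover have "((%s. W s x) has_real_derivative zt t x - \<epsilon> * (7 * ka)) (at t)"
    unfolding W_def by (auto intro!: derivative_eq_intros dt[OF t0])
   ultimately obtain e where e: "e > 0" "!!h. h > 0 ==> h < e ==> W t x < W (t - h) x"
    using DERIV_neg_dec_left[of "%s. W s x" "zt t x - \<epsilon> * (7 * ka)" t] by (auto simp: algebra_simps)
   define h where "h = min (e / 2) t"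
   have "W t x < W (t - h) x" using e t0 by (simp add: h_def)
   moreover have "W (t - h) x <= W t x"
    using tx t0 e by (intro mx) (auto simp: h_def)
   ultimately show False by simp
  qed
  moreover have "partial j (partial j (z t)) x <= 2 * \<epsilon>" for j
  proof -
   define g where "g s = W t (x + s *\<^sub>R axis j 1)" for s
   define g' where "g' s = partial j (z t) (x + s *\<^sub>R axis j 1) - \<epsilon> * (2 * (x $ j) + 2 * s)" for s
   have nrm: "(norm (x + s *\<^sub>R axis j 1))\<^sup>2 = nsq x + 2 * s * (x $ j) + s\<^sup>2" for s
    unfolding power2_norm_eq_inner power2_eq_square[of s]
    by (simp add: inner_add_left inner_add_right inner_axis inner_axis' distrib_left)
   have "(g has_real_derivative g' s) (at s)" for s
   proof -
    have "((%s. z t (x + s *\<^sub>R axis j 1)) has_real_derivative partial j (z t) (x + s *\<^sub>R axis j 1)) (at s)"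
     by (rule has_real_derivative_line[OF dx[OF t0]])
    thus ?thesis
     unfolding g_def[abs_def] g'_def W_def nrm by (auto intro!: derivative_eq_intros simp: algebra_simps)
   qed
   moreover have "(g' has_real_derivative partial j (partial j (z t)) x - 2 * \<epsilon>) (at 0)"
   proof -
    have "((%s. partial j (z t) (x + s *\<^sub>R axis j 1)) has_real_derivative
      partial j (partial j (z t)) (x + 0 *\<^sub>R axis j 1)) (at 0)"
     by (rule has_real_derivative_line[OF dxx[OF t0]])
    thus ?thesis
     unfolding g'_def[abs_def] by (auto intro!: derivative_eq_intros simp: algebra_simps)
   qed
   moreover have "g s <= g 0" for s using mx' by (simp add: g_def)
   ultimately have "partial j (partial j (z t)) x - 2 * \<epsilon> <= 0" by (rule second_derivative_at_max(2))
   thus ?thesis by simp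
  qed
  \<comment> \<open>The Laplacian of the quadratic part of the barrier is 6 \<epsilon>; the rate 7
    in time exceeds it, and this is the contradiction.\<close>
  hence "laplacian (z t) x <= (\<Sum>j\<in>(UNIV::3 set). 2 * \<epsilon>)"
   unfolding laplacian_def by (intro sum_mono)
  hence "laplacian (z t) x <= 6 * \<epsilon>" by simp
  hence "ka * laplacian (z t) x <= ka * (6 * \<epsilon>)" using ka by (intro mult_left_mono) auto
  ultimately show False using eq[OF t0, of x] ka \<epsilon> by (simp add: mult_ac)
 qed
 hence lim: "z T y <= \<epsilon> * (1 + nsq y + 7 * ka * T)" if "\<epsilon> > 0" for \<epsilon> using that by blast
 define A where "A = 1 + nsq y + 7 * ka * T"
 have A: "A > 0" using ka T by (simp add: A_def add_pos_nonneg)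
 have "z T y <= 0 + e" if "e > 0" for e
  using lim[of "e / A"] A that by (simp add: A_def[symmetric])
 thus ?thesis by (rule field_le_epsilon)
qed

subsection \<open>Convolutions\<close>

definition econv :: "(R3 => ennreal) => (R3 => ennreal) => R3 => ennreal" where
 "econv f g xi = (nint eta. f (xi - eta) * g eta)"

text \<open>The factor makes the convolution the transform of the pointwise product.\<close>

definition fconv :: "(R3 => complex) => (R3 => complex) => R3 => complex" where
 "fconv v w xi = (lint eta. v (xi - eta) * w eta) / of_real ((2 * pi) ^ 3)"

lemma distr_reflect_R3: "distr lborel borel (%eta::R3. xi - eta) = lborel"
proof -
 have "(lborel :: R3 measure) = density (distr lborel borel (%x. xi + (-1) *\<^sub>R x)) (%_. ennreal (\<bar>-1\<bar> ^ DIM(R3)))"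
  by (rule lborel_affine) simp
 thus ?thesis by (simp add: density_1)
qed

text \<open>One factor of a convolution is evaluated at \<open>xi - eta\<close>; its exceptional set
  must stay null under this reflection.\<close>

lemma AE_reflect_R3:
 fixes P :: "R3 => bool"
 assumes "AE eta in lborel. P eta"
 shows "AE eta in lborel. P (xi - eta)"
proof -
 have m: "(%eta::R3. xi - eta) \<in> lborel \<rightarrow>\<^sub>M borel" by measurable
 have "AE eta in distr lborel borel (%eta. xi - eta). P eta"
  unfolding distr_reflect_R3 by (rule assms)
 from AE_distrD[OF m this] show ?thesis .
qed

lemma nn_integral_reflect_R3:
 assumes [measurable]: "f \<in> BM"
 shows "(nint eta. f (xi - eta :: R3)) = (nint eta. f eta)"
 using nn_integral_distr[of "%eta. xi - eta" lborel borel f] by (simp add: distr_reflect_R3)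

lemma integral_reflect_R3:
 fixes f :: "R3 => 'b::{banach,second_countable_topology}"
 assumes [measurable]: "f \<in> BM"
 shows "(lint eta. f (xi - eta)) = (lint eta. f eta)"
 using integral_distr[of "%eta. xi - eta" lborel borel f] by (simp add: distr_reflect_R3)

lemma nn_integral_shift_R3:
 assumes [measurable]: "f \<in> BM"
 shows "(nint xi. f (xi - eta :: R3)) = (nint xi. f xi)"
proof -
 have "(\<integral>\<^sup>+xi. f (xi - eta) \<partial>distr lborel borel ((+) eta)) = (nint xi. f xi)"
  by (subst nn_integral_distr) auto
 thus ?thesis by (simp add: lborel_distr_plus)
qed

lemma econv_measurable[measurable]:
 assumes [measurable]: "f \<in> BM" "g \<in> BM"
 shows "econv f g \<in> BM"
 unfolding econv_def[abs_def] by measurable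

lemma fconv_measurable[measurable]:
 assumes [measurable]: "f \<in> BM" "g \<in> BM"
 shows "fconv f g \<in> BM"
 unfolding fconv_def[abs_def] by measurable

lemma nn_integral_econv:
 assumes [measurable]: "f \<in> BM" "g \<in> BM"
 shows "(nint xi. econv f g xi) = (nint xi. f xi) * (nint xi. g xi)"
proof -
 have "(nint xi. econv f g xi) = (nint eta. \<integral>\<^sup>+xi. f (xi - eta) * g eta \<partial>lborel)"
  unfolding econv_def by (rule lborel_pair.Fubini') measurable
 also have "... = (nint eta. (nint xi. f xi) * g eta)"
  by (intro nn_integral_cong) (simp add: nn_integral_multc nn_integral_shift_R3)
 finally show ?thesis by (simp add: nn_integral_cmult)
qed

lemma econv_commute:
 assumes [measurable]: "f \<in> BM" "g \<in> BM"
 shows "econv f g xi = econv g f xi"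
proof -
 have "econv f g xi = (nint eta. f (xi - (xi - eta)) * g (xi - eta))"
  unfolding econv_def by (rule nn_integral_reflect_R3[symmetric, of "%eta. f (xi - eta) * g eta"]) measurable
 thus ?thesis by (simp add: econv_def mult.commute)
qed

lemma econv_mono:
 assumes "!!eta. f eta <= f' eta" "!!eta. g eta <= g' eta"
 shows "econv f g xi <= econv f' g' xi"
 unfolding econv_def by (intro nn_integral_mono mult_mono assms) auto

text \<open>A non-integrable integrand gives the value 0, so no integrability hypothesis is
  necessary; the normalising factor is at most 1 and is dropped.\<close>

lemma ennreal_norm_fconv_le:
 "en (fconv v w xi) <= econv (%xi. en (v xi)) (%xi. en (w xi)) xi"
proof -
 have "(2 * pi) ^ 3 >= 1" using pi_gt3 by (intro one_le_power) simp
 hence "norm (fconv v w xi) <= norm (lint eta. v (xi - eta) * w eta)"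
  using divide_left_mono[of 1 "(2 * pi) ^ 3" "norm (lint eta. v (xi - eta) * w eta)"]
  by (simp add: fconv_def norm_divide norm_power norm_mult)
 hence "en (fconv v w xi) <= en (lint eta. v (xi - eta) * w eta)" by (rule ennreal_leI)
 also have "... <= (nint eta. en (v (xi - eta) * w eta))"
  by (cases "integrable lborel (%eta. v (xi - eta) * w eta)")
    (auto simp: not_integrable_integral_eq intro: integral_norm_bound_ennreal)
 finally show ?thesis by (simp add: econv_def norm_mult ennreal_mult)
qed

text \<open>The exponential at \<open>xi\<close> factorises into those at \<open>xi - eta\<close>
  and at \<open>eta\<close>; the rest is Fubini and translation invariance.\<close>

lemma ift_fconv:
 assumes v: "integrable lborel v" and w: "integrable lborel w"
 shows "ift v x * ift w x = ift (fconv v w) x"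
proof -
 have [measurable]: "v \<in> BM" "w \<in> BM"
  using v w by (auto dest: borel_measurable_integrable)
 have "continuous_on UNIV (%xi. cis (xi \<bullet> x))"
  unfolding cis_conv_exp by (intro continuous_intros)
 hence [measurable]: "(%xi. cis (xi \<bullet> x)) \<in> BM" by (rule borel_measurable_continuous_onI)
 have "integrable (lborel \<Otimes>\<^sub>M lborel) (%(xi, eta). cis (xi \<bullet> x) * (v (xi - eta) * w eta))"
 proof (rule integrableI_bounded)
  have "(\<integral>\<^sup>+p. en (case p of (xi, eta) => cis (xi \<bullet> x) * (v (xi - eta) * w eta)) \<partial>(lborel \<Otimes>\<^sub>M lborel)) =
    (nint xi. \<integral>\<^sup>+eta. en (cis (xi \<bullet> x) * (v (xi - eta) * w eta)) \<partial>lborel)"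
   by (subst lborel.nn_integral_fst[symmetric]) auto
  also have "... = (nint xi. econv (%xi. en (v xi)) (%xi. en (w xi)) xi)"
   by (simp add: econv_def norm_mult ennreal_mult)
  also have "... = (nint xi. en (v xi)) * (nint xi. en (w xi))" by (rule nn_integral_econv) measurable
  also have "... < \<infinity>"
   using v w unfolding integrable_iff_bounded by (auto intro: ennreal_mult_less_top[THEN iffD2])
  finally show "(\<integral>\<^sup>+p. en (case p of (xi, eta) => cis (xi \<bullet> x) * (v (xi - eta) * w eta)) \<partial>(lborel \<Otimes>\<^sub>M lborel)) < \<infinity>" .
 qed measurable
 from lborel_pair.Fubini_integral[OF this]
 have "(lint xi. cis (xi \<bullet> x) * (lint eta. v (xi - eta) * w eta)) =
   (lint eta. \<integral>xi. cis (xi \<bullet> x) * (v (xi - eta) * w eta) \<partial>lborel)" by simp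
 also have "... = (lint eta. (lint xi. cis (xi \<bullet> x) * v xi) * (cis (eta \<bullet> x) * w eta))"
 proof (intro Bochner_Integration.integral_cong refl)
  fix eta
  have "(lint xi. cis (xi \<bullet> x) * (v (xi - eta) * w eta)) =
    (lint xi. (cis ((xi - eta) \<bullet> x) * v (xi - eta)) * (cis (eta \<bullet> x) * w eta))"
  proof (intro Bochner_Integration.integral_cong refl)
   fix xi
   have "cis (xi \<bullet> x) = cis ((xi - eta) \<bullet> x) * cis (eta \<bullet> x)" by (simp add: cis_mult inner_diff_left)
   thus "cis (xi \<bullet> x) * (v (xi - eta) * w eta) = (cis ((xi - eta) \<bullet> x) * v (xi - eta)) * (cis (eta \<bullet> x) * w eta)"
    by (simp only: mult_ac)
  qed
  also have "... = (lint xi. cis ((xi - eta) \<bullet> x) * v (xi - eta)) * (cis (eta \<bullet> x) * w eta)"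
   by (rule integral_mult_left_zero)
  also have "(lint xi. cis ((xi - eta) \<bullet> x) * v (xi - eta)) = (lint xi. cis (xi \<bullet> x) * v xi)"
   by (rule integral_translate_R3[of "%xi. cis (xi \<bullet> x) * v xi"]) measurable
  finally show "(lint xi. cis (xi \<bullet> x) * (v (xi - eta) * w eta)) =
   (lint xi. cis (xi \<bullet> x) * v xi) * (cis (eta \<bullet> x) * w eta)" .
 qed
 also have "... = (lint xi. cis (xi \<bullet> x) * v xi) * (lint eta. cis (eta \<bullet> x) * w eta)"
  by (rule integral_mult_right_zero)
 finally have "(lint xi. cis (xi \<bullet> x) * (lint eta. v (xi - eta) * w eta)) = ..." .
 moreover have "(lint xi. cis (xi \<bullet> x) * fconv v w xi) =
   (lint xi. cis (xi \<bullet> x) * (lint eta. v (xi - eta) * w eta)) / of_real ((2 * pi) ^ 3)"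
  unfolding fconv_def by (simp only: times_divide_eq_right integral_divide_zero)
 ultimately show ?thesis by (simp only: inv_fourier_int_def) simp
qed

subsection \<open>Rapidly decaying functions\<close>

text \<open>Dominating functions take values in \<open>ennreal\<close>, so that their convolutions
  always exist; they are finite only almost everywhere.\<close>

definition rapid_dom :: "(R3 => ennreal) => bool" where
 "rapid_dom E \<longleftrightarrow> E \<in> BM & (\<forall>m::nat. (nint xi. ennreal ((1 + norm xi) ^ m) * E xi) < \<infinity>)"

definition rapid :: "(R3 => complex) => bool" where
 "rapid v \<longleftrightarrow> v \<in> BM & rapid_dom (%xi. en (v xi))"

lemma rapid_dom_measurable: "rapid_dom E ==> E \<in> BM" by (simp add: rapid_dom_def)

lemma rapid_dom_mono:
 assumes "rapid_dom E" "F \<in> BM" "!!xi. F xi <= E xi"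
 shows "rapid_dom F"
 unfolding rapid_dom_def
proof (intro conjI allI)
 fix m :: nat
 have "(nint xi. ennreal ((1 + norm xi) ^ m) * F xi) <= (nint xi. ennreal ((1 + norm xi) ^ m) * E xi)"
  by (intro nn_integral_mono mult_left_mono assms) auto
 also have "... < \<infinity>" using assms(1) by (simp add: rapid_dom_def)
 finally show "(nint xi. ennreal ((1 + norm xi) ^ m) * F xi) < \<infinity>" .
qed (fact assms(2))

lemma rapidI: "rapid_dom E ==> v \<in> BM ==> (!!xi. en (v xi) <= E xi) ==> rapid v"
 unfolding rapid_def by (auto intro: rapid_dom_mono)

lemma rapid_dom_zero: "rapid_dom (%xi. 0)" by (simp add: rapid_dom_def)

lemma rapid_dom_add:
 assumes "rapid_dom E" "rapid_dom F"
 shows "rapid_dom (%xi. E xi + F xi)"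
proof -
 have [measurable]: "E \<in> BM" "F \<in> BM"
  using assms by (auto simp: rapid_dom_def)
 show ?thesis
  using assms unfolding rapid_dom_def by (simp add: distrib_left nn_integral_add ennreal_add_less_top)
qed

lemma rapid_dom_poly:
 assumes "rapid_dom E" "A >= 0"
 shows "rapid_dom (%xi. ennreal (A * (1 + norm xi) ^ q) * E xi)"
 unfolding rapid_dom_def
proof (intro conjI allI)
 have [measurable]: "E \<in> BM" using assms by (auto simp: rapid_dom_def)
 show "(%xi. ennreal (A * (1 + norm xi) ^ q) * E xi) \<in> BM" by measurable
 fix m :: nat
 have "ennreal ((1 + norm xi) ^ m) * (ennreal (A * (1 + norm xi) ^ q) * E xi) =
   ennreal A * (ennreal ((1 + norm xi) ^ (m + q)) * E xi)" for xi :: R3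
  using assms(2) by (simp add: power_add ennreal_mult mult_ac)
 hence "(nint xi. ennreal ((1 + norm xi) ^ m) * (ennreal (A * (1 + norm xi) ^ q) * E xi)) =
   ennreal A * (nint xi. ennreal ((1 + norm xi) ^ (m + q)) * E xi)" by (simp add: nn_integral_cmult)
 also have "... < \<infinity>" using assms(1) by (auto simp: rapid_dom_def ennreal_mult_less_top)
 finally show "(nint xi. ennreal ((1 + norm xi) ^ m) * (ennreal (A * (1 + norm xi) ^ q) * E xi)) < \<infinity>" .
qed

text \<open>The polynomial weight is submultiplicative: 1 + |xi| <= (1 + |xi - eta|) (1 +
  |eta|).\<close>

lemma rapid_dom_econv:
 assumes "rapid_dom E" "rapid_dom F"
 shows "rapid_dom (econv E F)"
 unfolding rapid_dom_def
proof (intro conjI allI)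
 have [measurable]: "E \<in> BM" "F \<in> BM"
  using assms by (auto simp: rapid_dom_def)
 show "econv E F \<in> BM" by measurable
 fix m :: nat
 have "ennreal ((1 + norm xi) ^ m) * econv E F xi \<le>
   econv (%xi. ennreal ((1 + norm xi) ^ m) * E xi) (%xi. ennreal ((1 + norm xi) ^ m) * F xi) xi" for xi
  unfolding econv_def
 proof (subst nn_integral_cmult[symmetric])
  show "(nint eta. ennreal ((1 + norm xi) ^ m) * (E (xi - eta) * F eta)) \<le>
   (nint eta. ennreal ((1 + norm (xi - eta)) ^ m) * E (xi - eta) * (ennreal ((1 + norm eta) ^ m) * F eta))"
  proof (intro nn_integral_mono)
   fix eta :: R3
   have "norm xi <= norm (xi - eta) + norm eta" using norm_triangle_ineq[of "xi - eta" eta] by simp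
   hence "1 + norm xi <= (1 + norm (xi - eta)) * (1 + norm eta)"
    using mult_nonneg_nonneg[OF norm_ge_zero[of "xi - eta"] norm_ge_zero[of eta]]
    unfolding distrib_left distrib_right mult_1_left mult_1_right by linarith
   hence "(1 + norm xi) ^ m <= ((1 + norm (xi - eta)) * (1 + norm eta)) ^ m" by (intro power_mono) auto
   hence "ennreal ((1 + norm xi) ^ m) <= ennreal ((1 + norm (xi - eta)) ^ m) * ennreal ((1 + norm eta) ^ m)"
    by (simp add: power_mult_distrib ennreal_mult[symmetric] ennreal_leI)
   from mult_right_mono[OF this, of "E (xi - eta) * F eta"]
   show "ennreal ((1 + norm xi) ^ m) * (E (xi - eta) * F eta) \<le>
     ennreal ((1 + norm (xi - eta)) ^ m) * E (xi - eta) * (ennreal ((1 + norm eta) ^ m) * F eta)"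
    by (simp add: mult_ac)
  qed
 qed measurable
 hence "(nint xi. ennreal ((1 + norm xi) ^ m) * econv E F xi) \<le>
   (nint xi. econv (%xi. ennreal ((1 + norm xi) ^ m) * E xi) (%xi. ennreal ((1 + norm xi) ^ m) * F xi) xi)"
  by (intro nn_integral_mono)
 also have "... = (nint xi. ennreal ((1 + norm xi) ^ m) * E xi) * (nint xi. ennreal ((1 + norm xi) ^ m) * F xi)"
  by (rule nn_integral_econv) measurable
 also have "... < \<infinity>" using assms by (auto simp: rapid_dom_def ennreal_mult_less_top)
 finally show "(nint xi. ennreal ((1 + norm xi) ^ m) * econv E F xi) < \<infinity>" .
qed

lemma rapid_dom_finite: "rapid_dom E ==> (nint xi. E xi) < \<infinity>"
 unfolding rapid_dom_def by (auto dest: spec[of _ 0])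

lemma rapid_dom_AE_finite:
 assumes "rapid_dom E"
 shows "AE xi in lborel. E xi < \<infinity>"
 using nn_integral_noteq_infinite[of E lborel] rapid_dom_measurable[OF assms] rapid_dom_finite[OF assms]
 by (auto simp: less_top)

lemma rapid_integrable: "rapid v ==> integrable lborel v"
 unfolding rapid_def integrable_iff_bounded using rapid_dom_finite by auto

lemma rapid_measurable: "rapid v ==> v \<in> BM" by (simp add: rapid_def)

lemma rapid_add: "rapid v ==> rapid w ==> rapid (%xi. v xi + w xi)"
 by (rule rapidI[OF rapid_dom_add[of "%xi. en (v xi)" "%xi. en (w xi)"]])
   (auto simp: rapid_def ennreal_plus[symmetric] norm_triangle_ineq intro!: ennreal_leI simp del: ennreal_plus)

lemma rapid_mult_poly:
 assumes "rapid v" "m \<in> BM" "A >= 0" "!!xi. norm (m xi) <= A * (1 + norm xi) ^ q"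
 shows "rapid (%xi. m xi * v xi)"
proof (rule rapidI[OF rapid_dom_poly[of "%xi. en (v xi)" A q]])
 show "rapid_dom (%xi. en (v xi))" using assms(1) by (simp add: rapid_def)
 show "(%xi. m xi * v xi) \<in> BM" using assms(2) rapid_measurable[OF assms(1)] by measurable
 show "en (m xi * v xi) <= ennreal (A * (1 + norm xi) ^ q) * en (v xi)" for xi
  using assms(3,4) by (simp add: norm_mult ennreal_mult[symmetric] ennreal_leI mult_right_mono)
qed (fact assms(3))

lemma rapid_fconv:
 assumes "rapid v" "rapid w"
 shows "rapid (fconv v w)"
proof (rule rapidI[OF _ _ ennreal_norm_fconv_le])
 show "rapid_dom (econv (%xi. en (v xi)) (%xi. en (w xi)))"
  using assms by (intro rapid_dom_econv) (auto simp: rapid_def)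
qed (use assms in \<open>auto simp: rapid_def\<close>)

lemma rapid_mult_component: "rapid v ==> rapid (%xi. \<i> * of_real (xi $ j) * v xi)"
proof (rule rapid_mult_poly[where A = 1 and q = 1])
 show "(%xi::R3. \<i> * of_real (xi $ j)) \<in> BM"
  by (intro borel_measurable_continuous_onI continuous_intros)
 show "norm (\<i> * of_real (xi $ j)) <= 1 * (1 + norm xi) ^ 1" for xi :: R3
  using component_le_norm_cart[of xi j] by (simp add: norm_mult)
qed auto

subsection \<open>Families depending smoothly on time\<close>

text \<open>Functions of \<open>(t, xi)\<close>, \<open>t > 0\<close>, that are rapidly decaying locally uniformly in time; \<open>good k\<close>
 adds \<open>k\<close> time derivatives of the same kind.\<close>

definition good0 :: "(real => R3 => complex) => bool" where
 "good0 v \<longleftrightarrow> (\<forall>t>0. v t \<in> BM) &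
   (AE xi in lborel. \<forall>t>0. isCont (%s. v s xi) t) &
   (\<forall>t0>0. \<forall>t1. \<exists>E. rapid_dom E & (\<forall>t\<in>{t0..t1}. \<forall>xi. en (v t xi) <= E xi))"

primrec good :: "nat => (real => R3 => complex) => bool" where
 "good 0 v \<longleftrightarrow> good0 v"
| "good (Suc k) v \<longleftrightarrow> good0 v &
   (\<exists>v'. (AE xi in lborel. \<forall>t>0. ((%s. v s xi) has_vector_derivative v' t xi) (at t)) & good k v')"

lemma good_imp_good0: "good k v ==> good0 v" by (cases k) auto

lemma good_Suc_D: "good (Suc k) v ==> good k v"
proof (induction k arbitrary: v)
 case 0
 thus ?case by simp
next
 case (Suc k)
 from Suc.prems obtain v' where "good0 v" "good (Suc k) v'"
  "AE xi in lborel. \<forall>t>0. ((%s. v s xi) has_vector_derivative v' t xi) (at t)"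
  unfolding good.simps(2)[of "Suc k"] by blast
 with Suc.IH[of v'] show ?case unfolding good.simps(2)[of k v] by blast
qed

lemma good_SucI:
 "good0 v ==> AE xi in lborel. \<forall>t>0. ((%s. v s xi) has_vector_derivative v' t xi) (at t) ==> good k v' ==> good (Suc k) v"
 unfolding good.simps(2) by blast

lemma good_SucE:
 assumes "good (Suc k) v"
 obtains v' where "AE xi in lborel. \<forall>t>0. ((%s. v s xi) has_vector_derivative v' t xi) (at t)" "good k v'" "good0 v"
 using assms unfolding good.simps(2) by blast

lemma good0_measurable: "good0 v ==> t > 0 ==> v t \<in> BM" by (simp add: good0_def)

lemma good0_dom:
 assumes "good0 v" "t0 > 0"
 obtains E where "rapid_dom E" "!!t xi. t0 <= t ==> t <= t1 ==> en (v t xi) <= E xi"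
 using assms unfolding good0_def by (metis atLeastAtMost_iff)

lemma good0_rapid:
 assumes "good0 v" "t > 0"
 shows "rapid (v t)"
proof -
 obtain E where "rapid_dom E" "!!s xi. t <= s ==> s <= t ==> en (v s xi) <= E xi"
  using good0_dom[OF assms] by blast
 thus ?thesis using good0_measurable[OF assms] by (intro rapidI) auto
qed

lemma good_add: "good k v ==> good k w ==> good k (%t xi. v t xi + w t xi)"
proof (induction k arbitrary: v w)
 case 0
 hence v: "good0 v" and w: "good0 w" by auto
 show ?case
  unfolding good.simps good0_def
 proof (intro conjI allI impI)
  show "(%xi. v t xi + w t xi) \<in> BM" if "t > 0" for t
   using good0_measurable[OF v that] good0_measurable[OF w that] by measurable
  have "AE xi in lborel. \<forall>t>0. isCont (%s. v s xi) t" "AE xi in lborel. \<forall>t>0. isCont (%s. w s xi) t"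
   using v w unfolding good0_def by auto
  thus "AE xi in lborel. \<forall>t>0. isCont (%s. v s xi + w s xi) t" by eventually_elim auto
  fix t0 t1 :: real assume "t0 > 0"
  obtain E where E: "rapid_dom E" "!!t xi. t0 <= t ==> t <= t1 ==> en (v t xi) <= E xi"
   using good0_dom[OF v \<open>t0 > 0\<close>] by blast
  obtain F where F: "rapid_dom F" "!!t xi. t0 <= t ==> t <= t1 ==> en (w t xi) <= F xi"
   using good0_dom[OF w \<open>t0 > 0\<close>] by blast
  have "en (v t xi + w t xi) <= E xi + F xi" if "t \<in> {t0..t1}" for t xi
  proof -
   have "en (v t xi + w t xi) <= en (v t xi) + en (w t xi)"
    by (simp add: ennreal_plus[symmetric] norm_triangle_ineq ennreal_leI del: ennreal_plus)
   also have "... <= E xi + F xi" using that E F by (intro add_mono) auto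
   finally show ?thesis .
  qed
  thus "\<exists>E. rapid_dom E & (\<forall>t\<in>{t0..t1}. \<forall>xi. en (v t xi + w t xi) <= E xi)"
   using rapid_dom_add[OF E(1) F(1)] by (intro exI[of _ "%xi. E xi + F xi"]) auto
 qed
next
 case (Suc k)
 obtain v' where v': "AE xi in lborel. \<forall>t>0. ((%s. v s xi) has_vector_derivative v' t xi) (at t)" "good k v'" "good0 v"
  using good_SucE[OF Suc.prems(1)] by blast
 obtain w' where w': "AE xi in lborel. \<forall>t>0. ((%s. w s xi) has_vector_derivative w' t xi) (at t)" "good k w'" "good0 w"
  using good_SucE[OF Suc.prems(2)] by blast
 show ?case
 proof (rule good_SucI)
  show "good0 (%t xi. v t xi + w t xi)"
   by (rule good_imp_good0[OF Suc.IH[OF good_Suc_D[OF Suc.prems(1)] good_Suc_D[OF Suc.prems(2)]]])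
  show "AE xi in lborel. \<forall>t>0. ((%s. v s xi + w s xi) has_vector_derivative v' t xi + w' t xi) (at t)"
   using v'(1) w'(1) by eventually_elim (auto intro: has_vector_derivative_add)
  show "good k (%t xi. v' t xi + w' t xi)" by (rule Suc.IH[OF v'(2) w'(2)])
 qed
qed

lemma good_mult:
 assumes m: "m \<in> BM" and A: "A >= 0" "!!xi. norm (m xi) <= A * (1 + norm xi) ^ q"
 shows "good k v ==> good k (%t xi. m xi * v t xi)"
proof (induction k arbitrary: v)
 case 0
 hence v: "good0 v" by auto
 show ?case
  unfolding good.simps good0_def
 proof (intro conjI allI impI)
  show "(%xi. m xi * v t xi) \<in> BM" if "t > 0" for t
   using good0_measurable[OF v that] m by measurable
  have "AE xi in lborel. \<forall>t>0. isCont (%s. v s xi) t"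
   using v unfolding good0_def by auto
  thus "AE xi in lborel. \<forall>t>0. isCont (%s. m xi * v s xi) t" by eventually_elim auto
  fix t0 t1 :: real assume "t0 > 0"
  obtain E where E: "rapid_dom E" "!!t xi. t0 <= t ==> t <= t1 ==> en (v t xi) <= E xi"
   using good0_dom[OF v \<open>t0 > 0\<close>] by blast
  have "en (m xi * v t xi) <= ennreal (A * (1 + norm xi) ^ q) * E xi" if "t \<in> {t0..t1}" for t xi
   unfolding norm_mult ennreal_mult[OF norm_ge_zero norm_ge_zero]
   using that by (intro mult_mono ennreal_leI A E) auto
  thus "\<exists>E. rapid_dom E & (\<forall>t\<in>{t0..t1}. \<forall>xi. en (m xi * v t xi) <= E xi)"
   using rapid_dom_poly[OF E(1) A(1), of q] by blast
 qed
next
 case (Suc k)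
 obtain v' where v': "AE xi in lborel. \<forall>t>0. ((%s. v s xi) has_vector_derivative v' t xi) (at t)" "good k v'" "good0 v"
  using good_SucE[OF Suc.prems(1)] by blast
 show ?case
 proof (rule good_SucI)
  show "good0 (%t xi. m xi * v t xi)" by (rule good_imp_good0[OF Suc.IH[OF good_Suc_D[OF Suc.prems(1)]]])
  show "AE xi in lborel. \<forall>t>0. ((%s. m xi * v s xi) has_vector_derivative m xi * v' t xi) (at t)"
   using v'(1) by eventually_elim (auto intro: has_vector_derivative_mult_right)
  show "good k (%t xi. m xi * v' t xi)" by (rule Suc.IH[OF v'(2)])
 qed
qed

lemma good_zero: "good k (%t xi. 0)"
proof (induction k)
 case 0
 show ?case by (auto simp: good0_def intro: exI[of _ "%xi. 0"] rapid_dom_zero)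
next
 case (Suc k)
 have "good0 (%t xi. 0)" by (rule good_imp_good0[OF Suc])
 thus ?case by (rule good_SucI[where v' = "%t xi. 0"]) (use Suc in auto)
qed

lemma good_sum: "finite I ==> (!!i. i \<in> I ==> good k (v i)) ==> good k (%t xi. \<Sum>i\<in>I. v i t xi)"
 by (induction rule: finite_induct) (auto intro: good_zero good_add)

lemma good_const:
 assumes v: "rapid v"
 shows "good k (%t. v)"
proof -
 have g: "good0 (%t. v)"
  using v unfolding good0_def rapid_def by (auto intro: exI[of _ "%xi. en (v xi)"])
 show ?thesis
 proof (cases k)
  case (Suc l)
  show ?thesis unfolding Suc by (rule good_SucI[OF g, where v' = "%t xi. 0"]) (auto intro: good_zero)
 qed (use g in simp)
qed

text \<open>Positive times are covered by countably many bounded intervals away from 0, each with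
  its own dominating function; this keeps the exceptional set of frequencies null although the times
  are uncountable.\<close>

lemma time_in_exhaustion:
 assumes "(t::real) > 0"
 obtains n where "t \<in> {inverse (real (Suc n))<..<real (Suc n)}"
proof -
 obtain n :: nat where n: "max t (inverse t) < real n" using reals_Archimedean2 by blast
 hence "inverse (real (Suc n)) < inverse (inverse t)"
  using assms by (intro less_imp_inverse_less) auto
 hence "t \<in> {inverse (real (Suc n))<..<real (Suc n)}" using n by auto
 thus ?thesis using that by blast
qed

text \<open>For almost every \<open>xi\<close> the majorant of the convolution integrand becomes an
  integrable real function of \<open>eta\<close>, the dominating function for limits and derivatives
  inside the convolution.\<close>

lemma econv_AE_finite:
 assumes "rapid_dom E" "rapid_dom F"
 shows "AE xi in lborel. integrable lborel (%eta. enn2real (E (xi - eta) * F eta)) & (AE eta in lborel. E (xi - eta) * F eta < \<infinity>)"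
proof -
 have [measurable]: "E \<in> BM" "F \<in> BM"
  using assms by (auto simp: rapid_dom_def)
 show ?thesis
  using rapid_dom_AE_finite[OF rapid_dom_econv[OF assms]]
 proof eventually_elim
  case (elim xi)
  hence fin: "(nint eta. E (xi - eta) * F eta) < \<infinity>" by (simp add: econv_def)
  hence ae: "AE eta in lborel. E (xi - eta) * F eta < \<infinity>"
   using nn_integral_noteq_infinite[of "%eta. E (xi - eta) * F eta" lborel] by (auto simp: less_top)
  have "(nint eta. en (enn2real (E (xi - eta) * F eta))) = (nint eta. E (xi - eta) * F eta)"
   by (intro nn_integral_cong_AE) (use ae in \<open>auto simp: less_top\<close>)
  thus ?case using fin ae by (auto intro!: integrableI_bounded)
 qed
qed

lemma norm_le_enn2real: "en x <= E ==> E < \<infinity> ==> norm x <= enn2real E"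
 by (cases E) (auto simp: ennreal_le_iff)

lemma good_fconv_0:
 assumes v: "good0 v" and w: "good0 w"
 shows "good0 (%t. fconv (v t) (w t))"
 unfolding good0_def
proof (intro conjI allI impI)
 show "fconv (v t) (w t) \<in> BM" if "t > 0" for t
  using good0_measurable[OF v that] good0_measurable[OF w that] by measurable
 show "\<exists>E. rapid_dom E & (\<forall>t\<in>{t0..t1}. \<forall>xi. en (fconv (v t) (w t) xi) <= E xi)"
  if pos0: "t0 > 0" for t0 t1
 proof -
  obtain E where E: "rapid_dom E" "!!t xi. t0 <= t ==> t <= t1 ==> en (v t xi) <= E xi"
   using good0_dom[OF v pos0] by blast
  obtain F where F: "rapid_dom F" "!!t xi. t0 <= t ==> t <= t1 ==> en (w t xi) <= F xi"
   using good0_dom[OF w pos0] by blast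
  have "en (fconv (v t) (w t) xi) <= econv E F xi" if "t \<in> {t0..t1}" for t xi
   by (rule order_trans[OF ennreal_norm_fconv_le econv_mono]) (use that E(2) F(2) in auto)
  thus ?thesis using rapid_dom_econv[OF E(1) F(1)] by blast
 qed
 have "AE xi in lborel. \<forall>t\<in>{inverse (real (Suc n))<..<real (Suc n)}. isCont (%s. fconv (v s) (w s) xi) t" for n
 proof -
  have pos: "inverse (real (Suc n)) > 0" by simp
  obtain E where E: "rapid_dom E" "!!t xi. inverse (real (Suc n)) <= t ==> t <= real (Suc n) ==> en (v t xi) <= E xi"
   using good0_dom[OF v pos] by blast
  obtain F where F: "rapid_dom F" "!!t xi. inverse (real (Suc n)) <= t ==> t <= real (Suc n) ==> en (w t xi) <= F xi"
   using good0_dom[OF w pos] by blast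
  show ?thesis
   using econv_AE_finite[OF E(1) F(1)]
  proof eventually_elim
   case (elim xi)
   show ?case
   proof
    fix t assume t: "t \<in> {inverse (real (Suc n))<..<real (Suc n)}"
    have vc: "AE eta in lborel. \<forall>t>0. isCont (%s. v s (xi - eta)) t"
     using AE_reflect_R3[of "%eta. \<forall>t>0. isCont (%s. v s eta) t" xi] v unfolding good0_def by blast
    have wc: "AE eta in lborel. \<forall>t>0. isCont (%s. w s eta) t" using w unfolding good0_def by blast
    have t0: "t > 0" using t pos by (meson greaterThanLessThan_iff less_trans)
    have m: "(%eta. v s (xi - eta) * w s eta) \<in> borel_measurable lborel" if "s > 0" for s
     using good0_measurable[OF v that] good0_measurable[OF w that] by measurable
    have "((%s. \<integral>eta. v s (xi - eta) * w s eta \<partial>lborel) \<longlongrightarrow> (lint eta. v t (xi - eta) * w t eta)) (at t within UNIV)"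
    proof (rule tendsto_integral_dominated[where U = "{inverse (real (Suc n))<..<real (Suc n)}"
       and B = "%eta. enn2real (E (xi - eta) * F eta)"])
     show "(%eta. v s (xi - eta) * w s eta) \<in> borel_measurable lborel"
      if "s \<in> {inverse (real (Suc n))<..<real (Suc n)}" for s
      using that pos by (intro m) (meson greaterThanLessThan_iff less_trans)
     show "(%eta. v t (xi - eta) * w t eta) \<in> borel_measurable lborel" by (rule m[OF t0])
     show "AE eta in lborel. ((%s. v s (xi - eta) * w s eta) \<longlongrightarrow> v t (xi - eta) * w t eta) (at t)"
      using vc wc by eventually_elim (use t0 in \<open>auto simp: isCont_def intro!: tendsto_mult\<close>)
     show "AE eta in lborel. \<forall>s\<in>{inverse (real (Suc n))<..<real (Suc n)} \<inter> UNIV.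
       norm (v s (xi - eta) * w s eta) <= enn2real (E (xi - eta) * F eta)"
      using conjunct2[OF elim]
     proof eventually_elim
      case (elim eta)
      show ?case
      proof
       fix s assume "s \<in> {inverse (real (Suc n))<..<real (Suc n)} \<inter> UNIV"
       hence "en (v s (xi - eta) * w s eta) <= E (xi - eta) * F eta"
        unfolding norm_mult ennreal_mult[OF norm_ge_zero norm_ge_zero] by (intro mult_mono E(2) F(2)) auto
       thus "norm (v s (xi - eta) * w s eta) <= enn2real (E (xi - eta) * F eta)"
        by (rule norm_le_enn2real[OF _ elim])
      qed
     qed
    qed (use t elim in auto)
    thus "isCont (%s. fconv (v s) (w s) xi) t"
     unfolding isCont_def fconv_def by (intro tendsto_divide tendsto_const) auto
   qed
  qed
 qed
 hence "AE xi in lborel. \<forall>n. \<forall>t\<in>{inverse (real (Suc n))<..<real (Suc n)}. isCont (%s. fconv (v s) (w s) xi) t"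
  unfolding AE_all_countable by blast
 thus "AE xi in lborel. \<forall>t>0. isCont (%s. fconv (v s) (w s) xi) t"
 proof eventually_elim
  case (elim xi)
  show ?case
  proof (intro allI impI)
   fix t :: real assume t: "t > 0"
   obtain n where n: "t \<in> {inverse (real (Suc n))<..<real (Suc n)}" using time_in_exhaustion[OF t] by blast
   thus "isCont (%s. fconv (v s) (w s) xi) t" using elim by blast
  qed
 qed
qed

text \<open>Product rule under the convolution integral. On each time interval the derivative is
  dominated by the bound of one factor times that of the derivative of the other, summed over the
  two cases.\<close>

lemma good_fconv_derivative:
 assumes v: "good0 v" and w: "good0 w" and v': "good0 v'" and w': "good0 w'"
  and dv: "AE xi in lborel. \<forall>t>0. ((%s. v s xi) has_vector_derivative v' t xi) (at t)"
  and dw: "AE xi in lborel. \<forall>t>0. ((%s. w s xi) has_vector_derivative w' t xi) (at t)"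
 shows "AE xi in lborel. \<forall>t>0. ((%s. fconv (v s) (w s) xi) has_vector_derivative
   fconv (v t) (w' t) xi + fconv (v' t) (w t) xi) (at t)"
proof -
 have "AE xi in lborel. \<forall>t\<in>{inverse (real (Suc n))<..<real (Suc n)}.
   ((%s. fconv (v s) (w s) xi) has_vector_derivative fconv (v t) (w' t) xi + fconv (v' t) (w t) xi) (at t)" for n
 proof -
  define I where "I = {inverse (real (Suc n))<..<real (Suc n)}"
  have pos: "inverse (real (Suc n)) > 0" by simp
  have I0: "s > 0" if "s \<in> I" for s using that pos unfolding I_def by (meson greaterThanLessThan_iff less_trans)
  obtain E where E: "rapid_dom E" "!!t xi. inverse (real (Suc n)) <= t ==> t <= real (Suc n) ==> en (v t xi) <= E xi"
   using good0_dom[OF v pos] by blast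
  obtain F where F: "rapid_dom F" "!!t xi. inverse (real (Suc n)) <= t ==> t <= real (Suc n) ==> en (w t xi) <= F xi"
   using good0_dom[OF w pos] by blast
  obtain E' where E': "rapid_dom E'" "!!t xi. inverse (real (Suc n)) <= t ==> t <= real (Suc n) ==> en (v' t xi) <= E' xi"
   using good0_dom[OF v' pos] by blast
  obtain F' where F': "rapid_dom F'" "!!t xi. inverse (real (Suc n)) <= t ==> t <= real (Suc n) ==> en (w' t xi) <= F' xi"
   using good0_dom[OF w' pos] by blast
  show ?thesis
   using econv_AE_finite[OF E(1) F(1)] econv_AE_finite[OF E(1) F'(1)] econv_AE_finite[OF E'(1) F(1)]
   unfolding I_def[symmetric]
  proof eventually_elim
   case (elim xi)
   show ?case
   proof
    fix t assume t: "t \<in> I"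
    obtain r where r: "r > 0" "ball t r \<subseteq> I"
     using t open_contains_ball[of I] unfolding I_def by (metis open_greaterThanLessThan)
    have vc: "AE eta in lborel. \<forall>t>0. ((%s. v s (xi - eta)) has_vector_derivative v' t (xi - eta)) (at t)"
     using AE_reflect_R3[OF dv, of xi] .
    have m: "(%eta. a s (xi - eta) * b s eta) \<in> borel_measurable lborel" if "s \<in> I" "good0 a" "good0 b" for s a b
     using good0_measurable[OF that(2) I0[OF that(1)]] good0_measurable[OF that(3) I0[OF that(1)]] by measurable
    have prodle: "norm (a * b) <= enn2real (X * Y)" if "en a <= X" "en b <= Y" "X * Y < \<infinity>"
     for a b :: complex and X Y by (rule norm_le_enn2real[OF _ that(3)])
       (use that in \<open>auto simp: norm_mult ennreal_mult intro!: mult_mono\<close>)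
    have int: "integrable lborel (%eta. a s (xi - eta) * b s eta)"
     if "s \<in> I" "good0 a" "good0 b" "integrable lborel (%eta. enn2real (X (xi - eta) * Y eta)) & (AE eta in lborel. X (xi - eta) * Y eta < \<infinity>)"
      "!!t xi. inverse (real (Suc n)) <= t ==> t <= real (Suc n) ==> en (a t xi) <= X xi"
      "!!t xi. inverse (real (Suc n)) <= t ==> t <= real (Suc n) ==> en (b t xi) <= Y xi" for s a b X Y
    proof (rule Bochner_Integration.integrable_bound[OF conjunct1[OF that(4)] m[OF that(1-3)]])
     show "AE eta in lborel. norm (a s (xi - eta) * b s eta) <= norm (enn2real (X (xi - eta) * Y eta))"
      using conjunct2[OF that(4)]
     proof eventually_elim
      case (elim eta)
      have "norm (a s (xi - eta) * b s eta) <= enn2real (X (xi - eta) * Y eta)"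
       by (rule prodle[OF that(5) that(6) elim]) (use that(1) in \<open>auto simp: I_def\<close>)
      thus ?case by simp
     qed
    qed
    have "((%s. \<integral>eta. v s (xi - eta) * w s eta \<partial>lborel) has_derivative
      (%h. \<integral>eta. h *\<^sub>R (v t (xi - eta) * w' t eta + v' t (xi - eta) * w t eta) \<partial>lborel)) (at t)"
    proof (rule has_derivative_integral_dominated[where r = r
      and g' = "%s eta h. h *\<^sub>R (v s (xi - eta) * w' s eta + v' s (xi - eta) * w s eta)"
      and B = "%eta. enn2real (E (xi - eta) * F' eta) + enn2real (E' (xi - eta) * F eta)"])
     show "integrable lborel (%eta. v s (xi - eta) * w s eta)" if "s \<in> ball t r" for s
      using that r(2) by (intro int[of s v w E F]) (use v w E(2) F(2) elim in auto)
     show "(%eta. h *\<^sub>R (v t (xi - eta) * w' t eta + v' t (xi - eta) * w t eta)) \<in> borel_measurable lborel" for h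
      using m[OF t v w'] m[OF t v' w] by measurable
     show "AE eta in lborel. \<forall>s\<in>ball t r. ((%s. v s (xi - eta) * w s eta) has_derivative
       (%h. h *\<^sub>R (v s (xi - eta) * w' s eta + v' s (xi - eta) * w s eta))) (at s)"
      using vc dw
     proof eventually_elim
      case (elim eta)
      show ?case
      proof
       fix s assume "s \<in> ball t r"
       hence "s > 0" using r(2) I0 by blast
       hence "((%s. v s (xi - eta)) has_vector_derivative v' s (xi - eta)) (at s)"
        "((%s. w s eta) has_vector_derivative w' s eta) (at s)" using elim by blast+
       from has_vector_derivative_mult[OF this]
       show "((%s. v s (xi - eta) * w s eta) has_derivative
        (%h. h *\<^sub>R (v s (xi - eta) * w' s eta + v' s (xi - eta) * w s eta))) (at s)"
        unfolding has_vector_derivative_def .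
      qed
     qed
     show "AE eta in lborel. \<forall>s\<in>ball t r. \<forall>h. norm (h *\<^sub>R (v s (xi - eta) * w' s eta + v' s (xi - eta) * w s eta))
       <= (enn2real (E (xi - eta) * F' eta) + enn2real (E' (xi - eta) * F eta)) * norm h"
      using conjunct2[OF elim(2)] conjunct2[OF elim(3)]
     proof eventually_elim
      case (elim eta)
      show ?case
      proof (intro ballI allI)
       fix s h assume "s \<in> ball t r"
       hence s: "inverse (real (Suc n)) <= s" "s <= real (Suc n)" using r(2) by (auto simp: I_def)
       have "norm (v s (xi - eta) * w' s eta + v' s (xi - eta) * w s eta) \<le>
         enn2real (E (xi - eta) * F' eta) + enn2real (E' (xi - eta) * F eta)"
        by (rule order_trans[OF norm_triangle_ineq add_mono])
          (rule prodle[OF E(2)[OF s] F'(2)[OF s] elim(1)], rule prodle[OF E'(2)[OF s] F(2)[OF s] elim(2)])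
       thus "norm (h *\<^sub>R (v s (xi - eta) * w' s eta + v' s (xi - eta) * w s eta))
        <= (enn2real (E (xi - eta) * F' eta) + enn2real (E' (xi - eta) * F eta)) * norm h"
        unfolding norm_scaleR by (subst mult.commute) (simp add: mult_right_mono)
      qed
     qed
    qed (use r elim in auto)
    moreover have "(lint eta. h *\<^sub>R (v t (xi - eta) * w' t eta + v' t (xi - eta) * w t eta)) =
      h *\<^sub>R ((lint eta. v t (xi - eta) * w' t eta) + (lint eta. v' t (xi - eta) * w t eta))" for h
     using int[OF t v w' _ E(2) F'(2)] int[OF t v' w _ E'(2) F(2)] elim by simp
    ultimately have "((%s. \<integral>eta. v s (xi - eta) * w s eta \<partial>lborel) has_vector_derivative
      (lint eta. v t (xi - eta) * w' t eta) + (lint eta. v' t (xi - eta) * w t eta)) (at t)"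
     unfolding has_vector_derivative_def by (simp only:)
    from has_vector_derivative_divide[OF this, of "of_real ((2 * pi) ^ 3)"]
    show "((%s. fconv (v s) (w s) xi) has_vector_derivative fconv (v t) (w' t) xi + fconv (v' t) (w t) xi) (at t)"
     unfolding fconv_def add_divide_distrib .
   qed
  qed
 qed
 hence "AE xi in lborel. \<forall>n. \<forall>t\<in>{inverse (real (Suc n))<..<real (Suc n)}.
   ((%s. fconv (v s) (w s) xi) has_vector_derivative fconv (v t) (w' t) xi + fconv (v' t) (w t) xi) (at t)"
  unfolding AE_all_countable by blast
 thus ?thesis
 proof eventually_elim
  case (elim xi)
  show ?case
  proof (intro allI impI)
   fix t :: real assume t: "t > 0"
   obtain n where n: "t \<in> {inverse (real (Suc n))<..<real (Suc n)}" using time_in_exhaustion[OF t] by blast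
   thus "((%s. fconv (v s) (w s) xi) has_vector_derivative fconv (v t) (w' t) xi + fconv (v' t) (w t) xi) (at t)"
    using elim by blast
  qed
 qed
qed

lemma good_fconv: "good k v ==> good k w ==> good k (%t. fconv (v t) (w t))"
proof (induction k arbitrary: v w)
 case 0
 thus ?case using good_fconv_0 by simp
next
 case (Suc k)
 obtain v' where v': "AE xi in lborel. \<forall>t>0. ((%s. v s xi) has_vector_derivative v' t xi) (at t)" "good k v'" "good0 v"
  using good_SucE[OF Suc.prems(1)] by blast
 obtain w' where w': "AE xi in lborel. \<forall>t>0. ((%s. w s xi) has_vector_derivative w' t xi) (at t)" "good k w'" "good0 w"
  using good_SucE[OF Suc.prems(2)] by blast
 show ?case
 proof (rule good_SucI[OF good_fconv_0[OF v'(3) w'(3)]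
    good_fconv_derivative[OF v'(3) w'(3) good_imp_good0[OF v'(2)] good_imp_good0[OF w'(2)] v'(1) w'(1)]])
  show "good k (%t xi. fconv (v t) (w' t) xi + fconv (v' t) (w t) xi)"
   by (intro good_add Suc.IH v'(2) w'(2) good_Suc_D[OF Suc.prems(1)] good_Suc_D[OF Suc.prems(2)])
 qed
qed

subsection \<open>Smooth functions with given transform\<close>

lemma integrable_cis_mult:
 assumes "integrable lborel v"
 shows "integrable lborel (%xi. cis (xi \<bullet> x) * v xi)"
proof (rule Bochner_Integration.integrable_bound[OF assms])
 have "continuous_on UNIV (%xi. cis (xi \<bullet> x))"
  unfolding cis_conv_exp by (intro continuous_intros)
 hence [measurable]: "(%xi. cis (xi \<bullet> x)) \<in> BM" by (rule borel_measurable_continuous_onI)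
 have [measurable]: "v \<in> BM" using assms by (auto dest: borel_measurable_integrable)
 show "(%xi. cis (xi \<bullet> x) * v xi) \<in> borel_measurable lborel" by measurable
qed (auto simp: norm_mult)

lemma ift_add:
 "integrable lborel v ==> integrable lborel w ==> ift (%xi. v xi + w xi) x = ift v x + ift w x"
 unfolding inv_fourier_int_def by (simp add: distrib_left integrable_cis_mult add_divide_distrib)

lemma ift_cmult: "ift (%xi. c * v xi) x = c * ift v x"
proof -
 have "(lint xi. cis (xi \<bullet> x) * (c * v xi)) = (lint xi. c * (cis (xi \<bullet> x) * v xi))"
  by (simp only: mult_ac)
 also have "... = c * (lint xi. cis (xi \<bullet> x) * v xi)" by (rule integral_mult_right_zero)
 finally show ?thesis by (simp only: inv_fourier_int_def times_divide_eq_right)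
qed

lemma norm_inner_poly: "norm (\<i> * of_real (h \<bullet> xi)) <= norm h * (1 + norm xi) ^ 1" for h xi :: R3
proof -
 have "\<bar>h \<bullet> xi\<bar> <= norm h * norm xi" by (rule Cauchy_Schwarz_ineq2)
 also have "... <= norm h * (1 + norm xi)" by (intro mult_left_mono) auto
 finally show ?thesis by (simp add: norm_mult)
qed

lemma rapid_inner: "rapid v ==> rapid (%xi. \<i> * of_real (h \<bullet> xi) * v xi)"
proof (rule rapid_mult_poly[where A = "norm h" and q = 1])
 show "(%xi::R3. \<i> * of_real (h \<bullet> xi)) \<in> BM"
  by (intro borel_measurable_continuous_onI continuous_intros)
 show "norm (\<i> * of_real (h \<bullet> xi)) <= norm h * (1 + norm xi) ^ 1" for xi :: R3
  by (rule norm_inner_poly)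
qed auto

lemma good0_has_derivative:
 assumes v: "good0 v" and v': "good0 v'" and t: "t > 0"
  and d: "AE xi in lborel. \<forall>t>0. ((%s. v s xi) has_vector_derivative v' t xi) (at t)"
 shows "((%(t, x). ift (v t) x) has_derivative
   (%(\<tau>, h). \<tau> *\<^sub>R ift (v' t) x + ift (%xi. \<i> * of_real (h \<bullet> xi) * v t xi) x)) (at (t, x))"
proof -
 define g where "g = (%(p::real \<times> R3) xi. cis (xi \<bullet> snd p) * v (fst p) xi)"
 define g' where "g' = (%(p::real \<times> R3) xi q. cis (xi \<bullet> snd p) * (fst q *\<^sub>R v' (fst p) xi) +
   (xi \<bullet> snd q) *\<^sub>R (\<i> * cis (xi \<bullet> snd p)) * v (fst p) xi)"
 obtain E where E: "rapid_dom E" "!!s xi. t / 2 <= s ==> s <= 2 * t ==> en (v s xi) <= E xi"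
  using good0_dom[OF v, of "t / 2" "2 * t"] t by auto
 obtain F where F: "rapid_dom F" "!!s xi. t / 2 <= s ==> s <= 2 * t ==> en (v' s xi) <= F xi"
  using good0_dom[OF v', of "t / 2" "2 * t"] t by auto
 \<comment> \<open>Dominates the time derivative and, with one more power of |xi|, the spatial
   gradient.\<close>
 define H where "H xi = F xi + ennreal (1 * (1 + norm xi) ^ 1) * E xi" for xi
 have H: "rapid_dom H"
  unfolding H_def[abs_def] by (intro rapid_dom_add rapid_dom_poly F E) simp
 have [measurable]: "H \<in> BM" "E \<in> BM" "F \<in> BM"
  using H E F by (auto simp: rapid_dom_def)
 have cm[measurable]: "(%xi. cis (xi \<bullet> y)) \<in> BM" for y :: R3
 proof -
  have "continuous_on UNIV (%xi. cis (xi \<bullet> y))" unfolding cis_conv_exp by (intro continuous_intros)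
  thus ?thesis by (rule borel_measurable_continuous_onI)
 qed
 \<comment> \<open>Within distance \<open>t / 2\<close> of \<open>(t, x)\<close> all times lie
   between \<open>t / 2\<close> and \<open>2 * t\<close>, where the bounds \<open>E\<close> and
   \<open>F\<close> hold.\<close>
 have near: "t / 2 <= fst p & fst p <= 2 * t & fst p > 0" if "p \<in> ball (t, x) (t / 2)" for p
 proof -
  have "\<bar>t - fst p\<bar> <= dist (t, x) p" using dist_fst_le[of "(t, x)" p] by (simp add: dist_real_def)
  hence "\<bar>t - fst p\<bar> < t / 2" using that by simp
  thus ?thesis using t by linarith
 qed
 have "((%p. \<integral>xi. g p xi \<partial>lborel) has_derivative (%q. \<integral>xi. g' (t, x) xi q \<partial>lborel)) (at (t, x))"
 proof (rule has_derivative_integral_dominated[where r = "t / 2" and B = "%xi. enn2real (H xi)"])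
  show "integrable lborel (g p)" if "p \<in> ball (t, x) (t / 2)" for p
   unfolding g_def using near[OF that] by (intro integrable_cis_mult rapid_integrable good0_rapid[OF v]) auto
  show "(%xi. g' (t, x) xi q) \<in> borel_measurable lborel" for q
   unfolding g'_def fst_conv snd_conv using good0_measurable[OF v t] good0_measurable[OF v' t] by measurable
  show "AE xi in lborel. \<forall>p\<in>ball (t, x) (t / 2). ((%p. g p xi) has_derivative g' p xi) (at p)"
   using d
  proof eventually_elim
   case (elim xi)
   show ?case
   proof
    fix p assume "p \<in> ball (t, x) (t / 2)"
    hence "fst p > 0" using near by blast
    with elim have "((%s. v s xi) has_derivative (%h. h *\<^sub>R v' (fst p) xi)) (at (fst p))"
     unfolding has_vector_derivative_def by blast
    from has_derivative_compose[OF has_derivative_fst[OF has_derivative_ident] this]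
    have 1: "((%p. v (fst p) xi) has_derivative (%q. fst q *\<^sub>R v' (fst p) xi)) (at p)" .
    have 2: "((%p::real \<times> R3. cis (xi \<bullet> snd p)) has_derivative (%q. (xi \<bullet> snd q) *\<^sub>R (\<i> * cis (xi \<bullet> snd p)))) (at p)"
     by (rule has_derivative_cis) (auto intro!: derivative_eq_intros)
    from has_derivative_mult[OF 2 1]
    show "((%p. g p xi) has_derivative g' p xi) (at p)"
     unfolding g_def g'_def .
   qed
  qed
  show "AE xi in lborel. \<forall>p\<in>ball (t, x) (t / 2). \<forall>q. norm (g' p xi q) <= enn2real (H xi) * norm q"
   using rapid_dom_AE_finite[OF H]
  proof eventually_elim
   case (elim xi)
   hence fin: "E xi < \<infinity>" "F xi < \<infinity>"
    by (auto simp: H_def ennreal_mult_less_top ennreal_add_less_top)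
   have Heq: "enn2real (H xi) = enn2real (F xi) + (1 + norm xi) * enn2real (E xi)"
    unfolding H_def using fin
    by (subst enn2real_plus) (auto simp: ennreal_mult_less_top enn2real_mult simp del: ennreal_plus)
   show ?case
   proof (intro ballI allI)
    fix p and q :: "real \<times> R3" assume "p \<in> ball (t, x) (t / 2)"
    hence s: "t / 2 <= fst p" "fst p <= 2 * t" using near by blast+
    have a: "norm (v (fst p) xi) <= enn2real (E xi)" by (rule norm_le_enn2real[OF E(2)[OF s] fin(1)])
    have b: "norm (v' (fst p) xi) <= enn2real (F xi)" by (rule norm_le_enn2real[OF F(2)[OF s] fin(2)])
    have q: "\<bar>fst q\<bar> <= norm q" "norm (snd q) <= norm q"
     using norm_fst_le[of "fst q" "snd q"] norm_snd_le[of "snd q" "fst q"] by auto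
    have "norm (g' p xi q) <= \<bar>fst q\<bar> * norm (v' (fst p) xi) + \<bar>xi \<bullet> snd q\<bar> * norm (v (fst p) xi)"
     unfolding g'_def by (rule order_trans[OF norm_triangle_ineq]) (simp add: norm_mult)
    also have "... <= norm q * enn2real (F xi) + (norm xi * norm q) * enn2real (E xi)"
    proof (intro add_mono mult_mono q a b)
     show "\<bar>xi \<bullet> snd q\<bar> <= norm xi * norm q"
      using Cauchy_Schwarz_ineq2[of xi "snd q"] mult_left_mono[OF q(2), of "norm xi"] by simp
    qed auto
    also have "... <= enn2real (H xi) * norm q"
     unfolding Heq by (simp add: ring_distribs mult_ac)
    finally show "norm (g' p xi q) <= enn2real (H xi) * norm q" .
   qed
  qed
  show "integrable lborel (%xi. enn2real (H xi))"
  proof (rule integrableI_bounded)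
   have "(nint xi. en (enn2real (H xi))) = (nint xi. H xi)"
    by (intro nn_integral_cong_AE) (use rapid_dom_AE_finite[OF H] in \<open>auto simp: less_top\<close>)
   thus "(nint xi. en (enn2real (H xi))) < \<infinity>"
    using rapid_dom_finite[OF H] by simp
  qed measurable
 qed (use t in auto)
 from bounded_linear.has_derivative[OF bounded_linear_divide[of "of_real ((2 * pi) ^ 3)"] this]
 have 1: "((%p. (lint xi. g p xi) / of_real ((2 * pi) ^ 3)) has_derivative
   (%q. (lint xi. g' (t, x) xi q) / of_real ((2 * pi) ^ 3))) (at (t, x))" .
 have 2: "(lint xi. g' (t, x) xi q) / of_real ((2 * pi) ^ 3) =
   fst q *\<^sub>R ift (v' t) x + ift (%xi. \<i> * of_real (snd q \<bullet> xi) * v t xi) x" for q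
 proof -
  have i: "integrable lborel (%xi. of_real (fst q) * v' t xi)"
   using rapid_integrable[OF good0_rapid[OF v' t]] by simp
  have "(lint xi. g' (t, x) xi q) / of_real ((2 * pi) ^ 3) =
   ift (%xi. of_real (fst q) * v' t xi + \<i> * of_real (snd q \<bullet> xi) * v t xi) x"
   unfolding inv_fourier_int_def g'_def fst_conv snd_conv
   by (simp add: scaleR_conv_of_real distrib_left inner_commute mult_ac)
  also have "... = ift (%xi. of_real (fst q) * v' t xi) x + ift (%xi. \<i> * of_real (snd q \<bullet> xi) * v t xi) x"
   by (rule ift_add[OF i rapid_integrable[OF rapid_inner[OF good0_rapid[OF v t]]]])
  finally show ?thesis by (simp add: ift_cmult scaleR_conv_of_real)
 qed
 have 3: "(lint xi. g p xi) / of_real ((2 * pi) ^ 3) = ift (v (fst p)) (snd p)" for p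
  by (simp only: g_def inv_fourier_int_def)
 show ?thesis using 1 unfolding 2 3 by (simp only: case_prod_beta')
qed

text \<open>A spatial derivative multiplies the transform by a linear factor, a time derivative
  replaces \<open>v\<close> by \<open>v'\<close>; both results are of class \<open>k\<close>, so the
  induction closes.\<close>

lemma good_Ck_on:
 "good k v ==> Ck_on k ({0<..} \<times> UNIV) (%(t, x). ift (v t) x)"
proof (induction k arbitrary: v)
 case 0
 hence v: "good0 v" by simp
 have "((%p. \<integral>xi. cis (xi \<bullet> snd p) * v (fst p) xi \<partial>lborel) \<longlongrightarrow> (lint xi. cis (xi \<bullet> x) * v t xi)) (at (t, x) within {0<..} \<times> UNIV)"
  if t: "t > 0" for t x
 proof -
  obtain E where E: "rapid_dom E" "!!s xi. t / 2 <= s ==> s <= 2 * t ==> en (v s xi) <= E xi"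
   using good0_dom[OF v, of "t / 2" "2 * t"] t by auto
  have [measurable]: "E \<in> BM" using E by (auto simp: rapid_dom_def)
  have m: "(%xi. cis (xi \<bullet> y) * v s xi) \<in> borel_measurable lborel" if "s > 0" for s y
   using integrable_cis_mult[OF rapid_integrable[OF good0_rapid[OF v that]]] by (rule borel_measurable_integrable)
  show ?thesis
  proof (rule tendsto_integral_dominated[where U = "{t / 2<..<2 * t} \<times> UNIV" and B = "%xi. enn2real (E xi)"])
   show "AE xi in lborel. ((%p. cis (xi \<bullet> snd p) * v (fst p) xi) \<longlongrightarrow> cis (xi \<bullet> x) * v t xi) (at (t, x) within {0<..} \<times> UNIV)"
   proof -
    have "AE xi in lborel. \<forall>t>0. isCont (%s. v s xi) t" using v by (simp add: good0_def)
    thus ?thesis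
    proof eventually_elim
     case (elim xi)
     have "((%p. fst p) \<longlongrightarrow> fst (t, x)) (at (t, x) within {0<..} \<times> UNIV)" by (intro tendsto_intros)
     moreover have "isCont (%s. v s xi) (fst (t, x))" using elim t by simp
     ultimately have 1: "((%p. v (fst p) xi) \<longlongrightarrow> v t xi) (at (t, x) within {0<..} \<times> UNIV)"
      using isCont_tendsto_compose[of "fst (t, x)" "%s. v s xi"] by simp
     have "continuous_on UNIV (%p::real \<times> R3. cis (xi \<bullet> snd p))"
      unfolding cis_conv_exp by (intro continuous_intros)
     hence "((%p::real \<times> R3. cis (xi \<bullet> snd p)) \<longlongrightarrow> cis (xi \<bullet> snd (t, x))) (at (t, x) within {0<..} \<times> UNIV)"
      unfolding continuous_on_def by (blast intro: tendsto_within_subset)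
     from tendsto_mult[OF this 1] show ?case by simp
    qed
   qed
   show "AE xi in lborel. \<forall>p\<in>{t / 2<..<2 * t} \<times> UNIV \<inter> {0<..} \<times> UNIV. norm (cis (xi \<bullet> snd p) * v (fst p) xi) <= enn2real (E xi)"
    using rapid_dom_AE_finite[OF E(1)]
   proof eventually_elim
    case (elim xi)
    show ?case by (auto simp: norm_mult intro!: norm_le_enn2real[OF E(2) elim])
   qed
   show "integrable lborel (%xi. enn2real (E xi))"
   proof (rule integrableI_bounded)
    have "(nint xi. en (enn2real (E xi))) = (nint xi. E xi)"
     by (intro nn_integral_cong_AE) (use rapid_dom_AE_finite[OF E(1)] in \<open>auto simp: less_top\<close>)
    thus "(nint xi. en (enn2real (E xi))) < \<infinity>"
     using rapid_dom_finite[OF E(1)] by simp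
   qed measurable
  qed (use t m in \<open>auto intro!: open_Times\<close>)
 qed
 thus ?case
  unfolding Ck_on.simps continuous_on_def inv_fourier_int_def case_prod_beta by (auto intro!: tendsto_divide)
next
 case (Suc k)
 obtain v' where v': "AE xi in lborel. \<forall>t>0. ((%s. v s xi) has_vector_derivative v' t xi) (at t)" "good k v'" "good0 v"
  using good_SucE[OF Suc.prems] by blast
 have op: "open ({0<..} \<times> UNIV :: (real \<times> R3) set)" by (intro open_Times) auto
 show ?case
 proof (rule Ck_on_SucI[OF op])
  show "((%(t, x). ift (v t) x) has_derivative
   (%(\<tau>, h). \<tau> *\<^sub>R ift (v' (fst p)) (snd p) +
    ift (%xi. \<i> * of_real (h \<bullet> xi) * v (fst p) xi) (snd p))) (at p)"
   if "p \<in> {0<..} \<times> UNIV" for p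
   using good0_has_derivative[OF v'(3) good_imp_good0[OF v'(2)] _ v'(1), of "fst p" "snd p"] that by auto
  fix b :: "real \<times> R3" assume b: "b \<in> Basis"
  have zero: "ift (%xi. 0) y = 0" for y by (simp add: inv_fourier_int_def)
  show "Ck_on k ({0<..} \<times> UNIV) (%p. case b of (\<tau>, h) => \<tau> *\<^sub>R ift (v' (fst p)) (snd p) +
    ift (%xi. \<i> * of_real (h \<bullet> xi) * v (fst p) xi) (snd p))"
  proof (cases "fst b = 0")
   case True
   hence b': "b = (0, snd b)" by (metis prod.collapse)
   have "good k (%t xi. \<i> * of_real (snd b \<bullet> xi) * v t xi)"
   proof (rule good_mult[where A = "norm (snd b)" and q = 1, OF _ _ _ good_Suc_D[OF Suc.prems]])
    show "(%xi::R3. \<i> * of_real (snd b \<bullet> xi)) \<in> BM"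
     by (intro borel_measurable_continuous_onI continuous_intros)
    show "norm (\<i> * of_real (snd b \<bullet> xi)) <= norm (snd b) * (1 + norm xi) ^ 1" for xi :: R3
     by (rule norm_inner_poly)
   qed auto
   from Suc.IH[OF this] show ?thesis by (subst b') (simp add: case_prod_beta')
  next
   case False
   hence b': "b = (1, 0)" using b by (auto simp: Basis_prod_def)
   from Suc.IH[OF v'(2)] show ?thesis
    unfolding b' by (simp add: case_prod_beta' zero)
  qed
 qed
qed

subsection \<open>Real functions with rapidly decaying transform\<close>

text \<open>The inversion formula is required at every point, so that sums, products and derivatives
  of such functions can be computed on the side of the transforms.\<close>

definition rf :: "(R3 => real) => (R3 => complex) => bool" where
 "rf a v \<longleftrightarrow> rapid v & (\<forall>x. complex_of_real (a x) = ift v x)"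

lemma rf_rapid: "rf a v ==> rapid v" by (simp add: rf_def)

lemma rf_has_scalar_fourier: "rf a v ==> has_scalar_fourier (%x. complex_of_real (a x)) v"
 unfolding rf_def using has_scalar_fourier_inv[OF rapid_integrable] by presburger

lemma rf_add:
 assumes "rf a v" "rf b w"
 shows "rf (%x. a x + b x) (%xi. v xi + w xi)"
 using assms unfolding rf_def by (auto simp: rapid_add ift_add rapid_integrable)

lemma rapid_cmult: "rapid v ==> rapid (%xi. c * v xi)"
 by (rule rapid_mult_poly[where A = "norm c" and q = 0]) auto

lemma rf_cmult:
 assumes "rf a v"
 shows "rf (%x. c * a x) (%xi. of_real c * v xi)"
 using assms unfolding rf_def by (auto simp: rapid_cmult ift_cmult)

lemma rf_diff:
 assumes "rf a v" "rf b w"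
 shows "rf (%x. a x - b x) (%xi. v xi - w xi)"
 using rf_add[OF assms(1) rf_cmult[OF assms(2), of "-1"]] by simp

lemma rf_zero: "rf (%x. 0) (%xi. 0)" by (simp add: rf_def rapid_def rapid_dom_zero inv_fourier_int_def)

lemma rf_sum: "finite I ==> (!!i. i \<in> I ==> rf (a i) (v i)) ==> rf (%x. \<Sum>i\<in>I. a i x) (%xi. \<Sum>i\<in>I. v i xi)"
 by (induction rule: finite_induct) (auto intro: rf_zero rf_add)

lemma rf_mult:
 assumes "rf a v" "rf b w"
 shows "rf (%x. a x * b x) (fconv v w)"
 using assms unfolding rf_def by (auto simp: rapid_fconv ift_fconv[symmetric] rapid_integrable)

text \<open>Read off from the time dependent statement for a family constant in time.\<close>

lemma rapid_inv_fourier_derivative: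
 assumes "rapid v"
 shows "(ift v has_derivative (%h. ift (%xi. \<i> * of_real (h \<bullet> xi) * v xi) x)) (at x)"
proof -
 have "((%(t::real, x). ift v x) has_derivative
   (%(\<tau>, h). \<tau> *\<^sub>R ift (%xi. 0) x + ift (%xi. \<i> * of_real (h \<bullet> xi) * v xi) x)) (at (1, x))"
  by (rule good0_has_derivative[OF good_imp_good0[OF good_const[OF assms]] good_imp_good0[OF good_zero]]) auto
 from has_derivative_slice(1)[OF this] show ?thesis by simp
qed

lemma rf_partial:
 assumes "rf a v"
 shows "a differentiable (at x)" and "rf (partial j a) (%xi. \<i> * of_real (xi $ j) * v xi)"
proof -
 have r: "rapid v" and eq: "!!x. complex_of_real (a x) = ift v x"
  using assms by (auto simp: rf_def)
 have a: "a = (%x. Re (ift v x))"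
  using eq by (metis Re_complex_of_real)
 have d: "(a has_derivative (%h. Re (ift (%xi. \<i> * of_real (h \<bullet> xi) * v xi) x))) (at x)" for x
  unfolding a by (rule bounded_linear.has_derivative[OF bounded_linear_Re rapid_inv_fourier_derivative[OF r]])
 thus "a differentiable (at x)" unfolding differentiable_def by blast
 have p: "partial j a x = Re (ift (%xi. \<i> * of_real (xi $ j) * v xi) x)" for x
  unfolding partial_def frechet_derivative_at[OF d, symmetric] by (simp add: inner_axis')
 \<comment> \<open>The imaginary part of the inverse transform vanishes identically, hence so does
   its derivative.\<close>
 have im: "Im (ift (%xi. \<i> * of_real (xi $ j) * v xi) x) = 0" for x
 proof -
  have "((%x. Im (ift v x)) has_derivative (%h. Im (ift (%xi. \<i> * of_real (h \<bullet> xi) * v xi) x))) (at x)"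
   by (rule bounded_linear.has_derivative[OF bounded_linear_Im rapid_inv_fourier_derivative[OF r]])
  moreover have "(%x. Im (ift v x)) = (%x. 0)"
   using eq by (metis Im_complex_of_real)
  ultimately have "((%x. 0) has_derivative (%h. Im (ift (%xi. \<i> * of_real (h \<bullet> xi) * v xi) x))) (at x)"
   by (simp only:)
  from fun_cong[OF has_derivative_unique[OF this has_derivative_const], of "axis j 1"] show ?thesis by (simp add: inner_axis')
 qed
 show "rf (partial j a) (%xi. \<i> * of_real (xi $ j) * v xi)"
  unfolding rf_def using rapid_mult_component[OF r] p im by (auto intro!: complex_eqI)
qed

text \<open>Conjugation turns the inversion integral into its reflection, so its value is
  real.\<close>

lemma rf_of_hermitian:
 assumes v: "rapid v" and h: "AE xi in lborel. v (- xi) = cnj (v xi)"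
 shows "rf (%x. Re (ift v x)) v"
proof -
 have "cnj (ift v x) = ift v x" for x
 proof -
  have m: "(%xi. cis (xi \<bullet> x) * v xi) \<in> BM"
   using integrable_cis_mult[OF rapid_integrable[OF v]] by (auto dest: borel_measurable_integrable)
  have m': "(%xi. cis (- xi \<bullet> x) * v (- xi)) \<in> BM"
   using measurable_compose[of uminus borel borel, OF _ m] by simp
  have mc: "(%xi. cnj (cis (xi \<bullet> x) * v xi)) \<in> BM"
   by (rule measurable_compose[OF m borel_measurable_continuous_onI[OF linear_continuous_on[OF bounded_linear_cnj]]])
  have "cnj (lint xi. cis (xi \<bullet> x) * v xi) = (lint xi. cnj (cis (xi \<bullet> x) * v xi))"
   by (simp only: Bochner_Integration.integral_cnj)
  also have "... = (lint xi. cis (- xi \<bullet> x) * v (- xi))"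
   by (rule integral_cong_AE) (use mc m' h in \<open>auto elim!: eventually_mono simp: cis_cnj\<close>)
  also have "... = (lint xi. cis (xi \<bullet> x) * v xi)"
   using integral_reflect_R3[OF m, of 0] by simp
  finally show ?thesis by (simp add: inv_fourier_int_def)
 qed
 hence "Im (ift v x) = 0" for x by (metis Reals_cnj_iff complex_is_Real_iff)
 thus ?thesis unfolding rf_def using v by (auto intro: complex_eqI)
qed

lemma rf_hermitian:
 assumes "rf a v"
 shows "AE xi in lborel. v (- xi) = cnj (v xi)"
proof -
 have "AE xi in lborel. v xi = cnj (v (- xi))"
  by (rule has_scalar_fourier_unique[OF rf_has_scalar_fourier[OF assms]
     has_scalar_fourier_hermitian[OF rf_has_scalar_fourier[OF assms]]])
 thus ?thesis by eventually_elim (metis complex_cnj_cnj)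
qed

subsection \<open>Estimates for the scalar majorant\<close>

text \<open>Joint measurability in time and frequency, needed wherever the two integrations are
  exchanged.\<close>

definition jm :: "(real => R3 => 'b::topological_space) => bool" where
 "jm d \<longleftrightarrow> (%p. d (fst p) (snd p)) \<in> borel_measurable (borel \<Otimes>\<^sub>M borel)"

lemma jm_compose:
 "jm d ==> f \<in> borel_measurable M ==> g \<in> borel_measurable M ==> (%x. d (f x) (g x)) \<in> borel_measurable M"
 using measurable_compose[of "%x. (f x, g x)" M "borel \<Otimes>\<^sub>M borel" "%p. d (fst p) (snd p)" borel]
 by (simp add: jm_def)

lemma jm_at: "jm d ==> d t \<in> BM"
 using jm_compose[of d "%x. t" borel "%x. x"] by simp

lemma jm_econv:
 assumes "jm f" "jm g"
 shows "jm (%t. econv (f t) (g t))"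
proof -
 note [measurable (raw)] = jm_compose[OF assms(1)] jm_compose[OF assms(2)]
 show ?thesis unfolding jm_def econv_def by measurable
qed

lemma jm_fconv:
 assumes "jm f" "jm g"
 shows "jm (%t. fconv (f t) (g t))"
proof -
 note [measurable (raw)] = jm_compose[OF assms(1)] jm_compose[OF assms(2)]
 show ?thesis unfolding jm_def fconv_def by measurable
qed

definition duhamel :: "real => (real => R3 => ennreal) => real => R3 => ennreal" where
 "duhamel k g t xi = (\<integral>\<^sup>+s\<in>{0..t}. ennreal (hk k (t - s) xi) * g s xi \<partial>lborel)"

lemma jm_duhamel:
 assumes "jm g"
 shows "jm (duhamel k g)"
proof -
 note [measurable (raw)] = jm_compose[OF assms(1)]
 show ?thesis
  unfolding jm_def duhamel_def
  unfolding indicator_def atLeastAtMost_iff by measurable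
qed

text \<open>Weighted masses: \<open>chi1\<close> is the norm with weight \<open>1/|xi|\<close>, \<open>diss\<close> the time integral of that with
 weight \<open>|xi|\<close>.\<close>

definition chi1 :: "(R3 => ennreal) => ennreal" where
 "chi1 d = (nint xi. d xi * ennreal (1 / norm xi))"

definition diss :: "(real => R3 => ennreal) => real => ennreal" where
 "diss d t = (\<integral>\<^sup>+s\<in>{0..t}. (nint xi. d s xi * en xi) \<partial>lborel)"

lemma AE_nonzero_R3: "AE xi in lborel. (xi::R3) ~= 0"
proof -
 have "{0::R3} \<in> null_sets lborel" by (rule countable_imp_null_set_lborel) simp
 thus ?thesis using AE_not_in by force
qed

lemma nn_integral_exp_Icc_le:
 assumes "k > 0" "t >= s"
 shows "(\<integral>\<^sup>+r\<in>{s..t}. ennreal (exp (- (k * (r - s)))) \<partial>lborel) <= ennreal (1 / k)"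
proof -
 have "(nint r. ennreal (exp (- (k * (r - s)))) * indicator {s..t} r) =
   ennreal ((- exp (- (k * (t - s))) / k) - (- exp (- (k * (s - s))) / k))"
  by (rule nn_integral_FTC_Icc) (use assms in \<open>auto intro!: derivative_eq_intros simp: field_simps\<close>)
 also have "... <= ennreal (1 / k)"
  by (intro ennreal_leI) (use assms in \<open>auto simp: field_simps\<close>)
 finally show ?thesis .
qed

text \<open>At fixed xi the time integral of k |xi| exp (-k s |xi|^2) is at most 1/|xi|, which turns
  the weight of the dissipation into that of \<open>chi1\<close>.\<close>

lemma diss_heat_le:
 assumes [measurable]: "A \<in> BM" and k: "k > 0" and t: "t >= 0"
 shows "ennreal k * diss (%t xi. ennreal (hk k t xi) * A xi) t <= chi1 A"
proof -
 have "diss (%t xi. ennreal (hk k t xi) * A xi) t =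
   (nint s. \<integral>\<^sup>+xi. ennreal (hk k s xi) * A xi * en xi * ind t s \<partial>lborel)"
  unfolding diss_def by (intro nn_integral_cong) (simp add: nn_integral_multc)
 also have "... = (nint xi. \<integral>\<^sup>+s. ennreal (hk k s xi) * A xi * en xi * ind t s \<partial>lborel)"
  by (rule lborel_pair.Fubini'[symmetric]) measurable
 finally have *: "ennreal k * diss (%t xi. ennreal (hk k t xi) * A xi) t =
   (nint xi. ennreal k * (nint s. ennreal (hk k s xi) * A xi * en xi * ind t s))"
  by (simp add: nn_integral_cmult)
 show ?thesis
  unfolding * chi1_def
 proof (rule nn_integral_mono_AE)
  show "AE xi in lborel. ennreal k * (nint s. ennreal (hk k s xi) * A xi * en xi * ind t s)
    <= A xi * ennreal (1 / norm xi)"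
   using AE_nonzero_R3
  proof eventually_elim
   case (elim xi)
   hence n: "norm xi > 0" by simp
   have "(nint s. ennreal (hk k s xi) * A xi * en xi * ind t s) =
    (nint s. A xi * en xi * (ennreal (exp (- (k * nsq xi * (s - 0)))) * ind t s))"
    by (intro nn_integral_cong) (simp add: mult_ac)
   also have "... = A xi * en xi * (nint s. ennreal (exp (- (k * nsq xi * (s - 0)))) * ind t s)"
    by (rule nn_integral_cmult) measurable
   also have "... <= A xi * en xi * ennreal (1 / (k * nsq xi))"
    by (intro mult_left_mono nn_integral_exp_Icc_le) (use k n t in auto)
   finally have "ennreal k * (nint s. ennreal (hk k s xi) * A xi * en xi * ind t s)
     <= ennreal k * (A xi * en xi * ennreal (1 / (k * nsq xi)))" by (intro mult_left_mono) auto
   also have "... = A xi * (ennreal k * en xi * ennreal (1 / (k * nsq xi)))" by (simp only: mult_ac)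
   also have "ennreal k * en xi * ennreal (1 / (k * nsq xi)) = ennreal (1 / norm xi)"
    using k n by (simp add: ennreal_mult[symmetric] power2_eq_square)
   finally show ?case .
  qed
 qed
qed

lemma duhamel_le_integral: "k >= 0 ==> duhamel k g t xi <= (\<integral>\<^sup>+s\<in>{0..t}. g s xi \<partial>lborel)"
 unfolding duhamel_def
proof (intro nn_integral_mono)
 fix s assume k: "k >= 0"
 show "ennreal (hk k (t - s) xi) * g s xi * ind t s <= g s xi * ind t s"
 proof (cases "s \<in> {0..t}")
  case True
  hence "ennreal (hk k (t - s) xi) <= 1"
   using k by (simp add: ennreal_le_1)
  from mult_right_mono[OF this, of "g s xi"] show ?thesis by (simp add: indicator_def)
 qed simp
qed

text \<open>The kernel is at most 1, which bounds the first term. For the dissipation the two time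
  integrals are exchanged and the kernel is integrated over the later time, as in
  \<open>diss_heat_le\<close>. Each term contributes once, hence the factor 2.\<close>

lemma duhamel_estimate:
 assumes g: "jm g" and k: "k > 0" and t: "t >= 0"
 shows "chi1 (duhamel k g t) + ennreal k * diss (duhamel k g) t <= 2 * (\<integral>\<^sup>+s\<in>{0..t}. chi1 (g s) \<partial>lborel)"
proof -
 note [measurable (raw)] = jm_compose[OF g]
 note [measurable (raw)] = jm_compose[OF jm_duhamel[OF g, of k]]
 have I: "(\<integral>\<^sup>+s\<in>{0..t}. chi1 (g s) \<partial>lborel) = (nint xi. (\<integral>\<^sup>+s\<in>{0..t}. g s xi \<partial>lborel) * ennreal (1 / norm xi))"
 proof -
  have "(\<integral>\<^sup>+s\<in>{0..t}. chi1 (g s) \<partial>lborel) = (nint s. \<integral>\<^sup>+xi. g s xi * ennreal (1 / norm xi) * ind t s \<partial>lborel)"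
   unfolding chi1_def by (intro nn_integral_cong) (simp add: nn_integral_multc)
  also have "... = (nint xi. \<integral>\<^sup>+s. g s xi * ennreal (1 / norm xi) * ind t s \<partial>lborel)"
   by (rule lborel_pair.Fubini'[symmetric]) measurable
  also have "... = (nint xi. (nint s. g s xi * ind t s * ennreal (1 / norm xi)))" by (simp only: mult_ac)
  finally show ?thesis by (simp add: nn_integral_multc)
 qed
 have 1: "chi1 (duhamel k g t) <= (\<integral>\<^sup>+s\<in>{0..t}. chi1 (g s) \<partial>lborel)"
  unfolding I unfolding chi1_def
  by (intro nn_integral_mono mult_right_mono duhamel_le_integral) (use k in auto)
 have 2: "ennreal k * diss (duhamel k g) t <= (\<integral>\<^sup>+s\<in>{0..t}. chi1 (g s) \<partial>lborel)"
 proof -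
  have e1: "diss (duhamel k g) t = (nint s. \<integral>\<^sup>+xi. duhamel k g s xi * en xi * ind t s \<partial>lborel)"
   unfolding diss_def by (intro nn_integral_cong) (simp add: nn_integral_multc)
  also have "... = (nint xi. \<integral>\<^sup>+s. duhamel k g s xi * en xi * ind t s \<partial>lborel)"
   by (rule lborel_pair.Fubini'[symmetric]) measurable
  finally have *: "ennreal k * diss (duhamel k g) t =
    (nint xi. ennreal k * (nint s. duhamel k g s xi * en xi * ind t s))" by (simp add: nn_integral_cmult)
  show ?thesis
   unfolding * I
  proof (rule nn_integral_mono_AE)
   show "AE xi in lborel. ennreal k * (nint s. duhamel k g s xi * en xi * ind t s)
    <= (\<integral>\<^sup>+s\<in>{0..t}. g s xi \<partial>lborel) * ennreal (1 / norm xi)"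
    using AE_nonzero_R3
   proof eventually_elim
    case (elim xi)
    hence n: "norm xi > 0" by simp
    have "(nint s. duhamel k g s xi * en xi * ind t s) =
      (nint s. \<integral>\<^sup>+r. ennreal (hk k (s - r) xi) * g r xi * ind s r * en xi * ind t s \<partial>lborel)"
     unfolding duhamel_def by (intro nn_integral_cong) (simp add: nn_integral_multc indicator_def)
    also have "... = (nint r. \<integral>\<^sup>+s. ennreal (hk k (s - r) xi) * g r xi * ind s r * en xi * ind t s \<partial>lborel)"
     unfolding indicator_def atLeastAtMost_iff by (rule lborel_pair.Fubini') measurable
    also have "... = (nint r. (g r xi * ind t r * en xi) * (\<integral>\<^sup>+s\<in>{r..t}. ennreal (exp (- (k * nsq xi * (s - r)))) \<partial>lborel))"
    proof (intro nn_integral_cong)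
     fix r
     have "(nint s. ennreal (hk k (s - r) xi) * g r xi * ind s r * en xi * ind t s) =
       (nint s. (g r xi * ind t r * en xi) * (ennreal (exp (- (k * nsq xi * (s - r)))) * indicator {r..t} s))"
      by (intro nn_integral_cong) (auto simp: indicator_def mult_ac)
     thus "(nint s. ennreal (hk k (s - r) xi) * g r xi * ind s r * en xi * ind t s) =
       (g r xi * ind t r * en xi) * (\<integral>\<^sup>+s\<in>{r..t}. ennreal (exp (- (k * nsq xi * (s - r)))) \<partial>lborel)"
      by (simp add: nn_integral_cmult)
    qed
    also have "... <= (nint r. (g r xi * ind t r * en xi) * ennreal (1 / (k * nsq xi)))"
    proof (intro nn_integral_mono)
     fix r
     show "(g r xi * ind t r * en xi) * (\<integral>\<^sup>+s\<in>{r..t}. ennreal (exp (- (k * nsq xi * (s - r)))) \<partial>lborel)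
      <= (g r xi * ind t r * en xi) * ennreal (1 / (k * nsq xi))"
     proof (cases "r \<in> {0..t}")
      case True
      thus ?thesis using k n by (intro mult_left_mono nn_integral_exp_Icc_le) auto
     qed simp
    qed
    also have "... = (nint r. g r xi * ind t r * (en xi * ennreal (1 / (k * nsq xi))))"
     by (simp only: mult_ac)
    also have "... = (\<integral>\<^sup>+r\<in>{0..t}. g r xi \<partial>lborel) * (en xi * ennreal (1 / (k * nsq xi)))"
     by (rule nn_integral_multc) measurable
    finally have "ennreal k * (nint s. duhamel k g s xi * en xi * ind t s) \<le>
      ennreal k * ((\<integral>\<^sup>+r\<in>{0..t}. g r xi \<partial>lborel) * (en xi * ennreal (1 / (k * nsq xi))))"
     by (intro mult_left_mono) auto
    also have "... = (\<integral>\<^sup>+r\<in>{0..t}. g r xi \<partial>lborel) * (ennreal k * en xi * ennreal (1 / (k * nsq xi)))"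
     by (simp only: mult_ac)
    also have "ennreal k * en xi * ennreal (1 / (k * nsq xi)) = ennreal (1 / norm xi)"
     using k n by (simp add: ennreal_mult[symmetric] power2_eq_square)
    finally show ?case .
   qed
  qed
 qed
 show ?thesis using add_mono[OF 1 2] by (simp add: mult_2)
qed

text \<open>Since 1 <= |eta|/|xi| + |xi|/|eta|, an unweighted product of masses is controlled with
  the weight 1/|xi| on one factor and |xi| on the other.\<close>

lemma mass_product_le:
 assumes [measurable]: "d \<in> BM" "w \<in> BM"
 shows "(nint xi. w xi) * (nint xi. d xi) \<le>
   chi1 w * (nint xi. d xi * en xi) + chi1 d * (nint xi. w xi * en xi)"
proof -
 have "(nint xi. w xi) * (nint xi. d xi) = (nint xi. \<integral>\<^sup>+eta. w xi * d eta \<partial>lborel)"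
  by (simp add: nn_integral_cmult nn_integral_multc)
 also have "... <= (nint xi. \<integral>\<^sup>+eta. w xi * ennreal (1 / norm xi) * (d eta * en eta) +
    (w xi * en xi) * (d eta * ennreal (1 / norm eta)) \<partial>lborel)"
 proof (rule nn_integral_mono_AE)
  show "AE xi in lborel. (nint eta. w xi * d eta) <= (nint eta. w xi * ennreal (1 / norm xi) * (d eta * en eta) +
    (w xi * en xi) * (d eta * ennreal (1 / norm eta)))"
   using AE_nonzero_R3
  proof eventually_elim
   case (elim xi)
   show ?case
   proof (rule nn_integral_mono_AE)
    show "AE eta in lborel. w xi * d eta <= w xi * ennreal (1 / norm xi) * (d eta * en eta) +
      (w xi * en xi) * (d eta * ennreal (1 / norm eta))"
     using AE_nonzero_R3
    proof eventually_elim
     case eta: (elim eta)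
     have n: "norm xi > 0" "norm eta > 0" using elim eta by auto
     have "1 <= norm eta / norm xi + norm xi / norm eta"
     proof (cases "norm eta >= norm xi")
      case True
      hence "1 <= norm eta / norm xi" using n by simp
      moreover have "0 <= norm xi / norm eta" by simp
      ultimately show ?thesis by linarith
     next
      case False
      hence "1 <= norm xi / norm eta" using n by simp
      moreover have "0 <= norm eta / norm xi" by simp
      ultimately show ?thesis by linarith
     qed
     hence "ennreal 1 <= ennreal (norm eta / norm xi + norm xi / norm eta)" by (rule ennreal_leI)
     also have "... = ennreal (1 / norm xi) * en eta + en xi * ennreal (1 / norm eta)"
      by (simp add: ennreal_mult[symmetric])
     finally have "1 <= ennreal (1 / norm xi) * en eta + en xi * ennreal (1 / norm eta)" by simp
     from mult_left_mono[OF this, of "w xi * d eta"]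
     show ?case by (simp add: distrib_left mult_ac)
    qed
   qed
  qed
 qed
 also have "... = chi1 w * (nint xi. d xi * en xi) + chi1 d * (nint xi. w xi * en xi)"
  unfolding chi1_def by (simp add: nn_integral_add nn_integral_cmult nn_integral_multc mult.commute)
 finally show ?thesis .
qed

text \<open>Young's inequality p <= \<alpha> p^2 / |xi| + |xi| / (4 \<alpha>). With \<open>p\<close>
  the mass of the background, the first part is absorbed by the exponential growth allowed in time
  and the second by the dissipation.\<close>

lemma mass_le_interpolation:
 assumes [measurable]: "d \<in> BM" and a: "\<alpha> > 0" and p: "p >= 0"
 shows "ennreal p * (nint xi. d xi) \<le>
  ennreal (\<alpha> * p\<^sup>2) * chi1 d + ennreal (1 / (4 * \<alpha>)) * (nint xi. d xi * en xi)"
proof -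
 have "ennreal p * (nint xi. d xi) = (nint xi. ennreal p * d xi)" by (simp add: nn_integral_cmult)
 also have "... <= (nint xi. ennreal (\<alpha> * p\<^sup>2) * (d xi * ennreal (1 / norm xi)) + ennreal (1 / (4 * \<alpha>)) * (d xi * en xi))"
 proof (rule nn_integral_mono_AE)
  show "AE xi in lborel. ennreal p * d xi <= ennreal (\<alpha> * p\<^sup>2) * (d xi * ennreal (1 / norm xi)) + ennreal (1 / (4 * \<alpha>)) * (d xi * en xi)"
   using AE_nonzero_R3
  proof eventually_elim
   case (elim xi)
   hence n: "norm xi > 0" by simp
   have "0 <= (2 * \<alpha> * p - norm xi)\<^sup>2" by simp
   hence "4 * \<alpha> * norm xi * p <= 4 * \<alpha>\<^sup>2 * p\<^sup>2 + nsq xi"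
    by (simp add: power2_diff power_mult_distrib algebra_simps)
   hence "p <= (4 * \<alpha>\<^sup>2 * p\<^sup>2 + nsq xi) / (4 * \<alpha> * norm xi)"
    using a n by (subst pos_le_divide_eq) (auto simp: mult_ac)
   also have "... = \<alpha> * p\<^sup>2 * (1 / norm xi) + 1 / (4 * \<alpha>) * norm xi"
    using a n by (simp add: field_simps power2_eq_square)
   finally have "ennreal p <= ennreal (\<alpha> * p\<^sup>2) * ennreal (1 / norm xi) + ennreal (1 / (4 * \<alpha>)) * en xi"
    using a n by (simp add: ennreal_mult[symmetric] ennreal_plus[symmetric] ennreal_leI del: ennreal_plus)
   from mult_right_mono[OF this, of "d xi"] show ?case by (simp add: distrib_left distrib_right mult_ac)
  qed
 qed
 also have "... = ennreal (\<alpha> * p\<^sup>2) * chi1 d + ennreal (1 / (4 * \<alpha>)) * (nint xi. d xi * en xi)"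
  unfolding chi1_def by (simp add: nn_integral_add nn_integral_cmult)
 finally show ?thesis .
qed

text \<open>The integrand is the derivative of \<open>exp (lam * integral {0..s} q) / lam\<close>.
  The gain of 1/lam makes the part linear in the large background contract.\<close>

lemma exp_primitive_nn_integral_le:
 fixes q :: "real => real"
 assumes q: "continuous_on {0..t} q" "!!s. q s >= 0" and lam: "lam > 0" and t: "t >= 0"
 shows "(\<integral>\<^sup>+s\<in>{0..t}. ennreal (q s * exp (lam * integral {0..s} q)) \<partial>lborel) <= ennreal (exp (lam * integral {0..t} q) / lam)"
proof -
 define F where "F s = exp (lam * integral {0..s} q) / lam" for s
 have "((%s. q s * exp (lam * integral {0..s} q)) has_integral F t - F 0) {0..t}"
 proof (rule fundamental_theorem_of_calculus[OF t])
  fix s assume s: "s \<in> {0..t}"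
  have "((%s. integral {0..s} q) has_real_derivative q s) (at s within {0..t})"
   by (rule integral_has_real_derivative[OF q(1) s])
  hence "(F has_real_derivative q s * exp (lam * integral {0..s} q)) (at s within {0..t})"
   unfolding F_def[abs_def] using lam by (auto intro!: derivative_eq_intros simp: field_simps)
  thus "(F has_vector_derivative q s * exp (lam * integral {0..s} q)) (at s within {0..t})"
   by (simp add: has_real_derivative_iff_has_vector_derivative)
 qed
 from nn_integral_has_integral_lebesgue[OF _ this] q(2)
 have "(nint s. ennreal (ind t s * (q s * exp (lam * integral {0..s} q)))) = ennreal (F t - F 0)" by auto
 also have "(%s. ennreal (ind t s * (q s * exp (lam * integral {0..s} q)))) =
   (%s. ennreal (q s * exp (lam * integral {0..s} q)) * ind t s)" by (auto simp: indicator_def fun_eq_iff)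
 finally show ?thesis
  using lam by (auto simp: F_def intro!: ennreal_leI)
qed

lemma ennreal_mult_le_imp_le_divide:
 assumes "k > 0" "ennreal k * x <= ennreal y"
 shows "x <= ennreal (y / k)"
proof -
 have "x = ennreal (1 / k) * (ennreal k * x)"
  using assms(1) by (simp add: mult.assoc[symmetric] ennreal_mult[symmetric])
 also have "... <= ennreal (1 / k) * ennreal y" by (intro mult_left_mono assms) auto
 also have "... = ennreal (y / k)"
  using assms(1) by (subst ennreal_mult'[symmetric]) auto
 finally show ?thesis .
qed

section \<open>The exponential weight and the heat kernel\<close>

definition heat_const :: "real => real" where
 "heat_const ka = exp (1 / (2 * ka))"

text \<open>The exponential weight that makes the solution analytic for \<open>t > 0\<close>.\<close>

definition wt :: "real => R3 => real" where
 "wt t xi = exp (sqrt t * norm xi / 2)"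

text \<open>One half of the viscosity is kept; the other half has paid for the square of the weight,
  see \<open>wt_heat\<close>.\<close>

definition heat_maj :: "real => (R3 => real) => real => R3 => ennreal" where
 "heat_maj ka p t xi = ennreal (heat_const ka * hk (ka / 2) t xi * p xi)"

text \<open>The lower bound 1 lets unweighted quantities be estimated by weighted ones.\<close>

lemma wt_ge_1: "t >= 0 ==> wt t xi >= 1" by (simp add: wt_def)

lemma wt_submult: "t >= 0 ==> wt t xi <= wt t (xi - eta) * wt t eta"
proof -
 assume "t >= 0"
 moreover have "norm xi <= norm (xi - eta) + norm eta" using norm_triangle_ineq[of "xi - eta" eta] by simp
 ultimately have "sqrt t * norm xi <= sqrt t * (norm (xi - eta) + norm eta)" by (intro mult_left_mono) auto
 thus ?thesis
  unfolding wt_def exp_add[symmetric] exp_le_cancel_iff by (simp add: ring_distribs)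
qed

text \<open>Completing the square; the remainder 1/(2 ka) is the exponent in
  \<open>heat_const\<close>.\<close>

lemma sqrt_mult_le:
 assumes "ka > 0" "u >= 0"
 shows "sqrt u * r <= ka / 2 * u * r\<^sup>2 + 1 / (2 * ka)"
proof -
 have "0 <= (ka * (sqrt u * r) - 1)\<^sup>2" by simp
 hence "2 * ka * (sqrt u * r) <= ka\<^sup>2 * (u * r\<^sup>2) + 1"
  using assms by (simp add: power2_diff power_mult_distrib algebra_simps)
 hence "(2 * ka * (sqrt u * r)) / (2 * ka) <= (ka\<^sup>2 * (u * r\<^sup>2) + 1) / (2 * ka)"
  using assms by (intro divide_right_mono) auto
 thus ?thesis using assms by (simp add: field_simps power2_eq_square)
qed

text \<open>One power of the weight is used by the norm; the second is a reserve, spent on the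
  forcing in \<open>wt_b_integral\<close>.\<close>

lemma wt_heat:
 assumes "ka > 0" "t >= 0" "k >= ka"
 shows "(wt t xi)\<^sup>2 * hk k t xi <= heat_const ka * hk (ka / 2) t xi"
proof -
 have "sqrt t * norm xi <= ka / 2 * t * nsq xi + 1 / (2 * ka)" by (rule sqrt_mult_le) fact+
 moreover have "ka * (t * nsq xi) <= k * (t * nsq xi)" using assms by (intro mult_right_mono) auto
 ultimately have "sqrt t * norm xi + - (k * t * nsq xi) <= 1 / (2 * ka) + - (ka / 2 * t * nsq xi)"
  by (simp add: mult.assoc)
 thus ?thesis
  unfolding wt_def heat_const_def exp_add[symmetric] exp_double[symmetric] by (simp add: exp_add[symmetric])
qed

text \<open>Split the weight by sqrt t <= sqrt (t - s) + sqrt s: the part at \<open>s\<close> stays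
  with the integrand and the rest is paid by half of the heat kernel.\<close>

lemma wt_duhamel:
 assumes ka: "ka > 0" and st: "0 <= s" "s <= t" and k: "k >= ka"
 shows "wt t xi * hk k (t - s) xi <= heat_const ka * hk (ka / 2) (t - s) xi * wt s xi"
proof -
 have "sqrt t <= sqrt (t - s) + sqrt s" using sqrt_add_le_add_sqrt[of "t - s" s] st by simp
 hence "sqrt t * norm xi <= (sqrt (t - s) + sqrt s) * norm xi" by (intro mult_right_mono) auto
 hence 1: "sqrt t * norm xi / 2 <= sqrt (t - s) * norm xi / 2 + sqrt s * norm xi / 2"
  by (simp add: distrib_right)
 have 2: "sqrt (t - s) * norm xi <= ka / 2 * (t - s) * nsq xi + 1 / (2 * ka)"
  by (rule sqrt_mult_le) (use assms in auto)
 have 3: "0 <= sqrt (t - s) * norm xi" using st by simp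
 have "ka * ((t - s) * nsq xi) <= k * ((t - s) * nsq xi)" using assms by (intro mult_right_mono) auto
 hence "sqrt t * norm xi / 2 + - (k * (t - s) * nsq xi) \<le>
   1 / (2 * ka) + - (ka / 2 * (t - s) * nsq xi) + sqrt s * norm xi / 2"
  using 1 2 3 by (simp add: mult.assoc)
 thus ?thesis
  unfolding wt_def heat_const_def exp_add[symmetric] by simp
qed

lemma jm_heat_maj:
 assumes [measurable]: "p \<in> BM"
 shows "jm (heat_maj ka p)"
 unfolding jm_def heat_maj_def by measurable

text \<open>\<open>small_const\<close> is the smallness required of the data.\<close>

definition alpha_const :: "real => real => real" where
 "alpha_const ka c = 6 * c * heat_const ka / (ka / 2)"
text \<open>\<open>alpha_const\<close>, \<open>lambda_const\<close> and \<open>radius_const\<close>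
  are tuned so that each of the three terms added in \<open>const_half\<close> equals 1/6.\<close>

definition lambda_const :: "real => real => real" where
 "lambda_const ka c = 24 * c * heat_const ka * alpha_const ka c"
text \<open>Bounds the time integral of the squared background mass uniformly in time; see
  \<open>ps2_integral\<close>.\<close>

definition Psi_const :: "real => real => real" where
 "Psi_const ka P = (heat_const ka)\<^sup>2 * P\<^sup>2 / (ka / 2)"
definition growth_const :: "real => real => real => real" where
 "growth_const ka c P = exp (lambda_const ka c * Psi_const ka P)"
definition radius_const :: "real => real => real => real" where
 "radius_const ka c P = ka / 2 / (48 * c * heat_const ka * growth_const ka c P)"
text \<open>The level at which the weight is split, large enough that the part of the forcing that
  is not small takes up at most a quarter of the radius.\<close>

definition split_const :: "real => real => real => real => real" where
 "split_const ka c P n = max 1 (8 * heat_const ka * n * c * Psi_const ka P / radius_const ka c P)"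
text \<open>Chosen so that the initial data and the small part of the forcing together take up at
  most another quarter of the radius.\<close>

definition small_const :: "real => real => real => real => real" where
 "small_const ka c P n = radius_const ka c P / (8 * heat_const ka * (1 + split_const ka c P n))"

text \<open>\<open>p\<close> stands for the large data, \<open>A\<close> for the small ones,
  \<open>b\<close> for the quadratic term evaluated at the background and \<open>n\<close> for the
  number of components. Smallness of \<open>b\<close> is assumed without weight, whereas
  \<open>b_le\<close> allows the squared weight but gives no smallness; neither alone would control
  the weighted forcing.\<close>

locale majorant =
 fixes ka c P \<delta> n :: real and p A :: "R3 => real" and b :: "real => R3 => real"
 assumes ka: "ka > 0" and c: "c > 0" and P: "P >= 0" and n: "n >= 0" and \<delta>: "\<delta> >= 0"
  and pm[measurable]: "p \<in> BM" and p0: "!!xi. p xi >= 0"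
  and Am[measurable]: "A \<in> BM" and A0: "!!xi. A xi >= 0"
  and bm: "jm b" and b0: "!!t xi. b t xi >= 0"
  and p_mass: "(nint xi. ennreal (p xi)) <= ennreal P"
  and p_low: "(nint xi. ennreal (p xi / nsq xi)) <= ennreal P"
  and A_small: "chi1 (%xi. ennreal (A xi)) <= ennreal \<delta>"
  and b_small: "!!t. t >= 0 ==> (\<integral>\<^sup>+s\<in>{0..t}. chi1 (%xi. ennreal (b s xi)) \<partial>lborel) <= ennreal \<delta>"
  and b_le: "!!s xi. s >= 0 ==> ennreal ((wt s xi)\<^sup>2 * b s xi) <= ennreal (n * c * norm xi) * econv (heat_maj ka p s) (heat_maj ka p s) xi"
  and small: "\<delta> <= small_const ka c P n"
begin

abbreviation "K \<equiv> heat_const ka"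
abbreviation "k' \<equiv> ka / 2"
abbreviation "Q \<equiv> heat_maj ka p"
abbreviation "\<alpha> \<equiv> alpha_const ka c"
abbreviation "lam \<equiv> lambda_const ka c"
abbreviation "Eg \<equiv> growth_const ka c P"
abbreviation "R \<equiv> radius_const ka c P"

text \<open>By \<open>Q_mass\<close> this is the mass of \<open>Q\<close> at nonnegative times. The
  real integral makes continuity, and thus the fundamental theorem of calculus for the square,
  available.\<close>

definition ps :: "real => real" where
 "ps t = K * (lint xi. hk k' t xi * p xi)"

definition \<Psi> :: "real => real" where
 "\<Psi> t = integral {0..t} (%s. (ps s)\<^sup>2)"

lemma K1: "K >= 1"
 using ka by (simp add: heat_const_def)

lemma const_pos: "K > 0" "\<alpha> > 0" "lam > 0" "Eg > 0" "R > 0" "k' > 0" "Psi_const ka P >= 0"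
proof -
 show K: "K > 0" using K1 by simp
 show a: "\<alpha> > 0" using K c ka by (simp add: alpha_const_def)
 show "lam > 0" using K c a by (simp add: lambda_const_def)
 show E: "Eg > 0" by (simp add: growth_const_def)
 show "R > 0" using K c ka E by (simp add: radius_const_def)
 show "k' > 0" using ka by simp
 show "Psi_const ka P >= 0" using ka by (simp add: Psi_const_def)
qed

lemma p_integrable: "integrable lborel p"
 using p_mass p0 by (intro integrableI_bounded) (auto intro: le_less_trans)

lemma p_heat_integrable: "t >= 0 ==> integrable lborel (%xi. hk k' t xi * p xi)"
 by (rule Bochner_Integration.integrable_bound[OF p_integrable])
   (use ka p0 in \<open>auto simp: abs_mult intro!: mult_left_le_one_le\<close>)

lemma Q_mass: "t >= 0 ==> (nint xi. Q t xi) = ennreal (ps t)"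
proof -
 assume t: "t >= 0"
 have "(nint xi. Q t xi) = (nint xi. ennreal (K * (hk k' t xi * p xi)))"
  by (simp add: heat_maj_def mult.assoc)
 also have "... = ennreal (lint xi. K * (hk k' t xi * p xi))"
  by (rule nn_integral_eq_integral) (use p_heat_integrable[OF t] p0 const_pos in \<open>auto intro!: AE_I2\<close>)
 finally show ?thesis by (simp add: ps_def)
qed

lemma ps_nonneg: "ps t >= 0"
 unfolding ps_def using const_pos(1) p0 by (intro mult_nonneg_nonneg Bochner_Integration.integral_nonneg) auto

lemma ps_cont: "continuous_on {0..} ps"
 unfolding continuous_on_def
proof
 fix t :: real assume t: "t \<in> {0..}"
 have "((%s. \<integral>xi. hk k' s xi * p xi \<partial>lborel) \<longlongrightarrow> (lint xi. hk k' t xi * p xi)) (at t within {0..})"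
 proof (rule tendsto_integral_dominated[where U = UNIV and B = p])
  show "AE xi in lborel. ((%s. hk k' s xi * p xi) \<longlongrightarrow> hk k' t xi * p xi) (at t within {0..})"
   by (intro AE_I2 tendsto_intros)
  show "AE xi in lborel. \<forall>s\<in>UNIV \<inter> {0..}. norm (hk k' s xi * p xi) <= p xi"
   using ka p0 by (auto simp: abs_mult intro!: mult_left_le_one_le)
 qed (use p_integrable in auto)
 thus "(ps \<longlongrightarrow> ps t) (at t within {0..})"
  unfolding ps_def[abs_def] by (intro tendsto_intros)
qed

lemma ps2_cont: "continuous_on {0..t} (%s. (ps s)\<^sup>2)"
 by (intro continuous_intros continuous_on_subset[OF ps_cont]) auto

lemma ps_le: "t >= 0 ==> ps t <= K * P"
proof -
 assume t: "t >= 0"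
 have "ennreal (ps t) = (nint xi. Q t xi)" using Q_mass[OF t] by simp
 also have "... <= (nint xi. ennreal K * ennreal (p xi))"
  unfolding heat_maj_def ennreal_mult'[OF less_imp_le[OF const_pos(1)], symmetric]
  by (intro nn_integral_mono ennreal_leI mult_right_mono p0) (use ka t const_pos in \<open>auto intro!: mult_left_le\<close>)
 also have "... = ennreal K * (nint xi. ennreal (p xi))" by (simp add: nn_integral_cmult)
 also have "... <= ennreal K * ennreal P" by (intro mult_left_mono p_mass) auto
 finally show ?thesis using const_pos P by (simp add: ennreal_mult[symmetric] ennreal_le_iff)
qed

text \<open>Integrating the heat kernel over time costs 1/|xi|^2, which is the low-frequency weight
  in the hypothesis on the background data.\<close>

lemma ps_integral: "t >= 0 ==> (\<integral>\<^sup>+s\<in>{0..t}. ennreal (ps s) \<partial>lborel) <= ennreal (K * P / k')"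
proof -
 assume t: "t >= 0"
 note [measurable (raw)] = jm_compose[OF jm_heat_maj[OF pm, of ka]]
 have "(\<integral>\<^sup>+s\<in>{0..t}. ennreal (ps s) \<partial>lborel) = (nint s. \<integral>\<^sup>+xi. Q s xi * ind t s \<partial>lborel)"
  by (intro nn_integral_cong) (auto simp: Q_mass indicator_def)
 also have "... = (nint xi. \<integral>\<^sup>+s. Q s xi * ind t s \<partial>lborel)"
  by (rule lborel_pair.Fubini'[symmetric]) measurable
 also have "... <= (nint xi. ennreal (K / k') * ennreal (p xi / nsq xi))"
 proof (rule nn_integral_mono_AE)
  show "AE xi in lborel. (nint s. Q s xi * ind t s) <= ennreal (K / k') * ennreal (p xi / nsq xi)"
   using AE_nonzero_R3
  proof eventually_elim
   case (elim xi)
   hence nz: "k' * nsq xi > 0" using ka by simp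
   have "(nint s. Q s xi * ind t s) =
     (nint s. ennreal (K * p xi) * (ennreal (exp (- (k' * nsq xi * (s - 0)))) * ind t s))"
   proof (intro nn_integral_cong)
    fix s
    have "K * hk k' s xi * p xi = K * p xi * exp (- (k' * nsq xi * (s - 0)))" by (simp add: mult_ac)
    moreover have "0 <= K * p xi" using const_pos(1) p0[of xi] by simp
    ultimately show "Q s xi * ind t s =
      ennreal (K * p xi) * (ennreal (exp (- (k' * nsq xi * (s - 0)))) * ind t s)"
     by (simp only: heat_maj_def ennreal_mult' mult.assoc[of "ennreal _"])
   qed
   also have "... = ennreal (K * p xi) * (nint s. ennreal (exp (- (k' * nsq xi * (s - 0)))) * ind t s)"
    by (rule nn_integral_cmult) measurable
   also have "... <= ennreal (K * p xi) * ennreal (1 / (k' * nsq xi))"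
    by (intro mult_left_mono nn_integral_exp_Icc_le nz t) auto
   also have "... = ennreal (K / k') * ennreal (p xi / nsq xi)"
    using const_pos p0[of xi] ka by (simp add: ennreal_mult[symmetric])
   finally show ?case .
  qed
 qed
 also have "... = ennreal (K / k') * (nint xi. ennreal (p xi / nsq xi))"
  by (rule nn_integral_cmult) measurable
 also have "... <= ennreal (K / k') * ennreal P" by (intro mult_left_mono p_low) auto
 also have "... = ennreal (K * P / k')" using const_pos P ka by (simp add: ennreal_mult[symmetric])
 finally show ?thesis .
qed

text \<open>For negative times the integral defining \<open>ps\<close> may diverge and differ from
  the mass of \<open>Q\<close>, so the argument gives measurability only after truncation.\<close>

lemma ps_measurable_Icc: "(%s. ennreal (ps s) * ind t s) \<in> BM"
proof -
 note [measurable (raw)] = jm_compose[OF jm_heat_maj[OF pm, of ka]]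
 have "(%s. (nint xi. Q s xi) * ind t s) \<in> BM" by measurable
 also have "(%s. (nint xi. Q s xi) * ind t s) = (%s. ennreal (ps s) * ind t s)"
  by (auto simp: Q_mass indicator_def fun_eq_iff)
 finally show ?thesis .
qed

text \<open>One factor is bounded by the total mass and the other integrated in time; both weights
  on the background data enter here.\<close>

lemma ps2_integral: "t >= 0 ==> (\<integral>\<^sup>+s\<in>{0..t}. ennreal ((ps s)\<^sup>2) \<partial>lborel) <= ennreal (Psi_const ka P)"
proof -
 assume t: "t >= 0"
 have "(\<integral>\<^sup>+s\<in>{0..t}. ennreal ((ps s)\<^sup>2) \<partial>lborel) <= (nint s. ennreal (K * P) * (ennreal (ps s) * ind t s))"
 proof (intro nn_integral_mono)
  fix s
  show "ennreal ((ps s)\<^sup>2) * ind t s <= ennreal (K * P) * (ennreal (ps s) * ind t s)"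
  proof (cases "s \<in> {0..t}")
   case True
   hence "(ps s)\<^sup>2 <= K * P * ps s"
    unfolding power2_eq_square by (intro mult_right_mono ps_le ps_nonneg) auto
   thus ?thesis using True ps_nonneg const_pos P by (simp add: ennreal_mult[symmetric] ennreal_leI)
  qed simp
 qed
 also have "... = ennreal (K * P) * (\<integral>\<^sup>+s\<in>{0..t}. ennreal (ps s) \<partial>lborel)"
  by (rule nn_integral_cmult) (use ps_measurable_Icc in simp)
 also have "... <= ennreal (K * P) * ennreal (K * P / k')" by (intro mult_left_mono ps_integral t) auto
 also have "... = ennreal (Psi_const ka P)"
  using const_pos P ka by (simp add: ennreal_mult[symmetric] Psi_const_def power2_eq_square mult_ac)
 finally show ?thesis .
qed

lemma \<Psi>_nn: "t >= 0 ==> (\<integral>\<^sup>+s\<in>{0..t}. ennreal ((ps s)\<^sup>2) \<partial>lborel) = ennreal (\<Psi> t)"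
proof -
 assume t: "t >= 0"
 have "((%s. (ps s)\<^sup>2) has_integral \<Psi> t) {0..t}"
  unfolding \<Psi>_def by (intro integrable_integral integrable_continuous_real ps2_cont)
 from nn_integral_has_integral_lebesgue[OF _ this]
 have "(nint s. ennreal (ind t s * (ps s)\<^sup>2)) = ennreal (\<Psi> t)" by simp
 also have "(%s. ennreal (ind t s * (ps s)\<^sup>2)) = (%s. ennreal ((ps s)\<^sup>2) * ind t s)"
  by (auto simp: indicator_def fun_eq_iff)
 finally show ?thesis .
qed

lemma \<Psi>_mono: "s <= t ==> 0 <= s ==> \<Psi> s <= \<Psi> t"
 unfolding \<Psi>_def by (intro integral_subset_le integrable_continuous_real ps2_cont) auto

lemma \<Psi>_nonneg: "\<Psi> t >= 0"
 unfolding \<Psi>_def by (intro integral_nonneg integrable_continuous_real ps2_cont) auto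

lemma exp_\<Psi>_le: "t >= 0 ==> exp (lam * \<Psi> t) <= Eg"
 using ps2_integral[of t] const_pos unfolding \<Psi>_nn growth_const_def
 by (simp add: ennreal_le_iff \<Psi>_nn)

text \<open>A Bielecki norm adapted to the background: the radius may grow like
  \<open>exp (lam * \<Psi> t)\<close>, which by \<open>exp_\<Psi>_le\<close> stays bounded for all
  times.\<close>

definition Bnd :: "(real => R3 => ennreal) => real => bool" where
 "Bnd d r \<longleftrightarrow> (\<forall>t\<ge>0. chi1 (d t) + ennreal k' * diss d t <= ennreal (r * exp (lam * \<Psi> t)))"

lemma Bnd_chi1: "Bnd d r ==> t >= 0 ==> chi1 (d t) <= ennreal (r * exp (lam * \<Psi> t))"
 unfolding Bnd_def by (meson add_increasing2 order_refl order_trans zero_le le_iff_add)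

lemma Bnd_diss: "Bnd d r ==> t >= 0 ==> diss d t <= ennreal (r * exp (lam * \<Psi> t) / k')"
proof (rule ennreal_mult_le_imp_le_divide[OF const_pos(6)])
 assume "Bnd d r" "t >= 0"
 hence "chi1 (d t) + ennreal k' * diss d t <= ennreal (r * exp (lam * \<Psi> t))" by (simp add: Bnd_def)
 thus "ennreal k' * diss d t <= ennreal (r * exp (lam * \<Psi> t))"
  by (rule order_trans[rotated]) (simp add: add_increasing)
qed

text \<open>The background part is interpolated by \<open>mass_le_interpolation\<close>: its first
  half integrates to a multiple of 1/lam, its second half is dissipation. The part with
  \<open>W\<close> is a product of two quantities measured in the norm and carries the radius
  \<open>\<rho>\<close>.\<close>

lemma mass_estimate:
 assumes d: "jm d" "Bnd d r" and W: "jm W" "Bnd W \<rho>" and r: "r >= 0" "\<rho> >= 0" and t: "t >= 0"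
 shows "(\<integral>\<^sup>+s\<in>{0..t}. (ennreal (ps s) + (nint xi. W s xi)) * (nint xi. d s xi) \<partial>lborel)
  <= ennreal (r * exp (lam * \<Psi> t) * (\<alpha> / lam + 1 / (4 * \<alpha> * k') + 2 * \<rho> * Eg / k'))"
proof -
 note [measurable (raw)] = jm_compose[OF d(1)] jm_compose[OF W(1)]
 define zd where "zd s = (nint xi. d s xi * en xi)" for s
 define zW where "zW s = (nint xi. W s xi * en xi)" for s
 have [measurable]: "zd \<in> BM" "zW \<in> BM"
  unfolding zd_def[abs_def] zW_def[abs_def] by measurable
 define ex where "ex s = exp (lam * \<Psi> s)" for s
 have ex: "ex s > 0" for s by (simp add: ex_def)
 have exm: "(%s. ennreal ((ps s)\<^sup>2 * ex s) * ind t s) \<in> BM"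
 proof -
  have "continuous_on {0..t} (%s. (ps s)\<^sup>2 * ex s)"
   unfolding ex_def \<Psi>_def
   by (intro continuous_intros ps2_cont indefinite_integral_continuous_1 integrable_continuous_real)
  hence "set_borel_measurable borel {0..t} (%s. (ps s)\<^sup>2 * ex s)"
   by (intro borel_measurable_continuous_on_indicator[unfolded set_borel_measurable_def[symmetric]]) auto
  hence "(%s. ennreal (ind t s *\<^sub>R ((ps s)\<^sup>2 * ex s))) \<in> BM"
   unfolding set_borel_measurable_def by measurable
  also have "(%s. ennreal (ind t s *\<^sub>R ((ps s)\<^sup>2 * ex s))) = (%s. ennreal ((ps s)\<^sup>2 * ex s) * ind t s)"
   by (auto simp: indicator_def fun_eq_iff)
  finally show ?thesis .
 qed
 have "(\<integral>\<^sup>+s\<in>{0..t}. (ennreal (ps s) + (nint xi. W s xi)) * (nint xi. d s xi) \<partial>lborel) \<le>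
   (nint s. ennreal (\<alpha> * r) * (ennreal ((ps s)\<^sup>2 * ex s) * ind t s) +
    (ennreal (1 / (4 * \<alpha>)) * (zd s * ind t s) +
    (ennreal (\<rho> * Eg) * (zd s * ind t s) + ennreal (r * ex t) * (zW s * ind t s))))"
 proof (intro nn_integral_mono)
  fix s
  show "(ennreal (ps s) + (nint xi. W s xi)) * (nint xi. d s xi) * ind t s \<le>
    ennreal (\<alpha> * r) * (ennreal ((ps s)\<^sup>2 * ex s) * ind t s) +
    (ennreal (1 / (4 * \<alpha>)) * (zd s * ind t s) +
    (ennreal (\<rho> * Eg) * (zd s * ind t s) + ennreal (r * ex t) * (zW s * ind t s)))"
  proof (cases "s \<in> {0..t}")
   case True
   hence s: "s >= 0" "s <= t" by auto
   have "ennreal (ps s) * (nint xi. d s xi) <= ennreal (\<alpha> * (ps s)\<^sup>2) * chi1 (d s) + ennreal (1 / (4 * \<alpha>)) * zd s"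
    unfolding zd_def by (rule mass_le_interpolation[OF jm_at[OF d(1)] const_pos(2) ps_nonneg])
   also have "ennreal (\<alpha> * (ps s)\<^sup>2) * chi1 (d s) <= ennreal (\<alpha> * (ps s)\<^sup>2) * ennreal (r * ex s)"
    unfolding ex_def by (intro mult_left_mono Bnd_chi1 d s) auto
   also have "... = ennreal (\<alpha> * r) * ennreal ((ps s)\<^sup>2 * ex s)"
    using const_pos r ex[of s] by (simp add: ennreal_mult[symmetric] mult_ac)
   finally have 1: "ennreal (ps s) * (nint xi. d s xi) \<le>
     ennreal (\<alpha> * r) * ennreal ((ps s)\<^sup>2 * ex s) + ennreal (1 / (4 * \<alpha>)) * zd s" by (simp add: add_right_mono)
   have "(nint xi. W s xi) * (nint xi. d s xi) <= chi1 (W s) * zd s + chi1 (d s) * zW s"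
    unfolding zd_def zW_def by (rule mass_product_le[OF jm_at[OF d(1)] jm_at[OF W(1)]])
   \<comment> \<open>The growth of \<open>W\<close> is bounded crudely by its maximum
     \<open>Eg\<close>, so that the exponential at time \<open>t\<close> belongs to \<open>d\<close>
     alone and the result is again of the form required by \<open>Bnd\<close>.\<close>
   also have "... <= ennreal (\<rho> * Eg) * zd s + ennreal (r * ex t) * zW s"
   proof (intro add_mono mult_right_mono)
    show "chi1 (W s) <= ennreal (\<rho> * Eg)"
     by (rule order_trans[OF Bnd_chi1[OF W(2) s(1)]]) (intro ennreal_leI mult_left_mono exp_\<Psi>_le s r)
    show "chi1 (d s) <= ennreal (r * ex t)" by (rule order_trans[OF Bnd_chi1[OF d(2) s(1)]])
       (unfold ex_def, intro ennreal_leI mult_left_mono r,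
        use \<Psi>_mono[OF s(2,1)] const_pos in \<open>auto intro!: mult_left_mono\<close>)
   qed auto
   finally have 2: "(nint xi. W s xi) * (nint xi. d s xi) <= ennreal (\<rho> * Eg) * zd s + ennreal (r * ex t) * zW s" .
   show ?thesis using add_mono[OF 1 2] True by (simp add: distrib_right add_ac)
  qed simp
 qed
 also have "... = ennreal (\<alpha> * r) * (\<integral>\<^sup>+s\<in>{0..t}. ennreal ((ps s)\<^sup>2 * ex s) \<partial>lborel) +
   (ennreal (1 / (4 * \<alpha>)) * diss d t + (ennreal (\<rho> * Eg) * diss d t + ennreal (r * ex t) * diss W t))"
  unfolding diss_def zd_def[symmetric] zW_def[symmetric]
  using exm by (simp add: nn_integral_add nn_integral_cmult)
 also have "... <= ennreal (\<alpha> * r) * ennreal (ex t / lam) +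
   (ennreal (1 / (4 * \<alpha>)) * ennreal (r * ex t / k') + (ennreal (\<rho> * Eg) * ennreal (r * ex t / k') + ennreal (r * ex t) * ennreal (\<rho> * Eg / k')))"
 proof (intro add_mono mult_left_mono)
  show "(\<integral>\<^sup>+s\<in>{0..t}. ennreal ((ps s)\<^sup>2 * ex s) \<partial>lborel) <= ennreal (ex t / lam)"
   unfolding ex_def \<Psi>_def by (rule exp_primitive_nn_integral_le[OF ps2_cont _ const_pos(3) t]) simp
  show "diss d t <= ennreal (r * ex t / k')" "diss d t <= ennreal (r * ex t / k')"
   unfolding ex_def by (intro Bnd_diss d t)+
  show "diss W t <= ennreal (\<rho> * Eg / k')" by (rule order_trans[OF Bnd_diss[OF W(2) t]])
     (intro ennreal_leI divide_right_mono mult_left_mono exp_\<Psi>_le t r, use const_pos in auto)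
 qed auto
 also have "... = ennreal (\<alpha> * r * (ex t / lam) + (1 / (4 * \<alpha>) * (r * ex t / k') + (\<rho> * Eg * (r * ex t / k') + r * ex t * (\<rho> * Eg / k'))))"
  using const_pos r ex[of t] by (simp add: ennreal_mult[symmetric] ennreal_plus[symmetric] del: ennreal_plus)
 also have "\<alpha> * r * (ex t / lam) + (1 / (4 * \<alpha>) * (r * ex t / k') + (\<rho> * Eg * (r * ex t / k') + r * ex t * (\<rho> * Eg / k'))) =
   r * ex t * (\<alpha> / lam + 1 / (4 * \<alpha> * k') + 2 * \<rho> * Eg / k')"
  using const_pos ka by (simp add: field_simps)
 finally show ?thesis by (simp add: ex_def)
qed

end

lemma jm_add: "jm d ==> jm w ==> jm (%t xi. d t xi + w t xi :: ennreal)"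
 unfolding jm_def by measurable

lemma jm_mult: "jm d ==> jm w ==> jm (%t xi. d t xi * w t xi :: ennreal)"
 unfolding jm_def by measurable

lemma jm_cmult: "jm d ==> jm (%t xi. k * d t xi :: ennreal)"
 unfolding jm_def by measurable

lemma chi1_cmult: "d \<in> BM ==> chi1 (%xi. k * d xi) = k * chi1 d"
 unfolding chi1_def by (simp add: nn_integral_cmult mult.assoc)

lemma diss_cmult:
 assumes "jm d"
 shows "diss (%t xi. k * d t xi) t = k * diss d t"
proof -
 note [measurable (raw)] = jm_compose[OF assms]
 show ?thesis unfolding diss_def by (simp add: nn_integral_cmult mult.assoc)
qed

lemma chi1_add:
 "d \<in> BM ==> w \<in> BM ==> chi1 (%xi. d xi + w xi) = chi1 d + chi1 w"
 unfolding chi1_def by (simp add: nn_integral_add distrib_right)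

lemma diss_add:
 assumes "jm d" "jm w"
 shows "diss (%t xi. d t xi + w t xi) t = diss d t + diss w t"
proof -
 note [measurable (raw)] = jm_compose[OF assms(1)] jm_compose[OF assms(2)]
 show ?thesis unfolding diss_def by (simp add: nn_integral_add distrib_right)
qed

lemma chi1_mono: "(!!xi. d xi <= w xi) ==> chi1 d <= chi1 w"
 unfolding chi1_def by (intro nn_integral_mono mult_right_mono) auto

lemma chi1_norm_le:
 assumes "a >= 0" and [measurable]: "g \<in> BM"
 shows "chi1 (%xi. ennreal (a * norm xi) * g xi) <= ennreal a * (nint xi. g xi)"
proof -
 have "chi1 (%xi. ennreal (a * norm xi) * g xi) <= (nint xi. ennreal a * g xi)"
  unfolding chi1_def
 proof (intro nn_integral_mono)
  fix xi :: R3
  have "ennreal (a * norm xi) * ennreal (1 / norm xi) <= ennreal a"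
   using assms(1) by (subst ennreal_mult[symmetric]) (auto intro!: ennreal_leI)
  from mult_right_mono[OF this, of "g xi"]
  show "ennreal (a * norm xi) * g xi * ennreal (1 / norm xi) <= ennreal a * g xi" by (simp add: mult_ac)
 qed
 also have "... = ennreal a * (nint xi. g xi)" by (simp add: nn_integral_cmult)
 finally show ?thesis .
qed

text \<open>Absolute continuity of the integral, by dominated convergence along sequences; the point
  0 itself is a null set.\<close>

lemma tendsto_nn_integral_Icc_0:
 fixes M :: "real => ennreal"
 assumes [measurable]: "M \<in> BM" and fin: "(\<integral>\<^sup>+s\<in>{0..1}. M s \<partial>lborel) < \<infinity>"
 shows "((%t. \<integral>\<^sup>+s\<in>{0..t}. M s \<partial>lborel) \<longlongrightarrow> 0) (at_right 0)"
 unfolding tendsto_at_iff_sequentially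
proof (intro allI impI)
 fix X :: "nat => real" assume X: "\<forall>i. X i \<in> {0<..} - {0}" "X \<longlonglongrightarrow> 0"
 hence "eventually (%n. X n < 1) sequentially" by (auto intro: order_tendstoD)
 then obtain N where N: "!!n. n >= N ==> X n < 1" by (auto simp: eventually_sequentially)
 have "(%n. \<integral>\<^sup>+s. M s * indicator {0..X (n + N)} s \<partial>lborel) \<longlonglongrightarrow> (\<integral>\<^sup>+s. 0 \<partial>(lborel::real measure))"
 proof (rule nn_integral_dominated_convergence[where w = "%s. M s * ind 1 s"])
  show "AE s in lborel. M s * indicator {0..X (n + N)} s <= M s * ind 1 s" for n
   using N[of "n + N"] by (intro AE_I2) (auto simp: indicator_def)
  have "AE s in lborel. s ~= (0::real)"
   using AE_lborel_singleton by blast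
  thus "AE s in lborel. (%n. M s * indicator {0..X (n + N)} s) \<longlonglongrightarrow> 0"
  proof eventually_elim
   case (elim s)
   have "eventually (%n. indicator {0..X (n + N)} s = (0::ennreal)) sequentially"
   proof (cases "s > 0")
    case True
    have "(%n. X (n + N)) \<longlonglongrightarrow> 0" using X(2) by (rule LIMSEQ_ignore_initial_segment)
    from order_tendstoD(2)[OF this True] show ?thesis by eventually_elim auto
   qed (use elim in auto)
   hence "eventually (%n. M s * indicator {0..X (n + N)} s = 0) sequentially" by eventually_elim simp
   thus ?case by (rule tendsto_eventually)
  qed
 qed (use fin in auto)
 hence "(%n. \<integral>\<^sup>+s. M s * indicator {0..X (n + N)} s \<partial>lborel) \<longlonglongrightarrow> 0" by simp
 hence "(%n. \<integral>\<^sup>+s. M s * indicator {0..X n} s \<partial>lborel) \<longlonglongrightarrow> 0" by (rule LIMSEQ_offset)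
 thus "((%t. \<integral>\<^sup>+s\<in>{0..t}. M s \<partial>lborel) \<circ> X) \<longlonglongrightarrow> 0" by (simp add: comp_def)
qed

section \<open>Iteration of the scalar majorant\<close>

context majorant
begin

text \<open>Majorant of the difference of two Duhamel terms; the factor 2 counts the two places
  where the difference enters a quadratic term.\<close>

definition step :: "(real => R3 => ennreal) => (real => R3 => ennreal) => real => R3 => ennreal" where
 "step W d t xi = ennreal K * duhamel k' (%s xi. ennreal (2 * c * norm xi) * econv (%eta. Q s eta + W s eta) (d s) xi) t xi"

text \<open>The first increment: the heat flow of the small data and the Duhamel term of the forcing
  that the background exerts.\<close>

definition d0 :: "real => R3 => ennreal" where
 "d0 t xi = ennreal K * (ennreal (hk k' t xi) * ennreal (A xi)) +
   ennreal K * duhamel k' (%s xi. ennreal (wt s xi * b s xi)) t xi"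

text \<open>Increment and running sum are iterated together, because the sum so far is the
  coefficient of the next linear step.\<close>

primrec maj :: "nat => (real => R3 => ennreal) \<times> (real => R3 => ennreal)" where
 "maj 0 = (d0, d0)"
| "maj (Suc m) = (step (snd (maj m)) (fst (maj m)), %t xi. snd (maj m) t xi + step (snd (maj m)) (fst (maj m)) t xi)"

definition dn :: "nat => real => R3 => ennreal" where "dn m = fst (maj m)"
definition Wn :: "nat => real => R3 => ennreal" where "Wn m = snd (maj m)"
definition Wt :: "real => R3 => ennreal" where "Wt t xi = (\<Sum>m. dn m t xi)"
definition Xt :: "real => R3 => ennreal" where "Xt t xi = Q t xi + Wt t xi"
text \<open>Up to constants it dominates every Duhamel integral at a fixed frequency; that it is
  finite at almost every frequency makes a pointwise iteration possible.\<close>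

definition Zt :: "real => R3 => ennreal" where
 "Zt t xi = (\<integral>\<^sup>+s\<in>{0..t}. en xi * econv (Xt s) (Xt s) xi \<partial>lborel)"

lemma dn_0: "dn 0 = d0" and dn_Suc: "dn (Suc m) = step (Wn m) (dn m)" by (simp_all add: dn_def Wn_def)

lemma Wn_sum: "Wn m t xi = (\<Sum>l\<le>m. dn l t xi)" by (induction m) (auto simp: Wn_def dn_def)

lemma jm_Q: "jm Q" by (rule jm_heat_maj) measurable

lemma jm_norm: "jm (%t xi. ennreal (a * norm xi))"
 unfolding jm_def by measurable

lemma jm_flux: "jm W ==> jm d ==> jm (%s xi. ennreal (2 * c * norm xi) * econv (%eta. Q s eta + W s eta) (d s) xi)"
 by (intro jm_mult jm_norm jm_econv jm_add jm_Q)

lemma jm_step: "jm W ==> jm d ==> jm (step W d)"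
 unfolding step_def[abs_def] by (intro jm_cmult jm_duhamel jm_flux)

lemma jm_wt_b: "jm (%s xi. ennreal (wt s xi * b s xi))"
 using bm unfolding jm_def wt_def by measurable

lemma jm_d0: "jm d0"
proof -
 have "jm (%t xi. ennreal (hk k' t xi) * ennreal (A xi))"
  unfolding jm_def by measurable
 thus ?thesis
  unfolding d0_def[abs_def] by (intro jm_add jm_cmult jm_duhamel jm_wt_b)
qed

lemma jm_maj: "jm (dn m) & jm (Wn m)"
proof (induction m)
 case 0
 thus ?case by (simp add: dn_def Wn_def jm_d0)
next
 case (Suc m)
 thus ?case
  unfolding dn_def Wn_def maj.simps fst_conv snd_conv by (intro conjI jm_add jm_step) auto
qed

text \<open>Three times 1/6: the term absorbed by exponential growth, the dissipation from the
  interpolation, and the quadratic interaction within the radius.\<close>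

lemma const_half: "4 * c * K * (\<alpha> / lam + 1 / (4 * \<alpha> * k') + 2 * R * Eg / k') = 1 / 2"
proof -
 have "4 * c * K * (\<alpha> / lam) = 1 / 6"
  using const_pos(1,2) c unfolding lambda_const_def by (simp add: field_simps)
 moreover have "4 * c * K * (1 / (4 * \<alpha> * k')) = 1 / 6"
  using const_pos(1) c ka unfolding alpha_const_def by (simp add: field_simps)
 moreover have "4 * c * K * (2 * R * Eg / k') = 1 / 6"
  using const_pos(1,4) c ka unfolding radius_const_def by (simp add: field_simps)
 ultimately show ?thesis by (simp only: distrib_left)
qed

text \<open>The factor 4 c K in \<open>const_half\<close> consists of 2 from
  \<open>duhamel_estimate\<close>, 2 c from the flux and K from the weight.\<close>

lemma Bnd_step:
 assumes d: "jm d" "Bnd d r" and W: "jm W" "Bnd W R" and r: "r >= 0"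
 shows "Bnd (step W d) (r / 2)"
 unfolding Bnd_def
proof (intro allI impI)
 fix t :: real assume t: "t >= 0"
 define g where "g s xi = ennreal (2 * c * norm xi) * econv (%eta. Q s eta + W s eta) (d s) xi" for s xi
 have g: "jm g" unfolding g_def[abs_def] by (rule jm_flux[OF W(1) d(1)])
 note [measurable (raw)] = jm_compose[OF d(1)] jm_compose[OF W(1)] jm_compose[OF jm_Q]
 have st: "step W d = (%t xi. ennreal K * duhamel k' g t xi)"
  unfolding step_def[abs_def] g_def[abs_def] ..
 have "chi1 (step W d t) + ennreal k' * diss (step W d) t =
   ennreal K * (chi1 (duhamel k' g t) + ennreal k' * diss (duhamel k' g) t)"
  unfolding st using jm_duhamel[OF g, of k'] by (simp add: chi1_cmult jm_at diss_cmult distrib_left mult_ac)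
 also have "... <= ennreal K * (2 * (\<integral>\<^sup>+s\<in>{0..t}. chi1 (g s) \<partial>lborel))"
  by (intro mult_left_mono duhamel_estimate g const_pos(6) t) auto
 also have "(\<integral>\<^sup>+s\<in>{0..t}. chi1 (g s) \<partial>lborel) \<le>
   (nint s. ennreal (2 * c) * ((ennreal (ps s) + (nint xi. W s xi)) * (nint xi. d s xi) * ind t s))"
 proof (intro nn_integral_mono)
  fix s
  show "chi1 (g s) * ind t s \<le>
    ennreal (2 * c) * ((ennreal (ps s) + (nint xi. W s xi)) * (nint xi. d s xi) * ind t s)"
  proof (cases "s \<in> {0..t}")
   case True
   have "chi1 (g s) <= ennreal (2 * c) * (nint xi. econv (%eta. Q s eta + W s eta) (d s) xi)"
    unfolding g_def
   proof (rule chi1_norm_le)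
    show "econv (%eta. Q s eta + W s eta) (d s) \<in> BM" by measurable
   qed (use c in simp)
   also have "(nint xi. econv (%eta. Q s eta + W s eta) (d s) xi) =
     (nint eta. Q s eta + W s eta) * (nint xi. d s xi)" by (rule nn_integral_econv) measurable
   also have "(nint eta. Q s eta + W s eta) = ennreal (ps s) + (nint xi. W s xi)"
    using True by (subst nn_integral_add) (auto simp: Q_mass)
   finally show ?thesis using True by simp
  qed simp
 qed
 also have "... <= ennreal (2 * c) * ennreal (r * exp (lam * \<Psi> t) * (\<alpha> / lam + 1 / (4 * \<alpha> * k') + 2 * R * Eg / k'))"
 proof -
  have "(%s. ennreal (ps s) * ind t s + (nint xi. W s xi) * ind t s) \<in> BM"
   using ps_measurable_Icc[of t] by measurable
  hence "(%s. (ennreal (ps s) + (nint xi. W s xi)) * ind t s) \<in> BM" by (simp add: distrib_right)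
  hence "(%s. (ennreal (ps s) + (nint xi. W s xi)) * ind t s * (nint xi. d s xi)) \<in> BM" by measurable
  hence m: "(%s. (ennreal (ps s) + (nint xi. W s xi)) * (nint xi. d s xi) * ind t s) \<in> BM"
   by (simp only: mult_ac)
  show ?thesis
   using mass_estimate[OF d W r less_imp_le[OF const_pos(5)] t] m
   by (simp add: nn_integral_cmult mult_left_mono)
 qed
 finally have "chi1 (step W d t) + ennreal k' * diss (step W d) t \<le>
   ennreal K * (2 * (ennreal (2 * c) * ennreal (r * exp (lam * \<Psi> t) * (\<alpha> / lam + 1 / (4 * \<alpha> * k') + 2 * R * Eg / k'))))"
  by (simp add: mult_left_mono)
 also have "... = ennreal (K * (2 * ((2 * c) * (r * exp (lam * \<Psi> t) * (\<alpha> / lam + 1 / (4 * \<alpha> * k') + 2 * R * Eg / k')))))"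
 proof -
  have "ennreal K * (2 * (ennreal (2 * c) * ennreal y)) = ennreal (K * (2 * ((2 * c) * y)))" if "y >= 0" for y
   using that const_pos(1) c by (simp add: ennreal_mult mult_ac)
  moreover have "0 <= r * exp (lam * \<Psi> t) * (\<alpha> / lam + 1 / (4 * \<alpha> * k') + 2 * R * Eg / k')"
   using const_pos r by (intro mult_nonneg_nonneg add_nonneg_nonneg divide_nonneg_nonneg) auto
  ultimately show ?thesis by blast
 qed
 also have "K * (2 * ((2 * c) * (r * exp (lam * \<Psi> t) * (\<alpha> / lam + 1 / (4 * \<alpha> * k') + 2 * R * Eg / k')))) =
   r * exp (lam * \<Psi> t) * (4 * c * K * (\<alpha> / lam + 1 / (4 * \<alpha> * k') + 2 * R * Eg / k'))"
  by (simp only: mult_ac)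
 also have "... = r / 2 * exp (lam * \<Psi> t)" unfolding const_half by simp
 finally show "chi1 (step W d t) + ennreal k' * diss (step W d) t <= ennreal (r / 2 * exp (lam * \<Psi> t))" .
qed

text \<open>Split wt <= L + wt^2 / L. The first part uses the smallness of \<open>b\<close>; the
  second uses \<open>b_le\<close>, whose bound is not small but is divided by L.\<close>

lemma wt_b_integral:
 assumes t: "t >= 0"
 shows "(\<integral>\<^sup>+s\<in>{0..t}. chi1 (%xi. ennreal (wt s xi * b s xi)) \<partial>lborel) \<le>
  ennreal (split_const ka c P n * \<delta> + n * c * Psi_const ka P / split_const ka c P n)"
proof -
 define L where "L = split_const ka c P n"
 have L: "L >= 1" by (simp add: L_def split_const_def)
 note [measurable (raw)] = jm_compose[OF bm] jm_compose[OF jm_Q]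
 have le: "ennreal (wt s xi * b s xi) <= ennreal L * ennreal (b s xi) + ennreal (1 / L) * (ennreal (n * c * norm xi) * econv (Q s) (Q s) xi)"
  if s: "s >= 0" for s xi
 proof -
  have "wt s xi <= L + 1 / L * (wt s xi)\<^sup>2"
  proof (cases "wt s xi <= L")
   case True
   thus ?thesis using L by (simp add: add_increasing2)
  next
   case False
   hence "wt s xi * L <= wt s xi * wt s xi" using wt_ge_1[OF s, of xi] by (intro mult_left_mono) auto
   hence "wt s xi <= 1 / L * (wt s xi)\<^sup>2" using L by (simp add: field_simps power2_eq_square)
   thus ?thesis using L by simp
  qed
  from mult_right_mono[OF this b0, of s xi]
  have "wt s xi * b s xi <= L * b s xi + 1 / L * ((wt s xi)\<^sup>2 * b s xi)" by (simp add: distrib_right)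
  hence "ennreal (wt s xi * b s xi) <= ennreal (L * b s xi + 1 / L * ((wt s xi)\<^sup>2 * b s xi))" by (rule ennreal_leI)
  also have "... = ennreal L * ennreal (b s xi) + ennreal (1 / L) * ennreal ((wt s xi)\<^sup>2 * b s xi)"
   using L b0[of s xi] by (simp add: ennreal_mult[symmetric])
  also have "... <= ennreal L * ennreal (b s xi) + ennreal (1 / L) * (ennreal (n * c * norm xi) * econv (Q s) (Q s) xi)"
   by (intro add_mono mult_left_mono b_le s) auto
  finally show ?thesis .
 qed
 have "(\<integral>\<^sup>+s\<in>{0..t}. chi1 (%xi. ennreal (wt s xi * b s xi)) \<partial>lborel) \<le>
   (nint s. ennreal L * (chi1 (%xi. ennreal (b s xi)) * ind t s) + ennreal (n * c / L) * (ennreal ((ps s)\<^sup>2) * ind t s))"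
 proof (intro nn_integral_mono)
  fix s
  show "chi1 (%xi. ennreal (wt s xi * b s xi)) * ind t s \<le>
    ennreal L * (chi1 (%xi. ennreal (b s xi)) * ind t s) + ennreal (n * c / L) * (ennreal ((ps s)\<^sup>2) * ind t s)"
  proof (cases "s \<in> {0..t}")
   case True
   hence s: "s >= 0" by simp
   have "chi1 (%xi. ennreal (wt s xi * b s xi)) \<le>
     chi1 (%xi. ennreal L * ennreal (b s xi) + ennreal (1 / L) * (ennreal (n * c * norm xi) * econv (Q s) (Q s) xi))"
    by (intro chi1_mono le s)
   also have "... = ennreal L * chi1 (%xi. ennreal (b s xi)) + ennreal (1 / L) * chi1 (%xi. ennreal (n * c * norm xi) * econv (Q s) (Q s) xi)"
    by (simp add: chi1_add chi1_cmult)
   also have "chi1 (%xi. ennreal (n * c * norm xi) * econv (Q s) (Q s) xi) <= ennreal (n * c) * (nint xi. econv (Q s) (Q s) xi)"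
    using n c by (intro chi1_norm_le) simp_all
   also have "(nint xi. econv (Q s) (Q s) xi) = ennreal ((ps s)\<^sup>2)"
    using ps_nonneg s by (subst nn_integral_econv) (auto simp: Q_mass ennreal_mult[symmetric] power2_eq_square)
   finally have "chi1 (%xi. ennreal (wt s xi * b s xi)) \<le>
     ennreal L * chi1 (%xi. ennreal (b s xi)) + ennreal (1 / L) * (ennreal (n * c) * ennreal ((ps s)\<^sup>2))"
    by (simp add: mult_left_mono)
   also have "ennreal (1 / L) * (ennreal (n * c) * ennreal ((ps s)\<^sup>2)) = ennreal (n * c / L) * ennreal ((ps s)\<^sup>2)"
    using n c L by (simp add: ennreal_mult[symmetric] mult_ac)
   finally show ?thesis using True by simp
  qed simp
 qed
 also have "... = ennreal L * (\<integral>\<^sup>+s\<in>{0..t}. chi1 (%xi. ennreal (b s xi)) \<partial>lborel) + ennreal (n * c / L) * (\<integral>\<^sup>+s\<in>{0..t}. ennreal ((ps s)\<^sup>2) \<partial>lborel)"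
 proof -
  have "(%s. ennreal (ps s) * ind t s * (ennreal (ps s) * ind t s)) \<in> BM"
   using ps_measurable_Icc[of t] by measurable
  moreover have "ennreal (ps s) * ind t s * (ennreal (ps s) * ind t s) = ennreal ((ps s)\<^sup>2) * ind t s" for s
   using ps_nonneg[of s] by (simp add: indicator_def ennreal_mult[symmetric] power2_eq_square)
  ultimately have [measurable]: "(%s. ennreal ((ps s)\<^sup>2) * ind t s) \<in> BM" by simp
  have [measurable]: "(%s. chi1 (%xi. ennreal (b s xi))) \<in> BM"
   unfolding chi1_def by measurable
  show ?thesis by (simp add: nn_integral_add nn_integral_cmult)
 qed
 also have "... <= ennreal L * ennreal \<delta> + ennreal (n * c / L) * ennreal (Psi_const ka P)"
  by (intro add_mono mult_left_mono b_small ps2_integral t) auto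
 also have "... = ennreal (L * \<delta> + n * c * Psi_const ka P / L)"
  using L \<delta> n c const_pos by (simp add: ennreal_mult[symmetric])
 finally show ?thesis unfolding L_def .
qed

lemma smallness: "2 * K * \<delta> + 2 * K * (split_const ka c P n * \<delta> + n * c * Psi_const ka P / split_const ka c P n) <= R / 2"
proof -
 define L where "L = split_const ka c P n"
 have L: "L >= 1" "L >= 8 * K * n * c * Psi_const ka P / R" by (simp_all add: L_def split_const_def)
 have K: "K > 0" and R: "R > 0" using const_pos by auto
 have "\<delta> <= R / (8 * K * (1 + L))" using small by (simp add: small_const_def L_def)
 hence "\<delta> * (8 * K * (1 + L)) <= R" using K L by (subst (asm) pos_le_divide_eq) auto
 hence 1: "2 * K * \<delta> + 2 * K * (L * \<delta>) <= R / 4" by (simp add: algebra_simps)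
 have "8 * K * n * c * Psi_const ka P <= L * R" using L(2) R by (subst (asm) pos_divide_le_eq) auto
 hence "8 * K * n * c * Psi_const ka P / L <= R" using L(1) by (subst pos_divide_le_eq) (auto simp: mult_ac)
 hence 2: "2 * K * (n * c * Psi_const ka P / L) <= R / 4" by (simp add: mult_ac)
 show ?thesis using 1 2 unfolding L_def[symmetric] by (simp add: distrib_left)
qed

lemma Bnd_d0: "Bnd d0 (R / 2)"
 unfolding Bnd_def
proof (intro allI impI)
 fix t :: real assume t: "t >= 0"
 define hA where "hA = (%t (xi::R3). ennreal (hk k' t xi) * ennreal (A xi))"
 define g where "g = (%s xi. ennreal (wt s xi * b s xi))"
 have jA: "jm hA" unfolding jm_def hA_def by measurable
 have jg: "jm (duhamel k' g)" unfolding g_def by (intro jm_duhamel jm_wt_b)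
 have d0_eq: "d0 = (%t xi. ennreal K * hA t xi + ennreal K * duhamel k' g t xi)"
  unfolding d0_def[abs_def] hA_def g_def ..
 have hA1: "chi1 (hA t) <= chi1 (%xi. ennreal (A xi))"
 proof (rule chi1_mono)
  fix xi :: R3
  have "ennreal (hk k' t xi) <= 1" using ka t by (simp add: ennreal_le_1)
  from mult_right_mono[OF this, of "ennreal (A xi)"] show "hA t xi <= ennreal (A xi)" by (simp add: hA_def)
 qed
 have hA2: "ennreal k' * diss hA t <= chi1 (%xi. ennreal (A xi))"
  unfolding hA_def by (rule diss_heat_le) (use const_pos t in auto)
 have "chi1 (d0 t) + ennreal k' * diss d0 t =
   ennreal K * (chi1 (hA t) + ennreal k' * diss hA t) + ennreal K * (chi1 (duhamel k' g t) + ennreal k' * diss (duhamel k' g) t)"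
 proof -
  have [measurable]: "hA t \<in> BM" "duhamel k' g t \<in> BM"
   using jA jg by (auto intro: jm_at)
  have "chi1 (%xi. ennreal K * hA t xi + ennreal K * duhamel k' g t xi) =
    chi1 (%xi. ennreal K * hA t xi) + chi1 (%xi. ennreal K * duhamel k' g t xi)" by (rule chi1_add) measurable
  thus ?thesis unfolding d0_eq using jA jg
   by (simp add: chi1_cmult jm_at diss_add diss_cmult jm_cmult distrib_left mult_ac add_ac)
 qed
 also have "... <= ennreal K * (ennreal \<delta> + ennreal \<delta>) + ennreal K * (2 * (\<integral>\<^sup>+s\<in>{0..t}. chi1 (g s) \<partial>lborel))"
 proof (intro add_mono mult_left_mono)
  show "chi1 (hA t) <= ennreal \<delta>" "ennreal k' * diss hA t <= ennreal \<delta>"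
   using hA1 hA2 A_small by auto
  show "chi1 (duhamel k' g t) + ennreal k' * diss (duhamel k' g) t <= 2 * (\<integral>\<^sup>+s\<in>{0..t}. chi1 (g s) \<partial>lborel)"
   unfolding g_def by (intro duhamel_estimate jm_wt_b const_pos(6) t)
 qed auto
 also have "... <= ennreal K * (ennreal \<delta> + ennreal \<delta>) +
   ennreal K * (2 * ennreal (split_const ka c P n * \<delta> + n * c * Psi_const ka P / split_const ka c P n))"
  unfolding g_def by (intro add_mono mult_left_mono wt_b_integral t order_refl) auto
 also have "... = ennreal (2 * K * \<delta> + 2 * K * (split_const ka c P n * \<delta> + n * c * Psi_const ka P / split_const ka c P n))"
 proof -
  have "split_const ka c P n > 0" by (simp add: split_const_def less_max_iff_disj)
  hence "split_const ka c P n * \<delta> + n * c * Psi_const ka P / split_const ka c P n >= 0"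
   using \<delta> n c const_pos by simp
  moreover have "ennreal K * (ennreal \<delta> + ennreal \<delta>) + ennreal K * (2 * ennreal X) = ennreal (2 * K * \<delta> + 2 * K * X)"
   if X: "X >= 0" for X
  proof -
   have "ennreal \<delta> + ennreal \<delta> = ennreal (2 * \<delta>)" using \<delta> by (subst ennreal_plus[symmetric]) auto
   moreover have "2 * ennreal X = ennreal (2 * X)" using X by (simp add: ennreal_mult)
   moreover have "ennreal (2 * K * \<delta> + 2 * K * X) = ennreal (K * (2 * \<delta>)) + ennreal (K * (2 * X))"
    using \<delta> X const_pos(1) by (subst ennreal_plus[symmetric]) (auto simp: mult_ac)
   ultimately show ?thesis
    using \<delta> X const_pos(1) by (simp only: ennreal_mult less_imp_le mult_nonneg_nonneg zero_le_numeral)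
  qed
  ultimately show ?thesis by blast
 qed
 also have "... <= ennreal (R / 2 * exp (lam * \<Psi> t))"
 proof (rule ennreal_leI)
  have "1 <= exp (lam * \<Psi> t)" using const_pos \<Psi>_nonneg by simp
  hence "R / 2 * 1 <= R / 2 * exp (lam * \<Psi> t)" using const_pos by (intro mult_left_mono) auto
  thus "2 * K * \<delta> + 2 * K * (split_const ka c P n * \<delta> + n * c * Psi_const ka P / split_const ka c P n) <= R / 2 * exp (lam * \<Psi> t)"
   using smallness by linarith
 qed
 finally show "chi1 (d0 t) + ennreal k' * diss d0 t <= ennreal (R / 2 * exp (lam * \<Psi> t))" .
qed

lemma Bnd_add:
 assumes "jm d" "Bnd d r" "jm w" "Bnd w \<rho>" "r >= 0" "\<rho> >= 0"
 shows "Bnd (%t xi. d t xi + w t xi) (r + \<rho>)"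
 unfolding Bnd_def
proof (intro allI impI)
 fix t :: real assume t: "t >= 0"
 have "chi1 (%xi. d t xi + w t xi) + ennreal k' * diss (%t xi. d t xi + w t xi) t =
   (chi1 (d t) + ennreal k' * diss d t) + (chi1 (w t) + ennreal k' * diss w t)"
  using assms by (simp add: chi1_add jm_at diss_add distrib_left add_ac)
 also have "... <= ennreal (r * exp (lam * \<Psi> t)) + ennreal (\<rho> * exp (lam * \<Psi> t))"
  using assms t by (intro add_mono) (auto simp: Bnd_def)
 also have "... = ennreal ((r + \<rho>) * exp (lam * \<Psi> t))"
  using assms by (simp add: distrib_right)
 finally show "chi1 (%xi. d t xi + w t xi) + ennreal k' * diss (%t xi. d t xi + w t xi) t <= ennreal ((r + \<rho>) * exp (lam * \<Psi> t))" .
qed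

lemma Bnd_mono: "Bnd d r ==> r <= r' ==> Bnd d r'"
 unfolding Bnd_def by (meson ennreal_leI exp_ge_zero mult_right_mono order_trans)

text \<open>The radii R/2, R/4, ... add up to less than R, so each running sum satisfies the
  hypothesis of \<open>Bnd_step\<close>.\<close>

lemma Bnd_maj: "Bnd (dn m) (R / 2 ^ Suc m) & Bnd (Wn m) (R - R / 2 ^ Suc m)"
proof (induction m)
 case 0
 have "R - R / 2 ^ Suc 0 = R / 2" by simp
 thus ?case using Bnd_d0 by (simp add: dn_def Wn_def)
next
 case (Suc m)
 have R: "R > 0" using const_pos by simp
 have le: "R / 2 ^ k <= R" for k :: nat
  using R by (simp add: divide_le_eq)
 have WR: "Bnd (Wn m) R" by (rule Bnd_mono[OF conjunct2[OF Suc]]) (use R in simp)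
 have 1: "Bnd (step (Wn m) (dn m)) (R / 2 ^ Suc m / 2)" by (rule Bnd_step) (use jm_maj Suc WR R in auto)
 have 2: "Bnd (%t xi. Wn m t xi + step (Wn m) (dn m) t xi) (R - R / 2 ^ Suc m + R / 2 ^ Suc m / 2)"
  by (rule Bnd_add[OF _ conjunct2[OF Suc] _ 1]) (use jm_maj R le[of "Suc m"] in \<open>auto intro: jm_step\<close>)
 have "R - R / 2 ^ Suc m + R / 2 ^ Suc m / 2 = R - R / 2 ^ Suc (Suc m)" by (simp add: field_simps)
 with 1 2 show ?case by (simp add: dn_def Wn_def)
qed

lemma jm_Wt: "jm Wt"
proof -
 have "!!m. (%p. dn m (fst p) (snd p)) \<in> borel_measurable (borel \<Otimes>\<^sub>M borel)"
  using jm_maj unfolding jm_def by blast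
 thus ?thesis unfolding jm_def Wt_def by measurable
qed

lemma Wn_le_Wt: "Wn m t xi <= Wt t xi"
 unfolding Wn_sum Wt_def by (intro sum_le_suminf) auto

lemma Bnd_Wt: "Bnd Wt R"
 unfolding Bnd_def
proof (intro allI impI)
 fix t :: real assume t: "t >= 0"
 note [measurable (raw)] = jm_compose[OF conjunct1[OF jm_maj]]
 have c: "chi1 (Wt t) = (\<Sum>m. chi1 (dn m t))"
  unfolding chi1_def Wt_def by (subst nn_integral_suminf[symmetric]) auto
 have "diss Wt t = (nint s. (\<Sum>m. (nint xi. dn m s xi * en xi) * ind t s))"
  unfolding diss_def Wt_def by (intro nn_integral_cong) (simp add: nn_integral_suminf[symmetric])
 also have "... = (\<Sum>m. diss (dn m) t)"
  unfolding diss_def by (rule nn_integral_suminf) measurable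
 finally have "chi1 (Wt t) + ennreal k' * diss Wt t = (\<Sum>m. chi1 (dn m t)) + (\<Sum>m. ennreal k' * diss (dn m) t)"
  by (simp add: c)
 also have "... = (\<Sum>m. chi1 (dn m t) + ennreal k' * diss (dn m) t)" by (rule suminf_add) auto
 also have "... <= (\<Sum>m. ennreal (R / 2 ^ Suc m * exp (lam * \<Psi> t)))"
  using Bnd_maj t by (intro suminf_le) (auto simp: Bnd_def)
 also have "... = ennreal (R * exp (lam * \<Psi> t))"
 proof -
  have "(%m. (1 / 2) ^ Suc m) sums (1::real)" by (rule power_half_series)
  hence "(%m. R * exp (lam * \<Psi> t) * (1 / 2) ^ Suc m) sums (R * exp (lam * \<Psi> t) * 1)" by (rule sums_mult)
  hence "(%m. R / 2 ^ Suc m * exp (lam * \<Psi> t)) sums (R * exp (lam * \<Psi> t))"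
   by (simp add: power_divide mult_ac)
  thus ?thesis
   using const_pos by (intro suminf_ennreal_eq) auto
 qed
 finally show "chi1 (Wt t) + ennreal k' * diss Wt t <= ennreal (R * exp (lam * \<Psi> t))" .
qed

definition Mq :: "real => ennreal" where
 "Mq t = (\<integral>\<^sup>+s\<in>{0..t}. (nint xi. Xt s xi) * (nint xi. Xt s xi) \<partial>lborel)"

lemma jm_Xt: "jm Xt"
 unfolding Xt_def[abs_def] by (intro jm_add jm_Q jm_Wt)

lemma Mq_finite:
 assumes t: "t >= 0"
 shows "Mq t < \<infinity>"
proof -
 note [measurable (raw)] = jm_compose[OF jm_Q] jm_compose[OF jm_Wt]
 define q where "q s = (nint xi. Q s xi)" for s
 define l where "l s = (nint xi. Wt s xi)" for s
 have [measurable]: "q \<in> BM" "l \<in> BM"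
  unfolding q_def[abs_def] l_def[abs_def] by measurable
 have X: "(nint xi. Xt s xi) = q s + l s" for s
  unfolding Xt_def q_def l_def by (rule nn_integral_add) measurable
 have "Mq t <= (nint s. q s * q s * ind t s + 2 * ((q s + l s) * l s * ind t s))"
  unfolding Mq_def X
 proof (intro nn_integral_mono)
  fix s
  \<comment> \<open>Adding \<open>l s * l s\<close> turns the square into q^2 plus twice a quantity
    covered by \<open>mass_estimate\<close>, without any subtraction in
    \<open>ennreal\<close>.\<close>
  have "(q s + l s) * (q s + l s) <= (q s + l s) * (q s + l s) + l s * l s" by simp
  also have "... = q s * q s + 2 * ((q s + l s) * l s)"
   by (simp add: distrib_left distrib_right mult_2 mult_2_right add_ac mult_ac)
  finally show "(q s + l s) * (q s + l s) * ind t s <= q s * q s * ind t s + 2 * ((q s + l s) * l s * ind t s)"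
   by (simp add: indicator_def)
 qed
 also have "... = (\<integral>\<^sup>+s\<in>{0..t}. q s * q s \<partial>lborel) + 2 * (\<integral>\<^sup>+s\<in>{0..t}. (q s + l s) * l s \<partial>lborel)"
  by (simp add: nn_integral_add nn_integral_cmult)
 also have "(\<integral>\<^sup>+s\<in>{0..t}. q s * q s \<partial>lborel) = (\<integral>\<^sup>+s\<in>{0..t}. ennreal ((ps s)\<^sup>2) \<partial>lborel)"
  using ps_nonneg by (intro nn_integral_cong) (auto simp: q_def Q_mass indicator_def ennreal_mult[symmetric] power2_eq_square)
 also have "(\<integral>\<^sup>+s\<in>{0..t}. (q s + l s) * l s \<partial>lborel) =
   (\<integral>\<^sup>+s\<in>{0..t}. (ennreal (ps s) + (nint xi. Wt s xi)) * (nint xi. Wt s xi) \<partial>lborel)"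
  by (intro nn_integral_cong) (auto simp: q_def l_def Q_mass indicator_def)
 finally have *: "Mq t <= (\<integral>\<^sup>+s\<in>{0..t}. ennreal ((ps s)\<^sup>2) \<partial>lborel) +
   2 * (\<integral>\<^sup>+s\<in>{0..t}. (ennreal (ps s) + (nint xi. Wt s xi)) * (nint xi. Wt s xi) \<partial>lborel)" .
 have "(\<integral>\<^sup>+s\<in>{0..t}. ennreal ((ps s)\<^sup>2) \<partial>lborel) < \<infinity>"
  using ps2_integral[OF t] by (auto intro: le_less_trans)
 moreover have "(\<integral>\<^sup>+s\<in>{0..t}. (ennreal (ps s) + (nint xi. Wt s xi)) * (nint xi. Wt s xi) \<partial>lborel) < \<infinity>"
  using mass_estimate[OF jm_Wt Bnd_Wt jm_Wt Bnd_Wt _ _ t] const_pos by (auto intro: le_less_trans)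
 ultimately show ?thesis
  using * by (auto intro!: le_less_trans[OF *] simp: ennreal_add_less_top ennreal_mult_less_top)
qed

text \<open>This is why the Duhamel term vanishes at the initial time in the norm with weight
  1/|xi|.\<close>

lemma Mq_tendsto: "(Mq \<longlongrightarrow> 0) (at_right 0)"
proof -
 note [measurable (raw)] = jm_compose[OF jm_Xt]
 show ?thesis
  unfolding Mq_def[abs_def]
  by (rule tendsto_nn_integral_Icc_0) (use Mq_finite[of 1] in \<open>auto simp: Mq_def\<close>)
qed

lemma Zt_measurable: "Zt t \<in> BM"
proof -
 note [measurable (raw)] = jm_compose[OF jm_econv[OF jm_Xt jm_Xt]]
 show ?thesis unfolding Zt_def[abs_def] by measurable
qed

lemma Zt_mono: "s <= t ==> Zt s xi <= Zt t xi"
 unfolding Zt_def by (intro nn_integral_mono) (auto simp: indicator_def)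

lemma chi1_Zt: "chi1 (Zt t) <= Mq t"
proof -
 note [measurable (raw)] = jm_compose[OF jm_econv[OF jm_Xt jm_Xt]]
 note [measurable (raw)] = jm_compose[OF jm_Xt]
 have "chi1 (Zt t) = (nint xi. \<integral>\<^sup>+s. en xi * econv (Xt s) (Xt s) xi * ind t s * ennreal (1 / norm xi) \<partial>lborel)"
  unfolding chi1_def Zt_def by (intro nn_integral_cong) (simp add: nn_integral_multc)
 also have "... <= (nint xi. \<integral>\<^sup>+s. econv (Xt s) (Xt s) xi * ind t s \<partial>lborel)"
 proof (intro nn_integral_mono)
  fix xi :: R3 and s :: real
  have "en xi * ennreal (1 / norm xi) <= 1" by (subst ennreal_mult[symmetric]) (auto simp: ennreal_le_1)
  from mult_right_mono[OF this, of "econv (Xt s) (Xt s) xi * ind t s"]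
  show "en xi * econv (Xt s) (Xt s) xi * ind t s * ennreal (1 / norm xi) <= econv (Xt s) (Xt s) xi * ind t s"
   by (simp add: mult_ac)
 qed
 also have "... = (nint s. \<integral>\<^sup>+xi. econv (Xt s) (Xt s) xi * ind t s \<partial>lborel)"
  by (rule lborel_pair.Fubini') measurable
 also have "... = Mq t"
  unfolding Mq_def by (intro nn_integral_cong) (simp add: nn_integral_multc nn_integral_econv)
 finally show ?thesis .
qed

lemma Q_le_Xt: "Q t xi <= Xt t xi" and Wt_le_Xt: "Wt t xi <= Xt t xi" by (simp_all add: Xt_def)

lemma wt_b_le_econv:
 assumes s: "s >= 0"
 shows "ennreal (wt s xi * b s xi) <= ennreal (n * c) * (en xi * econv (Xt s) (Xt s) xi)"
proof -
 have "wt s xi * b s xi <= (wt s xi)\<^sup>2 * b s xi"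
  using wt_ge_1[OF s, of xi] by (intro mult_right_mono b0) (simp add: power2_eq_square)
 hence "ennreal (wt s xi * b s xi) <= ennreal ((wt s xi)\<^sup>2 * b s xi)" by (rule ennreal_leI)
 also have "... <= ennreal (n * c * norm xi) * econv (Q s) (Q s) xi" by (rule b_le[OF s])
 also have "... <= ennreal (n * c * norm xi) * econv (Xt s) (Xt s) xi"
  by (intro mult_left_mono econv_mono Q_le_Xt) auto
 also have "... = ennreal (n * c) * (en xi * econv (Xt s) (Xt s) xi)"
  using n c by (simp add: ennreal_mult mult_ac)
 finally show ?thesis .
qed

text \<open>In the summed recursion the kernels are dropped and every convolution is absorbed in
  that of \<open>Xt\<close> with itself: \<open>n * c\<close> comes from the forcing,
  \<open>2 * c\<close> from the steps. Time enters the bound only through \<open>Zt\<close>, which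
  is monotone.\<close>

lemma Wt_le:
 assumes t: "t >= 0"
 shows "Wt t xi <= ennreal K * (ennreal (A xi) + ennreal ((n + 2) * c) * Zt t xi)"
proof -
 note [measurable (raw)] = jm_compose[OF jm_econv[OF jm_Xt jm_Xt]]
 note [measurable (raw)] = jm_compose[OF jm_econv[OF jm_Xt conjunct1[OF jm_maj]]]
 note [measurable (raw)] = jm_compose[OF jm_Xt] jm_compose[OF conjunct1[OF jm_maj]]
 have 1: "dn 0 t xi <= ennreal K * (ennreal (A xi) + ennreal (n * c) * Zt t xi)"
 proof -
  have "ennreal (hk k' t xi) <= 1" using ka t by (simp add: ennreal_le_1)
  from mult_right_mono[OF this, of "ennreal (A xi)"]
  have a: "ennreal (hk k' t xi) * ennreal (A xi) <= ennreal (A xi)" by simp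
  have "duhamel k' (%s xi. ennreal (wt s xi * b s xi)) t xi <= (\<integral>\<^sup>+s\<in>{0..t}. ennreal (wt s xi * b s xi) \<partial>lborel)"
   by (rule duhamel_le_integral) (use ka in simp)
  also have "... <= (nint s. ennreal (n * c) * (en xi * econv (Xt s) (Xt s) xi * ind t s))"
  proof (intro nn_integral_mono)
   fix s
   show "ennreal (wt s xi * b s xi) * ind t s <= ennreal (n * c) * (en xi * econv (Xt s) (Xt s) xi * ind t s)"
    using wt_b_le_econv[of s xi] by (auto simp: indicator_def)
  qed
  also have "... = ennreal (n * c) * Zt t xi"
   unfolding Zt_def by (rule nn_integral_cmult) measurable
  finally have b: "duhamel k' (%s xi. ennreal (wt s xi * b s xi)) t xi <= ennreal (n * c) * Zt t xi" .
  show ?thesis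
   unfolding dn_0 d0_def distrib_left by (intro add_mono mult_left_mono a b) auto
 qed
 have 2: "(\<Sum>m. dn (Suc m) t xi) <= ennreal K * (ennreal (2 * c) * Zt t xi)"
 proof -
  have "dn (Suc m) t xi <= ennreal K * (nint s. ennreal (2 * c * norm xi) * (econv (Xt s) (dn m s) xi * ind t s))" for m
  proof -
   have "dn (Suc m) t xi <= ennreal K * (\<integral>\<^sup>+s\<in>{0..t}. ennreal (2 * c * norm xi) * econv (%eta. Q s eta + Wn m s eta) (dn m s) xi \<partial>lborel)"
    unfolding dn_Suc step_def by (intro mult_left_mono duhamel_le_integral) (use ka in auto)
   also have "... <= ennreal K * (nint s. ennreal (2 * c * norm xi) * (econv (Xt s) (dn m s) xi * ind t s))"
    unfolding mult.assoc
    by (intro mult_left_mono nn_integral_mono mult_right_mono econv_mono) (auto simp: Xt_def intro: add_left_mono Wn_le_Wt)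
   finally show ?thesis .
  qed
  hence "(\<Sum>m. dn (Suc m) t xi) <= (\<Sum>m. ennreal K * (nint s. ennreal (2 * c * norm xi) * (econv (Xt s) (dn m s) xi * ind t s)))"
   by (intro suminf_le) auto
  also have "... = ennreal K * (nint s. (\<Sum>m. ennreal (2 * c * norm xi) * (econv (Xt s) (dn m s) xi * ind t s)))"
   by (subst nn_integral_suminf) auto
  also have "(nint s. (\<Sum>m. ennreal (2 * c * norm xi) * (econv (Xt s) (dn m s) xi * ind t s))) =
    (nint s. ennreal (2 * c) * (en xi * econv (Xt s) (Wt s) xi * ind t s))"
  proof (intro nn_integral_cong)
   fix s
   have "econv (Xt s) (Wt s) xi = (\<Sum>m. econv (Xt s) (dn m s) xi)"
    unfolding econv_def Wt_def by (subst nn_integral_suminf[symmetric]) auto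
   note e1 = this
   show "(\<Sum>m. ennreal (2 * c * norm xi) * (econv (Xt s) (dn m s) xi * ind t s)) =
     ennreal (2 * c) * (en xi * econv (Xt s) (Wt s) xi * ind t s)"
   proof -
    have e2: "ennreal (2 * (c * norm xi)) = ennreal (2 * c) * en xi"
     using c by (subst ennreal_mult[symmetric]) (auto simp: mult.assoc)
    show ?thesis by (simp only: e1 e2 ennreal_suminf_cmult ennreal_suminf_multc mult.assoc)
   qed
  qed
  also have "... <= (nint s. ennreal (2 * c) * (en xi * econv (Xt s) (Xt s) xi * ind t s))"
   by (intro nn_integral_mono mult_left_mono mult_right_mono econv_mono Wt_le_Xt) auto
  also have "... = ennreal (2 * c) * Zt t xi"
   unfolding Zt_def by (rule nn_integral_cmult) measurable
  finally show ?thesis by (simp add: mult_left_mono)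
 qed
 have "Wt t xi = (\<Sum>m. dn (m + 1) t xi) + (\<Sum>m<1. dn m t xi)"
  unfolding Wt_def by (rule suminf_offset) simp
 hence "Wt t xi = dn 0 t xi + (\<Sum>m. dn (Suc m) t xi)" by (simp add: add.commute)
 also have "... <= ennreal K * (ennreal (A xi) + ennreal (n * c) * Zt t xi) + ennreal K * (ennreal (2 * c) * Zt t xi)"
  by (intro add_mono 1 2)
 also have "... = ennreal K * (ennreal (A xi) + ennreal ((n + 2) * c) * Zt t xi)"
  using n c by (simp add: distrib_left distrib_right ennreal_plus add_ac)
 finally show ?thesis .
qed

end

subsection \<open>Solution of the transformed system\<close>

definition heat_flow :: "('i => real) => ('i => R3 => complex) => 'i => real => R3 => complex" where
 "heat_flow kas v i t xi = of_real (hk (kas i) t xi) * v i xi"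

definition quad :: "('i::finite => 'i => 'i => R3 => complex) => ('i => R3 => complex) => 'i => R3 => complex" where
 "quad m y i xi = (SU j. SU k. m i j k xi * fconv (y j) (y k) xi)"

definition cduh :: "real => (real => R3 => complex) => real => R3 => complex" where
 "cduh k g t xi = (lint s. ind t s *\<^sub>R (of_real (hk k (t - s) xi) * g s xi))"

lemma ennreal_norm_integral_le:
 fixes f :: "'a => 'b::{banach,second_countable_topology}"
 shows "en (integral\<^sup>L M f) <= (\<integral>\<^sup>+x. en (f x) \<partial>M)"
 by (cases "integrable M f") (auto simp: not_integrable_integral_eq intro: integral_norm_bound_ennreal)

lemma fconv_weight:
 assumes sub: "!!eta. om xi <= om (xi - eta) * om eta" and pos: "!!eta. om eta >= 0"
  and [measurable]: "v \<in> BM" "w \<in> BM"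
  and v: "AE eta in lborel. ennreal (om eta * norm (v eta)) <= X eta"
  and w: "AE eta in lborel. ennreal (om eta * norm (w eta)) <= Y eta"
 shows "ennreal (om xi * norm (fconv v w xi)) <= econv X Y xi"
proof -
 have "ennreal (om xi * norm (fconv v w xi)) <= ennreal (om xi) * econv (%xi. en (v xi)) (%xi. en (w xi)) xi"
  unfolding ennreal_mult[OF pos norm_ge_zero] by (intro mult_left_mono ennreal_norm_fconv_le) simp
 also have "... <= econv X Y xi"
 proof (cases "om xi = 0")
  case False
  hence "om xi > 0" using pos[of xi] by simp
  have "ennreal (om xi) * econv (%xi. en (v xi)) (%xi. en (w xi)) xi \<le>
    (nint eta. ennreal (om xi) * (en (v (xi - eta)) * en (w eta)))"
   unfolding econv_def by (simp add: nn_integral_cmult)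
  also have "... <= (nint eta. X (xi - eta) * Y eta)"
  proof (rule nn_integral_mono_AE)
   show "AE eta in lborel. ennreal (om xi) * (en (v (xi - eta)) * en (w eta)) <= X (xi - eta) * Y eta"
    using AE_reflect_R3[OF v, of xi] w
   proof eventually_elim
    case (elim eta)
    have "ennreal (om xi) * (en (v (xi - eta)) * en (w eta)) \<le>
      ennreal (om (xi - eta) * om eta) * (en (v (xi - eta)) * en (w eta))"
     by (intro mult_right_mono ennreal_leI sub) auto
    also have "... = ennreal (om (xi - eta) * norm (v (xi - eta))) * ennreal (om eta * norm (w eta))"
     using pos by (simp add: ennreal_mult mult_ac)
    also have "... <= X (xi - eta) * Y eta" by (intro mult_mono elim) auto
    finally show ?case .
   qed
  qed
  finally show ?thesis unfolding econv_def .
 qed simp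
 finally show ?thesis .
qed

lemma fconv_integrand_integrable:
 fixes v w :: "R3 => complex"
 assumes [measurable]: "v \<in> BM" "w \<in> BM"
  and v: "AE eta in lborel. en (v eta) <= X eta"
  and w: "AE eta in lborel. en (w eta) <= X eta"
  and fin: "econv X X xi < \<infinity>"
 shows "integrable lborel (%eta. v (xi - eta) * w eta)"
proof (rule integrableI_bounded)
 have "(nint eta. en (v (xi - eta) * w eta)) <= econv X X xi"
  unfolding econv_def
 proof (rule nn_integral_mono_AE)
  show "AE eta in lborel. en (v (xi - eta) * w eta) <= X (xi - eta) * X eta"
   using AE_reflect_R3[OF v, of xi] w by eventually_elim (auto simp: norm_mult ennreal_mult intro!: mult_mono)
 qed
 with fin show "(nint eta. en (v (xi - eta) * w eta)) < \<infinity>" by (rule le_less_trans[rotated])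
qed measurable

lemma quad_weight:
 assumes sub: "!!eta. om xi <= om (xi - eta) * om eta" and pos: "!!eta. om eta >= 0"
  and m: "(SU j. SU k. norm (m i j k xi)) <= c * norm xi"
  and ym: "!!j. y j \<in> BM"
  and y: "!!j. AE eta in lborel. ennreal (om eta * norm (y j eta)) <= X eta"
 shows "ennreal (om xi * norm (quad m y i xi)) <= ennreal (c * norm xi) * econv X X xi"
proof -
 have "om xi * norm (quad m y i xi) <= (SU j. SU k. norm (m i j k xi) * (om xi * norm (fconv (y j) (y k) xi)))"
 proof -
  have "norm (quad m y i xi) <= (SU j. SU k. norm (m i j k xi) * norm (fconv (y j) (y k) xi))"
   unfolding quad_def norm_mult[symmetric] by (intro order_trans[OF norm_sum] sum_mono norm_sum)
  from mult_left_mono[OF this pos[of xi]] show ?thesis by (simp add: sum_distrib_left mult_ac)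
 qed
 hence "ennreal (om xi * norm (quad m y i xi)) <= ennreal (SU j. SU k. norm (m i j k xi) * (om xi * norm (fconv (y j) (y k) xi)))"
  by (rule ennreal_leI)
 also have "... = (SU j. SU k. en (m i j k xi) * ennreal (om xi * norm (fconv (y j) (y k) xi)))"
  using pos by (simp add: sum_ennreal[symmetric] ennreal_mult sum_nonneg)
 also have "... <= (SU j. SU k. en (m i j k xi) * econv X X xi)"
  by (intro sum_mono mult_left_mono fconv_weight sub pos y ym) auto
 also have "... = ennreal (SU j. SU k. norm (m i j k xi)) * econv X X xi"
 proof -
  have "ennreal (SU j. SU k. norm (m i j k xi)) = (SU j. SU k. en (m i j k xi))"
   by (simp add: sum_ennreal sum_nonneg)
  thus ?thesis by (simp only: sum_distrib_right)
 qed
 also have "... <= ennreal (c * norm xi) * econv X X xi" by (intro mult_right_mono ennreal_leI m) auto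
 finally show ?thesis .
qed

text \<open>For convolutions, y * y - z * z = (y - z) * y + z * (y - z). Finiteness at the given
  frequency is required because the integral is additive only on integrable functions.\<close>

lemma quad_diff_weight:
 assumes sub: "!!eta. om xi <= om (xi - eta) * om eta" and one: "!!eta. om eta >= 1"
  and m: "(SU j. SU k. norm (m i j k xi)) <= c * norm xi" and c: "c >= 0"
  and [measurable]: "!!j. y j \<in> BM" "!!j. z j \<in> BM"
   "X \<in> BM" "D \<in> BM"
  and y: "!!j. AE eta in lborel. ennreal (om eta * norm (y j eta)) <= X eta"
  and z: "!!j. AE eta in lborel. ennreal (om eta * norm (z j eta)) <= X eta"
  and d: "!!j. AE eta in lborel. ennreal (om eta * norm (y j eta - z j eta)) <= D eta"
  and fin: "econv X X xi < \<infinity>"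
 shows "ennreal (om xi * norm (quad m y i xi - quad m z i xi)) <= ennreal (2 * c * norm xi) * econv X D xi"
proof -
 have pos: "om eta >= 0" for eta using one[of eta] by simp
 have drop: "AE eta in lborel. en (u eta) <= X eta" if "AE eta in lborel. ennreal (om eta * norm (u eta)) <= X eta"
  for u :: "R3 => complex"
  using that
 proof eventually_elim
  case (elim eta)
  have "1 * norm (u eta) <= om eta * norm (u eta)" by (intro mult_right_mono one) auto
  hence "en (u eta) <= ennreal (om eta * norm (u eta))" by (intro ennreal_leI) simp
  thus ?case using elim by (rule order_trans)
 qed
 have i: "integrable lborel (%eta. u (xi - eta) * w eta)"
  if "u \<in> BM" "w \<in> BM"
   "AE eta in lborel. ennreal (om eta * norm (u eta)) <= X eta" "AE eta in lborel. ennreal (om eta * norm (w eta)) <= X eta" for u w :: "R3 => complex"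
  by (rule fconv_integrand_integrable[OF that(1,2) drop[OF that(3)] drop[OF that(4)] fin])
 have split: "fconv (y j) (y k) xi - fconv (z j) (z k) xi =
   fconv (%eta. y j eta - z j eta) (y k) xi + fconv (z j) (%eta. y k eta - z k eta) xi" for j k
  unfolding fconv_def diff_divide_distrib[symmetric] add_divide_distrib[symmetric]
  using i[OF _ _ y y, of j k] i[OF _ _ z z, of j k] i[OF _ _ z y, of j k]
  by (simp add: left_diff_distrib right_diff_distrib)
 have le: "ennreal (om xi * norm (fconv (y j) (y k) xi - fconv (z j) (z k) xi)) <= 2 * econv X D xi" for j k
 proof -
  have "om xi * norm (fconv (y j) (y k) xi - fconv (z j) (z k) xi) \<le>
    om xi * norm (fconv (%eta. y j eta - z j eta) (y k) xi) + om xi * norm (fconv (z j) (%eta. y k eta - z k eta) xi)"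
   unfolding split distrib_left[symmetric] by (intro mult_left_mono norm_triangle_ineq pos)
  hence "ennreal (om xi * norm (fconv (y j) (y k) xi - fconv (z j) (z k) xi)) \<le>
    ennreal (om xi * norm (fconv (%eta. y j eta - z j eta) (y k) xi) + om xi * norm (fconv (z j) (%eta. y k eta - z k eta) xi))"
   by (rule ennreal_leI)
  also have "... =
    ennreal (om xi * norm (fconv (%eta. y j eta - z j eta) (y k) xi)) + ennreal (om xi * norm (fconv (z j) (%eta. y k eta - z k eta) xi))"
   by (intro ennreal_plus mult_nonneg_nonneg pos norm_ge_zero)
  also have "... <= econv D X xi + econv X D xi" by (intro add_mono fconv_weight sub pos y z d) measurable
  also have "econv D X xi = econv X D xi" by (rule econv_commute) measurable
  finally show ?thesis by (simp add: mult_2)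
 qed
 have "om xi * norm (quad m y i xi - quad m z i xi) \<le>
   (SU j. SU k. norm (m i j k xi) * (om xi * norm (fconv (y j) (y k) xi - fconv (z j) (z k) xi)))"
 proof -
  have "quad m y i xi - quad m z i xi = (SU j. SU k. m i j k xi * (fconv (y j) (y k) xi - fconv (z j) (z k) xi))"
   unfolding quad_def by (simp add: sum_subtractf right_diff_distrib)
  hence "norm (quad m y i xi - quad m z i xi) <= (SU j. SU k. norm (m i j k xi) * norm (fconv (y j) (y k) xi - fconv (z j) (z k) xi))"
   unfolding norm_mult[symmetric] by (simp only:) (intro order_trans[OF norm_sum] sum_mono norm_sum)
  from mult_left_mono[OF this pos[of xi]] show ?thesis by (simp add: sum_distrib_left mult_ac)
 qed
 hence "ennreal (om xi * norm (quad m y i xi - quad m z i xi)) \<le>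
   ennreal (SU j. SU k. norm (m i j k xi) * (om xi * norm (fconv (y j) (y k) xi - fconv (z j) (z k) xi)))"
  by (rule ennreal_leI)
 also have "... = (SU j. SU k. en (m i j k xi) * ennreal (om xi * norm (fconv (y j) (y k) xi - fconv (z j) (z k) xi)))"
  using pos by (simp add: sum_ennreal[symmetric] ennreal_mult sum_nonneg)
 also have "... <= (SU j. SU k. en (m i j k xi) * (2 * econv X D xi))"
  by (intro sum_mono mult_left_mono le) auto
 also have "... = ennreal (SU j. SU k. norm (m i j k xi)) * (2 * econv X D xi)"
 proof -
  have "ennreal (SU j. SU k. norm (m i j k xi)) = (SU j. SU k. en (m i j k xi))"
   by (simp add: sum_ennreal sum_nonneg)
  thus ?thesis by (simp only: sum_distrib_right)
 qed
 also have "... <= ennreal (c * norm xi) * (2 * econv X D xi)" by (intro mult_right_mono ennreal_leI m) auto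
 also have "... = ennreal (2 * c * norm xi) * econv X D xi" using c by (simp add: ennreal_mult mult_ac)
 finally show ?thesis .
qed

lemma jm_quad:
 assumes "!!j. jm (y j)" and [measurable]: "!!i j k. m i j k \<in> BM"
 shows "jm (%s. quad m (%j. y j s) i)"
proof -
 note [measurable (raw)] = jm_compose[OF jm_fconv[OF assms(1) assms(1)]]
 show ?thesis unfolding jm_def quad_def by measurable
qed

lemma jm_heat_flow:
 assumes [measurable]: "!!i. v i \<in> BM"
 shows "jm (heat_flow kas v i)"
 unfolding jm_def heat_flow_def by measurable

lemma jm_cduh:
 assumes "jm g"
 shows "jm (cduh k g)"
proof -
 note [measurable (raw)] = jm_compose[OF assms(1)]
 show ?thesis unfolding jm_def cduh_def indicator_def atLeastAtMost_iff by measurable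
qed

lemma cduh_weight:
 assumes ka: "ka > 0" and k: "k >= ka" and t: "t >= 0" and g: "jm g"
 shows "ennreal (wt t xi * norm (cduh k g t xi)) \<le>
   ennreal (heat_const ka) * duhamel (ka / 2) (%s xi. ennreal (wt s xi * norm (g s xi))) t xi"
proof -
 note [measurable (raw)] = jm_compose[OF g]
 have wm[measurable]: "(%s. wt s xi) \<in> BM" unfolding wt_def by measurable
 have wp: "wt s xi > 0" for s by (simp add: wt_def)
 have Kp: "heat_const ka > 0" by (simp add: heat_const_def)
 have "ennreal (wt t xi * norm (cduh k g t xi)) = ennreal (wt t xi) * en (cduh k g t xi)"
  using wp[of t] by (intro ennreal_mult) auto
 also have "... <= ennreal (wt t xi) * (nint s. en (ind t s *\<^sub>R (of_real (hk k (t - s) xi) * g s xi)))"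
  unfolding cduh_def by (intro mult_left_mono ennreal_norm_integral_le) auto
 also have "... = (nint s. ennreal (wt t xi) * en (ind t s *\<^sub>R (of_real (hk k (t - s) xi) * g s xi)))"
  by (rule nn_integral_cmult[symmetric]) measurable
 also have "... <= (nint s. ennreal (heat_const ka) * (ennreal (hk (ka / 2) (t - s) xi) * ennreal (wt s xi * norm (g s xi)) * ind t s))"
 proof (intro nn_integral_mono)
  fix s
  show "ennreal (wt t xi) * en (ind t s *\<^sub>R (of_real (hk k (t - s) xi) * g s xi)) \<le>
   ennreal (heat_const ka) * (ennreal (hk (ka / 2) (t - s) xi) * ennreal (wt s xi * norm (g s xi)) * ind t s)"
  proof (cases "s \<in> {0..t}")
   case True
   have "wt t xi * hk k (t - s) xi * norm (g s xi) \<le>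
     heat_const ka * hk (ka / 2) (t - s) xi * wt s xi * norm (g s xi)"
    by (rule mult_right_mono[OF wt_duhamel[OF ka _ _ k]]) (use True in auto)
   hence "ennreal (wt t xi * hk k (t - s) xi * norm (g s xi)) \<le>
     ennreal (heat_const ka * hk (ka / 2) (t - s) xi * wt s xi * norm (g s xi))" by (rule ennreal_leI)
   thus ?thesis
    using True wp[of s] wp[of t] Kp by (simp add: norm_mult ennreal_mult mult.assoc less_imp_le)
  qed simp
 qed
 also have "... = ennreal (heat_const ka) * duhamel (ka / 2) (%s xi. ennreal (wt s xi * norm (g s xi))) t xi"
  unfolding duhamel_def by (rule nn_integral_cmult) measurable
 finally show ?thesis .
qed

text \<open>The data \<open>ph0\<close> may be large; small are only \<open>a\<close> and, by
  \<open>quad_small\<close>, the quadratic term of the heat flow of \<open>ph0\<close>. The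
  viscosities may differ; the majorant runs with their common lower bound \<open>ka\<close>.\<close>

locale mild_system =
 fixes kas :: "'i::finite => real" and ka c P \<delta> :: real
  and m :: "'i => 'i => 'i => R3 => complex" and a ph0 :: "'i => R3 => complex"
 assumes ka_pos: "ka > 0" and ka_le: "!!i. ka <= kas i" and c_pos: "c > 0" and P_nonneg: "P >= 0" and \<delta>_nonneg: "\<delta> >= 0"
  and m_meas[measurable]: "!!i j k. m i j k \<in> BM"
  and m_bound: "!!i xi. (SU j. SU k. norm (m i j k xi)) <= c * norm xi"
  and a_meas[measurable]: "!!i. a i \<in> BM"
  and ph0_meas[measurable]: "!!i. ph0 i \<in> BM"
  and ph0_mass: "(nint xi. ennreal (SU i. norm (ph0 i xi))) <= ennreal P"
  and ph0_low: "(nint xi. ennreal ((SU i. norm (ph0 i xi)) / nsq xi)) <= ennreal P"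
  and a_small: "chi1 (%xi. ennreal (SU i. norm (a i xi))) <= ennreal \<delta>"
  and quad_small: "!!t. t >= 0 ==>
   (\<integral>\<^sup>+s\<in>{0..t}. chi1 (%xi. ennreal (SU i. norm (quad m (%j. heat_flow kas ph0 j s) i xi))) \<partial>lborel) <= ennreal \<delta>"
  and \<delta>_small: "\<delta> <= small_const ka c P (real CARD('i))"

lemma heat_flow_weight:
 fixes kas :: "'i::finite => real"
 assumes "ka > 0" "ka <= kas i" "t >= 0"
 shows "ennreal ((wt t xi)\<^sup>2 * norm (heat_flow kas v i t xi)) <= heat_maj ka (%xi. SU i. norm (v i xi)) t xi"
proof -
 have "(wt t xi)\<^sup>2 * norm (heat_flow kas v i t xi) = (wt t xi)\<^sup>2 * hk (kas i) t xi * norm (v i xi)"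
  by (simp add: heat_flow_def norm_mult mult.assoc)
 also have "... <= heat_const ka * hk (ka / 2) t xi * (SU i. norm (v i xi))"
 proof -
  have 1: "(wt t xi)\<^sup>2 * hk (kas i) t xi <= heat_const ka * hk (ka / 2) t xi"
   by (rule wt_heat[OF assms(1,3,2)])
  have 2: "norm (v i xi) <= (SU i. norm (v i xi))" by (rule member_le_sum) auto
  show ?thesis by (rule mult_mono[OF 1 2]) (auto simp: heat_const_def)
 qed
 finally show ?thesis unfolding heat_maj_def by (rule ennreal_leI)
qed

text \<open>The square of the weight is again submultiplicative, so \<open>quad_weight\<close>
  bounds the quadratic term of the background by a convolution of majorants; summation over the
  components gives the factor CARD('i).\<close>

sublocale mild_system \<subseteq> majorant ka c P \<delta> "real CARD('i)" "%xi. SU i. norm (ph0 i xi)" "%xi. SU i. norm (a i xi)"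
 "%s xi. SU i. norm (quad m (%j. heat_flow kas ph0 j s) i xi)"
proof (unfold_locales)
 show "jm (%s xi. SU i. norm (quad m (%j. heat_flow kas ph0 j s) i xi))"
 proof -
  note [measurable (raw)] = jm_compose[OF jm_quad[OF jm_heat_flow[OF ph0_meas] m_meas]]
  show ?thesis unfolding jm_def by measurable
 qed
 fix s :: real and xi :: R3 assume s: "s >= 0"
 have one: "ennreal ((wt s xi)\<^sup>2 * norm (quad m (%j. heat_flow kas ph0 j s) i xi)) \<le>
   ennreal (c * norm xi) * econv (heat_maj ka (%xi. SU i. norm (ph0 i xi)) s) (heat_maj ka (%xi. SU i. norm (ph0 i xi)) s) xi" for i
 proof (rule quad_weight[where om = "%eta. (wt s eta)\<^sup>2"])
  show "(wt s xi)\<^sup>2 <= (wt s (xi - eta))\<^sup>2 * (wt s eta)\<^sup>2" for eta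
   unfolding power_mult_distrib[symmetric] by (intro power_mono wt_submult s) (simp add: wt_def)
  show "heat_flow kas ph0 j s \<in> BM" for j by (rule jm_at[OF jm_heat_flow]) measurable
  show "AE eta in lborel. ennreal ((wt s eta)\<^sup>2 * norm (heat_flow kas ph0 j s eta)) <= heat_maj ka (%xi. SU i. norm (ph0 i xi)) s eta" for j
   by (intro AE_I2 heat_flow_weight ka_pos ka_le s)
 qed (use m_bound in auto)
 have "ennreal ((wt s xi)\<^sup>2 * (SU i. norm (quad m (%j. heat_flow kas ph0 j s) i xi))) =
   (SU i. ennreal ((wt s xi)\<^sup>2 * norm (quad m (%j. heat_flow kas ph0 j s) i xi)))"
  by (simp add: sum_distrib_left sum_ennreal)
 also have "... <= (\<Sum>i\<in>(UNIV::'i set). ennreal (c * norm xi) * econv (heat_maj ka (%xi. SU i. norm (ph0 i xi)) s) (heat_maj ka (%xi. SU i. norm (ph0 i xi)) s) xi)"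
  by (intro sum_mono one)
 also have "... = ennreal (real CARD('i) * c * norm xi) * econv (heat_maj ka (%xi. SU i. norm (ph0 i xi)) s) (heat_maj ka (%xi. SU i. norm (ph0 i xi)) s) xi"
  using c_pos by (simp add: ennreal_mult ennreal_of_nat_eq_real_of_nat mult.assoc)
 finally show "ennreal ((wt s xi)\<^sup>2 * (SU i. norm (quad m (%j. heat_flow kas ph0 j s) i xi))) \<le>
  ennreal (real CARD('i) * c * norm xi) * econv (heat_maj ka (%xi. SU i. norm (ph0 i xi)) s) (heat_maj ka (%xi. SU i. norm (ph0 i xi)) s) xi" .
qed (use ka_pos c_pos P_nonneg \<delta>_nonneg ph0_mass ph0_low a_small quad_small \<delta>_small in \<open>auto intro: sum_nonneg\<close>)

section \<open>The iterates in Fourier variables and their limit\<close>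

context mild_system
begin

abbreviation "ph \<equiv> heat_flow kas ph0"

text \<open>The iteration starts at the heat flow of the large data alone; the small data enter with
  the first increment.\<close>

primrec xs :: "nat => 'i => real => R3 => complex" where
 "xs 0 = ph"
| "xs (Suc l) = (%i t xi. heat_flow kas (%i xi. ph0 i xi + a i xi) i t xi +
   cduh (kas i) (%s. quad m (%j. xs l j s) i) t xi)"

text \<open>A set of full measure on which all Duhamel integrals converge at all times; integer
  times suffice because \<open>Zt\<close> is monotone. Fixing it once makes the later identities
  hold at each of its points for all times simultaneously.\<close>

definition GG :: "R3 set" where
 "GG = {xi. xi ~= 0 & (\<forall>N::nat. Zt (real N) xi < \<infinity>)}"

definition x :: "'i => real => R3 => complex" where
 "x i t xi = (if xi \<in> GG then lim (%l. xs l i t xi) else 0)"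

definition dominated :: "('i => real => R3 => complex) => bool" where
 "dominated y \<longleftrightarrow> (\<forall>j. jm (y j)) & (\<forall>j s xi. s >= 0 \<longrightarrow> xi \<in> GG \<longrightarrow> ennreal (wt s xi * norm (y j s xi)) <= Xt s xi)"

lemma jm_xs: "jm (xs l i)"
proof (induction l arbitrary: i)
 case 0
 thus ?case by (simp add: jm_heat_flow)
next
 case (Suc l)
 have 1: "jm (heat_flow kas (%i xi. ph0 i xi + a i xi) i)" by (intro jm_heat_flow) measurable
 have 2: "jm (cduh (kas i) (%s. quad m (%j. xs l j s) i))" by (intro jm_cduh jm_quad Suc m_meas)
 show ?case using 1 2 unfolding jm_def xs.simps by measurable
qed

lemma GG_measurable[measurable]: "GG \<in> sets borel"
proof -
 have [measurable]: "Zt (real N) \<in> BM" for N by (rule Zt_measurable)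
 have "GG = (- {0}) \<inter> (\<Inter>N. {xi \<in> space borel. Zt (real N) xi < \<infinity>})" by (auto simp: GG_def)
 also have "... \<in> sets borel" by measurable
 finally show ?thesis .
qed

lemma GG_Z: "xi \<in> GG ==> Zt t xi < \<infinity>"
proof -
 assume g: "xi \<in> GG"
 obtain N :: nat where "t <= real N" using real_arch_simple by blast
 hence "Zt t xi <= Zt (real N) xi" by (rule Zt_mono)
 also have "... < \<infinity>" using g by (simp add: GG_def)
 finally show ?thesis .
qed

text \<open>For each integer time the weighted integral of \<open>Zt\<close> is at most
  \<open>Mq\<close>, which is finite; the countably many null sets are then united.\<close>

lemma AE_GG: "AE xi in lborel. xi \<in> GG"
proof -
 have "AE xi in lborel. Zt (real N) xi < \<infinity>" for N :: nat
 proof -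
  have [measurable]: "Zt (real N) \<in> BM" by (rule Zt_measurable)
  have "chi1 (Zt (real N)) < \<infinity>" using chi1_Zt Mq_finite by (rule le_less_trans) simp
  hence "AE xi in lborel. Zt (real N) xi * ennreal (1 / norm xi) ~= \<infinity>"
   unfolding chi1_def by (intro nn_integral_PInf_AE) auto
  thus ?thesis
   using AE_nonzero_R3
  proof eventually_elim
   case (elim xi)
   have "ennreal (1 / norm xi) ~= 0" using elim(2) by simp
   thus ?case using elim(1) by (auto simp: less_top ennreal_mult_eq_top_iff)
  qed
 qed
 hence "AE xi in lborel. \<forall>N::nat. Zt (real N) xi < \<infinity>" by (simp add: AE_all_countable)
 thus ?thesis using AE_nonzero_R3 by eventually_elim (auto simp: GG_def)
qed

lemma GG_econv:
 assumes "xi \<in> GG"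
 shows "AE s in lborel. s \<in> {0..t} \<longrightarrow> econv (Xt s) (Xt s) xi < \<infinity>"
proof -
 note [measurable (raw)] = jm_compose[OF jm_econv[OF jm_Xt jm_Xt]]
 have "(nint s. en xi * econv (Xt s) (Xt s) xi * ind t s) ~= \<infinity>"
  using GG_Z[OF assms, of t] unfolding Zt_def by simp
 hence "AE s in lborel. en xi * econv (Xt s) (Xt s) xi * ind t s ~= \<infinity>"
  by (intro nn_integral_PInf_AE) auto
 thus ?thesis
 proof eventually_elim
  case (elim s)
  have "en xi ~= 0" using assms by (simp add: GG_def)
  thus ?case using elim by (auto simp: less_top ennreal_mult_eq_top_iff)
 qed
qed

lemma dominated_quad:
 assumes y: "dominated y" and s: "s >= 0"
 shows "en (quad m (%j. y j s) i xi) <= ennreal (c * norm xi) * econv (Xt s) (Xt s) xi"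
proof -
 have "1 * norm (quad m (%j. y j s) i xi) <= wt s xi * norm (quad m (%j. y j s) i xi)"
  by (intro mult_right_mono wt_ge_1 s) auto
 hence "en (quad m (%j. y j s) i xi) <= ennreal (wt s xi * norm (quad m (%j. y j s) i xi))"
  by (intro ennreal_leI) simp
 also have "... <= ennreal (c * norm xi) * econv (Xt s) (Xt s) xi"
 proof (rule quad_weight[where om = "wt s"])
  show "y j s \<in> BM" for j using y by (intro jm_at) (simp add: dominated_def)
  show "AE eta in lborel. ennreal (wt s eta * norm (y j s eta)) <= Xt s eta" for j
   using AE_GG by eventually_elim (use y s in \<open>simp add: dominated_def\<close>)
 qed (use m_bound wt_submult[OF s] in \<open>auto simp: wt_def\<close>)
 finally show ?thesis .
qed

lemma duhamel_integrand_bound: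
 assumes y: "dominated y" and k: "k >= 0"
 shows "en (ind t s *\<^sub>R (of_real (hk k (t - s) xi) * quad m (%j. y j s) i xi) :: complex)
   <= ennreal c * (en xi * econv (Xt s) (Xt s) xi * ind t s)"
proof (cases "s \<in> {0..t}")
 case True
 have "hk k (t - s) xi * norm (quad m (%j. y j s) i xi) <= 1 * norm (quad m (%j. y j s) i xi)"
  using True k by (intro mult_right_mono) auto
 hence "ennreal (hk k (t - s) xi * norm (quad m (%j. y j s) i xi)) <= en (quad m (%j. y j s) i xi)"
  by (intro ennreal_leI) simp
 also have "... <= ennreal (c * norm xi) * econv (Xt s) (Xt s) xi" by (rule dominated_quad[OF y]) (use True in simp)
 also have "... = ennreal c * (en xi * econv (Xt s) (Xt s) xi)"
  using c_pos by (simp add: ennreal_mult mult.assoc)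
 finally show ?thesis using True by (simp add: norm_mult)
qed simp

lemma duhamel_bound_integral:
 "(nint s. ennreal c * (en xi * econv (Xt s) (Xt s) xi * ind t s)) = ennreal c * Zt t xi"
proof -
 note [measurable (raw)] = jm_compose[OF jm_econv[OF jm_Xt jm_Xt]]
 show ?thesis unfolding Zt_def by (rule nn_integral_cmult) measurable
qed

lemma duhamel_integrand_measurable:
 assumes y: "dominated y"
 shows "(%s. ind t s *\<^sub>R (of_real (hk k (t - s) xi) * quad m (%j. y j s) i xi) :: complex) \<in> BM"
proof -
 have "jm (%s. quad m (%j. y j s) i)" by (rule jm_quad) (use y in \<open>auto simp: dominated_def\<close>)
 note [measurable (raw)] = jm_compose[OF this]
 show ?thesis by measurable
qed

lemma duhamel_integrable:
 assumes y: "dominated y" and k: "k >= 0" and g: "xi \<in> GG"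
 shows "integrable lborel (%s. ind t s *\<^sub>R (of_real (hk k (t - s) xi) * quad m (%j. y j s) i xi) :: complex)"
proof (rule integrableI_bounded)
 have "(nint s. en (ind t s *\<^sub>R (of_real (hk k (t - s) xi) * quad m (%j. y j s) i xi) :: complex))
   <= ennreal c * Zt t xi"
  unfolding duhamel_bound_integral[symmetric] by (intro nn_integral_mono duhamel_integrand_bound y k)
 also have "... < \<infinity>" using GG_Z[OF g, of t] by (simp add: ennreal_mult_less_top)
 finally show "(nint s. en (ind t s *\<^sub>R (of_real (hk k (t - s) xi) * quad m (%j. y j s) i xi) :: complex)) < \<infinity>" .
qed (use duhamel_integrand_measurable[OF y] in simp)

lemma cduh_le_Z:
 assumes y: "dominated y" and k: "k >= 0"
 shows "en (cduh k (%s. quad m (%j. y j s) i) t xi) <= ennreal c * Zt t xi"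
 unfolding cduh_def duhamel_bound_integral[symmetric]
 by (rule order_trans[OF ennreal_norm_integral_le]) (intro nn_integral_mono duhamel_integrand_bound y k)

lemma ph_weight: "t >= 0 ==> ennreal (wt t xi * norm (ph i t xi)) <= Q t xi"
proof -
 assume t: "t >= 0"
 have "wt t xi * norm (ph i t xi) <= (wt t xi)\<^sup>2 * norm (ph i t xi)"
  using wt_ge_1[OF t, of xi] by (intro mult_right_mono) (simp_all add: power2_eq_square)
 hence "ennreal (wt t xi * norm (ph i t xi)) <= ennreal ((wt t xi)\<^sup>2 * norm (ph i t xi))" by (rule ennreal_leI)
 also have "... <= Q t xi" by (rule heat_flow_weight[OF ka_pos ka_le t])
 finally show ?thesis .
qed

lemma kas_nonneg: "kas i >= 0"
 using ka_pos ka_le[of i] by simp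

lemma xs_step_0:
 assumes t: "t >= 0"
 shows "ennreal (wt t xi * norm (xs (Suc 0) i t xi - xs 0 i t xi)) <= dn 0 t xi"
proof -
 have wp: "wt t xi > 0" by (simp add: wt_def)
 have eq: "xs (Suc 0) i t xi - xs 0 i t xi = heat_flow kas a i t xi + cduh (kas i) (%s. quad m (%j. ph j s) i) t xi"
  by (simp add: heat_flow_def distrib_left)
 have 1: "ennreal (wt t xi * norm (heat_flow kas a i t xi)) <= ennreal K * (ennreal (hk k' t xi) * ennreal (SU i. norm (a i xi)))"
 proof -
  have "wt t xi * norm (heat_flow kas a i t xi) <= (wt t xi)\<^sup>2 * norm (heat_flow kas a i t xi)"
   using wt_ge_1[OF t, of xi] by (intro mult_right_mono) (simp_all add: power2_eq_square)
  hence "ennreal (wt t xi * norm (heat_flow kas a i t xi)) <= ennreal ((wt t xi)\<^sup>2 * norm (heat_flow kas a i t xi))" by (rule ennreal_leI)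
  also have "... <= heat_maj ka (%xi. SU i. norm (a i xi)) t xi" by (rule heat_flow_weight[OF ka_pos ka_le t])
  also have "... = ennreal K * (ennreal (hk k' t xi) * ennreal (SU i. norm (a i xi)))"
   unfolding heat_maj_def using const_pos(1) by (simp add: ennreal_mult sum_nonneg mult.assoc)
  finally show ?thesis .
 qed
 have 2: "ennreal (wt t xi * norm (cduh (kas i) (%s. quad m (%j. ph j s) i) t xi)) \<le>
   ennreal K * duhamel k' (%s xi. ennreal (wt s xi * (SU i. norm (quad m (%j. ph j s) i xi)))) t xi"
 proof -
  have "ennreal (wt t xi * norm (cduh (kas i) (%s. quad m (%j. ph j s) i) t xi)) \<le>
    ennreal K * duhamel k' (%s xi. ennreal (wt s xi * norm (quad m (%j. ph j s) i xi))) t xi"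
   by (intro cduh_weight ka_pos ka_le t jm_quad jm_heat_flow m_meas ph0_meas)
  also have "... <= ennreal K * duhamel k' (%s xi. ennreal (wt s xi * (SU i. norm (quad m (%j. ph j s) i xi)))) t xi"
   unfolding duhamel_def
  proof (intro mult_left_mono nn_integral_mono mult_right_mono ennreal_leI)
   show "norm (quad m (%j. ph j s) i xi) <= (SU i. norm (quad m (%j. ph j s) i xi))" for s
    by (rule member_le_sum) auto
  qed (auto simp: wt_def)
  finally show ?thesis .
 qed
 have "wt t xi * norm (xs (Suc 0) i t xi - xs 0 i t xi) \<le>
   wt t xi * norm (heat_flow kas a i t xi) + wt t xi * norm (cduh (kas i) (%s. quad m (%j. ph j s) i) t xi)"
  unfolding eq distrib_left[symmetric] using wp by (intro mult_left_mono norm_triangle_ineq) auto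
 hence "ennreal (wt t xi * norm (xs (Suc 0) i t xi - xs 0 i t xi)) \<le>
   ennreal (wt t xi * norm (heat_flow kas a i t xi) + wt t xi * norm (cduh (kas i) (%s. quad m (%j. ph j s) i) t xi))"
  by (rule ennreal_leI)
 also have "... = ennreal (wt t xi * norm (heat_flow kas a i t xi)) + ennreal (wt t xi * norm (cduh (kas i) (%s. quad m (%j. ph j s) i) t xi))"
  using wp by (intro ennreal_plus) auto
 also have "... <= dn 0 t xi"
  unfolding dn_0 d0_def by (intro add_mono 1 2)
 finally show ?thesis .
qed

text \<open>The two bounds go through one induction: the next increment is estimated by the sizes of
  both preceding iterates, and these sizes are sums of the earlier increments.\<close>

lemma xs_main:
 "(\<forall>i t xi. t >= 0 \<longrightarrow> xi \<in> GG \<longrightarrow> ennreal (wt t xi * norm (xs (Suc l) i t xi - xs l i t xi)) <= dn l t xi) &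
  (\<forall>i t xi. t >= 0 \<longrightarrow> xi \<in> GG \<longrightarrow> ennreal (wt t xi * norm (xs l i t xi)) <= Q t xi + (\<Sum>q<l. dn q t xi))"
proof (induction l)
 case 0
 show ?case using xs_step_0 ph_weight by (auto simp del: xs.simps(2))
next
 case (Suc l)
 hence A: "!!i t xi. t >= 0 ==> xi \<in> GG ==> ennreal (wt t xi * norm (xs (Suc l) i t xi - xs l i t xi)) <= dn l t xi"
  and B: "!!i t xi. t >= 0 ==> xi \<in> GG ==> ennreal (wt t xi * norm (xs l i t xi)) <= Q t xi + (\<Sum>q<l. dn q t xi)"
  by blast+
 have wp: "wt t xi > 0" for t xi by (simp add: wt_def)
 have B': "ennreal (wt t xi * norm (xs (Suc l) i t xi)) <= Q t xi + (\<Sum>q<Suc l. dn q t xi)" if t: "t >= 0" and g: "xi \<in> GG" for i t xi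
 proof -
  have "wt t xi * norm (xs (Suc l) i t xi) <= wt t xi * norm (xs l i t xi) + wt t xi * norm (xs (Suc l) i t xi - xs l i t xi)"
   unfolding distrib_left[symmetric] using wp[of t xi] norm_triangle_sub[of "xs (Suc l) i t xi" "xs l i t xi"]
   by (intro mult_left_mono) auto
  hence "ennreal (wt t xi * norm (xs (Suc l) i t xi)) <= ennreal (wt t xi * norm (xs l i t xi) + wt t xi * norm (xs (Suc l) i t xi - xs l i t xi))"
   by (rule ennreal_leI)
  also have "... = ennreal (wt t xi * norm (xs l i t xi)) + ennreal (wt t xi * norm (xs (Suc l) i t xi - xs l i t xi))"
   using wp[of t xi] by (intro ennreal_plus) auto
  also have "... <= (Q t xi + (\<Sum>q<l. dn q t xi)) + dn l t xi" by (intro add_mono A B t g)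
  finally show ?thesis by (simp add: add.assoc)
 qed
 have W: "(\<Sum>q<Suc l. dn q t xi) = Wn l t xi" for t xi unfolding Wn_sum lessThan_Suc_atMost ..
 have dom: "dominated (xs l)" "dominated (xs (Suc l))"
 proof -
  have "Q t xi + (\<Sum>q<l. dn q t xi) <= Xt t xi" for t xi
   unfolding Xt_def Wt_def by (intro add_left_mono sum_le_suminf) auto
  thus "dominated (xs l)" unfolding dominated_def using jm_xs B by (meson order_trans)
  have "Q t xi + (\<Sum>q<Suc l. dn q t xi) <= Xt t xi" for t xi
   unfolding Xt_def Wt_def by (intro add_left_mono sum_le_suminf) auto
  thus "dominated (xs (Suc l))" unfolding dominated_def using jm_xs B' by (meson order_trans)
 qed
 have A': "ennreal (wt t xi * norm (xs (Suc (Suc l)) i t xi - xs (Suc l) i t xi)) <= dn (Suc l) t xi" if t: "t >= 0" and g: "xi \<in> GG" for i t xi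
 proof -
  define g1 where "g1 = (%s. quad m (%j. xs (Suc l) j s) i)"
  define g2 where "g2 = (%s. quad m (%j. xs l j s) i)"
  have j12: "jm g1" "jm g2" unfolding g1_def g2_def by (intro jm_quad jm_xs m_meas)+
  \<comment> \<open>The heat flow of the data is common to both iterates and cancels.\<close>
  have "xs (Suc (Suc l)) i t xi - xs (Suc l) i t xi = cduh (kas i) g1 t xi - cduh (kas i) g2 t xi"
   by (subst xs.simps(2), subst (2) xs.simps(2)) (simp add: g1_def g2_def del: xs.simps)
  also have "... = cduh (kas i) (%s xi. g1 s xi - g2 s xi) t xi"
   unfolding cduh_def by (subst Bochner_Integration.integral_diff[symmetric])
     (use duhamel_integrable[OF dom(2) kas_nonneg g] duhamel_integrable[OF dom(1) kas_nonneg g] in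
      \<open>auto simp: g1_def g2_def right_diff_distrib scaleR_diff_right simp del: xs.simps\<close>)
  finally have eq: "xs (Suc (Suc l)) i t xi - xs (Suc l) i t xi = cduh (kas i) (%s xi. g1 s xi - g2 s xi) t xi" .
  have "ennreal (wt t xi * norm (cduh (kas i) (%s xi. g1 s xi - g2 s xi) t xi)) \<le>
    ennreal K * duhamel k' (%s xi. ennreal (wt s xi * norm (g1 s xi - g2 s xi))) t xi"
   by (rule cduh_weight[OF ka_pos ka_le t]) (use j12 in \<open>simp add: jm_def\<close>)
  also have "... <= ennreal K * duhamel k' (%s xi. ennreal (2 * c * norm xi) * econv (%eta. Q s eta + Wn l s eta) (dn l s) xi) t xi"
   unfolding duhamel_def
  proof (intro mult_left_mono nn_integral_mono_AE)
   show "AE s in lborel. ennreal (hk k' (t - s) xi) * ennreal (wt s xi * norm (g1 s xi - g2 s xi)) * ind t s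
    <= ennreal (hk k' (t - s) xi) * (ennreal (2 * c * norm xi) * econv (%eta. Q s eta + Wn l s eta) (dn l s) xi) * ind t s"
    using GG_econv[OF g, of t]
   proof eventually_elim
    case (elim s)
    show ?case
    proof (cases "s \<in> {0..t}")
     case True
     hence s: "s >= 0" and fin: "econv (Xt s) (Xt s) xi < \<infinity>" using elim by auto
     have "ennreal (wt s xi * norm (g1 s xi - g2 s xi)) <= ennreal (2 * c * norm xi) * econv (%eta. Q s eta + Wn l s eta) (dn l s) xi"
      unfolding g1_def g2_def
     proof (rule quad_diff_weight[where om = "wt s" and y = "%j. xs (Suc l) j s" and z = "%j. xs l j s"])
      show "xs (Suc l) j s \<in> BM" "xs l j s \<in> BM" for j by (intro jm_at jm_xs)+
      show "(%eta. Q s eta + Wn l s eta) \<in> BM" "dn l s \<in> BM"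
       using jm_at[OF jm_Q] jm_at[OF conjunct1[OF jm_maj]] jm_at[OF conjunct2[OF jm_maj]] by measurable
      show "AE eta in lborel. ennreal (wt s eta * norm (xs (Suc l) j s eta)) <= Q s eta + Wn l s eta" for j
       using AE_GG by eventually_elim (use B'[OF s] W in \<open>simp del: xs.simps\<close>)
      show "AE eta in lborel. ennreal (wt s eta * norm (xs l j s eta)) <= Q s eta + Wn l s eta" for j
       using AE_GG
      proof eventually_elim
       case (elim eta)
       have "Q s eta + (\<Sum>q<l. dn q s eta) <= Q s eta + Wn l s eta"
        unfolding W[symmetric] by (intro add_left_mono) simp
       thus ?case using B[OF s elim] by (rule order_trans[rotated])
      qed
      show "AE eta in lborel. ennreal (wt s eta * norm (xs (Suc l) j s eta - xs l j s eta)) <= dn l s eta" for j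
       using AE_GG by eventually_elim (rule A[OF s])
      have "econv (%eta. Q s eta + Wn l s eta) (%eta. Q s eta + Wn l s eta) xi <= econv (Xt s) (Xt s) xi"
       by (intro econv_mono) (auto simp: Xt_def intro: add_left_mono Wn_le_Wt)
      thus "econv (%eta. Q s eta + Wn l s eta) (%eta. Q s eta + Wn l s eta) xi < \<infinity>"
       using fin by (rule le_less_trans)
     qed (use m_bound wt_submult[OF s] wt_ge_1[OF s] c_pos in auto)
     thus ?thesis by (intro mult_right_mono mult_left_mono) auto
    qed simp
   qed
  qed auto
  also have "... = dn (Suc l) t xi" unfolding dn_Suc step_def ..
  finally show ?thesis unfolding eq .
 qed
 show ?case using A' B' by blast
qed

lemma xs_diff: "t >= 0 ==> xi \<in> GG ==> ennreal (wt t xi * norm (xs (Suc l) i t xi - xs l i t xi)) <= dn l t xi"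
 using xs_main by blast

lemma dominated_xs: "dominated (xs l)"
proof -
 have "Q t xi + (\<Sum>q<l. dn q t xi) <= Xt t xi" for t xi
  unfolding Xt_def Wt_def by (intro add_left_mono sum_le_suminf) auto
 thus ?thesis unfolding dominated_def using jm_xs xs_main by (meson order_trans)
qed

lemma Wt_finite: "t >= 0 ==> xi \<in> GG ==> Wt t xi < \<infinity>"
 by (rule le_less_trans[OF Wt_le]) (use GG_Z[of xi t] in \<open>auto simp: ennreal_mult_less_top ennreal_add_less_top\<close>)

lemma norm_diff_le_dn: "t >= 0 ==> xi \<in> GG ==> en (xs (Suc l) i t xi - xs l i t xi) <= dn l t xi"
proof (rule order_trans[OF _ xs_diff])
 assume t: "t >= 0"
 have "1 * norm (xs (Suc l) i t xi - xs l i t xi) <= wt t xi * norm (xs (Suc l) i t xi - xs l i t xi)"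
  by (intro mult_right_mono wt_ge_1 t) auto
 thus "en (xs (Suc l) i t xi - xs l i t xi) <= ennreal (wt t xi * norm (xs (Suc l) i t xi - xs l i t xi))"
  by (intro ennreal_leI) simp
qed

text \<open>The iterates are telescoping sums of increments, whose majorants add up to
  \<open>Wt\<close>, finite on \<open>GG\<close>.\<close>

lemma xs_tendsto:
 assumes t: "t >= 0" and g: "xi \<in> GG"
 shows "(%l. xs l i t xi) \<longlonglongrightarrow> x i t xi"
proof -
 have "(\<Sum>l. en (xs (Suc l) i t xi - xs l i t xi)) <= Wt t xi"
  unfolding Wt_def by (intro suminf_le norm_diff_le_dn t g) auto
 hence "(\<Sum>l. en (xs (Suc l) i t xi - xs l i t xi)) ~= top"
  using Wt_finite[OF t g] by (auto simp: less_top top_unique)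
 hence "summable (%l. norm (xs (Suc l) i t xi - xs l i t xi))" by (intro summable_suminf_not_top) auto
 hence "summable (%l. xs (Suc l) i t xi - xs l i t xi)" by (rule summable_norm_cancel)
 hence "(%l. \<Sum>q<l. xs (Suc q) i t xi - xs q i t xi) \<longlonglongrightarrow> (\<Sum>l. xs (Suc l) i t xi - xs l i t xi)"
  by (rule summable_LIMSEQ)
 hence "(%l. xs l i t xi - xs 0 i t xi) \<longlonglongrightarrow> (\<Sum>l. xs (Suc l) i t xi - xs l i t xi)"
  unfolding sum_lessThan_telescope[of "%q. xs q i t xi"] .
 from tendsto_add[OF this tendsto_const[of "xs 0 i t xi"]]
 have "convergent (%l. xs l i t xi)" unfolding convergent_def by (auto simp del: xs.simps)
 thus ?thesis using g by (simp add: x_def convergent_LIMSEQ_iff)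
qed

lemma x_minus_ph_weight:
 assumes t: "t >= 0" and g: "xi \<in> GG"
 shows "ennreal (wt t xi * norm (x i t xi - ph i t xi)) <= Wt t xi"
proof -
 have wp: "wt t xi > 0" by (simp add: wt_def)
 have "ennreal (wt t xi * norm (xs l i t xi - ph i t xi)) <= (\<Sum>q<l. dn q t xi)" for l
 proof (induction l)
  case (Suc l)
  have "wt t xi * norm (xs (Suc l) i t xi - ph i t xi) <= wt t xi * norm (xs l i t xi - ph i t xi) + wt t xi * norm (xs (Suc l) i t xi - xs l i t xi)"
   unfolding distrib_left[symmetric] using wp norm_triangle_ineq[of "xs l i t xi - ph i t xi" "xs (Suc l) i t xi - xs l i t xi"]
   by (intro mult_left_mono) (auto simp del: xs.simps)
  hence "ennreal (wt t xi * norm (xs (Suc l) i t xi - ph i t xi)) <= ennreal (wt t xi * norm (xs l i t xi - ph i t xi) + wt t xi * norm (xs (Suc l) i t xi - xs l i t xi))"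
   by (rule ennreal_leI)
  also have "... = ennreal (wt t xi * norm (xs l i t xi - ph i t xi)) + ennreal (wt t xi * norm (xs (Suc l) i t xi - xs l i t xi))"
   using wp by (intro ennreal_plus) auto
  also have "... <= (\<Sum>q<l. dn q t xi) + dn l t xi" by (intro add_mono Suc xs_diff t g)
  finally show ?case by simp
 qed simp
 also have "(\<Sum>q<l. dn q t xi) <= Wt t xi" for l unfolding Wt_def by (intro sum_le_suminf) auto
 finally have *: "ennreal (wt t xi * norm (xs l i t xi - ph i t xi)) <= Wt t xi" for l .
 have "(%l. ennreal (wt t xi * norm (xs l i t xi - ph i t xi))) \<longlonglongrightarrow> ennreal (wt t xi * norm (x i t xi - ph i t xi))"
  by (intro tendsto_ennrealI tendsto_intros xs_tendsto t g)
 thus ?thesis by (rule LIMSEQ_le_const2) (use * in blast)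
qed

lemma jm_x: "jm (x i)"
proof -
 have [measurable]: "!!l. (%p. xs l i (fst p) (snd p)) \<in> borel_measurable (borel \<Otimes>\<^sub>M borel)"
  using jm_xs unfolding jm_def by blast
 show ?thesis unfolding jm_def x_def by measurable
qed

lemma dominated_x: "dominated x"
 unfolding dominated_def
proof (intro conjI allI impI jm_x)
 fix j s xi assume s: "(s::real) >= 0" and g: "xi \<in> GG"
 have "(%l. ennreal (wt s xi * norm (xs l j s xi))) \<longlonglongrightarrow> ennreal (wt s xi * norm (x j s xi))"
  by (intro tendsto_ennrealI tendsto_intros xs_tendsto s g)
 thus "ennreal (wt s xi * norm (x j s xi)) <= Xt s xi"
  by (rule LIMSEQ_le_const2) (use dominated_xs s g in \<open>auto simp: dominated_def\<close>)
qed

lemma dominated_norm: "dominated y ==> s >= 0 ==> xi \<in> GG ==> en (y j s xi) <= Xt s xi"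
proof -
 assume y: "dominated y" and s: "s >= 0" and g: "xi \<in> GG"
 have "1 * norm (y j s xi) <= wt s xi * norm (y j s xi)" by (intro mult_right_mono wt_ge_1 s) auto
 hence "en (y j s xi) <= ennreal (wt s xi * norm (y j s xi))" by (intro ennreal_leI) simp
 also have "... <= Xt s xi" using y s g by (simp add: dominated_def)
 finally show ?thesis .
qed

lemma quad_xs_tendsto:
 assumes s: "s >= 0" and fin: "econv (Xt s) (Xt s) xi < \<infinity>"
 shows "(%l. quad m (%j. xs l j s) i xi) \<longlonglongrightarrow> quad m (%j. x j s) i xi"
proof -
 have [measurable]: "Xt s \<in> BM" by (rule jm_at[OF jm_Xt])
 have [measurable]: "xs l j s \<in> BM" for l j by (rule jm_at[OF jm_xs])
 have [measurable]: "x j s \<in> BM" for j by (rule jm_at[OF jm_x])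
 have "(%l. fconv (xs l j s) (xs l k s) xi) \<longlonglongrightarrow> fconv (x j s) (x k s) xi" for j k
 proof -
  have ae: "AE eta in lborel. Xt s (xi - eta) * Xt s eta ~= \<infinity>"
   by (rule nn_integral_PInf_AE) (use fin in \<open>auto simp: econv_def\<close>)
  have "(%l. \<integral>eta. xs l j s (xi - eta) * xs l k s eta \<partial>lborel) \<longlonglongrightarrow> (lint eta. x j s (xi - eta) * x k s eta)"
  proof (rule integral_dominated_convergence[where w = "%eta. enn2real (Xt s (xi - eta) * Xt s eta)"])
   show "integrable lborel (%eta. enn2real (Xt s (xi - eta) * Xt s eta))"
   proof (rule integrableI_bounded)
    have "(nint eta. en (enn2real (Xt s (xi - eta) * Xt s eta))) = econv (Xt s) (Xt s) xi"
     unfolding econv_def by (intro nn_integral_cong_AE) (use ae in \<open>auto simp: less_top\<close>)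
    thus "(nint eta. en (enn2real (Xt s (xi - eta) * Xt s eta))) < \<infinity>" using fin by simp
   qed measurable
   show "AE eta in lborel. (%l. xs l j s (xi - eta) * xs l k s eta) \<longlonglongrightarrow> x j s (xi - eta) * x k s eta"
    using AE_reflect_R3[OF AE_GG, of xi] AE_GG by eventually_elim (intro tendsto_mult xs_tendsto s)
   show "AE eta in lborel. norm (xs l j s (xi - eta) * xs l k s eta) <= enn2real (Xt s (xi - eta) * Xt s eta)" for l
    using AE_reflect_R3[OF AE_GG, of xi] AE_GG ae
   proof eventually_elim
    case (elim eta)
    show ?case
    proof (rule norm_le_enn2real)
     show "en (xs l j s (xi - eta) * xs l k s eta) <= Xt s (xi - eta) * Xt s eta"
      unfolding norm_mult ennreal_mult[OF norm_ge_zero norm_ge_zero]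
      by (intro mult_mono dominated_norm dominated_xs s elim) auto
    qed (use elim in \<open>simp add: less_top\<close>)
   qed
  qed measurable
  thus ?thesis unfolding fconv_def by (intro tendsto_divide tendsto_const) auto
 qed
 thus ?thesis unfolding quad_def by (intro tendsto_sum tendsto_mult tendsto_const)
qed

text \<open>Dominated convergence twice: in the convolution variable, by
  \<open>quad_xs_tendsto\<close>, and in time, with a bound whose integral is a multiple of
  \<open>Zt\<close>.\<close>

theorem x_fixed_point:
 assumes t: "t >= 0" and g: "xi \<in> GG"
 shows "x i t xi = heat_flow kas (%i xi. ph0 i xi + a i xi) i t xi + cduh (kas i) (%s. quad m (%j. x j s) i) t xi"
proof -
 note [measurable (raw)] = jm_compose[OF jm_econv[OF jm_Xt jm_Xt]]
 define B where "B s = ennreal c * (en xi * econv (Xt s) (Xt s) xi * ind t s)" for s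
 have [measurable]: "B \<in> BM" unfolding B_def by measurable
 have Bfin: "AE s in lborel. B s < \<infinity>"
  using GG_econv[OF g, of t]
  by eventually_elim (auto simp: B_def indicator_def ennreal_mult_less_top less_top)
 have Bint: "(nint s. B s) < \<infinity>"
  unfolding B_def duhamel_bound_integral using GG_Z[OF g, of t] by (simp add: ennreal_mult_less_top)
 have "(%l. cduh (kas i) (%s. quad m (%j. xs l j s) i) t xi) \<longlonglongrightarrow> cduh (kas i) (%s. quad m (%j. x j s) i) t xi"
  unfolding cduh_def
 proof (rule integral_dominated_convergence[where w = "%s. enn2real (B s)"])
  show "integrable lborel (%s. enn2real (B s))"
  proof (rule integrableI_bounded)
   have "(nint s. en (enn2real (B s))) = (nint s. B s)"
    by (intro nn_integral_cong_AE) (use Bfin in \<open>auto simp: less_top\<close>)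
   thus "(nint s. en (enn2real (B s))) < \<infinity>" using Bint by simp
  qed measurable
  show "AE s in lborel. (%l. ind t s *\<^sub>R (of_real (hk (kas i) (t - s) xi) * quad m (%j. xs l j s) i xi)) \<longlonglongrightarrow>
    (ind t s *\<^sub>R (of_real (hk (kas i) (t - s) xi) * quad m (%j. x j s) i xi) :: complex)"
   using GG_econv[OF g, of t]
  proof eventually_elim
   case (elim s)
   show ?case
   proof (cases "s \<in> {0..t}")
    case True
    thus ?thesis using elim by (intro tendsto_intros quad_xs_tendsto) auto
   qed simp
  qed
  show "AE s in lborel. norm (ind t s *\<^sub>R (of_real (hk (kas i) (t - s) xi) * quad m (%j. xs l j s) i xi) :: complex) <= enn2real (B s)" for l
   using Bfin
  proof eventually_elim
   case (elim s)
   show ?case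
    by (rule norm_le_enn2real[OF _ elim]) (unfold B_def, rule duhamel_integrand_bound[OF dominated_xs kas_nonneg])
  qed
 qed (use duhamel_integrand_measurable[OF dominated_x] duhamel_integrand_measurable[OF dominated_xs] in simp_all)
 from tendsto_add[OF tendsto_const[of "heat_flow kas (%i xi. ph0 i xi + a i xi) i t xi"] this]
 have "(%l. xs (Suc l) i t xi) \<longlonglongrightarrow> heat_flow kas (%i xi. ph0 i xi + a i xi) i t xi + cduh (kas i) (%s. quad m (%j. x j s) i) t xi"
  by simp
 moreover have "(%l. xs (Suc l) i t xi) \<longlonglongrightarrow> x i t xi"
  using xs_tendsto[OF t g] by (rule LIMSEQ_Suc)
 ultimately show ?thesis by (rule LIMSEQ_unique[rotated])
qed

end

section \<open>Decay in frequency, regularity in time and the initial value\<close>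

lemma power_exp_bounded:
 fixes c :: real
 assumes c: "c > 0"
 obtains B where "B >= 0" "!!r. r >= 0 ==> (1 + r) ^ q * exp (- (c * r)) <= B"
proof
 show "exp c * (fact q / c ^ q) >= 0" using c by simp
 fix r :: real assume r: "r >= 0"
 \<comment> \<open>The term of order q in the exponential series at y = c (1 + r) bounds y^q by q!
   exp y; this is the origin of the stated bound.\<close>
 define y where "y = c * (1 + r)"
 have y: "y >= 0" using c r by (simp add: y_def)
 have "y ^ q / fact q <= exp y"
 proof -
  have s: "(%n. y ^ n /\<^sub>R fact n) sums exp y" by (rule exp_converges)
  have "(\<Sum>n\<in>{q}. y ^ n /\<^sub>R fact n) <= (\<Sum>n. y ^ n /\<^sub>R fact n)"
   by (rule sum_le_suminf[OF sums_summable[OF s]]) (use y in auto)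
  thus ?thesis using sums_unique[OF s] by (simp add: divide_inverse mult.commute)
 qed
 hence 1: "y ^ q <= fact q * exp y" by (simp add: pos_divide_le_eq mult.commute)
 have e: "exp y * exp (- (c * r)) = exp c" by (simp add: y_def exp_add[symmetric] distrib_left)
 have p: "y ^ q = c ^ q * (1 + r) ^ q" unfolding y_def by (rule power_mult_distrib)
 have "y ^ q * exp (- (c * r)) <= fact q * (exp y * exp (- (c * r)))"
  using mult_right_mono[OF 1, of "exp (- (c * r))"] by (simp only: mult.assoc exp_ge_zero simp_thms)
 hence "c ^ q * ((1 + r) ^ q * exp (- (c * r))) <= fact q * exp c"
  unfolding e p by (simp only: mult.assoc)
 thus "(1 + r) ^ q * exp (- (c * r)) <= exp c * (fact q / c ^ q)"
  using c by (simp add: field_simps)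
qed

text \<open>The exponential absorbs the polynomial weight and one further power of |xi|, the price
  of having only the weight 1/|xi| at disposal.\<close>

lemma rapid_dom_exp:
 assumes c: "c > 0" and [measurable]: "E \<in> BM" and E: "chi1 E < \<infinity>"
 shows "rapid_dom (%xi. ennreal (exp (- (c * norm xi))) * E xi)"
 unfolding rapid_dom_def
proof (intro conjI allI)
 fix q :: nat
 obtain B where B: "B >= 0" "!!r. r >= 0 ==> (1 + r) ^ Suc q * exp (- (c * r)) <= B"
  using power_exp_bounded[OF c] by blast
 have "(nint xi. ennreal ((1 + norm xi) ^ q) * (ennreal (exp (- (c * norm xi))) * E xi))
   <= (nint xi. ennreal B * (E xi * ennreal (1 / norm xi)))"
 proof (rule nn_integral_mono_AE)
  show "AE xi in lborel. ennreal ((1 + norm xi) ^ q) * (ennreal (exp (- (c * norm xi))) * E xi) <= ennreal B * (E xi * ennreal (1 / norm xi))"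
   using AE_nonzero_R3
  proof eventually_elim
   fix xi :: R3 assume nz: "xi ~= 0"
   have "(1 + norm xi) ^ q * exp (- (c * norm xi)) * norm xi <= (1 + norm xi) ^ q * exp (- (c * norm xi)) * (1 + norm xi)"
    by (intro mult_left_mono) auto
   also have "... = (1 + norm xi) ^ Suc q * exp (- (c * norm xi))" by simp
   also have "... <= B" by (rule B(2)) simp
   finally have "(1 + norm xi) ^ q * exp (- (c * norm xi)) <= B * (1 / norm xi)"
    using nz by (simp add: pos_le_divide_eq)
   hence "ennreal ((1 + norm xi) ^ q) * ennreal (exp (- (c * norm xi))) <= ennreal B * ennreal (1 / norm xi)"
    using B(1) by (simp add: ennreal_mult[symmetric] ennreal_leI)
   from mult_right_mono[OF this, of "E xi"]
   show "ennreal ((1 + norm xi) ^ q) * (ennreal (exp (- (c * norm xi))) * E xi) <= ennreal B * (E xi * ennreal (1 / norm xi))"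
    by (simp only: mult_ac zero_le simp_thms)
  qed
 qed
 also have "... = ennreal B * chi1 E" unfolding chi1_def by (rule nn_integral_cmult) measurable
 also have "... < \<infinity>" using E by (simp add: ennreal_mult_less_top)
 finally show "(nint xi. ennreal ((1 + norm xi) ^ q) * (ennreal (exp (- (c * norm xi))) * E xi)) < \<infinity>" .
qed measurable

text \<open>The intermediate weight is below the sum of the extreme ones: 1/r <= 1 + 1/r^2.\<close>

lemma chi1_finite_of_weights:
 fixes p :: "R3 => real"
 assumes [measurable]: "p \<in> BM" and p: "!!xi. p xi >= 0"
  and m: "(nint xi. ennreal (p xi)) < \<infinity>" and l: "(nint xi. ennreal (p xi / nsq xi)) < \<infinity>"
 shows "chi1 (%xi. ennreal (p xi)) < \<infinity>"
proof -
 have "chi1 (%xi. ennreal (p xi)) <= (nint xi. ennreal (p xi) + ennreal (p xi / nsq xi))"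
  unfolding chi1_def
 proof (rule nn_integral_mono)
  fix xi :: R3
  have "1 / norm xi <= 1 + 1 / nsq xi"
  proof -
   have *: "r <= 1 + r\<^sup>2" if "r >= 0" for r :: real
   proof -
    have "0 <= (1 - r)\<^sup>2" by simp
    also have "(1 - r)\<^sup>2 = 1 + r\<^sup>2 - 2 * r" by (simp add: power2_eq_square algebra_simps)
    finally show ?thesis using that by simp
   qed
   have "1 / norm xi <= 1 + (1 / norm xi)\<^sup>2" by (rule *) simp
   thus ?thesis by (simp add: power_divide)
  qed
  from mult_left_mono[OF this p[of xi]] have "p xi * (1 / norm xi) <= p xi + p xi / nsq xi"
   by (simp add: distrib_left)
  hence "ennreal (p xi * (1 / norm xi)) <= ennreal (p xi + p xi / nsq xi)" by (rule ennreal_leI)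
  thus "ennreal (p xi) * ennreal (1 / norm xi) <= ennreal (p xi) + ennreal (p xi / nsq xi)"
   using p[of xi] by (simp add: ennreal_mult[symmetric])
 qed
 also have "... < \<infinity>" using m l by (subst nn_integral_add) auto
 finally show ?thesis .
qed

lemma exp_neg_square_le: "k >= 0 ==> exp (- (k * r\<^sup>2)) <= exp k * exp (- (k * r))" for k r :: real
proof -
 assume k: "k >= 0"
 have "0 <= (1 - r)\<^sup>2 + r\<^sup>2 + 1" by simp
 hence "r <= 1 + r\<^sup>2" by (simp add: power2_eq_square algebra_simps)
 from mult_left_mono[OF this k] show ?thesis by (simp add: exp_add[symmetric] algebra_simps)
qed

lemma good_heat_flow:
 fixes kas :: "'i => real"
 assumes k: "kas i > 0" and vm[measurable]: "v i \<in> BM"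
  and fin: "chi1 (%xi. en (v i xi)) < \<infinity>"
 shows "good q (heat_flow kas v i)"
  and "t > 0 ==> ((%s. heat_flow kas v i s xi) has_vector_derivative - of_real (kas i * nsq xi) * heat_flow kas v i t xi) (at t)"
proof -
 have d: "((%s. heat_flow kas v i s xi) has_vector_derivative - of_real (kas i * nsq xi) * heat_flow kas v i t xi) (at t)" for t xi
  unfolding heat_flow_def
  by (rule has_vector_derivative_eq_rhs, (rule derivative_eq_intros has_vector_derivative_real_field | simp)+)
 thus "t > 0 ==> ((%s. heat_flow kas v i s xi) has_vector_derivative - of_real (kas i * nsq xi) * heat_flow kas v i t xi) (at t)" .
 have 0: "good0 (heat_flow kas v i)"
  unfolding good0_def
 proof (intro conjI allI impI AE_I2)
  show "heat_flow kas v i t \<in> BM" for t unfolding heat_flow_def by measurable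
  show "isCont (%s. heat_flow kas v i s xi) t" for xi t
   using d by (rule has_vector_derivative_continuous)
  fix t0 t1 :: real assume t0: "t0 > 0"
  \<comment> \<open>The Gaussian at the earliest time \<open>t0\<close> is replaced by an
    exponential through \<open>exp_neg_square_le\<close>; the power 0 only matches the form of
    \<open>rapid_dom_poly\<close>.\<close>
  define E where "E xi = ennreal (exp (kas i * t0) * (1 + norm xi) ^ 0) * (ennreal (exp (- (kas i * t0 * norm xi))) * en (v i xi))" for xi
  have "rapid_dom E"
   unfolding E_def using t0 k by (intro rapid_dom_poly rapid_dom_exp fin) auto
  moreover have "en (heat_flow kas v i t xi) <= E xi" if "t \<in> {t0..t1}" for t xi
  proof -
   have "hk (kas i) t xi <= exp (- (kas i * t0 * nsq xi))"
    using that k by (simp add: mult_right_mono)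
   also have "... <= exp (kas i * t0) * exp (- (kas i * t0 * norm xi))"
    by (rule exp_neg_square_le) (use k t0 in simp)
   finally have "hk (kas i) t xi * norm (v i xi) <= exp (kas i * t0) * exp (- (kas i * t0 * norm xi)) * norm (v i xi)"
    by (intro mult_right_mono) auto
   thus ?thesis
    unfolding E_def heat_flow_def norm_mult by (simp add: ennreal_mult[symmetric] ennreal_leI mult.assoc)
  qed
  ultimately show "\<exists>E. rapid_dom E & (\<forall>t\<in>{t0..t1}. \<forall>xi. en (heat_flow kas v i t xi) <= E xi)"
   by blast
 qed
 show "good q (heat_flow kas v i)"
 proof (induction q)
  case (Suc q)
  have "good q (%t xi. - of_real (kas i * nsq xi) * heat_flow kas v i t xi)"
  proof (rule good_mult[where A = "kas i" and q = 2])
   show "norm (- complex_of_real (kas i * nsq xi)) <= kas i * (1 + norm xi) ^ 2" for xi :: R3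
    using k by (simp add: norm_mult norm_power power_mono)
  qed (use k Suc in auto)
  thus ?case using 0 d by (intro good_SucI[OF 0]) (auto intro!: AE_I2)
 qed (use 0 in simp)
qed

lemma fconv_hermitian:
 assumes [measurable]: "v \<in> BM" "w \<in> BM"
  and v: "!!eta. v (- eta) = cnj (v eta)" and w: "!!eta. w (- eta) = cnj (w eta)"
 shows "fconv v w (- xi) = cnj (fconv v w xi)"
proof -
 have "(lint eta. v (- xi - eta) * w eta) = (lint eta. v (- xi - (0 - eta)) * w (0 - eta))"
  by (rule integral_reflect_R3[of "%eta. v (- xi - eta) * w eta" 0, symmetric]) measurable
 also have "... = (lint eta. cnj (v (xi - eta) * w eta))"
 proof (rule Bochner_Integration.integral_cong)
  fix eta :: R3
  have "v (- xi - (0 - eta)) = cnj (v (xi - eta))" using v[of "xi - eta"] by simp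
  thus "v (- xi - (0 - eta)) * w (0 - eta) = cnj (v (xi - eta) * w eta)" using w[of eta] by simp
 qed simp
 also have "... = cnj (lint eta. v (xi - eta) * w eta)" by (simp only: Bochner_Integration.integral_cnj)
 finally show ?thesis by (simp add: fconv_def)
qed

lemma quad_hermitian:
 assumes "!!j. y j \<in> BM" "!!j eta. y j (- eta) = cnj (y j eta)"
  and "!!i j k xi. m i j k (- xi) = cnj (m i j k xi)"
 shows "quad m y i (- xi) = cnj (quad m y i xi)"
 unfolding quad_def by (simp add: fconv_hermitian assms)

lemma cduh_hermitian:
 assumes "!!s. g s (- xi) = cnj (g s xi)"
 shows "cduh k g t (- xi) = cnj (cduh k g t xi)"
proof -
 have "cduh k g t (- xi) = (lint s. cnj (ind t s *\<^sub>R (of_real (hk k (t - s) xi) * g s xi)))"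
  unfolding cduh_def by (rule Bochner_Integration.integral_cong) (simp_all add: assms)
 thus ?thesis unfolding cduh_def by (simp only: Bochner_Integration.integral_cnj)
qed

text \<open>Integrating factor: the kernel splits into exp (-k t |xi|^2) and a function of
  \<open>s\<close> alone. The Duhamel term is thus a smooth factor times an indefinite integral,
  from which its continuity and derivative in time follow.\<close>

lemma cduh_eq_primitive:
 assumes i: "integrable lborel (%s. ind T s *\<^sub>R (of_real (hk k (T - s) xi) * g s xi) :: complex)"
 defines "G \<equiv> %s. of_real (exp (k * s * nsq xi)) * g s xi"
 shows "G integrable_on {0..T}"
  and "!!t. t \<in> {0..T} ==> cduh k g t xi = of_real (hk k t xi) * integral {0..t} G"
proof -
 have split: "of_real (hk k (t - s) xi) * g s xi = of_real (hk k t xi) * G s" for s t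
 proof -
  have "- (k * (t - s) * nsq xi) = - (k * t * nsq xi) + k * s * nsq xi" by (simp add: algebra_simps)
  hence "hk k (t - s) xi = hk k t xi * exp (k * s * nsq xi)" by (simp only: exp_add)
  thus ?thesis unfolding G_def by (simp only: of_real_mult mult.assoc)
 qed
 have one: "complex_of_real (exp r) * of_real (exp (- r)) = 1" "complex_of_real (exp (- r)) * of_real (exp r) = 1" for r
  by (simp_all only: of_real_mult[symmetric] exp_add[symmetric]) simp_all
 have "integrable lborel (%s. of_real (exp (k * T * nsq xi)) * (ind T s *\<^sub>R (of_real (hk k (T - s) xi) * g s xi)) :: complex)"
  by (rule integrable_mult_right[OF i])
 also have "(%s. of_real (exp (k * T * nsq xi)) * (ind T s *\<^sub>R (of_real (hk k (T - s) xi) * g s xi)) :: complex) =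
   (%s. ind T s *\<^sub>R G s)"
  unfolding split by (simp add: fun_eq_iff indicator_def mult.assoc[symmetric] one)
 finally have si: "set_integrable lborel {0..T} G" by (simp add: set_integrable_def)
 thus "G integrable_on {0..T}" by (rule set_borel_integral_eq_integral)
 fix t assume t: "t \<in> {0..T}"
 have sit: "set_integrable lborel {0..t} G" by (rule set_integrable_subset[OF si]) (use t in auto)
 have "cduh k g t xi = (lint s. of_real (hk k t xi) * (ind t s *\<^sub>R G s))"
  unfolding cduh_def split by (rule Bochner_Integration.integral_cong) auto
 also have "... = of_real (hk k t xi) * (lint s. ind t s *\<^sub>R G s)" by (rule integral_mult_right_zero)
 also have "(lint s. ind t s *\<^sub>R G s) = integral {0..t} G"
  using set_borel_integral_eq_integral(2)[OF sit] by (simp add: set_lebesgue_integral_def)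
 finally show "cduh k g t xi = of_real (hk k t xi) * integral {0..t} G" .
qed

lemma cduh_isCont:
 assumes i: "integrable lborel (%s. ind T s *\<^sub>R (of_real (hk k (T - s) xi) * g s xi) :: complex)"
  and t: "0 < t" "t < T"
 shows "isCont (%s. cduh k g s xi) t"
proof -
 define G where "G = (%s. of_real (exp (k * s * nsq xi)) * g s xi)"
 note P = cduh_eq_primitive[where g = g and xi = xi and k = k and T = T, OF i, folded G_def]
 have "continuous_on {0..T} (%s. of_real (hk k s xi) * integral {0..s} G)"
  by (intro continuous_intros indefinite_integral_continuous_1 P)
 hence "continuous_on {0<..<T} (%s. of_real (hk k s xi) * integral {0..s} G)"
  by (rule continuous_on_subset) auto
 hence "continuous_on {0<..<T} (%s. cduh k g s xi)" by (rule continuous_on_eq) (subst P(2), auto)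
 thus ?thesis using t by (simp add: continuous_on_eq_continuous_at)
qed

lemma cduh_has_vector_derivative:
 assumes i: "integrable lborel (%s. ind T s *\<^sub>R (of_real (hk k (T - s) xi) * g s xi) :: complex)"
  and t: "0 < t" "t < T" and c: "isCont (%s. g s xi) t"
 shows "((%s. cduh k g s xi) has_vector_derivative - of_real (k * nsq xi) * cduh k g t xi + g t xi) (at t)"
proof -
 define G where "G = (%s. of_real (exp (k * s * nsq xi)) * g s xi)"
 note P = cduh_eq_primitive[where g = g and xi = xi and k = k and T = T, OF i, folded G_def]
 define e where "e s = complex_of_real (hk k s xi)" for s
 have "isCont G t" unfolding G_def by (intro continuous_intros c)
 hence "((%u. integral {0..u} G) has_vector_derivative G t) (at t within {0..T})"
  using integral_has_vector_derivative_continuous_at[OF P(1), of t "{}"] t by (simp add: continuous_at_imp_continuous_within)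
 hence dI: "((%u. integral {0..u} G) has_vector_derivative G t) (at t)"
  using t by (simp add: at_within_Icc_at)
 have de: "(e has_vector_derivative - of_real (k * nsq xi) * e t) (at t)"
  unfolding e_def
  by (rule has_vector_derivative_eq_rhs, (rule derivative_eq_intros has_vector_derivative_real_field | simp)+)
 have "((%s. e s * integral {0..s} G) has_vector_derivative e t * G t + (- of_real (k * nsq xi) * e t) * integral {0..t} G) (at t)"
  by (rule has_vector_derivative_mult[OF de dI])
 moreover have "e t * G t = g t xi"
 proof -
  have "complex_of_real (exp (- r)) * of_real (exp r) = 1" for r
   by (simp only: of_real_mult[symmetric] exp_add[symmetric]) simp
  thus ?thesis unfolding e_def G_def by (simp only: mult.assoc[symmetric]) simp
 qed
 moreover have "e t * integral {0..t} G = cduh k g t xi"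
  using P(2)[of t] t by (simp add: e_def)
 ultimately have "((%s. e s * integral {0..s} G) has_vector_derivative - of_real (k * nsq xi) * cduh k g t xi + g t xi) (at t)"
  by (simp only: mult.assoc add.commute)
 thus ?thesis
 proof (rule has_vector_derivative_transform_within_open)
  show "open {0<..<T}" "t \<in> {0<..<T}" using t by auto
  show "e s * integral {0..s} G = cduh k g s xi" if "s \<in> {0<..<T}" for s using P(2)[of s] that by (simp add: e_def)
 qed
qed

context mild_system
begin

lemma xs_hermitian:
 assumes m: "!!i j k xi. m i j k (- xi) = cnj (m i j k xi)" and a: "!!i xi. a i (- xi) = cnj (a i xi)"
  and p: "!!i xi. ph0 i (- xi) = cnj (ph0 i xi)"
 shows "xs l i t (- xi) = cnj (xs l i t xi)"
proof (induction l arbitrary: i t xi)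
 case 0
 thus ?case by (simp add: heat_flow_def p)
next
 case (Suc l)
 have "quad m (%j. xs l j s) i (- xi) = cnj (quad m (%j. xs l j s) i xi)" for s
  by (rule quad_hermitian) (use jm_at[OF jm_xs] Suc m in auto)
 hence "cduh (kas i) (%s. quad m (%j. xs l j s) i) t (- xi) = cnj (cduh (kas i) (%s. quad m (%j. xs l j s) i) t xi)"
  by (rule cduh_hermitian)
 thus ?case by (simp add: heat_flow_def p a)
qed

text \<open>Each iterate has the symmetry exactly; it passes to the limit wherever both xi and -xi
  lie in \<open>GG\<close>.\<close>

lemma x_hermitian:
 assumes m: "!!i j k xi. m i j k (- xi) = cnj (m i j k xi)" and a: "!!i xi. a i (- xi) = cnj (a i xi)"
  and p: "!!i xi. ph0 i (- xi) = cnj (ph0 i xi)" and t: "t >= 0"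
 shows "AE xi in lborel. x i t (- xi) = cnj (x i t xi)"
 using AE_GG AE_reflect_R3[OF AE_GG, of 0]
proof eventually_elim
 case (elim xi)
 have 1: "(%l. xs l i t (- xi)) \<longlonglongrightarrow> x i t (- xi)" by (rule xs_tendsto[OF t]) (use elim in simp)
 have "(%l. cnj (xs l i t xi)) \<longlonglongrightarrow> cnj (x i t xi)" by (intro tendsto_intros xs_tendsto[OF t] elim)
 hence "(%l. xs l i t (- xi)) \<longlonglongrightarrow> cnj (x i t xi)" unfolding xs_hermitian[OF m a p] .
 with 1 show ?case by (rule LIMSEQ_unique)
qed

lemma x_minus_ph_le_Wt:
 assumes t: "t >= 0" and g: "xi \<in> GG"
 shows "en (x i t xi - ph i t xi) <= Wt t xi"
proof -
 have "1 * norm (x i t xi - ph i t xi) <= wt t xi * norm (x i t xi - ph i t xi)"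
  by (intro mult_right_mono wt_ge_1 t) auto
 hence "en (x i t xi - ph i t xi) <= ennreal (wt t xi * norm (x i t xi - ph i t xi))"
  by (intro ennreal_leI) simp
 also have "... <= Wt t xi" by (rule x_minus_ph_weight[OF t g])
 finally show ?thesis .
qed

lemma x_minus_ph_chi1:
 assumes t: "t >= 0"
 shows "chi1 (%xi. en (x i t xi - ph i t xi)) <= ennreal (R * Eg)"
proof -
 have "chi1 (%xi. en (x i t xi - ph i t xi)) <= chi1 (Wt t)"
  unfolding chi1_def
 proof (rule nn_integral_mono_AE)
  show "AE xi in lborel. en (x i t xi - ph i t xi) * ennreal (1 / norm xi) <= Wt t xi * ennreal (1 / norm xi)"
   using AE_GG by eventually_elim (intro mult_right_mono x_minus_ph_le_Wt t, auto)
 qed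
 also have "... <= ennreal (R * exp (lam * \<Psi> t))" by (rule Bnd_chi1[OF Bnd_Wt t])
 also have "... <= ennreal (R * Eg)" using exp_\<Psi>_le[OF t] const_pos by (intro ennreal_leI mult_left_mono) auto
 finally show ?thesis .
qed

lemma x_minus_ph_diss:
 assumes t: "t >= 0"
 shows "diss (%s xi. en (x i s xi - ph i s xi)) t <= ennreal (R * Eg / k')"
proof -
 have "diss (%s xi. en (x i s xi - ph i s xi)) t <= diss Wt t"
  unfolding diss_def
 proof (rule nn_integral_mono)
  fix s
  show "(nint xi. en (x i s xi - ph i s xi) * en xi) * ind t s
    <= (nint xi. Wt s xi * en xi) * ind t s"
  proof (cases "s \<in> {0..t}")
   case True
   have "(nint xi. en (x i s xi - ph i s xi) * en xi) <= (nint xi. Wt s xi * en xi)"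
   proof (rule nn_integral_mono_AE)
    show "AE xi in lborel. en (x i s xi - ph i s xi) * en xi <= Wt s xi * en xi"
     using AE_GG by eventually_elim (intro mult_right_mono x_minus_ph_le_Wt, use True in auto)
   qed
   thus ?thesis by (rule mult_right_mono) simp
  qed simp
 qed
 also have "... <= ennreal (R * exp (lam * \<Psi> t) / k')" by (rule Bnd_diss[OF Bnd_Wt t])
 also have "... <= ennreal (R * Eg / k')"
  using exp_\<Psi>_le[OF t] const_pos by (intro ennreal_leI divide_right_mono mult_left_mono) auto
 finally show ?thesis .
qed

text \<open>The difference is (exp (-k t |xi|^2) - 1) times the small data plus the Duhamel term.
  The former tends to 0 by dominated convergence, the latter is at most \<open>c\<close> times
  \<open>Mq t\<close>.\<close>

lemma x_initial:
 "((%t. chi1 (%xi. en (x i t xi - ph i t xi - a i xi))) \<longlongrightarrow> 0) (at_right 0)"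
proof -
 define e where "e t xi = (1 - hk (kas i) t xi) * norm (a i xi) * (1 / norm xi)" for t and xi :: R3
 have [measurable]: "e t \<in> BM" for t unfolding e_def by measurable
 have ai: "integrable lborel (%xi. norm (a i xi) * (1 / norm xi))"
 proof (rule integrableI_bounded)
  have "(nint xi. en (norm (a i xi) * (1 / norm xi))) <= chi1 (%xi. ennreal (SU i. norm (a i xi)))"
   unfolding chi1_def
  proof (rule nn_integral_mono)
   fix xi :: R3
   have "norm (a i xi) <= (SU i. norm (a i xi))" by (rule member_le_sum) auto
   hence "norm (a i xi) * (1 / norm xi) <= (SU i. norm (a i xi)) * (1 / norm xi)" by (rule mult_right_mono) simp
   hence "en (norm (a i xi) * (1 / norm xi)) <= ennreal ((SU i. norm (a i xi)) * (1 / norm xi))"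
    by (intro ennreal_leI) simp
   also have "... = ennreal (SU i. norm (a i xi)) * ennreal (1 / norm xi)"
    by (intro ennreal_mult sum_nonneg) auto
   finally show "en (norm (a i xi) * (1 / norm xi)) <= ennreal (SU i. norm (a i xi)) * ennreal (1 / norm xi)" .
  qed
  also have "... < \<infinity>" using a_small by (rule le_less_trans) simp
  finally show "(nint xi. en (norm (a i xi) * (1 / norm xi))) < \<infinity>" .
 qed measurable
 have e_le: "0 <= e t xi & e t xi <= norm (a i xi) * (1 / norm xi)" if "t >= 0" for t and xi :: R3
 proof -
  have "0 <= kas i * t * nsq xi" using kas_nonneg that by simp
  hence "0 <= 1 - hk (kas i) t xi" by simp
  moreover have "1 - hk (kas i) t xi <= 1" by simp
  ultimately have "e t xi <= 1 * norm (a i xi) * (1 / norm xi)" "0 <= e t xi"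
   unfolding e_def by (intro mult_right_mono mult_nonneg_nonneg; simp)+
  thus ?thesis by simp
 qed
 have "((%t. \<integral>xi. e t xi \<partial>lborel) \<longlongrightarrow> (\<integral>xi. (0::real) \<partial>(lborel :: R3 measure))) (at 0 within {0<..})"
 proof (rule tendsto_integral_dominated[where U = UNIV and B = "%xi. norm (a i xi) * (1 / norm xi)"])
  show "AE xi in lborel. ((%t. e t xi) \<longlongrightarrow> 0) (at 0 within {0<..})"
  proof (rule AE_I2)
   fix xi :: R3
   have "((%t. e t xi) \<longlongrightarrow> e 0 xi) (at 0 within {0<..})" unfolding e_def by (intro tendsto_intros)
   thus "((%t. e t xi) \<longlongrightarrow> 0) (at 0 within {0<..})" by (simp add: e_def)
  qed
  show "AE xi in lborel. \<forall>t\<in>UNIV \<inter> {0<..}. norm (e t xi) <= norm (a i xi) * (1 / norm xi)"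
   by (rule AE_I2) (use e_le in auto)
 qed (use ai in auto)
 hence lim1: "((%t. ennreal (lint xi. e t xi)) \<longlongrightarrow> 0) (at_right 0)"
  using tendsto_ennrealI[where x = 0] by simp
 have bound: "chi1 (%xi. en (x i t xi - ph i t xi - a i xi)) <= ennreal (lint xi. e t xi) + ennreal c * Mq t"
  if t: "t > 0" for t
 proof -
  have Zm[measurable]: "Zt t \<in> BM" by (rule Zt_measurable)
  have t0: "t >= 0" using t by simp
  have "chi1 (%xi. en (x i t xi - ph i t xi - a i xi)) <= (nint xi. ennreal (e t xi) + ennreal c * Zt t xi * ennreal (1 / norm xi))"
   unfolding chi1_def
  proof (rule nn_integral_mono_AE)
   show "AE xi in lborel. en (x i t xi - ph i t xi - a i xi) * ennreal (1 / norm xi) <= ennreal (e t xi) + ennreal c * Zt t xi * ennreal (1 / norm xi)"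
    using AE_GG
   proof eventually_elim
    case (elim xi)
    define q where "q = 1 - hk (kas i) t xi"
    define D where "D = cduh (kas i) (%s. quad m (%j. x j s) i) t xi"
    have q: "q >= 0" using kas_nonneg[of i] t by (simp add: q_def)
    have "x i t xi - ph i t xi - a i xi = - (of_real q * a i xi) + D"
     unfolding x_fixed_point[OF t0 elim] D_def q_def heat_flow_def by (simp add: algebra_simps)
    hence "norm (x i t xi - ph i t xi - a i xi) <= q * norm (a i xi) + norm D"
     using norm_triangle_ineq[of "- (of_real q * a i xi)" D] q by (simp add: norm_mult)
    hence "en (x i t xi - ph i t xi - a i xi) <= ennreal (q * norm (a i xi) + norm D)" by (rule ennreal_leI)
    also have "... = ennreal (q * norm (a i xi)) + en D" using q by (intro ennreal_plus) auto
    also have "... <= ennreal (q * norm (a i xi)) + ennreal c * Zt t xi"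
     unfolding D_def by (intro add_left_mono cduh_le_Z dominated_x kas_nonneg)
    finally have "en (x i t xi - ph i t xi - a i xi) * ennreal (1 / norm xi) \<le>
      (ennreal (q * norm (a i xi)) + ennreal c * Zt t xi) * ennreal (1 / norm xi)"
     by (rule mult_right_mono) simp
    also have "... = ennreal (q * norm (a i xi)) * ennreal (1 / norm xi) + ennreal c * Zt t xi * ennreal (1 / norm xi)"
     by (rule distrib_right)
    also have "ennreal (q * norm (a i xi)) * ennreal (1 / norm xi) = ennreal (e t xi)"
     unfolding e_def q_def[symmetric] using q by (intro ennreal_mult[symmetric] mult_nonneg_nonneg) auto
    finally show ?case .
   qed
  qed
  also have "... = (nint xi. ennreal (e t xi)) + ennreal c * chi1 (Zt t)"
   unfolding chi1_def by (simp add: nn_integral_add nn_integral_cmult mult.assoc)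
  also have "... <= (nint xi. ennreal (e t xi)) + ennreal c * Mq t"
   by (intro add_left_mono mult_left_mono chi1_Zt) simp
  also have "(nint xi. ennreal (e t xi)) = ennreal (lint xi. e t xi)"
  proof (rule nn_integral_eq_integral)
   show "integrable lborel (e t)"
    by (rule Bochner_Integration.integrable_bound[OF ai]) (use e_le[OF t0] in auto)
  qed (use e_le[OF t0] in auto)
  finally show ?thesis .
 qed
 have "((%t. ennreal (lint xi. e t xi) + ennreal c * Mq t) \<longlongrightarrow> 0 + ennreal c * 0) (at_right 0)"
  by (intro tendsto_add lim1 ennreal_tendsto_cmult Mq_tendsto) simp
 hence lim: "((%t. ennreal (lint xi. e t xi) + ennreal c * Mq t) \<longlongrightarrow> 0) (at_right 0)" by simp
 show ?thesis
 proof (rule tendsto_sandwich[OF _ _ tendsto_const lim])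
  show "\<forall>\<^sub>F t in at_right 0. chi1 (%xi. en (x i t xi - ph i t xi - a i xi)) <= ennreal (lint xi. e t xi) + ennreal c * Mq t"
   using bound by (auto simp: eventually_at_filter)
 qed simp
qed

lemma x_isCont:
 assumes g: "xi \<in> GG" and t: "t > 0"
 shows "isCont (%s. x i s xi) t"
proof -
 define X where "X s = heat_flow kas (%i xi. ph0 i xi + a i xi) i s xi + cduh (kas i) (%s. quad m (%j. x j s) i) s xi" for s
 have "isCont (%s. cduh (kas i) (%s. quad m (%j. x j s) i) s xi) t"
  by (rule cduh_isCont[where T = "t + 1"], rule duhamel_integrable[OF dominated_x kas_nonneg g]) (use t in auto)
 moreover have "isCont (%s. heat_flow kas (%i xi. ph0 i xi + a i xi) i s xi) t"
  unfolding heat_flow_def by (intro continuous_intros)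
 ultimately have "isCont X t" unfolding X_def by (intro continuous_intros)
 moreover have "\<forall>\<^sub>F s in nhds t. X s = x i s xi"
  using eventually_nhds_in_open[of "{0<..}" t] t
  by (auto elim!: eventually_mono simp: X_def x_fixed_point[OF _ g, symmetric])
 ultimately show ?thesis by (simp add: isCont_cong)
qed

lemma m_norm: "norm (m i j k xi) <= c * (1 + norm xi) ^ 1"
proof -
 have "norm (m i j k xi) <= (SU k. norm (m i j k xi))" by (rule member_le_sum) auto
 also have "... <= (SU j. SU k. norm (m i j k xi))"
  by (rule member_le_sum[of j UNIV "%j. SU k. norm (m i j k xi)"]) (auto intro: sum_nonneg)
 also have "... <= c * norm xi" by (rule m_bound)
 also have "... <= c * (1 + norm xi) ^ 1" using c_pos by (intro mult_left_mono) auto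
 finally show ?thesis .
qed

lemma chi1_sum_finite:
 "chi1 (%xi. ennreal (SU i. norm (ph0 i xi))) < \<infinity>" "chi1 (%xi. ennreal (SU i. norm (a i xi))) < \<infinity>"
proof -
 show "chi1 (%xi. ennreal (SU i. norm (ph0 i xi))) < \<infinity>" by (rule chi1_finite_of_weights)
    (use le_less_trans[OF ph0_mass] le_less_trans[OF ph0_low] in \<open>auto intro: sum_nonneg\<close>)
 show "chi1 (%xi. ennreal (SU i. norm (a i xi))) < \<infinity>"
  using a_small by (rule le_less_trans) simp
qed

text \<open>Dividing the weighted bound by the weight at \<open>t0\<close> leaves exponential decay,
  and monotonicity of \<open>Zt\<close> makes the remaining factor the same for all times up to
  \<open>t1\<close>.\<close>

lemma norm_x_le:
 assumes t: "0 < t0" "t0 <= t" "t <= t1"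
 shows "en (x i t xi) <= ennreal (exp (- (sqrt t0 / 2 * norm xi))) *
  (ennreal K * ennreal (SU i. norm (ph0 i xi)) + ennreal K * (ennreal (SU i. norm (a i xi)) + ennreal ((real CARD('i) + 2) * c) * Zt t1 xi))"
proof (cases "xi \<in> GG")
 case True
 have tt: "t >= 0" using t by simp
 have e1: "exp (- (sqrt t0 / 2 * norm xi)) * wt t xi >= 1"
 proof -
  have "sqrt t0 * norm xi <= sqrt t * norm xi" by (intro mult_right_mono) (use t in auto)
  thus ?thesis unfolding wt_def by (simp add: exp_add[symmetric])
 qed
 have "1 * norm (x i t xi) <= exp (- (sqrt t0 / 2 * norm xi)) * wt t xi * norm (x i t xi)"
  by (intro mult_right_mono e1) auto
 hence "en (x i t xi) <= ennreal (exp (- (sqrt t0 / 2 * norm xi)) * (wt t xi * norm (x i t xi)))"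
  by (intro ennreal_leI) (simp add: mult.assoc)
 also have "... = ennreal (exp (- (sqrt t0 / 2 * norm xi))) * ennreal (wt t xi * norm (x i t xi))"
  by (intro ennreal_mult) (auto simp: wt_def)
 also have "... <= ennreal (exp (- (sqrt t0 / 2 * norm xi))) * Xt t xi"
  using dominated_x True tt by (intro mult_left_mono) (auto simp: dominated_def)
 also have "... <= ennreal (exp (- (sqrt t0 / 2 * norm xi))) *
  (ennreal K * ennreal (SU i. norm (ph0 i xi)) + ennreal K * (ennreal (SU i. norm (a i xi)) + ennreal ((real CARD('i) + 2) * c) * Zt t1 xi))"
  unfolding Xt_def
 proof (intro mult_left_mono add_mono)
  have "hk k' t xi <= 1" using ka tt by simp
  hence "K * hk k' t xi * (SU i. norm (ph0 i xi)) <= K * 1 * (SU i. norm (ph0 i xi))"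
   using const_pos(1) by (intro mult_right_mono mult_left_mono sum_nonneg) auto
  hence "Q t xi <= ennreal (K * (SU i. norm (ph0 i xi)))" unfolding heat_maj_def by (intro ennreal_leI) simp
  also have "... = ennreal K * ennreal (SU i. norm (ph0 i xi))"
   using const_pos(1) by (intro ennreal_mult sum_nonneg) auto
  finally show "Q t xi <= ennreal K * ennreal (SU i. norm (ph0 i xi))" .
  have "Wt t xi <= ennreal K * (ennreal (SU i. norm (a i xi)) + ennreal ((real CARD('i) + 2) * c) * Zt t xi)"
   by (rule Wt_le[OF tt])
  also have "... <= ennreal K * (ennreal (SU i. norm (a i xi)) + ennreal ((real CARD('i) + 2) * c) * Zt t1 xi)"
   by (intro mult_left_mono add_left_mono Zt_mono t) auto
  finally show "Wt t xi <= ennreal K * (ennreal (SU i. norm (a i xi)) + ennreal ((real CARD('i) + 2) * c) * Zt t1 xi)" .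
 qed simp
 finally show ?thesis .
qed (simp add: x_def)

lemma good0_x: "good0 (x i)"
 unfolding good0_def
proof (intro conjI allI impI)
 show "x i t \<in> BM" for t by (rule jm_at[OF jm_x])
 show "AE xi in lborel. \<forall>t>0. isCont (%s. x i s xi) t"
  using AE_GG by eventually_elim (blast intro: x_isCont)
 fix t0 t1 :: real assume t0: "t0 > 0"
 \<comment> \<open>\<open>t1\<close> may be negative, the interval then being empty, whereas
   \<open>Mq_finite\<close> asks for a nonnegative time.\<close>
 define t2 where "t2 = max t1 0"
 have t2: "t2 >= 0" by (simp add: t2_def)
 have Zm[measurable]: "Zt t2 \<in> BM" by (rule Zt_measurable)
 define F where "F xi = ennreal K * ennreal (SU i. norm (ph0 i xi)) + ennreal K * (ennreal (SU i. norm (a i xi)) + ennreal ((real CARD('i) + 2) * c) * Zt t2 xi)" for xi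
 have Zf: "chi1 (Zt t2) < \<infinity>" using chi1_Zt Mq_finite[OF t2] by (rule le_less_trans)
 have "rapid_dom (%xi. ennreal (exp (- (sqrt t0 / 2 * norm xi))) * F xi)"
 proof (rule rapid_dom_exp)
  show "F \<in> BM" unfolding F_def by measurable
  have "chi1 F = ennreal K * chi1 (%xi. ennreal (SU i. norm (ph0 i xi))) + ennreal K * (chi1 (%xi. ennreal (SU i. norm (a i xi))) + ennreal ((real CARD('i) + 2) * c) * chi1 (Zt t2))"
   unfolding F_def by (simp add: chi1_add chi1_cmult)
  also have "... < \<infinity>" using chi1_sum_finite Zf by (auto simp: ennreal_mult_less_top)
  finally show "chi1 F < \<infinity>" .
 qed (use t0 in simp)
 moreover have "\<forall>t\<in>{t0..t1}. \<forall>xi. en (x i t xi) <= ennreal (exp (- (sqrt t0 / 2 * norm xi))) * F xi"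
  unfolding F_def by (intro ballI allI norm_x_le) (use t0 in \<open>auto simp: t2_def\<close>)
 ultimately show "\<exists>E. rapid_dom E & (\<forall>t\<in>{t0..t1}. \<forall>xi. en (x i t xi) <= E xi)" by blast
qed

lemma good_quad: "(!!j. good q (x j)) ==> good q (%s. quad m (%j. x j s) i)"
 unfolding quad_def using m_norm c_pos by (intro good_sum good_mult[where A = c and q = 1] good_fconv) auto

text \<open>At almost every frequency the quadratic term is continuous in time, because
  \<open>good0\<close> is stable under convolution; this supplies the hypothesis of
  \<open>cduh_has_vector_derivative\<close>.\<close>

lemma x_has_vector_derivative:
 "AE xi in lborel. \<forall>t>0. ((%s. x i s xi) has_vector_derivative
   - of_real (kas i * nsq xi) * x i t xi + quad m (%j. x j t) i xi) (at t)"
proof -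
 have "good 0 (%s. quad m (%j. x j s) i)" by (rule good_quad) (simp add: good0_x)
 hence "AE xi in lborel. \<forall>t>0. isCont (%s. quad m (%j. x j s) i xi) t" by (simp add: good0_def)
 thus ?thesis using AE_GG
 proof eventually_elim
  fix xi assume cont: "\<forall>t>0. isCont (%s. quad m (%j. x j s) i xi) t" and g: "xi \<in> GG"
  show "\<forall>t>0. ((%s. x i s xi) has_vector_derivative - of_real (kas i * nsq xi) * x i t xi + quad m (%j. x j t) i xi) (at t)"
  proof (intro allI impI)
   fix t :: real assume t: "t > 0"
   define H where "H = heat_flow kas (%i xi. ph0 i xi + a i xi) i"
   define D where "D = cduh (kas i) (%s. quad m (%j. x j s) i)"
   have D: "((%s. D s xi) has_vector_derivative - of_real (kas i * nsq xi) * D t xi + quad m (%j. x j t) i xi) (at t)"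
    unfolding D_def by (rule cduh_has_vector_derivative[where T = "t + 1"], rule duhamel_integrable[OF dominated_x kas_nonneg g]) (use cont t in auto)
   have H: "((%s. H s xi) has_vector_derivative - of_real (kas i * nsq xi) * H t xi) (at t)"
    unfolding H_def heat_flow_def
    by (rule has_vector_derivative_eq_rhs, (rule derivative_eq_intros has_vector_derivative_real_field | simp)+)
   have "((%s. H s xi + D s xi) has_vector_derivative - of_real (kas i * nsq xi) * H t xi +
     (- of_real (kas i * nsq xi) * D t xi + quad m (%j. x j t) i xi)) (at t)"
    by (rule has_vector_derivative_add[OF H D])
   moreover have "x i s xi = H s xi + D s xi" if "s > 0" for s
    unfolding H_def D_def using x_fixed_point[OF less_imp_le[OF that] g] .
   ultimately have "((%s. H s xi + D s xi) has_vector_derivative - of_real (kas i * nsq xi) * x i t xi + quad m (%j. x j t) i xi) (at t)"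
    using t by (simp add: algebra_simps)
   thus "((%s. x i s xi) has_vector_derivative - of_real (kas i * nsq xi) * x i t xi + quad m (%j. x j t) i xi) (at t)"
   proof (rule has_vector_derivative_transform_within_open)
    show "open {0::real<..}" "t \<in> {0<..}" using t by auto
    show "H s xi + D s xi = x i s xi" if "s \<in> {0<..}" for s
     unfolding H_def D_def using x_fixed_point[OF less_imp_le g] that by simp
   qed
  qed
 qed
qed

text \<open>Bootstrap: the equation expresses the time derivative by multiplications and
  convolutions of \<open>x\<close>, so class \<open>q\<close> of all components gives class
  \<open>Suc q\<close>.\<close>

lemma good_x: "good q (x i)"
proof (induction q arbitrary: i)
 case (Suc q)
 have "good q (%t xi. - of_real (kas i * nsq xi) * x i t xi)"
 proof (rule good_mult[where A = "kas i" and q = 2])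
  show "norm (- complex_of_real (kas i * nsq xi)) <= kas i * (1 + norm xi) ^ 2" for xi :: R3
   using kas_nonneg[of i] by (simp add: norm_mult norm_power mult_left_mono power_mono)
 qed (use kas_nonneg Suc in auto)
 thus ?case by (intro good_SucI[OF good0_x x_has_vector_derivative] good_add good_quad Suc)
qed (simp add: good0_x)

end

section \<open>Representatives of Fourier transforms\<close>

lemma has_scalar_fourier_measurable:
 assumes "has_scalar_fourier a v"
 shows "v \<in> BM"
proof -
 obtain N where "integrable lborel (%xi. v xi /\<^sub>R (1 + norm xi) ^ N)"
  using assms by (auto simp: has_scalar_fourier_def)
 hence [measurable]: "(%xi. v xi /\<^sub>R (1 + norm xi) ^ N) \<in> BM"
  by (auto dest: borel_measurable_integrable)
 have nz: "1 + norm xi ~= 0" for xi :: R3 using norm_ge_zero[of xi] by linarith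
 have "(%xi. (1 + norm xi) ^ N *\<^sub>R (v xi /\<^sub>R (1 + norm xi) ^ N)) \<in> BM" by measurable
 thus ?thesis using nz by simp
qed

lemma has_scalar_fourier_cong_AE:
 assumes a: "has_scalar_fourier a v" and eq: "AE xi in lborel. v xi = w xi" and [measurable]: "w \<in> BM"
 shows "has_scalar_fourier a w"
proof -
 have [measurable]: "v \<in> BM" by (rule has_scalar_fourier_measurable[OF a])
 obtain N where N: "integrable lborel (%xi. v xi /\<^sub>R (1 + norm xi) ^ N)"
  using a by (auto simp: has_scalar_fourier_def)
 have "integrable lborel (%xi. w xi /\<^sub>R (1 + norm xi) ^ N)"
  by (rule integrable_cong_AE_imp[OF N]) (measurable, use eq in eventually_elim, simp)
 moreover have "(lint xi. v xi * ift ph xi) = (lint xi. w xi * ift ph xi)" if ph: "test_function ph" for ph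
 proof (rule integral_cong_AE)
  have "continuous_on UNIV ph" using ph unfolding test_function_def smooth_on_def by (blast intro: Ck_on_imp_continuous_on)
  hence "ph \<in> BM" by (rule borel_measurable_continuous_onI)
  hence [measurable]: "ift ph \<in> BM" by (rule ift_measurable)
  show "(%xi. v xi * ift ph xi) \<in> borel_measurable lborel" "(%xi. w xi * ift ph xi) \<in> borel_measurable lborel"
   by measurable
  show "AE xi in lborel. v xi * ift ph xi = w xi * ift ph xi" using eq by eventually_elim simp
 qed
 ultimately show ?thesis using a unfolding has_scalar_fourier_def by (intro conjI exI[of _ N] allI impI) simp_all
qed

text \<open>Averaging a transform with its reflected conjugate gives the Hermitian symmetry at every
  frequency and not just almost everywhere, so that the iterates inherit it pointwise.\<close>

lemma fourier_representative:
 assumes "fourier_weight w a < \<infinity>"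
 obtains v :: "3 => R3 => complex" where "has_fourier a (%xi. \<chi> i. v i xi)" "!!i. v i \<in> BM"
  "!!i xi. v i (- xi) = cnj (v i xi)"
proof -
 obtain z where z: "has_fourier a z" using assms by (auto simp: fourier_weight_def split: if_splits)
 define v where "v i xi = (z xi $ i + cnj (z (- xi) $ i)) / 2" for i xi
 have zi: "has_scalar_fourier (%x. complex_of_real (a x $ i)) (%xi. z xi $ i)" for i using z by (simp add: has_fourier_def)
 have [measurable]: "(%xi. z xi $ i) \<in> BM" for i by (rule has_scalar_fourier_measurable[OF zi])
 have [measurable]: "(%xi. z (- xi) $ i) \<in> BM" for i
  by (rule measurable_compose[where f = "%xi. - xi" and g = "%xi. z xi $ i"]) measurable
 have [measurable]: "cnj \<in> BM"
  by (intro borel_measurable_continuous_onI continuous_on_cnj continuous_on_id)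
 have m: "v i \<in> BM" for i unfolding v_def by measurable
 have "has_scalar_fourier (%x. complex_of_real (a x $ i)) (v i)" for i
 proof (rule has_scalar_fourier_cong_AE[OF zi _ m])
  show "AE xi in lborel. z xi $ i = v i xi"
   using has_scalar_fourier_unique[OF zi has_scalar_fourier_hermitian[OF zi], of i]
   by eventually_elim (simp add: v_def)
 qed
 hence "has_fourier a (%xi. \<chi> i. v i xi)" by (simp add: has_fourier_def)
 moreover have "v i (- xi) = cnj (v i xi)" for i xi by (simp add: v_def add.commute)
 ultimately show thesis using that m by blast
qed

lemma norm_vec_le_sum: "norm (\<chi> i. v i :: complex^3) <= (SU i. norm (v i))"
 unfolding norm_vec_def by (rule order_trans[OF L2_set_le_sum]) auto

lemma sum_norm_le_norm_vec: "(SU i. norm (v i)) <= 3 * norm (\<chi> i. v i :: complex^3)"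
proof -
 have "(SU i. norm (v i)) <= (\<Sum>i\<in>(UNIV :: 3 set). norm (\<chi> i. v i :: complex^3))"
 proof (rule sum_mono)
  fix i
  show "norm (v i) <= norm (\<chi> i. v i :: complex^3)" using Finite_Cartesian_Product.norm_nth_le[of "\<chi> i. v i" i] by simp
 qed
 thus ?thesis by simp
qed

section \<open>Vector calculus and its counterpart in Fourier variables\<close>

lemma partial_eqI: "(a has_derivative D) (at x) ==> partial j a x = D (axis j 1)"
 unfolding partial_def by (simp add: frechet_derivative_at[symmetric])

lemma has_derivative_frechet: "a differentiable (at x) ==> (a has_derivative frechet_derivative a (at x)) (at x)"
 by (simp add: frechet_derivative_works)

lemma partial_component:
 fixes a :: "R3 => real^3"
 assumes "a differentiable (at x)"
 shows "(%y. a y $ i) differentiable (at x)" and "partial j (%y. a y $ i) x = partial j a x $ i"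
proof -
 have "((%y. a y $ i) has_derivative (%h. frechet_derivative a (at x) h $ i)) (at x)"
  using bounded_linear.has_derivative[OF bounded_linear_vec_nth has_derivative_frechet[OF assms]] .
 thus "(%y. a y $ i) differentiable (at x)" "partial j (%y. a y $ i) x = partial j a x $ i"
  by (auto simp: differentiable_def partial_eqI) (simp add: partial_def)
qed

lemma differentiable_vecI:
 fixes a :: "R3 => real^3"
 assumes "!!i. (%y. a y $ i) differentiable (at x)"
 shows "a differentiable (at x)"
 unfolding differentiable_componentwise_within[of a]
 using assms by (auto simp: Basis_vec_def inner_axis)

lemma Ck_on_partial: "Ck_on (Suc k) UNIV (a :: R3 => 'b::real_normed_vector) ==> Ck_on k UNIV (partial j a)"
 unfolding partial_def by (auto simp: Basis_vec_def)

lemma Ck_on_Suc_differentiable: "Ck_on (Suc k) UNIV a ==> a differentiable (at x)"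
 by (simp add: differentiable_on_def)

lemma partial_add:
 "a differentiable (at x) ==> b differentiable (at x) ==> partial j (%y. a y + b y) x = partial j a x + partial j b x"
 by (subst partial_eqI[OF has_derivative_add[OF has_derivative_frechet has_derivative_frechet]]) (auto simp: partial_def)

lemma partial_diff:
 "a differentiable (at x) ==> b differentiable (at x) ==> partial j (%y. a y - b y) x = partial j a x - partial j b x"
 by (subst partial_eqI[OF has_derivative_diff[OF has_derivative_frechet has_derivative_frechet]]) (auto simp: partial_def)

lemma partial_mult:
 fixes a b :: "R3 => real"
 shows "a differentiable (at x) ==> b differentiable (at x) ==> partial j (%y. a y * b y) x = a x * partial j b x + partial j a x * b x"
 by (subst partial_eqI[OF has_derivative_mult[OF has_derivative_frechet has_derivative_frechet]]) (auto simp: partial_def)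

lemma partial_cmult:
 fixes a :: "R3 => real"
 shows "a differentiable (at x) ==> partial j (%y. c * a y) x = c * partial j a x"
 by (subst partial_eqI[OF has_derivative_mult_right[OF has_derivative_frechet]]) (auto simp: partial_def)

lemma tensor_div_product:
 fixes a b :: "R3 => real^3"
 assumes a: "a differentiable (at x)" and b: "b differentiable (at x)"
 shows "(SU j. partial j (%y. a y $ j * b y $ i) x) = divergence a x * b x $ i + advect a b x $ i"
 by (simp add: partial_mult partial_component a b divergence_def advect_def sum_distrib_right sum.distrib)

text \<open>The Lamb identity a cross curl a = grad (|a|^2 / 2) - a . grad a, with the square
  written out in components so that the product rule applies.\<close>

lemma cross3_curl:
 fixes a :: "R3 => real^3"
 assumes a: "a differentiable (at x)"
 shows "cross3 (a x) (curl a x) $ i =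
  partial i (%y. 1 / 2 * (a y $ 1 * a y $ 1 + a y $ 2 * a y $ 2 + a y $ 3 * a y $ 3)) x - advect a a x $ i"
proof -
 note d = partial_component[OF a]
 have p: "partial i (%y. 1 / 2 * (a y $ 1 * a y $ 1 + a y $ 2 * a y $ 2 + a y $ 3 * a y $ 3)) x =
   a x $ 1 * partial i a x $ 1 + a x $ 2 * partial i a x $ 2 + a x $ 3 * partial i a x $ 3"
  by (simp add: partial_cmult partial_add partial_mult d differentiable_add differentiable_mult del: times_divide_eq_left)
    (simp add: distrib_left)
 have "\<forall>i. cross3 (a x) (curl a x) $ i = a x $ 1 * partial i a x $ 1 + a x $ 2 * partial i a x $ 2 + a x $ 3 * partial i a x $ 3 - advect a a x $ i"
  by (simp add: forall_3 cross3_simps curl_def advect_def sum_3 algebra_simps)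
 thus ?thesis using p by simp
qed

definition rfv :: "(R3 => real^3) => (3 => R3 => complex) => bool" where
 "rfv a v \<longleftrightarrow> (\<forall>i. rf (%x. a x $ i) (v i))"

lemma rfv_has_fourier: "rfv a v ==> has_fourier a (%xi. \<chi> i. v i xi)"
 by (simp add: rfv_def has_fourier_def rf_has_scalar_fourier)

lemma rfv_differentiable: "rfv a v ==> a differentiable (at x)"
 by (rule differentiable_vecI) (auto simp: rfv_def intro: rf_partial)

lemma rfv_partial:
 assumes "rfv a v"
 shows "rfv (partial j a) (%i xi. \<i> * of_real (xi $ j) * v i xi)"
 unfolding rfv_def
proof
 fix i
 have "rf (partial j (%x. a x $ i)) (%xi. \<i> * of_real (xi $ j) * v i xi)"
  by (rule rf_partial) (use assms in \<open>simp add: rfv_def\<close>)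
 moreover have "partial j (%x. a x $ i) = (%x. partial j a x $ i)"
  using partial_component(2)[OF rfv_differentiable[OF assms]] by (rule ext)
 ultimately show "rf (%x. partial j a x $ i) (%xi. \<i> * of_real (xi $ j) * v i xi)" by simp
qed

text \<open>The symbol of the curl, that is i xi cross v.\<close>

definition fcurl :: "(3 => R3 => complex) => 3 => R3 => complex" where
 "fcurl v i xi = (if i = 1 then \<i> * of_real (xi $ 2) * v 3 xi - \<i> * of_real (xi $ 3) * v 2 xi
  else if i = 2 then \<i> * of_real (xi $ 3) * v 1 xi - \<i> * of_real (xi $ 1) * v 3 xi
  else \<i> * of_real (xi $ 1) * v 2 xi - \<i> * of_real (xi $ 2) * v 1 xi)"

lemma rfv_curl:
 assumes "rfv a v"
 shows "rfv (curl a) (fcurl v)"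
proof -
 have "rf (%x. partial j a x $ i) (%xi. \<i> * of_real (xi $ j) * v i xi)" for i j
  using rfv_partial[OF assms] by (simp add: rfv_def)
 from rf_diff[OF this this] show ?thesis
  unfolding rfv_def forall_3 curl_def fcurl_def by simp
qed

text \<open>Matrix of the orthogonal projection onto the plane perpendicular to xi; at xi = 0 the
  quotient is 0 and the matrix is the identity.\<close>

definition leray_symbol :: "3 => 3 => R3 => real" where
 "leray_symbol l q xi = (if l = q then 1 else 0) - xi $ l * xi $ q / nsq xi"

lemma norm_R3_square: "(norm (xi::R3))\<^sup>2 = (xi $ 1)\<^sup>2 + (xi $ 2)\<^sup>2 + (xi $ 3)\<^sup>2"
 unfolding power2_norm_eq_inner by (simp add: inner_vec_def sum_3 power2_eq_square)

lemma leray_symbol_bound: "\<bar>leray_symbol l q xi\<bar> <= 2"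
proof -
 have "\<bar>xi $ l * xi $ q\<bar> <= norm xi * norm xi"
  unfolding abs_mult by (intro mult_mono component_le_norm_cart) auto
 hence "\<bar>xi $ l * xi $ q / nsq xi\<bar> <= 1" by (cases "xi = 0") (simp_all add: power2_eq_square)
 moreover have "\<bar>if l = q then 1 else 0 :: real\<bar> <= 1" by simp
 ultimately show ?thesis
  using abs_triangle_ineq4[of "if l = q then 1 else 0" "xi $ l * xi $ q / nsq xi"] unfolding leray_symbol_def by linarith
qed

lemma leray_symbol_transversal: "xi ~= 0 ==> (SU l. xi $ l * leray_symbol l q xi) = 0"
 "xi ~= 0 ==> (SU q. leray_symbol l q xi * xi $ q) = 0"
proof -
 assume nz: "xi ~= 0"
 have s: "(SU l. xi $ l * xi $ l) = nsq xi"
  unfolding norm_R3_square by (simp add: sum_3 power2_eq_square)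
 have "(SU l. xi $ l * leray_symbol l q xi) = (SU l. (if l = q then xi $ l else 0)) - (SU l. xi $ l * xi $ l) * (xi $ q / nsq xi)"
  unfolding sum_distrib_right sum_subtractf[symmetric] by (rule sum.cong) (auto simp: leray_symbol_def right_diff_distrib)
 thus "(SU l. xi $ l * leray_symbol l q xi) = 0" using nz unfolding s by simp
 have "(SU q. leray_symbol l q xi * xi $ q) = (SU q. (if q = l then xi $ q else 0)) - (xi $ l / nsq xi) * (SU q. xi $ q * xi $ q)"
  unfolding sum_distrib_left sum_subtractf[symmetric] by (rule sum.cong) (auto simp: leray_symbol_def left_diff_distrib)
 thus "(SU q. leray_symbol l q xi * xi $ q) = 0" using nz unfolding s by simp
qed

text \<open>The double cross product: i xi cross (i xi cross v) = |xi|^2 v - xi (xi . v).\<close>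

lemma fcurl_fcurl:
 assumes "xi ~= 0"
 shows "fcurl (fcurl v) i xi /\<^sub>R nsq xi = (SU q. of_real (leray_symbol i q xi) * v q xi)"
proof -
 have nz: "complex_of_real (nsq xi) ~= 0" using assms by simp
 have sq: "complex_of_real (nsq xi) = of_real (xi $ 1) ^ 2 + of_real (xi $ 2) ^ 2 + of_real (xi $ 3) ^ 2"
  by (simp add: norm_R3_square)
 have 1: "fcurl (fcurl v) i xi = complex_of_real (nsq xi) * v i xi - of_real (xi $ i) * (SU q. of_real (xi $ q) * v q xi)"
 proof -
  have "\<forall>i. fcurl (fcurl v) i xi = complex_of_real (nsq xi) * v i xi - of_real (xi $ i) * (SU q. of_real (xi $ q) * v q xi)"
   unfolding sq by (simp add: forall_3 fcurl_def sum_3 algebra_simps power2_eq_square)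
  thus ?thesis ..
 qed
 have 2: "(SU q. of_real (leray_symbol i q xi) * v q xi) =
   v i xi - of_real (xi $ i) * (SU q. of_real (xi $ q) * v q xi) / of_real (nsq xi)"
 proof -
  have "(SU q. of_real (leray_symbol i q xi) * v q xi) =
    (SU q. (if q = i then v q xi else 0) - of_real (xi $ i) * (of_real (xi $ q) * v q xi) / of_real (nsq xi))"
   by (rule sum.cong) (auto simp: leray_symbol_def left_diff_distrib mult.assoc)
  thus ?thesis by (simp add: sum_subtractf sum_distrib_left sum_divide_distrib)
 qed
 have "fcurl (fcurl v) i xi /\<^sub>R nsq xi = fcurl (fcurl v) i xi / of_real (nsq xi)"
  by (simp add: scaleR_conv_of_real divide_inverse mult.commute)
 thus ?thesis unfolding 1 2 diff_divide_distrib using nz by simp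
qed

text \<open>Away from 0 the symbol of the double curl divided by |xi|^2 is the projection matrix,
  and transforms matter only up to null sets.\<close>

lemma is_lerayI:
 assumes A: "rfv A v" and p: "rfv p w"
  and eq: "!!l. AE xi in lborel. w l xi = (SU q. of_real (leray_symbol l q xi) * v q xi)"
 shows "is_leray A p"
 unfolding is_leray_def
proof (intro exI conjI)
 have c: "rfv (curl (curl A)) (fcurl (fcurl v))" by (intro rfv_curl A)
 thus "has_fourier (curl (curl A)) (%xi. \<chi> i. fcurl (fcurl v) i xi)" by (rule rfv_has_fourier)
 have [measurable]: "fcurl (fcurl v) i \<in> BM" for i
  using c by (auto simp: rfv_def dest!: spec[of _ i] intro: rapid_measurable rf_rapid)
 show "has_fourier p (%xi. (\<chi> i. fcurl (fcurl v) i xi) /\<^sub>R nsq xi)"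
  unfolding has_fourier_def
 proof
  fix i
  have "has_scalar_fourier (%x. complex_of_real (p x $ i)) (w i)" using p by (auto simp: rfv_def intro: rf_has_scalar_fourier)
  hence "has_scalar_fourier (%x. complex_of_real (p x $ i)) (%xi. fcurl (fcurl v) i xi /\<^sub>R nsq xi)"
  proof (rule has_scalar_fourier_cong_AE)
   show "AE xi in lborel. w i xi = fcurl (fcurl v) i xi /\<^sub>R nsq xi"
    using AE_nonzero_R3 eq[of i] by eventually_elim (simp only: fcurl_fcurl not_False_eq_True)
  qed measurable
  thus "has_scalar_fourier (%x. complex_of_real (p x $ i)) (%xi. ((\<chi> i. fcurl (fcurl v) i xi) /\<^sub>R nsq xi) $ i)" by simp
 qed
qed

lemma rf_laplacian:
 assumes "rf a v"
 shows "rf (laplacian a) (%xi. - of_real (nsq xi) * v xi)"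
proof -
 have "rf (%x. SU j. partial j (partial j a) x) (%xi. SU j. \<i> * of_real (xi $ j) * (\<i> * of_real (xi $ j) * v xi))"
  by (intro rf_sum rf_partial assms) simp
 moreover have "(SU j. \<i> * of_real (xi $ j) * (\<i> * of_real (xi $ j) * v xi)) = - of_real (nsq xi) * v xi" for xi
  unfolding norm_R3_square by (simp add: sum_3 power2_eq_square algebra_simps)
 ultimately show ?thesis by (simp add: laplacian_def[abs_def])
qed

lemma good_time_derivative:
 assumes "good0 v" "good0 v'" "t > 0"
  and "AE xi in lborel. \<forall>t>0. ((%s. v s xi) has_vector_derivative v' t xi) (at t)"
 shows "((%s. Re (ift (v s) x)) has_real_derivative Re (ift (v' t) x)) (at t)"
proof -
 have "((%s. ift (v s) x) has_vector_derivative ift (v' t) x) (at t)"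
  using has_derivative_slice(2)[OF good0_has_derivative[OF assms, of x]] by (simp add: inv_fourier_int_def)
 from bounded_linear.has_vector_derivative[OF bounded_linear_Re this]
 show ?thesis by (simp add: has_real_derivative_iff_has_vector_derivative)
qed

lemma open_halfspace: "open ({0<..} \<times> UNIV :: (real \<times> R3) set)"
 by (intro open_Times open_greaterThan open_UNIV)

lemma smooth_time_deriv:
 fixes f :: "real => R3 => real^3"
 assumes f: "Ck_on (Suc k) ({0<..} \<times> UNIV) (%(t, x). f t x)" and t: "t > 0"
 shows "((%s. f s x) has_vector_derivative time_deriv f t x) (at t)"
proof -
 have "((%(t, x). f t x) has_derivative frechet_derivative (%(t, x). f t x) (at (t, x))) (at (t, x))"
  by (rule Ck_on_Suc_has_derivative[OF open_halfspace f]) (use t in simp)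
 from has_derivative_slice(2)[OF this] show ?thesis by (simp add: time_deriv_def vector_derivative_at)
qed

lemma smooth_space_partial:
 fixes f :: "real => R3 => real^3"
 assumes f: "smooth_on ({0<..} \<times> UNIV) (%(t, x). f t x)" and t: "t > 0"
 shows "f t differentiable (at x)" "partial j (f t) differentiable (at x)"
proof -
 have "Ck_on (Suc (Suc 0)) UNIV (f t)"
  using Ck_on_slice[OF _ t, of "Suc (Suc 0)" "%(t, x). f t x"] f by (simp only: smooth_on_def prod.case)
 thus "f t differentiable (at x)" "partial j (f t) differentiable (at x)"
  by (blast intro: Ck_on_Suc_differentiable Ck_on_partial)+
qed

lemma laplacian_component:
 fixes a :: "R3 => real^3"
 assumes a: "!!x. a differentiable (at x)" "!!j x. partial j a differentiable (at x)"
 shows "laplacian (%y. a y $ i) x = laplacian a x $ i"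
proof -
 have "partial j (%y. a y $ i) = (%y. partial j a y $ i)" for j
  using partial_component(2)[OF a(1)] by (rule ext)
 thus ?thesis by (simp add: laplacian_def partial_component(2)[OF a(2)])
qed

lemma laplacian_diff:
 fixes a b :: "R3 => 'b::real_normed_vector"
 assumes "!!x. a differentiable (at x)" "!!j x. partial j a differentiable (at x)"
  and "!!x. b differentiable (at x)" "!!j x. partial j b differentiable (at x)"
 shows "partial j (%y. a y - b y) differentiable (at x)"
  and "laplacian (%y. a y - b y) x = laplacian a x - laplacian b x"
proof -
 have *: "partial j (%y. a y - b y) = (%y. partial j a y - partial j b y)" for j
  using partial_diff[OF assms(1,3)] by (rule ext)
 thus "partial j (%y. a y - b y) differentiable (at x)" using assms by simp
 show "laplacian (%y. a y - b y) x = laplacian a x - laplacian b x"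
  by (simp add: laplacian_def * partial_diff[OF assms(2,4)] sum_subtractf)
qed

lemma laplacian_cmult:
 fixes a :: "R3 => real"
 assumes "!!x. a differentiable (at x)" "!!j x. partial j a differentiable (at x)"
 shows "partial j (%y. c * a y) differentiable (at x)"
  and "laplacian (%y. c * a y) x = c * laplacian a x"
proof -
 have *: "partial j (%y. c * a y) = (%y. c * partial j a y)" for j
  using partial_cmult[OF assms(1)] by (rule ext)
 thus "partial j (%y. c * a y) differentiable (at x)" using assms by simp
 show "laplacian (%y. c * a y) x = c * laplacian a x"
  by (simp add: laplacian_def * partial_cmult[OF assms(2)] sum_distrib_left)
qed

text \<open>Continuity up to t = 0 is demanded by the maximum principle; integrability of the
  transform of the datum is enough for it, no decay being available at that time.\<close>

lemma continuous_heat_extension: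
 fixes w :: "R3 => complex"
 assumes ka: "ka > 0" and w: "integrable lborel w"
 shows "continuous_on ({0..} \<times> UNIV) (%(t, x). Re (ift (%xi. of_real (hk ka t xi) * w xi) x))"
proof -
 have [measurable]: "w \<in> BM" using w by (auto dest: borel_measurable_integrable)
 define g where "g p xi = cis (xi \<bullet> snd p) * (of_real (hk ka (fst p) xi) * w xi)" for p :: "real \<times> R3" and xi :: R3
 have c: "continuous_on UNIV (%x. cis (x \<bullet> y))" for y :: R3
  unfolding cis_conv_exp by (intro continuous_intros)
 have [measurable]: "g p \<in> borel_measurable lborel" for p
  unfolding g_def using borel_measurable_continuous_onI[OF c[of "snd p"]] by measurable
 have "((%p. \<integral>xi. g p xi \<partial>lborel) \<longlongrightarrow> (lint xi. g q xi)) (at q within {0..} \<times> UNIV)" for q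
 proof (rule tendsto_integral_dominated[where U = UNIV and B = "%x. norm (w x)"])
  show "AE xi in lborel. ((%p. g p xi) \<longlongrightarrow> g q xi) (at q within {0..} \<times> UNIV)"
   unfolding g_def cis_conv_exp by (intro AE_I2 tendsto_intros)
  show "AE xi in lborel. \<forall>p\<in>UNIV \<inter> {0..} \<times> UNIV. norm (g p xi) <= norm (w xi)"
  proof (intro AE_I2 ballI)
   fix xi :: R3 and p :: "real \<times> R3" assume "p \<in> UNIV \<inter> {0..} \<times> UNIV"
   hence "hk ka (fst p) xi <= 1" using ka by (auto simp: mem_Times_iff)
   from mult_right_mono[OF this norm_ge_zero[of "w xi"]] show "norm (g p xi) <= norm (w xi)"
    by (simp add: g_def norm_mult)
  qed
 qed (use w in auto)
 hence "continuous_on ({0..} \<times> UNIV) (%p. \<integral>xi. g p xi \<partial>lborel)" by (simp add: continuous_on_def)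
 hence "continuous_on ({0..} \<times> UNIV) (%p. Re ((lint xi. g p xi) / of_real ((2 * pi) ^ 3)))"
  by (intro continuous_intros) auto
 thus ?thesis by (simp add: g_def inv_fourier_int_def case_prod_unfold)
qed

text \<open>The inverse transform of the explicit heat flow is another bounded solution with the
  same initial value; the maximum principle, applied to the difference with both signs, identifies
  the two.\<close>

theorem heat_solution_rfv:
 assumes ka: "ka > 0" and f: "heat_solution ka a f" and w: "has_fourier a (%xi. \<chi> i. w i xi)"
  and [measurable]: "!!i. w i \<in> BM" and herm: "!!i xi. w i (- xi) = cnj (w i xi)"
  and wi: "!!i. integrable lborel (w i)" and low: "!!i. chi1 (%xi. en (w i xi)) < \<infinity>" and t: "t > 0"
 shows "rfv (f t) (%i. heat_flow (%_. ka) w i t)"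
 unfolding rfv_def
proof
 fix i
 define h where "h = heat_flow (%_. ka) w i"
 define V where "V t x = Re (ift (h t) x)" for t x
 define d where "d t x = f t x $ i - V t x" for t x
 define h' where "h' t xi = - of_real (ka * nsq xi) * h t xi" for t xi
 have sm: "smooth_on ({0<..} \<times> UNIV) (%(t, x). f t x)" and cf: "continuous_on ({0..} \<times> UNIV) (%(t, x). f t x)"
  and heat: "!!t x. t > 0 ==> time_deriv f t x - ka *\<^sub>R laplacian (f t) x = 0" and f0: "f 0 = a"
  using f by (auto simp: heat_solution_def)
 obtain K where K: "!!t x. t >= 0 ==> norm (f t x) <= K" using f by (auto simp: heat_solution_def)
 have g0: "good0 h" unfolding h_def using good_heat_flow(1)[where q = 0 and kas = "%_. ka" and v = w and i = i] ka low by simp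
 have g': "good0 h'"
  unfolding h'_def
  using good_mult[where k = 0 and m = "%xi. - of_real (ka * nsq xi)" and A = ka and q = 2, OF _ _ _ g0[folded good.simps(1)]] ka
  by (auto simp: norm_mult norm_power power_mono)
 have dh: "AE xi in lborel. \<forall>t>0. ((%s. h s xi) has_vector_derivative h' t xi) (at t)"
  unfolding h_def h'_def using good_heat_flow(2)[where kas = "%_. ka" and v = w and i = i] ka low by (auto intro!: AE_I2)
 have rfV: "rf (V t) (h t)" if t: "t > 0" for t
  unfolding V_def[abs_def]
  by (rule rf_of_hermitian) (use good0_rapid[OF g0 t] in \<open>auto simp: h_def heat_flow_def herm\<close>)
 have Vbound: "\<bar>V t x\<bar> <= (lint xi. norm (w i xi))" if t: "t >= 0" for t x
 proof -
  have le: "norm (h t xi) <= norm (w i xi)" for xi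
  proof -
   have "hk ka t xi <= 1" using ka t by simp
   from mult_right_mono[OF this norm_ge_zero[of "w i xi"]] show ?thesis by (simp add: h_def heat_flow_def norm_mult)
  qed
  have hm: "h t \<in> BM" unfolding h_def by (rule jm_at[OF jm_heat_flow]) measurable
  have "\<bar>V t x\<bar> <= norm (ift (h t) x)" unfolding V_def by (rule abs_Re_le_cmod)
  also have "... <= (lint xi. norm (h t xi))" by (rule norm_ift_le)
  also have "... <= (lint xi. norm (w i xi))"
  proof (rule integral_mono)
   show "integrable lborel (%xi. norm (h t xi))"
    by (rule integrable_norm, rule Bochner_Integration.integrable_bound[OF wi[of i]]) (use le hm in auto)
  qed (use wi le in auto)
  finally show ?thesis .
 qed
 have fd: "f t differentiable (at x)" "partial j (f t) differentiable (at x)" if "t > 0" for t x j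
  using smooth_space_partial[OF sm that] by auto
 have fc: "(%y. f t y $ i) differentiable (at x)" "partial j (%y. f t y $ i) differentiable (at x)" if t: "t > 0" for t x j
 proof -
  show "(%y. f t y $ i) differentiable (at x)" by (rule partial_component(1)[OF fd(1)[OF t]])
  have "partial j (%y. f t y $ i) = (%y. partial j (f t) y $ i)"
   using partial_component(2)[OF fd(1)[OF t]] by (rule ext)
  thus "partial j (%y. f t y $ i) differentiable (at x)" using partial_component(1)[OF fd(2)[OF t]] by simp
 qed
 have Vd: "V t differentiable (at x)" "partial j (V t) differentiable (at x)" if t: "t > 0" for t x j
  using rf_partial[OF rfV[OF t]] by (auto intro: rf_partial)
 define dt where "dt t x = time_deriv f t x $ i - Re (ift (h' t) x)" for t x
 have time: "((%s. d s x) has_real_derivative dt t x) (at t)" if t: "t > 0" for t x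
 proof -
  have "((%s. f s x) has_vector_derivative time_deriv f t x) (at t)"
   by (rule smooth_time_deriv[of 0]) (use sm t in \<open>auto simp only: smooth_on_def\<close>)
  from bounded_linear.has_vector_derivative[OF bounded_linear_vec_nth this]
  have "((%s. f s x $ i) has_real_derivative time_deriv f t x $ i) (at t)"
   by (simp add: has_real_derivative_iff_has_vector_derivative)
  from DERIV_diff[OF this good_time_derivative[OF g0 g' t dh]] show ?thesis unfolding d_def dt_def V_def .
 qed
 have lap: "dt t x = ka * laplacian (d t) x" if t: "t > 0" for t x
 proof -
  have "rf (laplacian (V t)) (%xi. - of_real (nsq xi) * h t xi)" by (rule rf_laplacian[OF rfV[OF t]])
  from rf_cmult[OF this, of ka]
  have "rf (%x. ka * laplacian (V t) x) (h' t)" by (simp add: h'_def[abs_def] mult.assoc)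
  hence "complex_of_real (ka * laplacian (V t) x) = ift (h' t) x" by (simp only: rf_def)
  hence 1: "Re (ift (h' t) x) = ka * laplacian (V t) x" by (metis Re_complex_of_real)
  have "time_deriv f t x = ka *\<^sub>R laplacian (f t) x" using heat[OF t, of x] by simp
  hence 2: "time_deriv f t x $ i = ka * laplacian (%y. f t y $ i) x"
   using laplacian_component[OF fd[OF t]] by simp
  have "d t = (%y. f t y $ i - V t y)" by (simp add: d_def[abs_def])
  hence "laplacian (d t) x = laplacian (%y. f t y $ i) x - laplacian (V t) x"
   using laplacian_diff(2)[OF fc[OF t] Vd[OF t]] by simp
  thus ?thesis unfolding dt_def 1 2 by (simp add: right_diff_distrib)
 qed
 have dd: "d t differentiable (at x)" "partial j (d t) differentiable (at x)" if t: "t > 0" for t x j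
 proof -
  have eq: "d t = (%y. f t y $ i - V t y)" by (simp add: d_def[abs_def])
  show "d t differentiable (at x)" unfolding eq using fc(1)[OF t] Vd(1)[OF t] by (rule differentiable_diff)
  show "partial j (d t) differentiable (at x)" unfolding eq by (rule laplacian_diff(1)[OF fc[OF t] Vd[OF t]])
 qed
 have cont: "continuous_on ({0..} \<times> UNIV) (%(t, x). d t x)"
 proof -
  have "continuous_on ({0..} \<times> UNIV) (%p. (%(t, x). f t x) p $ i - (%(t, x). V t x) p)"
   using cf continuous_heat_extension[OF ka wi[of i]]
   by (intro continuous_intros) (auto simp: V_def h_def heat_flow_def[abs_def] case_prod_unfold)
  thus ?thesis by (simp add: d_def case_prod_unfold)
 qed
 \<comment> \<open>A heat solution is continuous up to time 0, so its initial datum is continuous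
   and equals its inversion integral at every point.\<close>
 have d0: "d 0 x = 0" for x
 proof -
  have "continuous_on UNIV (%x. (%(t, x). f t x) (0, x))"
   by (rule continuous_on_compose2[OF cf]) (auto intro!: continuous_intros)
  hence "continuous_on UNIV a" by (simp add: f0)
  hence "continuous_on UNIV (%x. complex_of_real (a x $ i))" by (intro continuous_intros)
  hence "complex_of_real (a x $ i) = ift (w i) x"
   by (rule continuous_eq_inv_fourier_int[OF _ _ wi]) (use w in \<open>simp add: has_fourier_def\<close>)
  moreover have "h 0 = w i" by (simp add: h_def heat_flow_def fun_eq_iff)
  ultimately show ?thesis by (simp add: d_def V_def f0) (metis Re_complex_of_real)
 qed
 have sgn: "c * d t y <= 0" if c: "\<bar>c\<bar> = 1" and t: "t >= 0" for c t y
 proof (rule heat_maximum_principle[OF ka, where z = "%t y. c * d t y" and zt = "%t y. c * dt t y" and K = "K + (lint xi. norm (w i xi))"])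
  show "continuous_on ({0..} \<times> UNIV) (%(t, x). c * d t x)"
   using continuous_on_mult[OF continuous_on_const cont] by (simp add: case_prod_unfold)
  show "c * d t x <= K + (lint xi. norm (w i xi))" if t: "t >= 0" for t x
  proof -
   have "c * d t x <= \<bar>c * d t x\<bar>" by simp
   also have "... = \<bar>f t x $ i - V t x\<bar>" using c by (simp add: abs_mult d_def)
   also have "... <= \<bar>f t x $ i\<bar> + \<bar>V t x\<bar>" by (rule abs_triangle_ineq4)
   also have "... <= K + (lint xi. norm (w i xi))"
    using order_trans[OF component_le_norm_cart K[OF t]] by (intro add_mono Vbound t) auto
   finally show ?thesis .
  qed
  show "((%s. c * d s x) has_real_derivative c * dt t x) (at t)" if "t > 0" for t x
   by (rule DERIV_cmult[OF time[OF that]])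
  show "(%y. c * d t y) differentiable (at x)" "partial j (%y. c * d t y) differentiable (at x)"
   "c * dt t x = ka * laplacian (%y. c * d t y) x" if t: "t > 0" for t x j
   using dd[OF t] laplacian_cmult[OF dd[OF t]] lap[OF t] by (auto intro: differentiable_mult)
 qed (use d0 t in auto)
 have "d t x = 0" for x using sgn[of 1 t x] sgn[of "- 1" t x] t by simp
 hence "(%x. f t x $ i) = V t" by (simp add: d_def fun_eq_iff)
 thus "rf (%x. f t x $ i) (heat_flow (%_. ka) w i t)" using rfV[OF t] by (simp add: h_def)
qed

subsection \<open>The magnetohydrodynamic system in Fourier variables\<close>

text \<open>An index \<open>(False, l)\<close> stands for the component \<open>u\<^sub>l\<close>, and \<open>(True, l)\<close> for \<open>h\<^sub>l\<close>.\<close>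

type_synonym mhd_index = "bool \<times> 3"

text \<open>With P the projection, these are the symbols of -P div (u tensor u - h tensor h) and of
  -div (u tensor h - h tensor u). The index \<open>j\<close> labels the factor contracted with the
  derivative, so the sign depends on whether that factor is magnetic.\<close>

definition mhd_symbol :: "mhd_index => mhd_index => mhd_index => R3 => complex" where
 "mhd_symbol i j k xi = (if fst j then 1 else -1) * (\<i> * of_real (xi $ snd j)) *
   (if fst i then (if fst j ~= fst k & snd k = snd i then 1 else 0)
   else (if fst j = fst k then of_real (leray_symbol (snd i) (snd k) xi) else 0))"

definition momentum_flux :: "(mhd_index => R3 => complex) => 3 => R3 => complex" where
 "momentum_flux y i xi = (SU j. \<i> * of_real (xi $ j) *
   (fconv (y (False, j)) (y (False, i)) xi - fconv (y (True, j)) (y (True, i)) xi))"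

definition induction_flux :: "(mhd_index => R3 => complex) => 3 => R3 => complex" where
 "induction_flux y i xi = (SU j. \<i> * of_real (xi $ j) *
   (fconv (y (False, j)) (y (True, i)) xi - fconv (y (True, j)) (y (False, i)) xi))"

lemma sum_mhd_index:
 "(\<Sum>p\<in>(UNIV :: mhd_index set). F p) = (SU l. F (False, l)) + (SU l. F (True, l))"
proof -
 have "(\<Sum>p\<in>(UNIV :: mhd_index set). F p) = (SU b. SU l. F (b, l))"
  unfolding UNIV_Times_UNIV[symmetric] by (simp add: sum.cartesian_product)
 thus ?thesis by (simp add: UNIV_bool)
qed

lemma quad_mhd_induction: "quad mhd_symbol y (True, l) xi = - induction_flux y l xi"
proof -
 have e: "(SU q. (if q = l then 1 else 0) * F q) = F l" for F :: "3 => complex"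
  by (simp add: if_distrib[of "%z. z * _"] cong: if_cong)
 have d: "(SU q. c * (d * ((if q = l then 1 else 0) * F q)) - c' * (d' * ((if q = l then 1 else 0) * G q))) = c * (d * F l) - c' * (d' * G l)"
  for c d c' d' :: complex and F G :: "3 => complex"
  by (simp add: sum_subtractf sum_distrib_left[symmetric] e)
 show ?thesis
  unfolding quad_def sum_mhd_index mhd_symbol_def induction_flux_def
  by (simp add: d sum_negf[symmetric] sum.distrib[symmetric] algebra_simps)
qed

lemma quad_mhd_momentum:
 "quad mhd_symbol y (False, l) xi = - (SU q. of_real (leray_symbol l q xi) * momentum_flux y q xi)"
proof -
 have "(SU q. of_real (leray_symbol l q xi) * momentum_flux y q xi) =
  (SU j. SU q. of_real (leray_symbol l q xi) * (\<i> * of_real (xi $ j) *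
    (fconv (y (False, j)) (y (False, q)) xi - fconv (y (True, j)) (y (True, q)) xi)))"
  unfolding momentum_flux_def sum_distrib_left by (rule sum.swap)
 thus ?thesis
  unfolding quad_def sum_mhd_index mhd_symbol_def
  by (simp add: sum_negf[symmetric] sum.distrib[symmetric] algebra_simps)
qed

text \<open>36 pairs of indices, each contributing at most 2 |xi|.\<close>

lemma mhd_symbol_bound:
 "(SU j. SU k. norm (mhd_symbol i j k xi)) <= 72 * norm xi"
proof -
 have "norm (mhd_symbol i j k xi) <= 2 * norm xi" for j k
 proof -
  have "norm (mhd_symbol i j k xi) = \<bar>xi $ snd j\<bar> *
    norm (if fst i then (if fst j ~= fst k & snd k = snd i then 1 else 0)
   else (if fst j = fst k then of_real (leray_symbol (snd i) (snd k) xi) else 0) :: complex)"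
   by (simp add: mhd_symbol_def norm_mult)
  also have "... <= norm xi * 2" by (intro mult_mono component_le_norm_cart) (auto simp: leray_symbol_bound)
  finally show ?thesis by simp
 qed
 hence "(SU j. SU k. norm (mhd_symbol i j k xi)) <= (\<Sum>j\<in>(UNIV::mhd_index set). \<Sum>k\<in>(UNIV::mhd_index set). 2 * norm xi)"
  by (intro sum_mono)
 thus ?thesis by simp
qed

lemma mhd_symbol_measurable: "mhd_symbol i j k \<in> BM"
proof -
 have [measurable]: "leray_symbol l q \<in> BM" for l q
  unfolding leray_symbol_def by measurable
 show ?thesis by (cases "fst i"; cases "fst j = fst k"; cases "snd k = snd i")
    ((simp add: mhd_symbol_def[abs_def]; fail) | (simp add: mhd_symbol_def[abs_def], measurable))+
qed

lemma mhd_symbol_hermitian: "mhd_symbol i j k (- xi) = cnj (mhd_symbol i j k xi)"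
 by (simp add: mhd_symbol_def leray_symbol_def)

lemma rf_momentum_flux:
 assumes a: "rfv a (%l. y (False, l))" and b: "rfv b (%l. y (True, l))"
 shows "rf (%x. SU j. partial j (%z. a z $ j * a z $ i - b z $ j * b z $ i) x) (momentum_flux y i)"
 unfolding momentum_flux_def[abs_def]
 by (intro rf_sum rf_partial rf_diff rf_mult finite_UNIV) (use a b in \<open>auto simp: rfv_def\<close>)

lemma rf_induction_flux:
 assumes a: "rfv a (%l. y (False, l))" and b: "rfv b (%l. y (True, l))"
 shows "rf (%x. SU j. partial j (%z. a z $ j * b z $ i - b z $ j * a z $ i) x) (induction_flux y i)"
 unfolding induction_flux_def[abs_def]
 by (intro rf_sum rf_partial rf_diff rf_mult finite_UNIV) (use a b in \<open>auto simp: rfv_def\<close>)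

lemma sum_partial_diff:
 fixes a b :: "3 => R3 => real"
 assumes "!!j. a j differentiable (at x)" "!!j. b j differentiable (at x)"
 shows "(SU j. partial j (%z. a j z - b j z) x) = (SU j. partial j (a j) x) - (SU j. partial j (b j) x)"
 by (simp add: partial_diff[OF assms] sum_subtractf)

text \<open>By \<open>cross3_curl\<close> and divergence-freeness, the forcing is a gradient minus
  the divergence of a tensor a - b tensor b; so up to a gradient it is minus the momentum
  flux.\<close>

lemma rf_forcing_F:
 assumes a: "rfv a (%l. y (False, l))" and b: "rfv b (%l. y (True, l))"
  and div: "!!x. divergence a x = 0" "!!x. divergence b x = 0"
 obtains s where "!!i. rf (%x. forcing_F a b x $ i) (%xi. \<i> * of_real (xi $ i) * s xi - momentum_flux y i xi)"
proof -
 define q where "q a z = 1 / 2 * (a z $ 1 * a z $ 1 + a z $ 2 * a z $ 2 + a z $ 3 * a z $ 3)" for a :: "R3 => real^3" and z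
 have qe: "\<exists>s. rf (q a) s" if "rfv a v" for a v
 proof -
  have r: "rf (%x. a x $ i) (v i)" for i using that by (simp add: rfv_def)
  show ?thesis
   unfolding q_def[abs_def]
   by (rule exI, rule rf_cmult[OF rf_add[OF rf_add[OF rf_mult[OF r[of 1] r[of 1]] rf_mult[OF r[of 2] r[of 2]]] rf_mult[OF r[of 3] r[of 3]]]])
 qed
 obtain sa sb where s: "rf (q a) sa" "rf (q b) sb" using qe[OF a] qe[OF b] by blast
 note da = rfv_differentiable[OF a] and db = rfv_differentiable[OF b]
 have "rf (%x. forcing_F a b x $ i) (%xi. \<i> * of_real (xi $ i) * (sa xi - sb xi) - momentum_flux y i xi)" for i
 proof -
  have "forcing_F a b x $ i = partial i (%z. q a z - q b z) x - (SU j. partial j (%z. a z $ j * a z $ i - b z $ j * b z $ i) x)" for x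
  proof -
   have 1: "(SU j. partial j (%z. a z $ j * a z $ i - b z $ j * b z $ i) x) = advect a a x $ i - advect b b x $ i"
    using sum_partial_diff[of "%j z. a z $ j * a z $ i" x "%j z. b z $ j * b z $ i"]
    by (simp add: tensor_div_product da db div differentiable_mult partial_component(1))
   have 2: "partial i (%z. q a z - q b z) x = partial i (q a) x - partial i (q b) x"
    by (rule partial_diff) (use s in \<open>auto intro: rf_partial\<close>)
   have c: "cross3 (v x) (curl v x) $ i = partial i (q v) x - advect v v x $ i" if "v differentiable (at x)" for v
    unfolding q_def[abs_def] by (rule cross3_curl[OF that])
   show ?thesis
    unfolding 1 2 forcing_F_def vector_minus_component c[OF da] c[OF db] by simp
  qed
  moreover have "rf (%x. partial i (%z. q a z - q b z) x - (SU j. partial j (%z. a z $ j * a z $ i - b z $ j * b z $ i) x))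
    (%xi. \<i> * of_real (xi $ i) * (sa xi - sb xi) - momentum_flux y i xi)"
   by (intro rf_diff rf_partial s rf_momentum_flux a b)
  ultimately show ?thesis by simp
 qed
 thus thesis by (rule that)
qed

lemma rf_forcing_G:
 assumes a: "rfv a (%l. y (False, l))" and b: "rfv b (%l. y (True, l))"
  and div: "!!x. divergence a x = 0" "!!x. divergence b x = 0"
 shows "rf (%x. forcing_G a b x $ i) (%xi. - induction_flux y i xi)"
proof -
 note da = rfv_differentiable[OF a] and db = rfv_differentiable[OF b]
 have "forcing_G a b x $ i = (-1) * (SU j. partial j (%z. a z $ j * b z $ i - b z $ j * a z $ i) x)" for x
  using sum_partial_diff[of "%j z. a z $ j * b z $ i" x "%j z. b z $ j * a z $ i"]
  by (simp add: tensor_div_product da db div differentiable_mult partial_component(1) forcing_G_def)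
 thus ?thesis using rf_cmult[OF rf_induction_flux[OF a b], of "-1" i] by simp
qed

text \<open>With U = a - f and H = b - g the mixed terms complete the products, so the flux is that
  of the full fields minus that of the background.\<close>

lemma rfv_flux_U:
 assumes a: "rfv a (%l. y (False, l))" and b: "rfv b (%l. y (True, l))"
  and f: "rfv f (%l. v (False, l))" and g: "rfv g (%l. v (True, l))"
 shows "rfv (tensor_div (%x. flux_U (f x) (g x) (a x - f x) (b x - g x))) (%i xi. momentum_flux y i xi - momentum_flux v i xi)"
 unfolding rfv_def
proof
 fix i
 have "(%z. flux_U (f z) (g z) (a z - f z) (b z - g z) $ j $ i) =
   (%z. (a z $ j * a z $ i - b z $ j * b z $ i) - (f z $ j * f z $ i - g z $ j * g z $ i))" for j
  by (rule ext) (simp add: flux_U_def tensor_def algebra_simps)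
 hence "(%x. tensor_div (%x. flux_U (f x) (g x) (a x - f x) (b x - g x)) x $ i) =
   (%x. SU j. partial j (%z. (a z $ j * a z $ i - b z $ j * b z $ i) - (f z $ j * f z $ i - g z $ j * g z $ i)) x)"
  by (simp add: tensor_div_def)
 also have "... = (%x. (SU j. partial j (%z. a z $ j * a z $ i - b z $ j * b z $ i) x) - (SU j. partial j (%z. f z $ j * f z $ i - g z $ j * g z $ i) x))"
  by (intro ext sum_partial_diff differentiable_diff differentiable_mult partial_component(1) rfv_differentiable) (use assms in blast)+
 finally show "rf (%x. tensor_div (%x. flux_U (f x) (g x) (a x - f x) (b x - g x)) x $ i) (%xi. momentum_flux y i xi - momentum_flux v i xi)"
  using rf_diff[OF rf_momentum_flux[OF a b] rf_momentum_flux[OF f g]] by simp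
qed

lemma rfv_flux_H:
 assumes a: "rfv a (%l. y (False, l))" and b: "rfv b (%l. y (True, l))"
  and f: "rfv f (%l. v (False, l))" and g: "rfv g (%l. v (True, l))"
 shows "rfv (tensor_div (%x. flux_H (f x) (g x) (a x - f x) (b x - g x))) (%i xi. induction_flux y i xi - induction_flux v i xi)"
 unfolding rfv_def
proof
 fix i
 have "(%z. flux_H (f z) (g z) (a z - f z) (b z - g z) $ j $ i) =
   (%z. (a z $ j * b z $ i - b z $ j * a z $ i) - (f z $ j * g z $ i - g z $ j * f z $ i))" for j
  by (rule ext) (simp add: flux_H_def tensor_def algebra_simps)
 hence "(%x. tensor_div (%x. flux_H (f x) (g x) (a x - f x) (b x - g x)) x $ i) =
   (%x. SU j. partial j (%z. (a z $ j * b z $ i - b z $ j * a z $ i) - (f z $ j * g z $ i - g z $ j * f z $ i)) x)"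
  by (simp add: tensor_div_def)
 also have "... = (%x. (SU j. partial j (%z. a z $ j * b z $ i - b z $ j * a z $ i) x) - (SU j. partial j (%z. f z $ j * g z $ i - g z $ j * f z $ i) x))"
  by (intro ext sum_partial_diff differentiable_diff differentiable_mult partial_component(1) rfv_differentiable) (use assms in blast)+
 finally show "rf (%x. tensor_div (%x. flux_H (f x) (g x) (a x - f x) (b x - g x)) x $ i) (%xi. induction_flux y i xi - induction_flux v i xi)"
  using rf_diff[OF rf_induction_flux[OF a b] rf_induction_flux[OF f g]] by simp
qed

text \<open>The projection symbol annihilates xi; this is where the gradient part of the forcing
  disappears.\<close>

lemma leray_gradient:
 assumes "xi ~= 0"
 shows "(SU q. of_real (leray_symbol l q xi) * (\<i> * of_real (xi $ q) * s - r q)) = - (SU q. of_real (leray_symbol l q xi) * (r q :: complex))"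
proof -
 have "(SU q. of_real (leray_symbol l q xi) * (\<i> * of_real (xi $ q) * s - r q)) =
   of_real (SU q. leray_symbol l q xi * xi $ q) * (\<i> * s) - (SU q. of_real (leray_symbol l q xi) * r q)"
  unfolding of_real_sum sum_distrib_right of_real_mult right_diff_distrib sum_subtractf by (simp only: mult_ac)
 thus ?thesis using leray_symbol_transversal(2)[OF assms] by simp
qed

lemma fconv_commute:
 assumes [measurable]: "v \<in> BM" "w \<in> BM"
 shows "fconv v w xi = fconv w v xi"
proof -
 have "(lint eta. v (xi - eta) * w eta) = (lint eta. v (xi - (xi - eta)) * w (xi - eta))"
  by (rule integral_reflect_R3[of "%eta. v (xi - eta) * w eta" xi, symmetric]) measurable
 thus ?thesis by (simp add: fconv_def mult.commute)
qed

text \<open>For the velocity, the projection is perpendicular to xi. For the magnetic field, xi_j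
  xi_l is symmetric while the flux is antisymmetric in its indices, by commutativity of the
  convolution.\<close>

lemma quad_mhd_divergence_free:
 assumes y: "!!i. y i \<in> BM" and nz: "xi ~= 0"
 shows "(SU l. of_real (xi $ l) * quad mhd_symbol y (b, l) xi) = 0"
proof (cases b)
 case False
 have "(SU l. of_real (xi $ l) * quad mhd_symbol y (False, l) xi) =
   - (SU l. SU q. of_real (xi $ l) * (of_real (leray_symbol l q xi) * momentum_flux y q xi))"
  by (simp add: quad_mhd_momentum sum_distrib_left sum_negf)
 also have "(SU l. SU q. of_real (xi $ l) * (of_real (leray_symbol l q xi) * momentum_flux y q xi)) =
   (SU q. of_real (SU l. xi $ l * leray_symbol l q xi) * momentum_flux y q xi)"
  by (subst sum.swap) (simp add: sum_distrib_right mult.assoc)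
 finally show ?thesis using False by (simp add: leray_symbol_transversal(1)[OF nz])
next
 case True
 have "(SU l. of_real (xi $ l) * induction_flux y l xi) = 0"
  unfolding induction_flux_def sum_3
  using fconv_commute[OF y y, of _ _ xi] by (simp add: algebra_simps)
 thus ?thesis using True by (simp add: quad_mhd_induction sum_negf)
qed

text \<open>The projection symbol is bounded, real and even, hence preserves rapid decay and
  Hermitian symmetry, and the inverse transform is real.\<close>

lemma rf_quad_momentum:
 assumes a: "rfv a (%l. y (False, l))" and b: "rfv b (%l. y (True, l))"
 shows "rf (%z. Re (ift (quad mhd_symbol y (False, l)) z)) (quad mhd_symbol y (False, l))"
proof (rule rf_of_hermitian)
 note m = rf_momentum_flux[OF a b]
 have sm: "(%xi. complex_of_real (leray_symbol l q xi)) \<in> BM" for q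
  unfolding leray_symbol_def by measurable
 have r: "rapid (%xi. of_real (leray_symbol l q xi) * momentum_flux y q xi)" for q
  by (rule rapid_mult_poly[where A = 2 and q = 0, OF rf_rapid[OF m] sm]) (auto simp: leray_symbol_bound)
 have "rapid (%xi. (-1) * ((of_real (leray_symbol l 1 xi) * momentum_flux y 1 xi + of_real (leray_symbol l 2 xi) * momentum_flux y 2 xi) + of_real (leray_symbol l 3 xi) * momentum_flux y 3 xi))"
  by (intro rapid_cmult rapid_add r)
 moreover have "quad mhd_symbol y (False, l) = (%xi. (-1) * ((of_real (leray_symbol l 1 xi) * momentum_flux y 1 xi + of_real (leray_symbol l 2 xi) * momentum_flux y 2 xi) + of_real (leray_symbol l 3 xi) * momentum_flux y 3 xi))"
  by (simp add: fun_eq_iff quad_mhd_momentum sum_3)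
 ultimately show "rapid (quad mhd_symbol y (False, l))" by simp
 show "AE xi in lborel. quad mhd_symbol y (False, l) (- xi) = cnj (quad mhd_symbol y (False, l) xi)"
  using rf_hermitian[OF m[of 1]] rf_hermitian[OF m[of 2]] rf_hermitian[OF m[of 3]]
  by eventually_elim (simp add: quad_mhd_momentum sum_3 leray_symbol_def)
qed

text \<open>Only \<open>A\<close> is assumed measurable: \<open>B\<close> will be the weighted norm
  of the forcing as a function of time, whose measurability is not part of the data. The constant is
  therefore moved to the side of \<open>A\<close> before monotonicity is used.\<close>

lemma nn_integral_le_cmult:
 assumes [measurable]: "A \<in> borel_measurable M" and k: "k > 0"
  and le: "AE s in M. A s <= ennreal k * B s"
 shows "(\<integral>\<^sup>+s. A s \<partial>M) <= ennreal k * (\<integral>\<^sup>+s. B s \<partial>M)"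
proof -
 have e: "ennreal (1 / k) * (ennreal k * X) = X" "ennreal k * (ennreal (1 / k) * X) = X" for X
  using k by (simp_all add: mult.assoc[symmetric] ennreal_mult[symmetric])
 have "(\<integral>\<^sup>+s. A s \<partial>M) = ennreal k * (\<integral>\<^sup>+s. ennreal (1 / k) * A s \<partial>M)"
  by (simp add: nn_integral_cmult e)
 also have "... <= ennreal k * (\<integral>\<^sup>+s. B s \<partial>M)"
 proof (intro mult_left_mono nn_integral_mono_AE)
  show "AE s in M. ennreal (1 / k) * A s <= B s"
   using le
  proof eventually_elim
   case (elim s)
   from mult_left_mono[OF this, of "ennreal (1 / k)"] show ?case by (simp add: e)
  qed
 qed simp
 finally show ?thesis .
qed

text \<open>The factor 3 passes from the Euclidean norm to the sum of the moduli of the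
  components.\<close>

lemma weight_sum_le:
 assumes a: "has_fourier a (%xi. \<chi> i. v i xi)" and [measurable]: "!!i. v i \<in> BM" "W \<in> BM"
  and W: "!!xi. W xi >= 0"
 shows "(nint xi. ennreal (W xi * (SU l. norm (v l xi)))) <= ennreal 3 * fourier_weight W a"
 unfolding fourier_weight_eq[OF a]
proof (rule nn_integral_le_cmult)
 show "AE xi in lborel. ennreal (W xi * (SU l. norm (v l xi))) <= ennreal 3 * ennreal (W xi * norm (\<chi> i. v i xi))"
 proof (rule AE_I2)
  fix xi
  have "W xi * (SU l. norm (v l xi)) <= W xi * (3 * norm (\<chi> i. v i xi))"
   by (intro mult_left_mono sum_norm_le_norm_vec W)
  hence "ennreal (W xi * (SU l. norm (v l xi))) <= ennreal (3 * (W xi * norm (\<chi> i. v i xi)))"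
   by (intro ennreal_leI) simp
  thus "ennreal (W xi * (SU l. norm (v l xi))) <= ennreal 3 * ennreal (W xi * norm (\<chi> i. v i xi))"
   using W by (simp only: ennreal_mult norm_ge_zero zero_le_numeral mult_nonneg_nonneg)
 qed
qed auto

lemma fourier_weight_le_sum:
 assumes a: "has_fourier a (%xi. \<chi> i. v i xi)" and [measurable]: "!!i. v i \<in> BM" "W \<in> BM"
  and W: "!!xi. W xi >= 0"
 shows "fourier_weight W a <= (SU l. \<integral>\<^sup>+xi. en (v l xi) * ennreal (W xi) \<partial>lborel)"
proof -
 have "fourier_weight W a <= (nint xi. (SU l. en (v l xi) * ennreal (W xi)))"
  unfolding fourier_weight_eq[OF a]
 proof (rule nn_integral_mono)
  fix xi
  have "W xi * norm (\<chi> i. v i xi) <= W xi * (SU l. norm (v l xi))"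
   by (intro mult_left_mono norm_vec_le_sum W)
  hence "ennreal (W xi * norm (\<chi> i. v i xi)) <= ennreal (SU l. norm (v l xi) * W xi)"
   by (intro ennreal_leI) (simp add: sum_distrib_left mult.commute)
  also have "... = (SU l. ennreal (norm (v l xi) * W xi))" using W by (simp add: sum_ennreal)
  also have "... = (SU l. en (v l xi) * ennreal (W xi))" using W by (simp add: ennreal_mult)
  finally show "ennreal (W xi * norm (\<chi> i. v i xi)) <= (SU l. en (v l xi) * ennreal (W xi))" .
 qed
 also have "... = (SU l. \<integral>\<^sup>+xi. en (v l xi) * ennreal (W xi) \<partial>lborel)"
  by (rule nn_integral_sum) measurable
 finally show ?thesis .
qed

lemma chi1_ennreal: "chi1 (%xi. ennreal (r xi)) = (nint xi. ennreal (1 / norm xi * r xi))"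
 unfolding chi1_def by (rule nn_integral_cong) (simp add: ennreal_mult''[symmetric])

section \<open>The data of the problem as a system of mild equations\<close>

locale mhd_data =
 fixes \<nu> \<mu> P \<delta> :: real and u01 u02 h01 h02 :: "R3 => real^3" and f g :: "real => R3 => real^3"
  and v1 v2 k1 k2 :: "3 => R3 => complex"
 assumes \<nu>: "\<nu> > 0" and \<mu>: "\<mu> > 0" and P0: "P >= 0" and \<delta>0: "\<delta> >= 0"
  and small_\<delta>: "18 * \<delta> <= small_const (min \<nu> \<mu>) 72 (3 * P) (real CARD(mhd_index))"
  and wdiv: "weakly_divergence_free u01" "weakly_divergence_free u02" "weakly_divergence_free h01" "weakly_divergence_free h02"
  and mass: "fourier_weight (%xi. 1 + 1 / nsq xi) u02 + fourier_weight (%xi. 1 + 1 / nsq xi) h02 <= ennreal P"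
  and heat_f: "heat_solution \<nu> u02 f" and div_f: "!!t z. t > 0 ==> divergence (f t) z = 0"
  and heat_g: "heat_solution \<mu> h02 g" and div_g: "!!t z. t > 0 ==> divergence (g t) z = 0"
  and forcing: "!!t. t >= 0 ==> fw1 u01 + fw1 h01
     + (\<integral>\<^sup>+\<tau>\<in>{0..t}. fw1 (forcing_F (f \<tau>) (g \<tau>)) \<partial>lborel)
     + (\<integral>\<^sup>+\<tau>\<in>{0..t}. fw1 (forcing_G (f \<tau>) (g \<tau>)) \<partial>lborel)
    <= ennreal \<delta>"
  and fou: "has_fourier u01 (%xi. \<chi> i. v1 i xi)" "has_fourier u02 (%xi. \<chi> i. v2 i xi)"
   "has_fourier h01 (%xi. \<chi> i. k1 i xi)" "has_fourier h02 (%xi. \<chi> i. k2 i xi)"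
  and v_meas[measurable]: "!!i. v1 i \<in> BM" "!!i. v2 i \<in> BM"
   "!!i. k1 i \<in> BM" "!!i. k2 i \<in> BM"
  and v_herm: "!!i xi. v1 i (- xi) = cnj (v1 i xi)" "!!i xi. v2 i (- xi) = cnj (v2 i xi)"
   "!!i xi. k1 i (- xi) = cnj (k1 i xi)" "!!i xi. k2 i (- xi) = cnj (k2 i xi)"
begin

definition visc :: "mhd_index => real" where "visc i = (if fst i then \<mu> else \<nu>)"
definition ini :: "mhd_index => R3 => complex" where "ini i = (if fst i then k1 else v1) (snd i)"
definition bg :: "mhd_index => R3 => complex" where "bg i = (if fst i then k2 else v2) (snd i)"

lemma ini_measurable[measurable]: "ini i \<in> BM" and bg_measurable[measurable]: "bg i \<in> BM"
 by (auto simp: ini_def bg_def)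

lemma weight_sum_split:
 assumes [measurable]: "!!i. y i \<in> BM" "W \<in> BM" and W: "!!xi. W xi >= 0"
 shows "(nint xi. ennreal (W xi * (\<Sum>i\<in>(UNIV :: mhd_index set). norm (y i xi :: complex)))) =
  (nint xi. ennreal (W xi * (SU l. norm (y (False, l) xi)))) + (nint xi. ennreal (W xi * (SU l. norm (y (True, l) xi))))"
proof -
 have "ennreal (W xi * (\<Sum>i\<in>(UNIV :: mhd_index set). norm (y i xi))) =
   ennreal (W xi * (SU l. norm (y (False, l) xi))) + ennreal (W xi * (SU l. norm (y (True, l) xi)))" for xi
  unfolding sum_mhd_index distrib_left using W by (intro ennreal_plus mult_nonneg_nonneg sum_nonneg) auto
 thus ?thesis by (simp add: nn_integral_add)
qed

lemma bg_weight:
 "(nint xi. ennreal ((1 + 1 / nsq xi) * (SU i. norm (bg i xi)))) <= ennreal (3 * P)"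
proof -
 have "(nint xi. ennreal ((1 + 1 / nsq xi) * (SU i. norm (bg i xi)))) =
   (nint xi. ennreal ((1 + 1 / nsq xi) * (SU l. norm (v2 l xi)))) + (nint xi. ennreal ((1 + 1 / nsq xi) * (SU l. norm (k2 l xi))))"
  using weight_sum_split[of bg "%xi. 1 + 1 / nsq xi"] by (simp add: bg_def)
 also have "... <= ennreal 3 * fourier_weight (%xi. 1 + 1 / nsq xi) u02 + ennreal 3 * fourier_weight (%xi. 1 + 1 / nsq xi) h02"
  by (intro add_mono weight_sum_le fou) auto
 also have "... <= ennreal 3 * ennreal P" unfolding distrib_left[symmetric] by (intro mult_left_mono mass) simp
 also have "... = ennreal (3 * P)" using P0 by (simp add: ennreal_mult)
 finally show ?thesis .
qed

lemma bg_mass: "(nint xi. ennreal (SU i. norm (bg i xi))) <= ennreal (3 * P)"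
 and bg_low: "(nint xi. ennreal ((SU i. norm (bg i xi)) / nsq xi)) <= ennreal (3 * P)"
proof -
 have n: "(SU i. norm (bg i xi)) >= 0" for xi by (intro sum_nonneg) auto
 show "(nint xi. ennreal (SU i. norm (bg i xi))) <= ennreal (3 * P)"
  by (rule order_trans[OF nn_integral_mono bg_weight]) (use n in \<open>auto simp: distrib_right intro!: ennreal_leI\<close>)
 show "(nint xi. ennreal ((SU i. norm (bg i xi)) / nsq xi)) <= ennreal (3 * P)"
  by (rule order_trans[OF nn_integral_mono bg_weight]) (use n in \<open>auto simp: distrib_right intro!: ennreal_leI\<close>)
qed

lemma bg_component_le: "en (bg i xi) <= ennreal (SU i. norm (bg i xi))"
 by (intro ennreal_leI member_le_sum) auto

lemma bg_integrable: "integrable lborel (bg i)"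
proof (rule integrableI_bounded)
 have "(nint xi. en (bg i xi)) <= ennreal (3 * P)"
  by (rule order_trans[OF nn_integral_mono bg_mass]) (rule bg_component_le)
 thus "(nint xi. en (bg i xi)) < \<infinity>" by (rule le_less_trans) simp
qed simp

lemma bg_chi1: "chi1 (%xi. en (bg i xi)) < \<infinity>"
proof -
 have "chi1 (%xi. en (bg i xi)) <= chi1 (%xi. ennreal (SU i. norm (bg i xi)))"
  by (rule chi1_mono) (rule bg_component_le)
 also have "... < \<infinity>"
  by (rule chi1_finite_of_weights) (use le_less_trans[OF bg_mass] le_less_trans[OF bg_low] in \<open>auto intro: sum_nonneg\<close>)
 finally show ?thesis .
qed

lemma rfv_background:
 assumes t: "t > 0"
 shows "rfv (f t) (%l. heat_flow visc bg (False, l) t)" "rfv (g t) (%l. heat_flow visc bg (True, l) t)"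
proof -
 have 1: "heat_flow visc bg (False, l) = heat_flow (%_. \<nu>) v2 l" "heat_flow visc bg (True, l) = heat_flow (%_. \<mu>) k2 l" for l
  by (simp_all add: heat_flow_def[abs_def] visc_def bg_def)
 have i: "integrable lborel (v2 l)" "integrable lborel (k2 l)" for l
  using bg_integrable[of "(False, l)"] bg_integrable[of "(True, l)"] by (simp_all add: bg_def)
 have c: "chi1 (%xi. en (v2 l xi)) < \<infinity>" "chi1 (%xi. en (k2 l xi)) < \<infinity>" for l
  using bg_chi1[of "(False, l)"] bg_chi1[of "(True, l)"] by (simp_all add: bg_def)
 show "rfv (f t) (%l. heat_flow visc bg (False, l) t)" "rfv (g t) (%l. heat_flow visc bg (True, l) t)"
  unfolding 1 by (rule heat_solution_rfv[OF \<nu> heat_f fou(2) v_meas(2) v_herm(2) i(1) c(1) t])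
    (rule heat_solution_rfv[OF \<mu> heat_g fou(4) v_meas(4) v_herm(4) i(2) c(2) t])
qed

text \<open>The quadratic term of the background is the projected forcing \<open>F\<close> for the
  velocity and the forcing \<open>G\<close> for the magnetic field. The factor 18 is 2 * 3, for the
  size of the projection symbol and the number of components, times 3 from
  \<open>weight_sum_le\<close>; for \<open>G\<close> the last 3 alone would do.\<close>

lemma background_momentum_weight:
 assumes s: "s > 0"
 defines "y \<equiv> %j. heat_flow visc bg j s"
 shows "chi1 (%xi. ennreal (SU l. norm (quad mhd_symbol y (False, l) xi))) \<le>
   ennreal 18 * fw1 (forcing_F (f s) (g s))"
  and "chi1 (%xi. ennreal (SU l. norm (quad mhd_symbol y (True, l) xi))) \<le>
   ennreal 18 * fw1 (forcing_G (f s) (g s))"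
proof -
 note r = rfv_background[OF s, folded y_def] and d = div_f[OF s] div_g[OF s]
 obtain q where q: "!!i. rf (%x. forcing_F (f s) (g s) x $ i) (%xi. \<i> * of_real (xi $ i) * q xi - momentum_flux y i xi)"
  using rf_forcing_F[OF r[unfolded y_def] d] unfolding y_def by blast
 define F where "F i xi = \<i> * of_real (xi $ i) * q xi - momentum_flux y i xi" for i xi
 have rF: "rfv (forcing_F (f s) (g s)) F" unfolding rfv_def F_def[abs_def] using q by blast
 have Fm[measurable]: "F i \<in> BM" for i
  using rF by (auto simp: rfv_def intro: rapid_measurable rf_rapid)
 have "chi1 (%xi. ennreal (SU l. norm (quad mhd_symbol y (False, l) xi))) \<le>
   (nint xi. ennreal 6 * ennreal (1 / norm xi * (SU l. norm (F l xi))))"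
  unfolding chi1_ennreal
 proof (rule nn_integral_mono_AE)
  show "AE xi in lborel. ennreal (1 / norm xi * (SU l. norm (quad mhd_symbol y (False, l) xi))) \<le>
    ennreal 6 * ennreal (1 / norm xi * (SU l. norm (F l xi)))"
   using AE_nonzero_R3
  proof eventually_elim
   fix xi :: R3 assume nz: "xi ~= 0"
   have "norm (quad mhd_symbol y (False, l) xi) <= 2 * (SU l. norm (F l xi))" for l
   proof -
    have "quad mhd_symbol y (False, l) xi = (SU q. of_real (leray_symbol l q xi) * F q xi)"
     unfolding quad_mhd_momentum F_def leray_gradient[OF nz] ..
    also have "norm ... <= (SU q. 2 * norm (F q xi))"
     by (rule order_trans[OF norm_sum sum_mono]) (auto simp: norm_mult intro!: mult_right_mono leray_symbol_bound)
    finally show ?thesis by (simp add: sum_distrib_left)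
   qed
   hence "(SU l. norm (quad mhd_symbol y (False, l) xi)) <= (\<Sum>l\<in>(UNIV :: 3 set). 2 * (SU l. norm (F l xi)))"
    by (intro sum_mono)
   also have "... = 6 * (SU l. norm (F l xi))" by simp
   finally have "1 / norm xi * (SU l. norm (quad mhd_symbol y (False, l) xi)) <= 1 / norm xi * (6 * (SU l. norm (F l xi)))"
    by (rule mult_left_mono) simp
   hence "ennreal (1 / norm xi * (SU l. norm (quad mhd_symbol y (False, l) xi))) <= ennreal (6 * (1 / norm xi * (SU l. norm (F l xi))))"
    by (intro ennreal_leI) simp
   also have "... = ennreal 6 * ennreal (1 / norm xi * (SU l. norm (F l xi)))"
    by (intro ennreal_mult mult_nonneg_nonneg sum_nonneg) auto
   finally show "ennreal (1 / norm xi * (SU l. norm (quad mhd_symbol y (False, l) xi))) \<le>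
    ennreal 6 * ennreal (1 / norm xi * (SU l. norm (F l xi)))" .
  qed
 qed
 also have "... = ennreal 6 * (nint xi. ennreal (1 / norm xi * (SU l. norm (F l xi))))"
  by (rule nn_integral_cmult) measurable
 also have "... <= ennreal 6 * (ennreal 3 * fw1 (forcing_F (f s) (g s)))"
  by (intro mult_left_mono weight_sum_le rfv_has_fourier rF) auto
 also have "... = ennreal 18 * fw1 (forcing_F (f s) (g s))"
  by (simp add: mult.assoc[symmetric] ennreal_mult[symmetric] del: ennreal_numeral)
 finally show "chi1 (%xi. ennreal (SU l. norm (quad mhd_symbol y (False, l) xi))) \<le>
   ennreal 18 * fw1 (forcing_F (f s) (g s))" .
 define G where "G i xi = - induction_flux y i xi" for i xi
 have rG: "rfv (forcing_G (f s) (g s)) G"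
  unfolding rfv_def G_def[abs_def] using rf_forcing_G[OF r[unfolded y_def] d] unfolding y_def by blast
 have Gm[measurable]: "G i \<in> BM" for i
  using rG by (auto simp: rfv_def intro: rapid_measurable rf_rapid)
 have "chi1 (%xi. ennreal (SU l. norm (quad mhd_symbol y (True, l) xi))) =
   (nint xi. ennreal (1 / norm xi * (SU l. norm (G l xi))))"
  unfolding chi1_ennreal by (simp add: quad_mhd_induction G_def)
 also have "... <= ennreal 3 * fw1 (forcing_G (f s) (g s))" by (intro weight_sum_le rfv_has_fourier rG) auto
 also have "... <= ennreal 18 * fw1 (forcing_G (f s) (g s))" by (intro mult_right_mono ennreal_leI) auto
 finally show "chi1 (%xi. ennreal (SU l. norm (quad mhd_symbol y (True, l) xi))) \<le>
   ennreal 18 * fw1 (forcing_G (f s) (g s))" .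
qed

lemma background_quad_small:
 assumes t: "t >= 0"
 shows "(\<integral>\<^sup>+s\<in>{0..t}. chi1 (%xi. ennreal (SU i. norm (quad mhd_symbol (%j. heat_flow visc bg j s) i xi))) \<partial>lborel) <= ennreal (18 * \<delta>)"
proof -
 have jq: "jm (%s. quad mhd_symbol (%j. heat_flow visc bg j s) i)" for i
  by (intro jm_quad jm_heat_flow mhd_symbol_measurable) measurable
 note [measurable (raw)] = jm_compose[OF jq]
 define A where "A b s = chi1 (%xi. ennreal (SU l. norm (quad mhd_symbol (%j. heat_flow visc bg j s) (b, l) xi)))" for b s
 have Am[measurable]: "A b \<in> BM" for b unfolding A_def[abs_def] chi1_def by measurable
 have "chi1 (%xi. ennreal (SU i. norm (quad mhd_symbol (%j. heat_flow visc bg j s) i xi))) = A False s + A True s" for s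
  unfolding A_def chi1_ennreal by (rule weight_sum_split) (auto intro: jm_at[OF jq])
 hence "(\<integral>\<^sup>+s\<in>{0..t}. chi1 (%xi. ennreal (SU i. norm (quad mhd_symbol (%j. heat_flow visc bg j s) i xi))) \<partial>lborel) =
   (\<integral>\<^sup>+s\<in>{0..t}. A False s \<partial>lborel) + (\<integral>\<^sup>+s\<in>{0..t}. A True s \<partial>lborel)"
  by (simp add: distrib_right nn_integral_add)
 also have "... <= ennreal 18 * (\<integral>\<^sup>+\<tau>\<in>{0..t}. fw1 (forcing_F (f \<tau>) (g \<tau>)) \<partial>lborel) +
   ennreal 18 * (\<integral>\<^sup>+\<tau>\<in>{0..t}. fw1 (forcing_G (f \<tau>) (g \<tau>)) \<partial>lborel)"
 proof (intro add_mono nn_integral_le_cmult)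
  \<comment> \<open>The comparison holds for positive times only; time 0 is a null set.\<close>
  show "AE s in lborel. A False s * ind t s <= ennreal 18 * (fw1 (forcing_F (f s) (g s)) * ind t s)"
   using AE_lborel_singleton[of 0]
   by eventually_elim (use background_momentum_weight(1) in \<open>auto simp: indicator_def A_def simp del: ennreal_numeral\<close>)
  show "AE s in lborel. A True s * ind t s <= ennreal 18 * (fw1 (forcing_G (f s) (g s)) * ind t s)"
   using AE_lborel_singleton[of 0]
   by eventually_elim (use background_momentum_weight(2) in \<open>auto simp: indicator_def A_def simp del: ennreal_numeral\<close>)
 qed auto
 also have "... <= ennreal 18 * ennreal \<delta>"
  unfolding distrib_left[symmetric]
 proof (rule mult_left_mono)
  show "(\<integral>\<^sup>+\<tau>\<in>{0..t}. fw1 (forcing_F (f \<tau>) (g \<tau>)) \<partial>lborel) +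
   (\<integral>\<^sup>+\<tau>\<in>{0..t}. fw1 (forcing_G (f \<tau>) (g \<tau>)) \<partial>lborel) <= ennreal \<delta>"
   by (rule order_trans[OF _ forcing[OF t]]) (simp add: add_increasing add.assoc)
 qed simp
 also have "... = ennreal (18 * \<delta>)" using \<delta>0 by (simp add: ennreal_mult)
 finally show ?thesis .
qed

lemma initial_weight: "fw1 u01 + fw1 h01 <= ennreal \<delta>"
 by (rule order_trans[OF _ forcing[of 0]]) (simp_all add: add_increasing2 add.assoc)

lemma initial_small: "chi1 (%xi. ennreal (SU i. norm (ini i xi))) <= ennreal (18 * \<delta>)"
proof -
 have "chi1 (%xi. ennreal (SU i. norm (ini i xi))) =
   (nint xi. ennreal (1 / norm xi * (SU l. norm (v1 l xi)))) + (nint xi. ennreal (1 / norm xi * (SU l. norm (k1 l xi))))"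
  unfolding chi1_ennreal using weight_sum_split[of ini "%xi. 1 / norm xi"] by (simp add: ini_def)
 also have "... <= ennreal 3 * fw1 u01 + ennreal 3 * fw1 h01" by (intro add_mono weight_sum_le fou) auto
 also have "... <= ennreal 3 * ennreal \<delta>" unfolding distrib_left[symmetric] by (intro mult_left_mono initial_weight) simp
 also have "... = ennreal (3 * \<delta>)" using \<delta>0 by (simp add: ennreal_mult)
 also have "... <= ennreal (18 * \<delta>)" using \<delta>0 by (intro ennreal_leI) simp
 finally show ?thesis .
qed

end

sublocale mhd_data \<subseteq> mild_system visc "min \<nu> \<mu>" 72 "3 * P" "18 * \<delta>" mhd_symbol ini bg
 by unfold_locales
   (use \<nu> \<mu> P0 \<delta>0 mhd_symbol_bound mhd_symbol_measurable bg_mass bg_low initial_small background_quad_small small_\<delta>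
   in \<open>auto simp: visc_def\<close>)

section \<open>The solution in physical variables\<close>

context mhd_data
begin

definition fld :: "bool => real => R3 => real^3" where
 "fld b t z = (\<chi> l. Re (ift (x (b, l) t) z))"

definition bgf :: "bool => real => R3 => real^3" where "bgf b = (if b then g else f)"
definition inif :: "bool => R3 => real^3" where "inif b = (if b then h01 else u01)"

text \<open>At time 0 the value is the given datum itself: its transform is known to be integrable
  only with the weight 1/|xi|, so an absolutely convergent inversion integral is not guaranteed.
  That the datum is attained as a limit is \<open>initial_attained\<close>.\<close>

definition sol :: "bool => real => R3 => real^3" where
 "sol b t = (if t = 0 then inif b else (%z. fld b t z - bgf b t z))"

text \<open>The projection of minus the divergence of the momentum flux of \<open>y\<close>.\<close>

definition leray_field :: "(mhd_index => R3 => complex) => R3 => real^3" where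
 "leray_field y z = (\<chi> l. Re (ift (quad mhd_symbol y (False, l)) z))"

abbreviation "xt t \<equiv> %j. x j t"
abbreviation "pt t \<equiv> %j. ph j t"

lemma ini_bg_hermitian: "ini i (- xi) = cnj (ini i xi)" "bg i (- xi) = cnj (bg i xi)"
 by (auto simp: ini_def bg_def v_herm)

lemma rfv_fld: "t > 0 ==> rfv (fld b t) (%l. x (b, l) t)"
 unfolding rfv_def fld_def
 by (auto intro!: rf_of_hermitian good0_rapid[OF good0_x] x_hermitian mhd_symbol_hermitian ini_bg_hermitian)

lemma rfv_bgf: "t > 0 ==> rfv (bgf b t) (%l. ph (b, l) t)"
 using rfv_background[of t] by (cases b) (simp_all add: bgf_def)

lemma smooth_bgf: "smooth_on ({0<..} \<times> UNIV) (%(t, z). bgf b t z)"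
 using heat_f heat_g by (simp add: bgf_def heat_solution_def)

lemma smooth_fld: "smooth_on ({0<..} \<times> UNIV) (%(t, z). fld b t z)"
 unfolding smooth_on_def
proof (intro allI Ck_on_vec[OF open_halfspace])
 fix k i
 have "Ck_on k ({0<..} \<times> UNIV) (%p. Re ((%(t, z). ift (x (b, i) t) z) p))"
  by (intro Ck_on_bounded_linear[OF bounded_linear_Re open_halfspace] good_Ck_on good_x)
 thus "Ck_on k ({0<..} \<times> UNIV) (%p. (%(t, z). fld b t z) p $ i)"
  by (simp add: fld_def case_prod_unfold)
qed

lemma smooth_sol: "smooth_on ({0<..} \<times> UNIV) (%(t, z). sol b t z)"
 unfolding smooth_on_def
proof
 fix k
 have "Ck_on k ({0<..} \<times> UNIV) (%p. (%(t, z). fld b t z) p - (%(t, z). bgf b t z) p)"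
  using smooth_fld smooth_bgf by (intro Ck_on_diff[OF open_halfspace]) (simp_all add: smooth_on_def)
 thus "Ck_on k ({0<..} \<times> UNIV) (%(t, z). sol b t z)"
  by (rule iffD1[OF Ck_on_cong[OF open_halfspace], rotated]) (auto simp: sol_def)
qed

text \<open>The time derivative is computed twice, from joint smoothness and under the inversion
  integral; comparing the two brings in the evolution equation of the transform.\<close>

lemma fld_equation:
 assumes t: "t > 0"
 shows "time_deriv (fld b) t z $ l - visc (b, l) * laplacian (fld b t) z $ l = Re (ift (quad mhd_symbol (xt t) (b, l)) z)"
proof -
 define q where "q s = quad mhd_symbol (xt s) (b, l)" for s
 define d where "d s xi = - of_real (visc (b, l) * nsq xi) * x (b, l) s xi + q s xi" for s xi
 have qg: "good0 q" using good_quad[of 0, OF good_x] unfolding q_def by simp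
 have mg: "good0 (%s xi. - of_real (visc (b, l) * nsq xi) * x (b, l) s xi)"
 proof -
  have "good 0 (%s xi. - of_real (visc (b, l) * nsq xi) * x (b, l) s xi)"
  proof (rule good_mult[where A = "visc (b, l)" and q = 2])
   show "norm (- complex_of_real (visc (b, l) * nsq xi)) <= visc (b, l) * (1 + norm xi) ^ 2" for xi :: R3
    using kas_nonneg[of "(b, l)"] by (simp add: norm_mult norm_power mult_left_mono power_mono)
  qed (use kas_nonneg good_x in auto)
  thus ?thesis by simp
 qed
 have dg: "good0 d" using good_add[of 0, simplified, OF mg qg] unfolding d_def .
 have "((%s. Re (ift (x (b, l) s) z)) has_real_derivative Re (ift (d t) z)) (at t)"
  by (rule good_time_derivative[OF good0_x dg t]) (use x_has_vector_derivative[of "(b, l)"] in \<open>simp add: d_def q_def\<close>)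
 moreover have "((%s. Re (ift (x (b, l) s) z)) has_real_derivative time_deriv (fld b) t z $ l) (at t)"
 proof -
  have "((%s. fld b s z) has_vector_derivative time_deriv (fld b) t z) (at t)"
   by (rule smooth_time_deriv[of 0]) (use smooth_fld t in \<open>auto simp only: smooth_on_def\<close>)
  from bounded_linear.has_vector_derivative[OF bounded_linear_vec_nth this, of l]
  show ?thesis by (simp add: has_real_derivative_iff_has_vector_derivative fld_def)
 qed
 ultimately have 1: "time_deriv (fld b) t z $ l = Re (ift (d t) z)" by (rule DERIV_unique[rotated])
 note r = rfv_fld[OF t, of b]
 have rl: "rf (%z. fld b t z $ l) (x (b, l) t)" using r by (simp add: rfv_def)
 have lap: "laplacian (%z. fld b t z $ l) z = laplacian (fld b t) z $ l"
  by (rule laplacian_component) (use rfv_differentiable[OF r] rfv_differentiable[OF rfv_partial[OF r]] in auto)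
 have lr: "rf (%z. visc (b, l) * laplacian (%z. fld b t z $ l) z) (%xi. of_real (visc (b, l)) * (- of_real (nsq xi) * x (b, l) t xi))"
  by (rule rf_cmult[OF rf_laplacian[OF rl]])
 have "ift (d t) z = ift (%xi. of_real (visc (b, l)) * (- of_real (nsq xi) * x (b, l) t xi)) z + ift (q t) z"
  using ift_add[OF rapid_integrable[OF rf_rapid[OF lr]] rapid_integrable[OF good0_rapid[OF qg t]], of z]
  by (simp add: d_def[abs_def] mult.assoc)
 also have "ift (%xi. of_real (visc (b, l)) * (- of_real (nsq xi) * x (b, l) t xi)) z = complex_of_real (visc (b, l) * laplacian (fld b t) z $ l)"
  using lr unfolding rf_def lap[symmetric] by metis
 finally show ?thesis unfolding 1 q_def by simp
qed

text \<open>The background solves the heat equation with the same viscosity, so subtracting it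
  leaves only the quadratic term of the full fields.\<close>

lemma sol_equation:
 assumes t: "t > 0"
 shows "time_deriv (sol b) t z - visc (b, l) *\<^sub>R laplacian (sol b t) z = (\<chi> l. Re (ift (quad mhd_symbol (xt t) (b, l)) z))"
proof -
 have sb: "sol b s = (%z. fld b s z - bgf b s z)" if "s > 0" for s using that by (simp add: sol_def)
 have "((%s. fld b s z - bgf b s z) has_vector_derivative time_deriv (fld b) t z - time_deriv (bgf b) t z) (at t)"
  by (intro has_vector_derivative_diff smooth_time_deriv[of 0]) (use smooth_fld smooth_bgf t in \<open>auto simp only: smooth_on_def\<close>)
 hence "((%s. sol b s z) has_vector_derivative time_deriv (fld b) t z - time_deriv (bgf b) t z) (at t)"
 proof (rule has_vector_derivative_transform_within_open)
  show "open {0::real<..}" "t \<in> {0<..}" using t by auto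
  show "fld b s z - bgf b s z = sol b s z" if "s \<in> {0<..}" for s using that sb by simp
 qed
 hence td: "time_deriv (sol b) t z = time_deriv (fld b) t z - time_deriv (bgf b) t z"
  unfolding time_deriv_def[of "sol b"] by (rule vector_derivative_at)
 have lp: "laplacian (sol b t) z = laplacian (fld b t) z - laplacian (bgf b t) z"
  unfolding sb[OF t] by (rule laplacian_diff(2))
    (auto intro: rfv_differentiable[OF rfv_fld[OF t]] rfv_differentiable[OF rfv_bgf[OF t]]
     rfv_differentiable[OF rfv_partial[OF rfv_fld[OF t]]] rfv_differentiable[OF rfv_partial[OF rfv_bgf[OF t]]])
 have "time_deriv (bgf b) t z = visc (b, l) *\<^sub>R laplacian (bgf b t) z"
  using heat_f heat_g t by (auto simp: bgf_def visc_def heat_solution_def)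
 hence "time_deriv (sol b) t z - visc (b, l) *\<^sub>R laplacian (sol b t) z = time_deriv (fld b) t z - visc (b, l) *\<^sub>R laplacian (fld b t) z"
  unfolding td lp by (simp add: algebra_simps)
 also have "... = (\<chi> l. Re (ift (quad mhd_symbol (xt t) (b, l)) z))"
 proof (rule iffD2[OF vec_eq_iff], rule allI)
  fix i
  have "visc (b, l) = visc (b, i)" by (simp add: visc_def)
  thus "(time_deriv (fld b) t z - visc (b, l) *\<^sub>R laplacian (fld b t) z) $ i = (\<chi> l. Re (ift (quad mhd_symbol (xt t) (b, l)) z)) $ i"
   using fld_equation[OF t, of b z i] by simp
 qed
 finally show ?thesis .
qed

lemma rfv_leray_field:
 assumes t: "t > 0"
 shows "rfv (leray_field (xt t)) (%l. quad mhd_symbol (xt t) (False, l))" "rfv (leray_field (pt t)) (%l. quad mhd_symbol (pt t) (False, l))"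
 unfolding rfv_def leray_field_def vec_lambda_beta
 using rf_quad_momentum[OF rfv_fld[OF t] rfv_fld[OF t]] rf_quad_momentum[OF rfv_background[OF t]] by blast+

text \<open>The two witnesses are the projected term of the background minus that of the full
  fields, and the projected term of the background; in -p + q the background cancels.\<close>

lemma velocity_equation:
 assumes t: "t > 0"
 shows "is_leray (tensor_div (%z. flux_U (f t z) (g t z) (sol False t z) (sol True t z))) (%z. leray_field (pt t) z - leray_field (xt t) z)"
  and "is_leray (forcing_F (f t) (g t)) (leray_field (pt t))"
  and "time_deriv (sol False) t z - \<nu> *\<^sub>R laplacian (sol False t) z = - (leray_field (pt t) z - leray_field (xt t) z) + leray_field (pt t) z"
proof -
 have e: "sol b t z = fld b t z - bgf b t z" for b z using t by (simp add: sol_def)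
 note r = rfv_fld[OF t, of False] rfv_fld[OF t, of True] rfv_background[OF t]
 have flux: "rfv (tensor_div (%z. flux_U (f t z) (g t z) (sol False t z) (sol True t z))) (%i xi. momentum_flux (xt t) i xi - momentum_flux (pt t) i xi)"
  unfolding e bgf_def using rfv_flux_U[OF r] by simp
 show "is_leray (tensor_div (%z. flux_U (f t z) (g t z) (sol False t z) (sol True t z))) (%z. leray_field (pt t) z - leray_field (xt t) z)"
 proof (rule is_lerayI[OF flux])
  show "rfv (%z. leray_field (pt t) z - leray_field (xt t) z) (%l xi. quad mhd_symbol (pt t) (False, l) xi - quad mhd_symbol (xt t) (False, l) xi)"
   using rfv_leray_field[OF t] by (auto simp: rfv_def intro!: rf_diff)
  show "AE xi in lborel. quad mhd_symbol (pt t) (False, l) xi - quad mhd_symbol (xt t) (False, l) xi =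
    (SU q. of_real (leray_symbol l q xi) * (momentum_flux (xt t) q xi - momentum_flux (pt t) q xi))" for l
   by (rule AE_I2) (simp add: quad_mhd_momentum right_diff_distrib sum_subtractf)
 qed
 obtain q where q: "!!i. rf (%x. forcing_F (f t) (g t) x $ i) (%xi. \<i> * of_real (xi $ i) * q xi - momentum_flux (pt t) i xi)"
  using rf_forcing_F[OF rfv_background[OF t] div_f[OF t] div_g[OF t]] by blast
 show "is_leray (forcing_F (f t) (g t)) (leray_field (pt t))"
 proof (rule is_lerayI[OF _ rfv_leray_field(2)[OF t]])
  show "rfv (forcing_F (f t) (g t)) (%i xi. \<i> * of_real (xi $ i) * q xi - momentum_flux (pt t) i xi)"
   unfolding rfv_def using q by blast
  show "AE xi in lborel. quad mhd_symbol (pt t) (False, l) xi =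
    (SU j. of_real (leray_symbol l j xi) * (\<i> * of_real (xi $ j) * q xi - momentum_flux (pt t) j xi))" for l
   using AE_nonzero_R3 by eventually_elim (simp only: quad_mhd_momentum leray_gradient not_False_eq_True)
 qed
 show "time_deriv (sol False) t z - \<nu> *\<^sub>R laplacian (sol False t) z = - (leray_field (pt t) z - leray_field (xt t) z) + leray_field (pt t) z"
  using sol_equation[OF t, of False z] by (simp add: visc_def leray_field_def)
qed

lemma magnetic_equation:
 assumes t: "t > 0"
 shows "time_deriv (sol True) t z - \<mu> *\<^sub>R laplacian (sol True t) z =
   - tensor_div (%z. flux_H (f t z) (g t z) (sol False t z) (sol True t z)) z + forcing_G (f t) (g t) z"
proof -
 have e: "sol b t z = fld b t z - bgf b t z" for b z using t by (simp add: sol_def)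
 note r = rfv_fld[OF t, of False] rfv_fld[OF t, of True] rfv_background[OF t]
 define T where "T = tensor_div (%z. flux_H (f t z) (g t z) (sol False t z) (sol True t z))"
 have flux: "rfv T (%i xi. induction_flux (xt t) i xi - induction_flux (pt t) i xi)"
  unfolding T_def e bgf_def using rfv_flux_H[OF r] by simp
 have "Re (ift (quad mhd_symbol (xt t) (True, i)) z) = - T z $ i + forcing_G (f t) (g t) z $ i" for i
 proof -
  have "rf (%z. forcing_G (f t) (g t) z $ i - T z $ i) (%xi. - induction_flux (pt t) i xi - (induction_flux (xt t) i xi - induction_flux (pt t) i xi))"
   by (rule rf_diff[OF rf_forcing_G[OF rfv_background[OF t] div_f[OF t] div_g[OF t]]]) (use flux in \<open>simp add: rfv_def\<close>)
  also have "(%xi. - induction_flux (pt t) i xi - (induction_flux (xt t) i xi - induction_flux (pt t) i xi)) = quad mhd_symbol (xt t) (True, i)"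
   by (simp add: fun_eq_iff quad_mhd_induction)
  finally have "complex_of_real (forcing_G (f t) (g t) z $ i - T z $ i) = ift (quad mhd_symbol (xt t) (True, i)) z"
   by (simp only: rf_def)
  hence "Re (ift (quad mhd_symbol (xt t) (True, i)) z) = forcing_G (f t) (g t) z $ i - T z $ i"
   by (metis Re_complex_of_real)
  thus ?thesis by simp
 qed
 thus ?thesis
  using sol_equation[OF t, of True z] unfolding T_def[symmetric] by (simp add: visc_def vec_eq_iff)
qed

text \<open>All data are transversal to xi, the heat factor is the same for the three components of
  a field, and the quadratic term is transversal at every time; the fixed point equation transfers
  this to \<open>x\<close>.\<close>

lemma x_transversal:
 assumes t: "t >= 0"
 shows "AE xi in lborel. (SU l. of_real (xi $ l) * x (b, l) t xi) = 0"
proof -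
 have "AE xi in lborel. (SU l. of_real (xi $ l) * ini (b, l) xi) = 0 & (SU l. of_real (xi $ l) * bg (b, l) xi) = 0"
  using weakly_divergence_free_fourier[OF wdiv(1) fou(1)] weakly_divergence_free_fourier[OF wdiv(2) fou(2)]
   weakly_divergence_free_fourier[OF wdiv(3) fou(3)] weakly_divergence_free_fourier[OF wdiv(4) fou(4)]
  by eventually_elim (simp add: ini_def bg_def)
 thus ?thesis using AE_GG
 proof eventually_elim
  fix xi assume z: "(SU l. of_real (xi $ l) * ini (b, l) xi) = 0 & (SU l. of_real (xi $ l) * bg (b, l) xi) = 0" and g: "xi \<in> GG"
  have nz: "xi ~= 0" using g by (simp add: GG_def)
  define k where "k = visc (b, 1)"
  have k: "visc (b, l) = k" for l by (simp add: k_def visc_def)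
  define D where "D l s = ind t s *\<^sub>R (of_real (hk k (t - s) xi) * quad mhd_symbol (xt s) (b, l) xi)" for l s
  have Di: "integrable lborel (D l)" for l
   unfolding D_def using duhamel_integrable[OF dominated_x _ g, of k t "(b, l)"] kas_nonneg[of "(b, 1)"] by (simp add: k_def)
  have "(SU l. of_real (xi $ l) * cduh (visc (b, l)) (%s. quad mhd_symbol (xt s) (b, l)) t xi) = (SU l. of_real (xi $ l) * (lint s. D l s))"
   unfolding cduh_def D_def k ..
  also have "... = (SU l. (lint s. of_real (xi $ l) * D l s))" by simp
  also have "... = (lint s. (SU l. of_real (xi $ l) * D l s))"
   by (rule Bochner_Integration.integral_sum[symmetric]) (rule integrable_mult_right[OF Di])
  also have "... = (\<integral>s. 0 \<partial>(lborel :: real measure))"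
  proof (rule Bochner_Integration.integral_cong)
   fix s
   have "(SU l. of_real (xi $ l) * D l s) = ind t s *\<^sub>R (of_real (hk k (t - s) xi) * (SU l. of_real (xi $ l) * quad mhd_symbol (xt s) (b, l) xi))"
    unfolding D_def sum_distrib_left scaleR_sum_right by (simp add: mult_ac)
   thus "(SU l. of_real (xi $ l) * D l s) = 0"
    unfolding quad_mhd_divergence_free[OF jm_at[OF jm_x] nz] by simp
  qed simp
  finally have c0: "(SU l. of_real (xi $ l) * cduh (visc (b, l)) (%s. quad mhd_symbol (xt s) (b, l)) t xi) = 0" by simp
  have "(SU l. of_real (xi $ l) * heat_flow visc (%i xi. bg i xi + ini i xi) (b, l) t xi) =
    of_real (hk k t xi) * ((SU l. of_real (xi $ l) * bg (b, l) xi) + (SU l. of_real (xi $ l) * ini (b, l) xi))"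
   unfolding heat_flow_def k by (simp add: sum_distrib_left sum.distrib[symmetric] distrib_left mult_ac)
  hence "(SU l. of_real (xi $ l) * heat_flow visc (%i xi. bg i xi + ini i xi) (b, l) t xi) = 0" using z by simp
  with c0 show "(SU l. of_real (xi $ l) * x (b, l) t xi) = 0"
   unfolding x_fixed_point[OF t g] distrib_left sum.distrib by simp
 qed
qed

lemma divergence_sol:
 assumes t: "t > 0"
 shows "divergence (sol b t) z = 0"
proof -
 note r = rfv_fld[OF t, of b]
 have "rf (%z. SU j. partial j (fld b t) z $ j) (%xi. SU j. \<i> * of_real (xi $ j) * x (b, j) t xi)"
  by (rule rf_sum) (use rfv_partial[OF r] in \<open>auto simp: rfv_def\<close>)
 hence "complex_of_real (divergence (fld b t) z) = ift (%xi. SU j. \<i> * of_real (xi $ j) * x (b, j) t xi) z"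
  by (simp add: rf_def divergence_def)
 also have "... = 0"
 proof -
  have "AE xi in lborel. cis (xi \<bullet> z) * (SU j. \<i> * of_real (xi $ j) * x (b, j) t xi) = 0"
   using x_transversal[of t b] t by (auto elim!: eventually_mono simp: sum_distrib_left[symmetric] mult.assoc)
  thus ?thesis unfolding inv_fourier_int_def by (simp add: integral_eq_zero_AE)
 qed
 finally have 1: "divergence (fld b t) z = 0" by simp
 have 2: "divergence (bgf b t) z = 0" using div_f[OF t] div_g[OF t] by (simp add: bgf_def)
 have "sol b t = (%z. fld b t z - bgf b t z)" using t by (simp add: sol_def)
 thus ?thesis
  using 1 2 by (simp add: divergence_def partial_diff rfv_differentiable[OF r] rfv_differentiable[OF rfv_bgf[OF t]] sum_subtractf)
qed

text \<open>Subtracting the background field leaves \<open>x - ph\<close> on the side of transforms,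
  which is the quantity controlled by \<open>Wt\<close>.\<close>

lemma sol_has_fourier:
 assumes t: "t > 0"
 shows "has_fourier (sol b t) (%xi. \<chi> l. x (b, l) t xi - ph (b, l) t xi)"
proof -
 have "rfv (sol b t) (%l xi. x (b, l) t xi - ph (b, l) t xi)"
  using rfv_fld[OF t, of b] rfv_bgf[OF t, of b] t by (auto simp: rfv_def sol_def intro!: rf_diff)
 thus ?thesis by (rule rfv_has_fourier)
qed

lemma inif_has_fourier: "has_fourier (inif b) (%xi. \<chi> l. ini (b, l) xi)"
 using fou by (simp add: inif_def ini_def)

lemma x_minus_ph_measurable[measurable]: "(%xi. x i t xi - ph i t xi) \<in> BM"
proof -
 have [measurable]: "x i t \<in> BM" by (rule jm_at[OF jm_x])
 have [measurable]: "ph i t \<in> BM" by (rule jm_at[OF jm_heat_flow]) measurable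
 show ?thesis by measurable
qed

lemma initial_attained: "((%t. fw1 (%z. sol b t z - inif b z)) \<longlongrightarrow> 0) (at_right 0)"
proof (rule tendsto_sandwich[OF _ _ tendsto_const])
 have "((%t. SU l. chi1 (%xi. en (x (b, l) t xi - ph (b, l) t xi - ini (b, l) xi))) \<longlongrightarrow> (\<Sum>l\<in>(UNIV::3 set). 0)) (at_right 0)"
  by (intro tendsto_sum x_initial)
 thus "((%t. SU l. chi1 (%xi. en (x (b, l) t xi - ph (b, l) t xi - ini (b, l) xi))) \<longlongrightarrow> 0) (at_right 0)" by simp
 have "fw1 (%z. sol b t z - inif b z) <= (SU l. chi1 (%xi. en (x (b, l) t xi - ph (b, l) t xi - ini (b, l) xi)))"
  if t: "t > 0" for t
  unfolding chi1_def
 proof (rule fourier_weight_le_sum)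
  have "(%xi. (\<chi> l. x (b, l) t xi - ph (b, l) t xi) - (\<chi> l. ini (b, l) xi)) = (%xi. \<chi> l. x (b, l) t xi - ph (b, l) t xi - ini (b, l) xi)"
   by (simp add: fun_eq_iff vec_eq_iff)
  thus "has_fourier (%z. sol b t z - inif b z) (%xi. \<chi> l. x (b, l) t xi - ph (b, l) t xi - ini (b, l) xi)"
   using has_fourier_diff[OF sol_has_fourier[OF t] inif_has_fourier, of b b] by simp
 qed auto
 thus "\<forall>\<^sub>F t in at_right 0. fw1 (%z. sol b t z - inif b z) \<le>
   (SU l. chi1 (%xi. en (x (b, l) t xi - ph (b, l) t xi - ini (b, l) xi)))"
  by (auto simp: eventually_at_filter)
qed simp

theorem solution: "global_smooth_solution \<nu> \<mu> f g u01 h01 (sol False) (sol True)"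
 unfolding global_smooth_solution_def
proof (intro conjI allI impI)
 show "smooth_on ({0<..} \<times> UNIV) (%(t, z). sol False t z)" "smooth_on ({0<..} \<times> UNIV) (%(t, z). sol True t z)"
  by (rule smooth_sol)+
 show "sol False 0 = u01" "sol True 0 = h01" by (simp_all add: sol_def inif_def)
 show "((%t. fw1 (%z. sol False t z - u01 z)) \<longlongrightarrow> 0) (at_right 0)"
  "((%t. fw1 (%z. sol True t z - h01 z)) \<longlongrightarrow> 0) (at_right 0)"
  using initial_attained[of False] initial_attained[of True] by (simp_all add: inif_def)
 fix t :: real assume t: "t > 0"
 show "\<exists>p q. is_leray (tensor_div (%z. flux_U (f t z) (g t z) (sol False t z) (sol True t z))) p &
   is_leray (forcing_F (f t) (g t)) q &
   (\<forall>z. time_deriv (sol False) t z - \<nu> *\<^sub>R laplacian (sol False t) z = - p z + q z)"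
  using velocity_equation[OF t] by blast
 show "divergence (sol False t) z = 0" "divergence (sol True t) z = 0" for z by (rule divergence_sol[OF t])+
 show "time_deriv (sol True) t z - \<mu> *\<^sub>R laplacian (sol True t) z =
   - tensor_div (%z. flux_H (f t z) (g t z) (sol False t z) (sol True t z)) z + forcing_G (f t) (g t) z" for z
  by (rule magnetic_equation[OF t])
qed

text \<open>The summand \<delta> covers time 0, where the solution is the datum; for positive times
  the bound of the majorant is summed over three components.\<close>

lemma sol_weight:
 assumes t: "t >= 0"
 shows "fw1 (sol b t) <= ennreal (3 * (R * Eg) + \<delta>)"
proof (cases "t = 0")
 case True
 have "fw1 (sol b t) <= fw1 u01 + fw1 h01"
  using True by (cases b) (simp_all add: sol_def inif_def)
 also have "... <= ennreal \<delta>" by (rule initial_weight)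
 also have "... <= ennreal (3 * (R * Eg) + \<delta>)" using const_pos by (intro ennreal_leI) simp
 finally show ?thesis .
next
 case False
 hence t: "t > 0" using t by simp
 have "fw1 (sol b t) <= (SU l. chi1 (%xi. en (x (b, l) t xi - ph (b, l) t xi)))"
  unfolding chi1_def by (rule fourier_weight_le_sum[OF sol_has_fourier[OF t]]) auto
 also have "... <= (\<Sum>l\<in>(UNIV :: 3 set). ennreal (R * Eg))"
  by (intro sum_mono x_minus_ph_chi1) (use t in simp)
 also have "... = ennreal (3 * (R * Eg))" using const_pos by (simp add: ennreal_mult)
 also have "... <= ennreal (3 * (R * Eg) + \<delta>)" using \<delta>0 by (intro ennreal_leI) simp
 finally show ?thesis .
qed

lemma sol_dissipation:
 assumes t: "t >= 0"
 shows "(\<integral>\<^sup>+\<tau>\<in>{0..t}. fourier_weight norm (sol b \<tau>) \<partial>lborel) <= ennreal (3 * (R * Eg / k'))"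
proof -
 have jd: "jm (%s xi. en (x i s xi - ph i s xi))" for i
 proof -
  have "jm (x i)" by (rule jm_x)
  note [measurable (raw)] = jm_compose[OF this]
  have "jm (ph i)" by (rule jm_heat_flow) measurable
  note [measurable (raw)] = jm_compose[OF this]
  show ?thesis unfolding jm_def by measurable
 qed
 note [measurable (raw)] = jm_compose[OF jd]
 define N where "N l s = (nint xi. en (x (b, l) s xi - ph (b, l) s xi) * en xi)" for l s
 have [measurable]: "N l \<in> BM" for l unfolding N_def by measurable
 have "(\<integral>\<^sup>+\<tau>\<in>{0..t}. fourier_weight norm (sol b \<tau>) \<partial>lborel) <= (nint \<tau>. (SU l. N l \<tau> * ind t \<tau>))"
 proof (rule nn_integral_mono_AE)
  \<comment> \<open>At time 0 \<open>sol\<close> is the datum and not the difference of inverse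
    transforms; a single time does not count.\<close>
  show "AE \<tau> in lborel. fourier_weight norm (sol b \<tau>) * ind t \<tau> <= (SU l. N l \<tau> * ind t \<tau>)"
   using AE_lborel_singleton[of 0]
  proof eventually_elim
   fix \<tau> :: real assume nz: "\<tau> ~= 0"
   show "fourier_weight norm (sol b \<tau>) * ind t \<tau> <= (SU l. N l \<tau> * ind t \<tau>)"
   proof (cases "\<tau> \<in> {0..t}")
    case True
    hence p: "\<tau> > 0" using nz by simp
    have "fourier_weight norm (sol b \<tau>) <= (SU l. N l \<tau>)"
     unfolding N_def by (rule fourier_weight_le_sum[OF sol_has_fourier[OF p]]) auto
    thus ?thesis using True by simp
   qed simp
  qed
 qed
 also have "... = (SU l. diss (%s xi. en (x (b, l) s xi - ph (b, l) s xi)) t)"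
  unfolding diss_def N_def[symmetric] by (rule nn_integral_sum) measurable
 also have "... <= (\<Sum>l\<in>(UNIV :: 3 set). ennreal (R * Eg / k'))" by (intro sum_mono x_minus_ph_diss t)
 also have "... = ennreal (3 * (R * Eg / k'))"
 proof -
  have "0 <= R * Eg / k'" using const_pos by simp
  thus ?thesis by (simp add: ennreal_mult del: times_divide_eq_right)
 qed
 finally show ?thesis .
qed

lemma total_bound:
 assumes t: "t >= 0"
 shows "fw1 (sol False t)
      + ennreal \<nu> * (\<integral>\<^sup>+\<tau>\<in>{0..t}. fourier_weight norm (sol False \<tau>) \<partial>lborel)
      + fw1 (sol True t)
      + ennreal \<mu> * (\<integral>\<^sup>+\<tau>\<in>{0..t}. fourier_weight norm (sol True \<tau>) \<partial>lborel)
     <= ennreal (2 * (3 * (R * Eg) + \<delta>) + (\<nu> + \<mu>) * (3 * (R * Eg / k')))"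
proof -
 define X where "X = 3 * (R * Eg) + \<delta>"
 define Y where "Y = 3 * (R * Eg / k')"
 have X: "X >= 0" and Y: "Y >= 0" using const_pos \<delta>0 by (simp_all add: X_def Y_def)
 have "fw1 (sol False t)
      + ennreal \<nu> * (\<integral>\<^sup>+\<tau>\<in>{0..t}. fourier_weight norm (sol False \<tau>) \<partial>lborel)
      + fw1 (sol True t)
      + ennreal \<mu> * (\<integral>\<^sup>+\<tau>\<in>{0..t}. fourier_weight norm (sol True \<tau>) \<partial>lborel)
   <= ennreal X + ennreal \<nu> * ennreal Y + ennreal X + ennreal \<mu> * ennreal Y"
  unfolding X_def Y_def by (intro add_mono mult_left_mono sol_weight sol_dissipation t) auto
 also have "... = ennreal (X + \<nu> * Y + X + \<mu> * Y)"
  using X Y \<nu> \<mu> by (simp add: ennreal_mult[symmetric] ennreal_plus[symmetric] del: ennreal_plus)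
 also have "X + \<nu> * Y + X + \<mu> * Y = 2 * X + (\<nu> + \<mu>) * Y" by (simp add: algebra_simps)
 finally show ?thesis unfolding X_def Y_def .
qed

end

section \<open>Choice of the constants and conclusion\<close>

lemma constants_positive:
 assumes "ka > 0" "c > 0"
 shows "growth_const ka c P > 0" "radius_const ka c P > 0" "small_const ka c P n > 0"
proof -
 have K: "heat_const ka > 0" by (simp add: heat_const_def)
 show g: "growth_const ka c P > 0" by (simp add: growth_const_def)
 show r: "radius_const ka c P > 0" unfolding radius_const_def using assms K g by simp
 have "split_const ka c P n >= 1" by (simp add: split_const_def)
 thus "small_const ka c P n > 0" unfolding small_const_def using r K by simp
qed

theorem theorem2p1:
  fixes \<mu> \<nu> M C :: real
  assumes "\<mu> > 0" and "\<nu> > 0" and "M > 0" and "annulus_constant C"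
  shows "\<exists>C\<^sub>s \<delta>\<^sub>0 :: real. C\<^sub>s > 0 \<and> \<delta>\<^sub>0 > 0 \<and>
    (\<forall>(u01 :: real^3 \<Rightarrow> real^3) (u02 :: real^3 \<Rightarrow> real^3)
      (h01 :: real^3 \<Rightarrow> real^3) (h02 :: real^3 \<Rightarrow> real^3)
      (f :: real \<Rightarrow> real^3 \<Rightarrow> real^3) (g :: real \<Rightarrow> real^3 \<Rightarrow> real^3).
      weakly_divergence_free u01 \<and> weakly_divergence_free u02 \<and>
      weakly_divergence_free h01 \<and> weakly_divergence_free h02 \<and>
      smooth_on UNIV (\<lambda>x. u01 x + u02 x) \<and> smooth_on UNIV (\<lambda>x. h01 x + h02 x) \<and>
      fourier_weight (\<lambda>\<xi>. 1 + 1 / (norm \<xi>)\<^sup>2) u02 + fourier_weight (\<lambda>\<xi>. 1 + 1 / (norm \<xi>)\<^sup>2) h02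
        \<le> ennreal (4 * C * M) \<and>
      heat_solution \<nu> u02 f \<and> (\<forall>t>0. \<forall>x. divergence (f t) x = 0) \<and>
      heat_solution \<mu> h02 g \<and> (\<forall>t>0. \<forall>x. divergence (g t) x = 0) \<and>
      (\<forall>t\<ge>0. fourier_weight (\<lambda>\<xi>. 1 / norm \<xi>) u01 + fourier_weight (\<lambda>\<xi>. 1 / norm \<xi>) h01
          + (\<integral>\<^sup>+\<tau>\<in>{0..t}. fourier_weight (\<lambda>\<xi>. 1 / norm \<xi>) (forcing_F (f \<tau>) (g \<tau>)) \<partial>lborel)
          + (\<integral>\<^sup>+\<tau>\<in>{0..t}. fourier_weight (\<lambda>\<xi>. 1 / norm \<xi>) (forcing_G (f \<tau>) (g \<tau>)) \<partial>lborel)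
        \<le> ennreal \<delta>\<^sub>0)
      \<longrightarrow>
      (\<exists>U H. global_smooth_solution \<nu> \<mu> f g u01 h01 U H \<and>
        (\<forall>t\<ge>0. fourier_weight (\<lambda>\<xi>. 1 / norm \<xi>) (U t)
            + ennreal \<nu> * (\<integral>\<^sup>+\<tau>\<in>{0..t}. fourier_weight norm (U \<tau>) \<partial>lborel)
            + fourier_weight (\<lambda>\<xi>. 1 / norm \<xi>) (H t)
            + ennreal \<mu> * (\<integral>\<^sup>+\<tau>\<in>{0..t}. fourier_weight norm (H \<tau>) \<partial>lborel)
          \<le> ennreal (C\<^sub>s * \<delta>\<^sub>0))))"
proof -
 \<comment> \<open>The smaller viscosity governs all components. Among the arguments below, 72
   bounds the symbol of the system and 3 * P the background masses summed over components; division
   by 18 compensates the factor of \<open>background_momentum_weight\<close>.\<close>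
 define ka where "ka = min \<nu> \<mu>"
 define P where "P = 4 * C * M"
 define \<delta>\<^sub>0 where "\<delta>\<^sub>0 = small_const ka 72 (3 * P) (real CARD(mhd_index)) / 18"
 define RE where "RE = radius_const ka 72 (3 * P) * growth_const ka 72 (3 * P)"
 define B where "B = 2 * (3 * RE + \<delta>\<^sub>0) + (\<nu> + \<mu>) * (3 * (RE / (ka / 2)))"
 have ka: "ka > 0" using assms by (simp add: ka_def)
 have P: "P >= 0" using assms by (simp add: P_def annulus_constant_def)
 have pos: "\<delta>\<^sub>0 > 0" "RE > 0"
  unfolding \<delta>\<^sub>0_def RE_def using constants_positive[OF ka, of 72] by auto
 have B: "B > 0" unfolding B_def using pos ka assms by (intro add_pos_pos mult_pos_pos) auto
 have main: "\<exists>U H. global_smooth_solution \<nu> \<mu> f g u01 h01 U H &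
    (\<forall>t\<ge>0. fw1 (U t)
      + ennreal \<nu> * (\<integral>\<^sup>+\<tau>\<in>{0..t}. fourier_weight norm (U \<tau>) \<partial>lborel)
      + fw1 (H t)
      + ennreal \<mu> * (\<integral>\<^sup>+\<tau>\<in>{0..t}. fourier_weight norm (H \<tau>) \<partial>lborel)
     <= ennreal B)"
  if wd: "weakly_divergence_free u01" "weakly_divergence_free u02" "weakly_divergence_free h01" "weakly_divergence_free h02"
  and mass: "fourier_weight (%xi. 1 + 1 / nsq xi) u02 + fourier_weight (%xi. 1 + 1 / nsq xi) h02 <= ennreal P"
  and f: "heat_solution \<nu> u02 f" "\<forall>t>0. \<forall>x. divergence (f t) x = 0"
  and g: "heat_solution \<mu> h02 g" "\<forall>t>0. \<forall>x. divergence (g t) x = 0"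
  and frc: "!!t. t >= 0 ==> fw1 u01 + fw1 h01
     + (\<integral>\<^sup>+\<tau>\<in>{0..t}. fw1 (forcing_F (f \<tau>) (g \<tau>)) \<partial>lborel)
     + (\<integral>\<^sup>+\<tau>\<in>{0..t}. fw1 (forcing_G (f \<tau>) (g \<tau>)) \<partial>lborel)
    <= ennreal \<delta>\<^sub>0" for u01 u02 h01 h02 f g
 proof -
  \<comment> \<open>\<open>fourier_weight\<close> is infinite unless the transform is a function, so
    finiteness provides transforms; for the small data the hypothesis at time 0 is enough.\<close>
  have fin: "fourier_weight (%xi. 1 + 1 / nsq xi) u02 < \<infinity>" "fourier_weight (%xi. 1 + 1 / nsq xi) h02 < \<infinity>"
   "fw1 u01 < \<infinity>" "fw1 h01 < \<infinity>"
   using le_less_trans[OF mass ennreal_less_top] le_less_trans[OF frc[of 0] ennreal_less_top]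
   by (auto simp: ennreal_add_less_top)
  obtain v1 where v1: "has_fourier u01 (%xi. \<chi> i. v1 i xi)" "!!i. v1 i \<in> BM" "!!i xi. v1 i (- xi) = cnj (v1 i xi)"
   using fourier_representative[OF fin(3)] by blast
  obtain v2 where v2: "has_fourier u02 (%xi. \<chi> i. v2 i xi)" "!!i. v2 i \<in> BM" "!!i xi. v2 i (- xi) = cnj (v2 i xi)"
   using fourier_representative[OF fin(1)] by blast
  obtain k1 where k1: "has_fourier h01 (%xi. \<chi> i. k1 i xi)" "!!i. k1 i \<in> BM" "!!i xi. k1 i (- xi) = cnj (k1 i xi)"
   using fourier_representative[OF fin(4)] by blast
  obtain k2 where k2: "has_fourier h02 (%xi. \<chi> i. k2 i xi)" "!!i. k2 i \<in> BM" "!!i xi. k2 i (- xi) = cnj (k2 i xi)"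
   using fourier_representative[OF fin(2)] by blast
  interpret mhd_data \<nu> \<mu> P \<delta>\<^sub>0 u01 u02 h01 h02 f g v1 v2 k1 k2
  proof unfold_locales
   show "18 * \<delta>\<^sub>0 <= small_const (min \<nu> \<mu>) 72 (3 * P) (real CARD(mhd_index))"
    by (simp add: \<delta>\<^sub>0_def ka_def)
  qed (fact assms P less_imp_le[OF pos(1)] wd mass f(1) g(1) frc v1 v2 k1 k2 f(2)[rule_format] g(2)[rule_format])+
  show ?thesis
   using solution total_bound unfolding B_def RE_def ka_def by blast
 qed
 \<comment> \<open>\<open>B\<close> and \<open>\<delta>\<^sub>0\<close> depend only on the fixed
   parameters, so their quotient is an admissible \<open>C\<^sub>s\<close>.\<close>
 have "B / \<delta>\<^sub>0 > 0" "B / \<delta>\<^sub>0 * \<delta>\<^sub>0 = B" using B pos by auto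
 thus ?thesis
  using main pos(1) unfolding P_def by (intro exI[of _ "B / \<delta>\<^sub>0"] exI[of _ "\<delta>\<^sub>0"] conjI allI impI) (auto simp del: times_divide_eq_left)
qed

end
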